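(* Let $p$ be a prime with $p>101$. Let $F$ be an integral quintic form (homogeneous of degree $5$) whose reduction modulo $p$ is a non-degenerate quintic form over $\mathbb{F}_p$ of order at least $6$. Then $R(F)$ is dense in $\mathbb{Q}_p$.
   Context: For an integral form $F$ in $r$ variables, $R(F)=\{F(\overline{x})/F(\overline{y}) : \overline{x},\overline{y}\in\mathbb{Z}^r,\ F(\overline{y})\neq 0\}$, and density is in the $p$-adic topology. The order of a form over a field $K$ is the smallest integer $m$ such that the form is equivalent, via an invertible linear change of variables over $K$, to a form explicitly involving only $m$ variables; a form in $n$ variables is non-degenerate if its order equals $n$. *)

theory Defs
  imports Complex_Main "HOL-Library.Poly_Mapping" "HOL-Computational_Algebra.Primes"
begin

text \<open>Multivariate polynomials with integer coefficients in variables X_0, X_1, ...,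
  represented as finitely supported maps from monomials (exponent vectors) to coefficients.\<close>
type_synonym zpoly = "(nat \<Rightarrow>\<^sub>0 nat) \<Rightarrow>\<^sub>0 int"

definition zVar :: "nat \<Rightarrow> zpoly" where
  "zVar i = Poly_Mapping.single (Poly_Mapping.single i 1) 1"

definition zConst :: "int \<Rightarrow> zpoly" where
  "zConst c = Poly_Mapping.single 0 c"

definition mon_deg :: "(nat \<Rightarrow>\<^sub>0 nat) \<Rightarrow> nat" where
  "mon_deg \<alpha> = (\<Sum>i\<in>Poly_Mapping.keys \<alpha>. Poly_Mapping.lookup \<alpha> i)"

definition is_int_form :: "nat \<Rightarrow> nat \<Rightarrow> zpoly \<Rightarrow> bool" where
  "is_int_form n d F \<longleftrightarrow> (\<forall>\<alpha>\<in>Poly_Mapping.keys F. Poly_Mapping.keys \<alpha> \<subseteq> {..<n} \<and> mon_deg \<alpha> = d)"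

definition zeval :: "zpoly \<Rightarrow> (nat \<Rightarrow> int) \<Rightarrow> int" where
  "zeval F x = (\<Sum>\<alpha>\<in>Poly_Mapping.keys F. Poly_Mapping.lookup F \<alpha> * (\<Prod>i\<in>Poly_Mapping.keys \<alpha>. x i ^ Poly_Mapping.lookup \<alpha> i))"

definition lin_subst :: "nat \<Rightarrow> (nat \<Rightarrow> nat \<Rightarrow> int) \<Rightarrow> zpoly \<Rightarrow> zpoly" where
  "lin_subst n A F = (\<Sum>\<alpha>\<in>Poly_Mapping.keys F. zConst (Poly_Mapping.lookup F \<alpha>) *
      (\<Prod>i\<in>Poly_Mapping.keys \<alpha>. (\<Sum>j<n. zConst (A i j) * zVar j) ^ Poly_Mapping.lookup \<alpha> i))"

definition invertible_mod :: "int \<Rightarrow> nat \<Rightarrow> (nat \<Rightarrow> nat \<Rightarrow> int) \<Rightarrow> bool" where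
  "invertible_mod p n A \<longleftrightarrow> (\<exists>B :: nat \<Rightarrow> nat \<Rightarrow> int. \<forall>i<n. \<forall>k<n.
      (\<Sum>j<n. A i j * B j k) mod p = (if i = k then 1 else 0) mod p)"

definition involves_only_mod :: "int \<Rightarrow> nat \<Rightarrow> zpoly \<Rightarrow> bool" where
  "involves_only_mod p m P \<longleftrightarrow> (\<forall>\<alpha>\<in>Poly_Mapping.keys P. \<not> Poly_Mapping.keys \<alpha> \<subseteq> {..<m} \<longrightarrow> p dvd Poly_Mapping.lookup P \<alpha>)"

definition equiv_m_vars_mod :: "int \<Rightarrow> nat \<Rightarrow> zpoly \<Rightarrow> nat \<Rightarrow> bool" where
  "equiv_m_vars_mod p n F m \<longleftrightarrow>
     (\<exists>A. invertible_mod p n A \<and> involves_only_mod p m (lin_subst n A F))"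

definition order_mod :: "int \<Rightarrow> nat \<Rightarrow> zpoly \<Rightarrow> nat" where
  "order_mod p n F = (LEAST m. equiv_m_vars_mod p n F m)"

definition nondegenerate_mod :: "int \<Rightarrow> nat \<Rightarrow> zpoly \<Rightarrow> bool" where
  "nondegenerate_mod p n F \<longleftrightarrow> order_mod p n F = n"

definition ratio_set :: "zpoly \<Rightarrow> rat set" where
  "ratio_set F = {of_int (zeval F x) / of_int (zeval F y) | x y. zeval F y \<noteq> 0}"

text \<open>A set of rationals is dense in Q_p: since Q is dense in Q_p, this means every
  rational q is approximated p-adically to any precision p^k, i.e. s - q has
  p-adic valuation at least k (s - q = p^k a / b with p not dividing b).\<close>
definition padic_dense :: "int \<Rightarrow> rat set \<Rightarrow> bool" where
  "padic_dense p S \<longleftrightarrow> (\<forall>q::rat. \<forall>k::nat. \<exists>s\<in>S. \<exists>a b::int.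
      b \<noteq> 0 \<and> \<not> p dvd b \<and> s - q = of_int (p ^ k * a) / of_int b)"

end

theory Submission
  imports
    "HOL-Algebra.Algebraic_Closure_Type"
    "HOL-Library.Product_Plus"
    "HOL-Library.Cardinality"
    "HOL-Library.FuncSet"
    "HOL-Combinatorics.Permutations"
    "HOL-Computational_Algebra.Computational_Algebra"
    Defs
begin

text \<open>By Hensel's lemma it suffices to find a nonsingular zero of \<open>F\<close> modulo \<open>p\<close>: along a line through it \<open>F\<close> takes
  all \<open>p\<close>-adic values divisible by \<open>p\<close>. Suppose that all zeros over the prime field are singular, and let \<open>\<Phi>\<close> be the
  symmetric 5-linear form with \<open>\<Phi> x x x x x = F x\<close>. In at least six variables Chevalley's theorem gives a zero \<open>a \<noteq> 0\<close>,
  and \<open>F (x a + y) = 10 x\<^sup>3 \<Phi> a a a y y + 10 x\<^sup>2 \<Phi> a a y y y + 5 x \<Phi> a y y y y + \<Phi> y y y y y\<close> is for every \<open>y\<close> a cubic in \<open>x\<close>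
  without simple roots. Restricting \<open>y\<close> to lines turns this into polynomial identities, because a polynomial of small
  degree all of whose values are squares (or nonsquares, or noncubes) over a large prime field is, up to a constant, a
  perfect power. Together with Chevalley's theorem these identities produce in each case a vertex, which is
  impossible for a non-degenerate form.\<close>

text \<open>The perfect-power statements would follow from the Weil bound; Stepanov's method gives
  them with explicit constants. A polynomial in X and Y that vanishes on Y = X is divisible by Y -
  X, so putting Y = X^p yields a factor X^p - X; repeated division produces high order at all points
  without derivatives. The count for degree 10 needs (p - 1)/2 >= 50, the origin of the bound on p.
  The obstacle is a zero a for which \<open>\<Phi> a a a y y\<close> vanishes on large subspaces,
  because the cubic in x then drops in degree. The extreme case is a plane of zeros: its parallel
  planes carry cubics that split into three lines, and the resulting norm identity has degree
  divisible by 3 on one side, 5 or 7 on the other. Two independent zeros without such a plane are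
  excluded by quadrics of zeros; a zero that is unique up to scalars is excluded by families of
  cubics in x of full degree. In six variables a Chevalley system may have total degree 5, less one
  for each dimension that the solution has to avoid. This budget dictates which conditions are
  imposed together.\<close>

section \<open>Prime fields with more than 101 elements\<close>

text \<open>\<open>field_gcd\<close> gives polynomials over the field gcds and prime factors. Prime
  cardinality means that the power map with exponent \<open>CARD('a)\<close> is the identity on the
  field and additive on every commutative extension.\<close>

class big_prime_field = field_gcd + finite +
  assumes prime_CARD: "prime (card (UNIV :: 'a set))"
    and CARD_gt: "101 < card (UNIV :: 'a set)"
begin

lemma of_nat_CARD_eq_0: "of_nat (card (UNIV :: 'a set)) = (0 :: 'a)"
proof -
  have "(\<Sum>x\<in>(UNIV :: 'a set). x + 1) = (\<Sum>x\<in>(UNIV :: 'a set). x)"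
    by (rule sum.reindex_bij_witness[of _ "\<lambda>x. x - 1" "\<lambda>x. x + 1"]) auto
  then show ?thesis
    by (simp add: sum.distrib)
qed

subclass finite_field
  by unfold_locales (use of_nat_CARD_eq_0 prime_CARD prime_gt_0_nat in blast)

lemma CHAR_eq_CARD: "CHAR('a) = card (UNIV :: 'a set)"
proof -
  have "CHAR('a) dvd card (UNIV :: 'a set)"
    using of_nat_CARD_eq_0 local.of_nat_eq_0_iff_char_dvd by blast
  then show ?thesis
    using prime_CARD local.CHAR_not_1' prime_nat_iff by auto
qed

end

lemma numeral_neq_0_big_prime_field [simp]:
  "(numeral k :: 'a :: big_prime_field) \<noteq> 0" if "numeral k \<le> (101 :: nat)"
proof
  assume "(numeral k :: 'a) = 0"
  then have "(of_nat (numeral k) :: 'a) = 0" by simp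
  then have "CHAR('a) dvd numeral k"
    using of_nat_eq_0_iff_char_dvd by blast
  then have "CHAR('a) \<le> numeral k" by (simp add: dvd_imp_le)
  then show False using that CARD_gt[where ?'a='a] by (simp add: CHAR_eq_CARD)
qed

lemma odd_CARD: "odd (card (UNIV :: 'a :: big_prime_field set))"
  using prime_CARD[where ?'a='a] CARD_gt[where ?'a='a] prime_odd_nat by fastforce

lemma two_neq_0: "(2 :: 'a :: big_prime_field) \<noteq> 0"
  by (rule numeral_neq_0_big_prime_field) simp

lemma pow_CARD [simp]: "(x :: 'a :: big_prime_field) ^ CARD('a) = x"
  by (rule finite_field_power_card_eq_same)

lemma frobenius_add:
  assumes "CHAR('b :: comm_ring_1) = card (UNIV :: 'a :: big_prime_field set)"
  shows "(x + y :: 'b) ^ CARD('a) = x ^ CARD('a) + y ^ CARD('a)"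
proof (rule freshmans_dream)
  show "prime CHAR('b)" unfolding assms by (rule prime_CARD)
qed (rule assms[symmetric])

text \<open>Frobenius is additive on polynomials and fixes the coefficients, so only X is replaced
  by X^p.\<close>

lemma poly_pow_CARD:
  fixes P :: "'a :: big_prime_field poly"
  shows "P ^ CARD('a) = pcompose P (monom 1 CARD('a))"
proof (induction P)
  case 0
  then show ?case using CARD_gt[where ?'a='a] by (simp add: zero_power)
next
  case (pCons a P)
  have "pCons a P = [:a:] + monom 1 1 * P"
    by (simp add: monom_altdef)
  then have "pCons a P ^ CARD('a) = [:a:] ^ CARD('a) + (monom 1 1 * P) ^ CARD('a)"
    by (simp only: frobenius_add[where ?'a='a and ?'b="'a poly"] semiring_char_poly CHAR_eq_CARD)
  also have "\<dots> = [:a:] + monom 1 CARD('a) * P ^ CARD('a)"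
    by (simp add: poly_const_pow power_mult_distrib monom_power)
  finally show ?case
    using pCons by (simp add: pcompose_pCons)
qed

lemma exists_nonsquare: "\<exists>n :: 'a :: big_prime_field. \<forall>s. n \<noteq> s\<^sup>2"
proof (rule ccontr)
  assume "\<not> ?thesis"
  then have "surj (\<lambda>s :: 'a. s\<^sup>2)" by (metis surjI)
  then have "inj (\<lambda>s :: 'a. s\<^sup>2)" by (simp add: finite_UNIV_surj_inj)
  from injD[OF this, of 1 "-1"] have "(1 :: 'a) = -1" by simp
  then have "(2 :: 'a) = 0" by (metis add.right_inverse one_add_one)
  then show False using two_neq_0 by blast
qed

definition nonsq :: "'a :: big_prime_field"
  where "nonsq = (SOME n. \<forall>s. n \<noteq> s\<^sup>2)"

lemma nonsq: "nonsq \<noteq> (s :: 'a :: big_prime_field)\<^sup>2"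
  using someI_ex[OF exists_nonsquare[where ?'a='a]] unfolding nonsq_def by blast

lemma nonsq_neq_0 [simp]: "(nonsq :: 'a :: big_prime_field) \<noteq> 0"
  using nonsq[of 0] by auto

text \<open>x^2 - nonsq y^2 is the norm form of the quadratic extension, hence anisotropic.\<close>

lemma nonsq_norm_eq_0:
  "x\<^sup>2 = nonsq * y\<^sup>2 \<longleftrightarrow> x = 0 \<and> y = (0 :: 'a :: big_prime_field)"
proof
  assume eq: "x\<^sup>2 = nonsq * y\<^sup>2"
  have "y = 0"
  proof (rule ccontr)
    assume "y \<noteq> 0"
    then have "nonsq = (x / y)\<^sup>2" using eq by (simp add: field_simps)
    then show False using nonsq by blast
  qed
  then show "x = 0 \<and> y = 0" using eq by simp
qed simp

text \<open>Squaring has fibres of size at most 2, so the nonzero squares \<open>S\<close> make up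
  at least half of the nonzero elements. Their multiples \<open>N\<close> by \<open>nonsq\<close>
  are equally many and disjoint from them, so nothing else is left.\<close>

lemma nonsquare_times_nonsq:
  fixes a :: "'a :: big_prime_field"
  assumes "\<And>s. a \<noteq> s\<^sup>2"
  shows "\<exists>s. s \<noteq> 0 \<and> nonsq * a = s\<^sup>2"
proof -
  define S :: "'a set" where "S = (\<lambda>s. s\<^sup>2) ` (UNIV - {0})"
  define N :: "'a set" where "N = (\<lambda>s. nonsq * s) ` S"
  have fin: "finite S" unfolding S_def by simp
  have two: "card (UNIV - {0} :: 'a set) \<le> card S * 2"
  proof -
    have "UNIV - {0} = (\<Union>y\<in>S. {s \<in> UNIV - {0}. s\<^sup>2 = (y :: 'a)})"
      unfolding S_def by blast
    then have "card (UNIV - {0} :: 'a set) = card (\<Union>y\<in>S. {s \<in> UNIV - {0}. s\<^sup>2 = (y :: 'a)})"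
      by (rule arg_cong)
    also have "\<dots> \<le> (\<Sum>y\<in>S. card {s \<in> UNIV - {0}. s\<^sup>2 = y})"
      by (rule card_UN_le[OF fin])
    also have "\<dots> \<le> (\<Sum>y\<in>S. 2)"
    proof (rule sum_mono)
      fix y assume "y \<in> S"
      then obtain s0 where s0: "y = s0\<^sup>2" unfolding S_def by blast
      have "{s \<in> UNIV - {0}. s\<^sup>2 = y} \<subseteq> {s0, - s0}"
        using s0 by (auto simp: power2_eq_iff)
      then have "card {s \<in> UNIV - {0}. s\<^sup>2 = y} \<le> card {s0, - s0}"
        by (rule card_mono[rotated]) simp
      also have "\<dots> \<le> 2" by (simp add: card_insert_if)
      finally show "card {s \<in> UNIV - {0}. s\<^sup>2 = y} \<le> 2" .
    qed
    finally show ?thesis by simp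
  qed
  have cN: "card N = card S" unfolding N_def by (rule card_image) (auto simp: inj_on_def)
  have a0: "a \<noteq> 0" using assms[of 0] by auto
  have disjoint: "S \<inter> N = {}"
  proof (rule ccontr)
    assume "S \<inter> N \<noteq> {}"
    then obtain x y :: 'a where "x\<^sup>2 = nonsq * y\<^sup>2" "y \<noteq> 0" unfolding S_def N_def by blast
    then show False using nonsq_norm_eq_0 by blast
  qed
  have sub: "S \<subseteq> UNIV - {0}" "N \<subseteq> UNIV - {0}"
    unfolding S_def N_def by auto
  have "card (S \<union> N) = card S + card N"
    by (rule card_Un_disjoint) (use disjoint fin in \<open>auto simp: N_def\<close>)
  moreover have "card (S \<union> N) \<le> card (UNIV - {0} :: 'a set)"
    by (rule card_mono) (use sub in auto)
  ultimately have "card (S \<union> N) = card (UNIV - {0} :: 'a set)"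
    using cN two by linarith
  then have "S \<union> N = UNIV - {0}"
    by (intro card_subset_eq) (use sub in auto)
  moreover have "a \<in> UNIV - {0}" using a0 by simp
  moreover have "a \<notin> S" using assms unfolding S_def by auto
  ultimately obtain s where s: "s \<noteq> 0" "a = nonsq * s\<^sup>2" unfolding N_def S_def by blast
  show ?thesis
    by (rule exI[of _ "nonsq * s"]) (use s in \<open>auto simp: power2_eq_square\<close>)
qed

section \<open>Counting polynomials in two variables\<close>

text \<open>Rank-nullity in counting form: a nonempty fibre is mapped injectively into the kernel by
  subtracting one of its points. With cardinalities in place of dimensions, no bases of polynomial
  spaces are needed.\<close>

lemma card_le_kernel_times_image:
  fixes f :: "'b :: ab_group_add \<Rightarrow> 'c :: ab_group_add"
  assumes "finite G" and minus: "\<And>x y. x \<in> G \<Longrightarrow> y \<in> G \<Longrightarrow> x - y \<in> G"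
    and additive: "\<And>x y. f (x - y) = f x - f y"
  shows "card G \<le> card {x \<in> G. f x = 0} * card (f ` G)"
proof -
  have "G = (\<Union>y\<in>f ` G. {x \<in> G. f x = y})" by blast
  then have "card G = card (\<Union>y\<in>f ` G. {x \<in> G. f x = y})" by simp
  also have "\<dots> \<le> (\<Sum>y\<in>f ` G. card {x \<in> G. f x = y})"
    using assms(1) by (intro card_UN_le) simp
  also have "\<dots> \<le> (\<Sum>y\<in>f ` G. card {x \<in> G. f x = 0})"
  proof (rule sum_mono)
    fix y assume "y \<in> f ` G"
    then obtain x0 where x0: "x0 \<in> G" "f x0 = y" by blast
    show "card {x \<in> G. f x = y} \<le> card {x \<in> G. f x = 0}"
    proof (rule card_inj_on_le[of "\<lambda>x. x - x0"])
      show "(\<lambda>x. x - x0) ` {x \<in> G. f x = y} \<subseteq> {x \<in> G. f x = 0}"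
        using x0 minus additive by auto
    qed (use assms(1) in \<open>auto simp: inj_on_def\<close>)
  qed
  finally show ?thesis by (simp add: mult.commute)
qed

lemma card_degree_le:
  "finite {P :: 'a :: {comm_ring_1, finite} poly. degree P \<le> N} \<and>
   card {P :: 'a poly. degree P \<le> N} = CARD('a) ^ Suc N"
proof (induction N)
  case 0
  have "{P :: 'a poly. degree P \<le> 0} = range (\<lambda>a. [:a:])"
    by (auto elim: degree_eq_zeroE)
  moreover have "inj (\<lambda>a :: 'a. [:a:])" by (auto simp: inj_on_def)
  ultimately show ?case by (simp add: card_image)
next
  case (Suc N)
  have "{P :: 'a poly. degree P \<le> Suc N} = (\<lambda>(a, P). pCons a P) ` (UNIV \<times> {P. degree P \<le> N})"
  proof (intro equalityI subsetI)
    fix P :: "'a poly" assume "P \<in> {P. degree P \<le> Suc N}"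
    then show "P \<in> (\<lambda>(a, P). pCons a P) ` (UNIV \<times> {P. degree P \<le> N})"
      by (cases P) (auto split: if_splits simp: image_iff)
  qed (auto simp: degree_pCons_eq_if)
  moreover have "inj_on (\<lambda>(a, P). pCons a P) (UNIV \<times> {P :: 'a poly. degree P \<le> N})"
    by (auto simp: inj_on_def)
  ultimately show ?case using Suc by (simp add: card_image card_cartesian_product)
qed

text \<open>A \<open>poly poly\<close> is read as a polynomial in two variables: X is the inner one
  and Y the outer one, later replaced by X^p. So k bounds the degree in Y and M the degree in
  X.\<close>

definition bipolys :: "nat \<Rightarrow> nat \<Rightarrow> 'a :: {comm_ring_1, finite} poly poly set"
  where "bipolys k M = {P. degree P \<le> k \<and> (\<forall>j. degree (coeff P j) \<le> M)}"

lemma card_bipolys: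
  "finite (bipolys k M :: 'a :: {comm_ring_1, finite} poly poly set) \<and>
   card (bipolys k M :: 'a poly poly set) = CARD('a) ^ (Suc k * Suc M)"
proof (induction k)
  case 0
  have "(bipolys 0 M :: 'a poly poly set) = (\<lambda>a. [:a:]) ` {P. degree P \<le> M}"
  proof (intro equalityI subsetI)
    fix P :: "'a poly poly" assume "P \<in> bipolys 0 M"
    then have *: "degree P = 0" "degree (coeff P 0) \<le> M" unfolding bipolys_def by auto
    then obtain a where "P = [:a:]" by (auto elim: degree_eq_zeroE)
    then show "P \<in> (\<lambda>a. [:a:]) ` {P. degree P \<le> M}" using * by auto
  qed (auto simp: bipolys_def coeff_pCons split: nat.splits)
  moreover have "inj_on (\<lambda>a :: 'a poly. [:a:]) S" for S by (auto simp: inj_on_def)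
  ultimately show ?case using card_degree_le[where ?'a='a, of M] by (simp add: card_image)
next
  case (Suc k)
  have "(bipolys (Suc k) M :: 'a poly poly set) =
      (\<lambda>(a, P). pCons a P) ` ({P. degree P \<le> M} \<times> bipolys k M)"
  proof (intro equalityI subsetI)
    fix P :: "'a poly poly" assume *: "P \<in> bipolys (Suc k) M"
    obtain a Q where P: "P = pCons a Q" by (cases P)
    have "degree a \<le> M" using * P unfolding bipolys_def by (metis (mono_tags) coeff_pCons_0 mem_Collect_eq)
    moreover have "degree (coeff Q j) \<le> M" for j
      using * P unfolding bipolys_def by (metis (mono_tags) coeff_pCons_Suc mem_Collect_eq)
    moreover have "degree Q \<le> k" using * P unfolding bipolys_def by (auto split: if_splits)
    ultimately show "P \<in> (\<lambda>(a, P). pCons a P) ` ({P. degree P \<le> M} \<times> bipolys k M)"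
      using P unfolding bipolys_def by auto
  qed (auto simp: bipolys_def degree_pCons_eq_if coeff_pCons split: nat.splits)
  moreover have "inj_on (\<lambda>(a, P). pCons a P) S" for S :: "('a poly \<times> 'a poly poly) set"
    by (auto simp: inj_on_def)
  ultimately show ?case using Suc card_degree_le[where ?'a='a, of M]
    by (simp add: card_image card_cartesian_product power_add)
qed

lemma bipolys_diff: "P \<in> bipolys k M \<Longrightarrow> Q \<in> bipolys k M \<Longrightarrow> P - Q \<in> bipolys k M"
  unfolding bipolys_def by (auto intro: degree_diff_le)

text \<open>Total degree in X and Y. The guard is needed since \<open>degree 0 = 0\<close>: without
  it a vanishing coefficient would still demand j \<le> N.\<close>

definition tdeg_le :: "nat \<Rightarrow> 'a :: comm_ring_1 poly poly \<Rightarrow> bool"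
  where "tdeg_le N P \<longleftrightarrow> (\<forall>j. coeff P j \<noteq> 0 \<longrightarrow> degree (coeff P j) + j \<le> N)"

lemma tdeg_le_0 [simp]: "tdeg_le N 0"
  by (simp add: tdeg_le_def)

lemma tdeg_le_add: "tdeg_le N P \<Longrightarrow> tdeg_le N Q \<Longrightarrow> tdeg_le N (P + Q)"
  unfolding tdeg_le_def
proof (intro allI impI)
  fix j
  assume *: "\<forall>j. coeff P j \<noteq> 0 \<longrightarrow> degree (coeff P j) + j \<le> N"
    "\<forall>j. coeff Q j \<noteq> 0 \<longrightarrow> degree (coeff Q j) + j \<le> N" "coeff (P + Q) j \<noteq> 0"
  have "j \<le> N" using * by (metis add_leE add.right_neutral coeff_add)
  moreover have "degree (coeff P j) \<le> N - j" using * \<open>j \<le> N\<close> by (cases "coeff P j = 0") force+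
  moreover have "degree (coeff Q j) \<le> N - j" using * \<open>j \<le> N\<close> by (cases "coeff Q j = 0") force+
  ultimately have "degree (coeff (P + Q) j) \<le> N - j" by (simp add: degree_add_le)
  then show "degree (coeff (P + Q) j) + j \<le> N" using \<open>j \<le> N\<close> by simp
qed

lemma tdeg_le_uminus: "tdeg_le N P \<Longrightarrow> tdeg_le N (- P)"
  unfolding tdeg_le_def by simp

lemma tdeg_le_diff: "tdeg_le N P \<Longrightarrow> tdeg_le N Q \<Longrightarrow> tdeg_le N (P - Q)"
  using tdeg_le_add[of N P "- Q"] tdeg_le_uminus[of N Q] by simp

lemma tdeg_le_mult: "tdeg_le M P \<Longrightarrow> tdeg_le N Q \<Longrightarrow> tdeg_le (M + N) (P * Q)"
  unfolding tdeg_le_def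
proof (intro allI impI)
  fix j
  assume P: "\<forall>j. coeff P j \<noteq> 0 \<longrightarrow> degree (coeff P j) + j \<le> M"
    and Q: "\<forall>j. coeff Q j \<noteq> 0 \<longrightarrow> degree (coeff Q j) + j \<le> N" and nz: "coeff (P * Q) j \<noteq> 0"
  obtain i where i: "i \<le> j" "coeff P i * coeff Q (j - i) \<noteq> 0"
    using nz unfolding coeff_mult by (metis (mono_tags, lifting) atMost_iff sum.neutral)
  then have "coeff P i \<noteq> 0" "coeff Q (j - i) \<noteq> 0" by auto
  then have jMN: "j \<le> M + N" using P Q i by (metis add_le_mono le_add_diff_inverse add_leE)
  have "degree (coeff (P * Q) j) \<le> M + N - j"
    unfolding coeff_mult
  proof (rule degree_sum_le)
    fix i assume "i \<in> {..j}"
    then have ij: "i \<le> j" by simp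
    show "degree (coeff P i * coeff Q (j - i)) \<le> M + N - j"
    proof (cases "coeff P i = 0 \<or> coeff Q (j - i) = 0")
      case False
      then have "degree (coeff P i) + i \<le> M" "degree (coeff Q (j - i)) + (j - i) \<le> N" using P Q by auto
      then have "degree (coeff P i) + degree (coeff Q (j - i)) \<le> M + N - j" using ij by linarith
      then show ?thesis using degree_mult_le le_trans by blast
    qed auto
  qed simp
  then show "degree (coeff (P * Q) j) + j \<le> M + N" using jMN by simp
qed

lemma tdeg_le_const: "degree c \<le> N \<Longrightarrow> tdeg_le N [:c:]"
  unfolding tdeg_le_def by (auto simp: coeff_pCons split: nat.splits)

lemma tdeg_le_lift: "degree c \<le> N \<Longrightarrow> tdeg_le N (map_poly (\<lambda>a. [:a:]) c)"
  unfolding tdeg_le_def by (auto simp: coeff_map_poly dest: le_degree)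

lemma tdeg_le_bipolys: "P \<in> bipolys k M \<Longrightarrow> tdeg_le (k + M) P"
  unfolding tdeg_le_def
proof (intro allI impI)
  fix j assume P: "P \<in> bipolys k M" and "coeff P j \<noteq> 0"
  then have "j \<le> k" using le_degree[of P j] unfolding bipolys_def by simp
  moreover have "degree (coeff P j) \<le> M" using P unfolding bipolys_def by simp
  ultimately show "degree (coeff P j) + j \<le> k + M" by simp
qed

lemma degree_diagonal_le:
  assumes "tdeg_le N P"
  shows "degree (poly P [:0, 1:]) \<le> N"
  unfolding poly_altdef
proof (rule degree_sum_le)
  fix i assume "i \<in> {..degree P}"
  show "degree (coeff P i * [:0, 1:] ^ i) \<le> N"
  proof (cases "coeff P i = 0")
    case False
    then have "degree (coeff P i) + i \<le> N" using assms unfolding tdeg_le_def by blast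
    moreover have "degree ([:0, 1:] ^ i :: 'a poly) \<le> i"
      using degree_power_le[of "[:0, 1:] :: 'a poly" i] by (simp split: if_splits)
    ultimately show ?thesis using degree_mult_le[of "coeff P i" "[:0, 1:] ^ i"] by linarith
  qed simp
qed simp

text \<open>The quotient by Y - X; the remainder of this division is the value on the diagonal Y =
  X.\<close>

abbreviation diag_div :: "'a :: comm_ring_1 poly poly \<Rightarrow> 'a poly poly"
  where "diag_div P \<equiv> synthetic_div P [:0, 1:]"

lemma tdeg_le_diag_div: "tdeg_le N P \<Longrightarrow> tdeg_le (N - 1) (diag_div P)"
proof (induction P arbitrary: N)
  case (pCons a P)
  show ?case
  proof (cases "P = 0")
    case False
    have "tdeg_le (N - 1) P"
      using pCons.prems unfolding tdeg_le_def
    proof (intro allI impI)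
      fix j assume *: "\<forall>j. coeff (pCons a P) j \<noteq> 0 \<longrightarrow> degree (coeff (pCons a P) j) + j \<le> N"
        and nz: "coeff P j \<noteq> 0"
      show "degree (coeff P j) + j \<le> N - 1" using *[rule_format, of "Suc j"] nz by simp
    qed
    moreover have "N \<ge> 1"
    proof -
      have "coeff (pCons a P) (Suc (degree P)) \<noteq> 0" using False by simp
      then show ?thesis using pCons.prems unfolding tdeg_le_def by (metis One_nat_def add_leE Suc_le_mono le0 le_trans)
    qed
    ultimately have "tdeg_le (N - 1 - 1) (diag_div P)" "degree (poly P [:0, 1:]) \<le> N - 1"
      using pCons.IH degree_diagonal_le by blast+
    then show ?thesis
      unfolding tdeg_le_def synthetic_div_pCons
    proof (intro allI impI)
      fix j assume *: "\<forall>j. coeff (diag_div P) j \<noteq> 0 \<longrightarrow> degree (coeff (diag_div P) j) + j \<le> N - 1 - 1"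
        and d: "degree (poly P [:0, 1:]) \<le> N - 1"
        and nz: "coeff (pCons (poly P [:0, 1:]) (diag_div P)) j \<noteq> 0"
      show "degree (coeff (pCons (poly P [:0, 1:]) (diag_div P)) j) + j \<le> N - 1"
      proof (cases j)
        case (Suc k)
        then have "degree (coeff (diag_div P) k) + k \<le> N - 1 - 1" using * nz by simp
        moreover have "N - 1 - 1 + 1 \<le> N - 1"
        proof -
          have "degree P \<noteq> 0"
          proof
            assume "degree P = 0"
            then have "diag_div P = 0" by (simp add: synthetic_div_eq_0_iff)
            then show False using nz Suc by simp
          qed
          then have "Suc (Suc 0) \<le> Suc (degree P)" by simp
          moreover have "coeff (pCons a P) (Suc (degree P)) \<noteq> 0" using False by simp
          ultimately show ?thesis using pCons.prems unfolding tdeg_le_def by fastforce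
        qed
        ultimately show ?thesis using Suc by simp
      qed (use d in simp)
    qed
  qed simp
qed simp

lemma synthetic_div_diff:
  fixes P Q :: "'b :: comm_ring_1 poly"
  shows "synthetic_div (P - Q) c = synthetic_div P c - synthetic_div Q c"
proof (induction P arbitrary: Q)
  case 0
  show ?case by (induction Q) (simp_all flip: add: minus_pCons)
next
  case (pCons a P)
  show ?case by (cases Q) (simp add: pCons.IH)
qed

lemma diag_div_times:
  fixes P :: "'a :: comm_ring_1 poly poly"
  assumes "poly P [:0, 1:] = 0"
  shows "P = [:- [:0, 1:], 1:] * diag_div P"
  using synthetic_div_correct'[of "[:0, 1:]" P] assms by simp

lemma sum_order_UNIV_le_degree:
  fixes P :: "'a :: big_prime_field poly"
  assumes "P \<noteq> 0"
  shows "(\<Sum>t\<in>UNIV. order t P) \<le> degree P"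
proof -
  have "(\<Sum>t\<in>UNIV. order t P) = (\<Sum>t | poly P t = 0. order t P)"
    by (rule sum.mono_neutral_right) (auto simp: order_root)
  then show ?thesis using sum_order_le_degree[OF assms] by simp
qed

text \<open>When all degrees in X are below n, the exponents of X after Y = X^n are numbers in base
  n whose digits keep the two variables apart, so nothing cancels.\<close>

lemma frob_subst_eq_0:
  fixes P :: "'a :: idom poly poly"
  assumes "\<And>j. degree (coeff P j) < n" "poly P (monom 1 n) = 0"
  shows "P = 0"
  using assms
proof (induction P)
  case (pCons a P)
  have a: "degree a < n" using pCons.prems(1)[of 0] by simp
  have eq: "a + monom 1 n * poly P (monom 1 n) = 0" using pCons.prems(2) by simp
  have z: "poly P (monom 1 n) = 0"
  proof (rule ccontr)
    assume *: "poly P (monom 1 n) \<noteq> 0"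
    have "a = - (monom 1 n * poly P (monom 1 n))" using eq by (simp add: eq_neg_iff_add_eq_0)
    then have "degree a = n + degree (poly P (monom 1 n))"
      using * by (simp add: degree_mult_eq degree_monom_eq)
    then show False using a by simp
  qed
  then have "P = 0" using pCons.IH pCons.prems(1)[of "Suc _"] by simp
  then show ?case using eq by simp
qed simp

definition cdeg_le :: "nat \<Rightarrow> 'a :: comm_ring_1 poly poly \<Rightarrow> bool"
  where "cdeg_le K P \<longleftrightarrow> (\<forall>j. degree (coeff P j) \<le> K)"

lemma cdeg_le_mult: "cdeg_le K P \<Longrightarrow> cdeg_le L Q \<Longrightarrow> cdeg_le (K + L) (P * Q)"
  unfolding cdeg_le_def coeff_mult
  by (intro allI degree_sum_le) (auto intro: order_trans[OF degree_mult_le] add_mono)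

lemma cdeg_le_diff: "cdeg_le K P \<Longrightarrow> cdeg_le K Q \<Longrightarrow> cdeg_le K (P - Q)"
  unfolding cdeg_le_def by (auto intro: degree_diff_le)

lemma cdeg_le_const: "degree c \<le> K \<Longrightarrow> cdeg_le K [:c:]"
  unfolding cdeg_le_def by (auto simp: coeff_pCons split: nat.splits)

lemma cdeg_le_lift: "cdeg_le 0 (map_poly (\<lambda>a. [:a:]) c)"
  unfolding cdeg_le_def by (simp add: coeff_map_poly)

lemma degree_frob_subst_le:
  fixes P :: "'a :: comm_ring_1 poly poly"
  assumes "degree P \<le> k" "cdeg_le K P"
  shows "degree (poly P (monom 1 n)) \<le> K + n * k"
  unfolding poly_altdef
proof (rule degree_sum_le)
  fix i assume i: "i \<in> {..degree P}"
  have "degree (coeff P i * monom 1 n ^ i) \<le> degree (coeff P i) + n * i"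
    using degree_mult_le[of "coeff P i" "monom 1 n ^ i"] degree_monom_le[of "1 :: 'a" "n * i"]
    by (simp add: monom_power mult.commute)
  also have "\<dots> \<le> K + n * k" using assms i unfolding cdeg_le_def by (auto intro!: add_mono)
  finally show "degree (coeff P i * monom 1 n ^ i) \<le> K + n * k" .
qed simp

text \<open>A condition with values in polynomials of degree at most k costs at most k + 1
  dimensions.\<close>

lemma card_kernel_step:
  fixes f :: "'b :: ab_group_add \<Rightarrow> 'a :: {comm_ring_1, finite} poly"
  assumes "finite G" "\<And>x y. x \<in> G \<Longrightarrow> y \<in> G \<Longrightarrow> x - y \<in> G" "\<And>x y. f (x - y) = f x - f y"
    and "\<And>x. x \<in> G \<Longrightarrow> degree (f x) \<le> k" and "card G \<ge> CARD('a) ^ u" "u \<ge> Suc k"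
  shows "card {x \<in> G. f x = 0} \<ge> CARD('a) ^ (u - Suc k)"
proof -
  have "CARD('a) ^ (u - Suc k) * CARD('a) ^ Suc k = CARD('a) ^ u"
    using assms(6) by (metis le_add_diff_inverse2 power_add)
  also have "\<dots> \<le> card {x \<in> G. f x = 0} * card (f ` G)"
    using card_le_kernel_times_image[of G f] assms by (meson le_trans)
  also have "card (f ` G) \<le> CARD('a) ^ Suc k"
    using card_mono[of "{P :: 'a poly. degree P \<le> k}" "f ` G"] card_degree_le[where ?'a='a, of k] assms(4)
    by auto
  finally show ?thesis by (simp add: mult_le_mono2 card_gt_0_iff)
qed

section \<open>Stepanov's method for square values\<close>

context
  fixes d :: "'a :: big_prime_field poly"
begin

definition hds :: "'a poly poly" where "hds = map_poly (\<lambda>a. [:a:]) d"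

text \<open>Put g = d^((p-1)/2) and Y = X^p, so that \<open>hds\<close>, which is d(Y), becomes d
  g^2. Then (A + B d g)(1 + g) = (A + B d(Y)) + (A + B d) g, and \<open>hE\<close> divides both
  brackets by Y - X. The new pair is to be read as A + B g.\<close>

definition hE :: "'a poly poly \<times> 'a poly poly \<Rightarrow> 'a poly poly \<times> 'a poly poly" where
  "hE T = (diag_div (fst T + snd T * hds), diag_div (fst T + snd T * [:d:]))"

text \<open>From (A + B g)(1 + g) d = (A d + B d(Y)) + (A + B) d g, which leads back to the shape A
  + B d g. Alternating between the two shapes costs a factor d only at every second
  division.\<close>

definition hO :: "'a poly poly \<times> 'a poly poly \<Rightarrow> 'a poly poly \<times> 'a poly poly" where
  "hO T = (diag_div (fst T * [:d:] + snd T * hds), diag_div (fst T + snd T))"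

text \<open>d(Y) and d agree on the diagonal, so this single condition makes both brackets of
  \<open>hE\<close> divisible by Y - X. The same holds for \<open>cO\<close> and
  \<open>hO\<close>.\<close>

definition cE :: "'a poly poly \<times> 'a poly poly \<Rightarrow> 'a poly" where
  "cE T = poly (fst T + snd T * [:d:]) [:0, 1:]"

definition cO :: "'a poly poly \<times> 'a poly poly \<Rightarrow> 'a poly" where
  "cO T = poly (fst T + snd T) [:0, 1:]"

text \<open>Equal to 1 where d is a nonzero square, so that 1 + hg does not vanish there.\<close>

definition hg :: "'a poly" where "hg = d ^ ((CARD('a) - 1) div 2)"

definition evE :: "'a poly poly \<times> 'a poly poly \<Rightarrow> 'a poly" where
  "evE T = poly (fst T) (monom 1 CARD('a)) + poly (snd T) (monom 1 CARD('a)) * d * hg"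

definition evO :: "'a poly poly \<times> 'a poly poly \<Rightarrow> 'a poly" where
  "evO T = poly (fst T) (monom 1 CARD('a)) + poly (snd T) (monom 1 CARD('a)) * hg"

abbreviation frobX :: "'a poly" where "frobX \<equiv> monom 1 CARD('a) - [:0, 1:]"

lemma poly_hds: "poly hds q = pcompose d q"
  by (simp add: hds_def pcompose_altdef)

lemma hds_diag: "poly hds [:0, 1:] = d"
  by (simp add: poly_hds pcompose_idR)

lemma poly_hds_frob: "poly hds (monom 1 CARD('a)) = d * hg\<^sup>2"
proof -
  have *: "CARD('a) = Suc (2 * ((CARD('a) - 1) div 2))" using odd_CARD[where ?'a='a] by presburger
  have "poly hds (monom 1 CARD('a)) = d ^ CARD('a)" by (simp add: poly_hds poly_pow_CARD)
  also have "\<dots> = d * hg\<^sup>2"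
    by (subst *) (simp add: hg_def power_mult[symmetric] mult.commute)
  finally show ?thesis .
qed

lemma diag_div_frob:
  "poly P [:0, 1:] = 0 \<Longrightarrow>
   poly P (monom 1 CARD('a)) = frobX * poly (diag_div P) (monom 1 CARD('a))"
  by (subst diag_div_times[of P]) (simp_all add: algebra_simps)

lemma hE_ev: "cE T = 0 \<Longrightarrow> frobX * evO (hE T) = evE T * (1 + hg)"
proof -
  assume c: "cE T = 0"
  let ?F = "monom 1 CARD('a) :: 'a poly"
  have c1: "poly (fst T + snd T * [:d:]) [:0, 1:] = 0" using c by (simp only: cE_def)
  have c2: "poly (fst T + snd T * hds) [:0, 1:] = 0" using c1 by (simp add: hds_diag mult.commute)
  have "frobX * evO (hE T) = poly (fst T + snd T * hds) ?F + poly (fst T + snd T * [:d:]) ?F * hg"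
    unfolding diag_div_frob[OF c1] diag_div_frob[OF c2] evO_def hE_def fst_conv snd_conv
    by (simp only: algebra_simps)
  also have "\<dots> = evE T * (1 + hg)"
    by (simp add: evE_def poly_hds_frob algebra_simps power2_eq_square)
  finally show ?thesis .
qed

lemma hO_ev: "cO T = 0 \<Longrightarrow> frobX * evE (hO T) = evO T * (1 + hg) * d"
proof -
  assume c: "cO T = 0"
  let ?F = "monom 1 CARD('a) :: 'a poly"
  have c1: "poly (fst T + snd T) [:0, 1:] = 0" using c by (simp only: cO_def)
  have c2: "poly (fst T * [:d:] + snd T * hds) [:0, 1:] = 0"
  proof -
    have "poly (fst T * [:d:] + snd T * hds) [:0, 1:] = poly (fst T + snd T) [:0, 1:] * d"
      by (simp add: hds_diag algebra_simps)
    then show ?thesis using c1 by simp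
  qed
  have "frobX * evE (hO T) = poly (fst T * [:d:] + snd T * hds) ?F + poly (fst T + snd T) ?F * d * hg"
    unfolding diag_div_frob[OF c1] diag_div_frob[OF c2] evE_def hO_def fst_conv snd_conv
    by (simp only: algebra_simps)
  also have "\<dots> = evO T * (1 + hg) * d"
    by (simp add: evO_def poly_hds_frob algebra_simps power2_eq_square)
  finally show ?thesis .
qed

lemma hE_diff: "hE (S - T) = hE S - hE T"
  by (simp add: hE_def synthetic_div_diff[symmetric] minus_prod_def algebra_simps)

lemma hO_diff: "hO (S - T) = hO S - hO T"
  by (simp add: hO_def synthetic_div_diff[symmetric] minus_prod_def algebra_simps)

lemma cE_diff: "cE (S - T) = cE S - cE T"
  by (simp add: cE_def algebra_simps)

lemma cO_diff: "cO (S - T) = cO S - cO T"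
  by (simp add: cO_def algebra_simps)

text \<open>The components differ in degree by 8, the degree of d. One round of \<open>hE\<close>
  and \<open>hO\<close> raises N by 6 = 8 - 2: one multiplication by d and two divisions by Y -
  X.\<close>

lemma hE_tdeg:
  assumes "degree d \<le> 8" "tdeg_le (N + 8) (fst T)" "tdeg_le N (snd T)"
  shows "degree (cE T) \<le> N + 8" "tdeg_le (N + 7) (fst (hE T))" "tdeg_le (N + 7) (snd (hE T))"
proof -
  have 1: "tdeg_le (N + 8) (fst T + snd T * hds)"
    unfolding hds_def using assms by (intro tdeg_le_add tdeg_le_mult tdeg_le_lift)
  have 2: "tdeg_le (N + 8) (fst T + snd T * [:d:])"
    using assms by (intro tdeg_le_add tdeg_le_mult tdeg_le_const)
  show "degree (cE T) \<le> N + 8" unfolding cE_def by (rule degree_diagonal_le[OF 2])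
  show "tdeg_le (N + 7) (fst (hE T))" "tdeg_le (N + 7) (snd (hE T))"
    using tdeg_le_diag_div[OF 1] tdeg_le_diag_div[OF 2] by (simp_all add: hE_def add.commute)
qed

lemma hO_tdeg:
  assumes "degree d \<le> 8" "tdeg_le (N + 7) (fst T)" "tdeg_le (N + 7) (snd T)"
  shows "degree (cO T) \<le> N + 7" "tdeg_le (N + 6 + 8) (fst (hO T))" "tdeg_le (N + 6) (snd (hO T))"
proof -
  have 1: "tdeg_le (N + 7 + 8) (fst T * [:d:] + snd T * hds)"
    unfolding hds_def using assms by (intro tdeg_le_add tdeg_le_mult tdeg_le_lift tdeg_le_const)
  have 2: "tdeg_le (N + 7) (fst T + snd T)"
    using assms by (intro tdeg_le_add)
  show "degree (cO T) \<le> N + 7" unfolding cO_def by (rule degree_diagonal_le[OF 2])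
  show "tdeg_le (N + 6 + 8) (fst (hO T))" "tdeg_le (N + 6) (snd (hO T))"
    using tdeg_le_diag_div[OF 1] tdeg_le_diag_div[OF 2] by (simp_all add: hO_def add.commute)
qed

text \<open>There are 6(M+1) + 2(M-3) = 8M unknown coefficients, while the six conditions cost 6N +
  87 = 6M + 69 with N = M - 3. Six divisions, three of each kind, explain the exponents 6, 6 and
  3.\<close>

lemma h_auxiliary_pair:
  assumes d: "degree d \<le> 8" and M: "M \<ge> 51"
  obtains T where "fst T \<in> bipolys 5 M" "snd T \<in> bipolys 1 (M - 4)" "T \<noteq> 0"
    "frobX ^ 6 dvd evE T * (1 + hg) ^ 6 * d ^ 3"
proof -
  define G0 :: "('a poly poly \<times> 'a poly poly) set" where "G0 = bipolys 5 M \<times> bipolys 1 (M - 4)"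
  define f1 where "f1 = hE" define f2 where "f2 = (\<lambda>T. hO (f1 T))"
  define f3 where "f3 = (\<lambda>T. hE (f2 T))" define f4 where "f4 = (\<lambda>T. hO (f3 T))"
  define f5 where "f5 = (\<lambda>T. hE (f4 T))" define f6 where "f6 = (\<lambda>T. hO (f5 T))"
  define G1 where "G1 = {T \<in> G0. cE T = 0}" define G2 where "G2 = {T \<in> G1. cO (f1 T) = 0}"
  define G3 where "G3 = {T \<in> G2. cE (f2 T) = 0}" define G4 where "G4 = {T \<in> G3. cO (f3 T) = 0}"
  define G5 where "G5 = {T \<in> G4. cE (f4 T) = 0}" define G6 where "G6 = {T \<in> G5. cO (f5 T) = 0}"
  have fd: "f1 (S - T) = f1 S - f1 T" "f2 (S - T) = f2 S - f2 T" "f3 (S - T) = f3 S - f3 T"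
    "f4 (S - T) = f4 S - f4 T" "f5 (S - T) = f5 S - f5 T" for S T
    by (simp_all add: f1_def f2_def f3_def f4_def f5_def hE_diff hO_diff)
  note diffs = fd cE_diff cO_diff
  have G0: "finite G0" "card G0 = CARD('a) ^ (6 * (M + 1) + 2 * (M - 3))"
  proof -
    have e: "Suc 5 * Suc M + Suc 1 * Suc (M - 4) = 6 * (M + 1) + 2 * (M - 3)" using M by simp
    have "card G0 = CARD('a) ^ (Suc 5 * Suc M) * CARD('a) ^ (Suc 1 * Suc (M - 4))"
      unfolding G0_def card_cartesian_product
      by (simp only: card_bipolys[where ?'a='a, THEN conjunct2])
    then show "card G0 = CARD('a) ^ (6 * (M + 1) + 2 * (M - 3))"
      unfolding power_add[symmetric] e .
    show "finite G0" unfolding G0_def using card_bipolys[where ?'a='a] by blast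
  qed
  define N where "N = M - 3"
  have NM: "5 + M = N + 8" "1 + (M - 4) = N" using M unfolding N_def by simp_all
  have t0: "tdeg_le (N + 8) (fst T)" "tdeg_le N (snd T)" if "T \<in> G0" for T
    using that tdeg_le_bipolys[of "fst T" 5 M] tdeg_le_bipolys[of "snd T" 1 "M - 4"]
    unfolding G0_def NM by (auto simp: mem_Times_iff)
  note E1 = hE_tdeg[OF d t0, folded f1_def]
  have O1: "degree (cO (f1 T)) \<le> N + 7" "tdeg_le (N + 6 + 8) (fst (f2 T))" "tdeg_le (N + 6) (snd (f2 T))"
    if "T \<in> G0" for T using hO_tdeg[OF d E1(2,3)[OF that that]] unfolding f2_def by auto
  have E2: "degree (cE (f2 T)) \<le> N + 6 + 8" "tdeg_le (N + 6 + 7) (fst (f3 T))" "tdeg_le (N + 6 + 7) (snd (f3 T))"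
    if "T \<in> G0" for T using hE_tdeg[OF d O1(2,3)[OF that]] unfolding f3_def by auto
  have O2: "degree (cO (f3 T)) \<le> N + 6 + 7" "tdeg_le (N + 6 + 6 + 8) (fst (f4 T))" "tdeg_le (N + 6 + 6) (snd (f4 T))"
    if "T \<in> G0" for T using hO_tdeg[OF d E2(2,3)[OF that]] unfolding f4_def by auto
  have E3: "degree (cE (f4 T)) \<le> N + 6 + 6 + 8" "tdeg_le (N + 6 + 6 + 7) (fst (f5 T))" "tdeg_le (N + 6 + 6 + 7) (snd (f5 T))"
    if "T \<in> G0" for T using hE_tdeg[OF d O2(2,3)[OF that]] unfolding f5_def by auto
  have O3: "degree (cO (f5 T)) \<le> N + 6 + 6 + 7" if "T \<in> G0" for T
    using hO_tdeg(1)[OF d E3(2,3)[OF that]] .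
  have G0m: "x - y \<in> G0" if "x \<in> G0" "y \<in> G0" for x y
    using that unfolding G0_def by (auto simp: mem_Times_iff intro: bipolys_diff)
  have G1: "card G1 \<ge> CARD('a) ^ (6 * (M + 1) + 2 * (M - 3) - Suc (N + 8))"
    unfolding G1_def by (rule card_kernel_step) (use G0 G0m diffs E1(1) M in \<open>auto simp: N_def\<close>)
  have G2: "card G2 \<ge> CARD('a) ^ (6 * (M + 1) + 2 * (M - 3) - Suc (N + 8) - Suc (N + 7))"
    unfolding G2_def by (rule card_kernel_step) (use G0 G0m diffs O1(1) G1 M in \<open>auto simp: N_def G1_def\<close>)
  have G3: "card G3 \<ge> CARD('a) ^ (6 * (M + 1) + 2 * (M - 3) - Suc (N + 8) - Suc (N + 7) - Suc (N + 6 + 8))"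
    unfolding G3_def by (rule card_kernel_step) (use G0 G0m diffs E2(1) G2 M in \<open>auto simp: N_def G1_def G2_def\<close>)
  have G4: "card G4 \<ge> CARD('a) ^ (6 * (M + 1) + 2 * (M - 3) - Suc (N + 8) - Suc (N + 7) - Suc (N + 6 + 8) - Suc (N + 6 + 7))"
    unfolding G4_def by (rule card_kernel_step) (use G0 G0m diffs O2(1) G3 M in \<open>auto simp: N_def G1_def G2_def G3_def\<close>)
  have G5: "card G5 \<ge> CARD('a) ^ (6 * (M + 1) + 2 * (M - 3) - Suc (N + 8) - Suc (N + 7) - Suc (N + 6 + 8) - Suc (N + 6 + 7) - Suc (N + 6 + 6 + 8))"
    unfolding G5_def by (rule card_kernel_step) (use G0 G0m diffs E3(1) G4 M in \<open>auto simp: N_def G1_def G2_def G3_def G4_def\<close>)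
  have G6: "card G6 \<ge> CARD('a) ^ (6 * (M + 1) + 2 * (M - 3) - Suc (N + 8) - Suc (N + 7) - Suc (N + 6 + 8) - Suc (N + 6 + 7) - Suc (N + 6 + 6 + 8) - Suc (N + 6 + 6 + 7))"
    unfolding G6_def by (rule card_kernel_step) (use G0 G0m diffs O3 G5 M in \<open>auto simp: N_def G1_def G2_def G3_def G4_def G5_def\<close>)
  have "6 * (M + 1) + 2 * (M - 3) - Suc (N + 8) - Suc (N + 7) - Suc (N + 6 + 8) - Suc (N + 6 + 7) - Suc (N + 6 + 6 + 8) - Suc (N + 6 + 6 + 7) \<ge> 1"
    using M unfolding N_def by simp
  then have "card G6 \<ge> CARD('a) ^ 1"
    by (rule order_trans[OF power_increasing G6]) simp
  then have "card G6 > 1" using CARD_gt[where ?'a='a] by simp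
  then obtain T where T: "T \<in> G6" "T \<noteq> 0"
  proof -
    have "finite G6" using \<open>card G6 > 1\<close> card.infinite by fastforce
    then have "\<exists>S\<in>G6. \<exists>T\<in>G6. S \<noteq> T"
      using \<open>card G6 > 1\<close> card_le_Suc0_iff_eq[of G6] by fastforce
    then show ?thesis using that by blast
  qed
  then have cs: "cE T = 0" "cO (f1 T) = 0" "cE (f2 T) = 0" "cO (f3 T) = 0" "cE (f4 T) = 0" "cO (f5 T) = 0"
    unfolding G6_def G5_def G4_def G3_def G2_def G1_def by auto
  let ?w = frobX
  have "evE T * (1 + hg) ^ 6 * d ^ 3 = ?w ^ 6 * evE (f6 T)"
  proof -
    have r: "evE T * (1 + hg) = ?w * evO (f1 T)" "evO (f1 T) * (1 + hg) * d = ?w * evE (f2 T)"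
      "evE (f2 T) * (1 + hg) = ?w * evO (f3 T)" "evO (f3 T) * (1 + hg) * d = ?w * evE (f4 T)"
      "evE (f4 T) * (1 + hg) = ?w * evO (f5 T)" "evO (f5 T) * (1 + hg) * d = ?w * evE (f6 T)"
      using hE_ev[OF cs(1)] hO_ev[OF cs(2)] hE_ev[OF cs(3)] hO_ev[OF cs(4)] hE_ev[OF cs(5)] hO_ev[OF cs(6)]
      by (simp_all add: f1_def f2_def f3_def f4_def f5_def f6_def)
    have two: "x * (1 + hg) ^ 2 * d = ?w ^ 2 * z" if "x * (1 + hg) = ?w * y" "y * (1 + hg) * d = ?w * z" for x y z
    proof -
      have "x * (1 + hg) ^ 2 * d = (x * (1 + hg)) * (1 + hg) * d" by (simp add: power2_eq_square mult_ac)
      also have "\<dots> = ?w * (y * (1 + hg) * d)" unfolding that(1) by (simp only: mult_ac)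
      also have "\<dots> = ?w ^ 2 * z" unfolding that(2) by (simp only: mult_ac power2_eq_square)
      finally show ?thesis .
    qed
    have "evE T * (1 + hg) ^ 6 * d ^ 3 = (evE T * (1 + hg)\<^sup>2 * d) * ((1 + hg)\<^sup>2 * d) * ((1 + hg)\<^sup>2 * d)"
      by (simp add: eval_nat_numeral mult_ac)
    also have "\<dots> = ?w\<^sup>2 * (evE (f2 T) * (1 + hg)\<^sup>2 * d) * ((1 + hg)\<^sup>2 * d)"
      unfolding two[OF r(1,2)] by (simp only: mult_ac)
    also have "\<dots> = ?w\<^sup>2 * ?w\<^sup>2 * (evE (f4 T) * (1 + hg)\<^sup>2 * d)"
      unfolding two[OF r(3,4)] by (simp only: mult_ac)
    also have "\<dots> = ?w ^ 6 * evE (f6 T)"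
      unfolding two[OF r(5,6)] by (simp add: eval_nat_numeral mult_ac)
    finally show ?thesis .
  qed
  then have "?w ^ 6 dvd evE T * (1 + hg) ^ 6 * d ^ 3" by simp
  moreover have "fst T \<in> bipolys 5 M" "snd T \<in> bipolys 1 (M - 4)"
    using T unfolding G6_def G5_def G4_def G3_def G2_def G1_def G0_def by auto
  ultimately show ?thesis using that T by blast
qed

text \<open>Squaring A = - B d g at Y = X^p gives A^2 = B^2 d(X) d(Y) there. All degrees in X are at
  most 2M < p, so this is an identity in two variables; the bound M - 4 on B serves to make 2(M-4) +
  8 = 2M. Putting Y = s with d(s) a nonzero square shows that d is a square up to a square
  constant.\<close>

lemma auxiliary_pair_eq_0:
  assumes d: "degree d \<le> 8" and T: "fst T \<in> bipolys 5 ((CARD('a) - 1) div 2)"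
      "snd T \<in> bipolys 1 ((CARD('a) - 1) div 2 - 4)"
    and ev: "evE T = 0" and nz: "T \<noteq> 0"
    and s: "poly d s1 = c1\<^sup>2" "c1 \<noteq> 0" "poly d s2 = c2\<^sup>2" "c2 \<noteq> 0" "s1 \<noteq> s2"
  shows "\<exists>k. d = k\<^sup>2"
proof -
  let ?M = "(CARD('a) - 1) div 2" and ?F = "monom 1 CARD('a) :: 'a poly"
  define A where "A = fst T" define B where "B = snd T"
  have M: "2 * ?M < CARD('a)" "?M \<ge> 50" using CARD_gt[where ?'a='a] by auto
  have "A * A - B * B * [:d:] * hds = 0"
  proof (rule frob_subst_eq_0)
    have "cdeg_le (?M + ?M) (A * A)"
      using T(1) by (intro cdeg_le_mult) (auto simp: A_def bipolys_def cdeg_le_def)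
    moreover have "cdeg_le (?M - 4 + (?M - 4) + 8 + 0) (B * B * [:d:] * hds)"
      using T(2) d unfolding hds_def
      by (intro cdeg_le_mult cdeg_le_const cdeg_le_lift) (auto simp: B_def bipolys_def cdeg_le_def)
    moreover have "?M - 4 + (?M - 4) + 8 + 0 = ?M + ?M" using M by linarith
    ultimately have "cdeg_le (?M + ?M) (A * A - B * B * [:d:] * hds)"
      using cdeg_le_diff by simp
    then show "degree (coeff (A * A - B * B * [:d:] * hds) j) < CARD('a)" for j
      using M(1) unfolding cdeg_le_def mult_2[symmetric] by (meson le_less_trans)
    have "poly A ?F = - (poly B ?F * d * hg)"
      using ev unfolding evE_def A_def B_def by (simp add: eq_neg_iff_add_eq_0)
    then have "poly A ?F * poly A ?F = (poly B ?F * d * hg) * (poly B ?F * d * hg)" by simp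
    then show "poly (A * A - B * B * [:d:] * hds) ?F = 0"
      by (simp add: poly_hds_frob power2_eq_square mult_ac)
  qed
  then have eq: "A * A = B * B * [:d:] * hds" by simp
  have "B \<noteq> 0"
  proof
    assume "B = 0"
    then have "A = 0" using eq by simp
    then show False using nz \<open>B = 0\<close> unfolding A_def B_def by (simp add: prod_eq_iff)
  qed
  \<comment> \<open>B has degree at most 1 in Y and cannot vanish at both \<open>s1\<close> and
    \<open>s2\<close>.\<close>
  have "\<exists>s c. poly d s = c\<^sup>2 \<and> c \<noteq> 0 \<and> poly B [:s:] \<noteq> 0"
  proof (rule ccontr)
    assume *: "\<not> ?thesis"
    have "degree B \<le> 1" using T(2) unfolding B_def bipolys_def by simp
    then have B: "B = [:coeff B 0, coeff B 1:]"
      by (intro poly_eqI) (auto simp: coeff_pCons coeff_eq_0 split: nat.splits)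
    define b0 b1 where "b0 = coeff B 0" "b1 = coeff B 1"
    note B = B[folded b0_b1_def]
    have "b0 + smult s1 b1 = 0" "b0 + smult s2 b1 = 0"
      using * s by (auto simp: B)
    then have "smult s1 b1 = smult s2 b1" by (metis add_left_cancel)
    then have "smult (s1 - s2) b1 = 0" by (simp add: smult_diff_left)
    then have "b1 = 0" using s(5) by simp
    then show False using \<open>b0 + smult s1 b1 = 0\<close> \<open>B \<noteq> 0\<close> B by simp
  qed
  then obtain s c where sc: "poly d s = c\<^sup>2" "c \<noteq> 0" "poly B [:s:] \<noteq> 0" by blast
  define a where "a = poly A [:s:]" define b where "b = poly B [:s:]"
  have "poly (A * A) [:s:] = poly (B * B * [:d:] * hds) [:s:]" using eq by simp
  moreover have "pcompose r [:s:] = [:poly r s:]" for r :: "'a poly"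
    by (induction r) (simp_all add: pcompose_pCons)
  then have "poly hds [:s:] = [:c\<^sup>2:]"
    by (simp add: poly_hds sc(1)[symmetric])
  ultimately have ab: "a\<^sup>2 = b\<^sup>2 * smult (c\<^sup>2) d"
    by (simp add: a_def b_def power2_eq_square mult_ac)
  then have "b\<^sup>2 dvd a\<^sup>2" by (metis dvd_triv_left)
  then have "b dvd a" by simp
  then obtain h where "a = b * h" by blast
  then have "b\<^sup>2 * h\<^sup>2 = b\<^sup>2 * smult (c\<^sup>2) d" using ab by (simp add: power_mult_distrib)
  moreover have "b\<^sup>2 \<noteq> 0" using sc(3) b_def by simp
  ultimately have "h\<^sup>2 = smult (c\<^sup>2) d" using mult_left_cancel by blast
  then have "d = smult (inverse (c\<^sup>2)) (h\<^sup>2)" using sc(2) by simp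
  also have "\<dots> = (smult (inverse c) h)\<^sup>2" by (simp add: power2_eq_square)
  finally show ?thesis by blast
qed

end

text \<open>d = nonsq \<delta> is a square outside the exceptional points, and there the auxiliary
  polynomial together with d^3 has order at least 6. So 6(p - 4) is at most its degree, at most M +
  5p, plus 24, which fails for large p; the auxiliary polynomial is therefore 0. Four exceptions are
  tolerated because a quartic will produce that many in \<open>zero_plane_vanish\<close>.\<close>

theorem mostly_nonsquare_values:
  fixes \<delta> :: "'a :: big_prime_field poly"
  assumes deg: "degree \<delta> \<le> 8" and few: "card {t. \<exists>s. s \<noteq> 0 \<and> poly \<delta> t = s\<^sup>2} \<le> 4"
  shows "\<exists>h. \<delta> = smult nonsq (h\<^sup>2)"
proof (cases "\<delta> = 0")
  case True
  then show ?thesis by (intro exI[of _ 0]) simp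
next
  case False
  let ?p = "CARD('a)" and ?M = "(CARD('a) - 1) div 2"
  define Ex where "Ex = {t. \<exists>s. s \<noteq> 0 \<and> poly \<delta> t = s\<^sup>2}"
  define d where "d = smult nonsq \<delta>"
  have dd: "degree d \<le> 8" "d \<noteq> 0" using deg False by (auto simp: d_def)
  have sq: "\<exists>c. c \<noteq> 0 \<and> poly d t = c\<^sup>2" if "t \<notin> Ex" "poly \<delta> t \<noteq> 0" for t
  proof -
    have "poly \<delta> t \<noteq> s\<^sup>2" for s using that unfolding Ex_def by (cases "s = 0") auto
    then show ?thesis using nonsquare_times_nonsq[of "poly \<delta> t"] by (simp add: d_def)
  qed
  have p101: "?p > 101" by (rule CARD_gt)
  moreover obtain k where k: "?p = 2 * k + 1" using odd_CARD[where ?'a='a] by (auto elim: oddE)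
  ultimately have M: "?M \<ge> 51" "2 * ?M = ?p - 1" "?p > 101" by simp_all
  obtain T where T: "fst T \<in> bipolys 5 ?M" "snd T \<in> bipolys 1 (?M - 4)" "T \<noteq> 0"
    "(monom 1 ?p - [:0, 1:]) ^ 6 dvd evE d T * (1 + hg d) ^ 6 * d ^ 3"
    by (rule h_auxiliary_pair[OF dd(1) M(1)])
  show ?thesis
  proof (cases "evE d T = 0")
    case True
    have "card (UNIV - (Ex \<union> {t. poly \<delta> t = 0})) > 1"
    proof -
      have "card {t. poly \<delta> t = 0} \<le> 8" using card_poly_roots_bound[OF False] deg by linarith
      then have "card (Ex \<union> {t. poly \<delta> t = 0}) \<le> 12"
        using few card_Un_le[of Ex "{t. poly \<delta> t = 0}"] unfolding Ex_def by linarith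
      then show ?thesis using M(3) by (subst card_Diff_subset) auto
    qed
    then have "\<not> (\<forall>s1\<in>UNIV - (Ex \<union> {t. poly \<delta> t = 0}). \<forall>s2\<in>UNIV - (Ex \<union> {t. poly \<delta> t = 0}). s1 = s2)"
      using card_le_Suc0_iff_eq[of "UNIV - (Ex \<union> {t. poly \<delta> t = 0})"] by (simp del: Diff_iff Un_iff)
    then obtain s1 s2 where s: "s1 \<notin> Ex" "s2 \<notin> Ex" "poly \<delta> s1 \<noteq> 0" "poly \<delta> s2 \<noteq> 0" "s1 \<noteq> s2"
      by blast
    obtain c1 c2 where "c1 \<noteq> 0" "poly d s1 = c1\<^sup>2" "c2 \<noteq> 0" "poly d s2 = c2\<^sup>2"
      using sq[OF s(1,3)] sq[OF s(2,4)] by blast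
    then obtain k where "d = k\<^sup>2"
      using auxiliary_pair_eq_0[OF dd(1) T(1,2) True T(3)] s(5) by blast
    then have "smult (inverse nonsq) d = smult (inverse nonsq) (k\<^sup>2)" by simp
    then have "\<delta> = smult (inverse nonsq) (k\<^sup>2)" by (simp add: d_def)
    also have "\<dots> = smult nonsq ((smult (inverse nonsq) k)\<^sup>2)"
      by (simp add: power2_eq_square field_simps)
    finally show ?thesis by blast
  next
    case R: False
    define m where "m = ?M"
    have hgv: "poly (hg d) t = poly d t ^ m" for t by (simp add: hg_def m_def)
    have g1: "poly (1 + hg d) t \<noteq> 0" if tEx: "t \<notin> Ex" for t
    proof (cases "poly \<delta> t = 0")
      case True
      then show ?thesis using M unfolding poly_add hgv by (simp add: d_def m_def zero_power)
    next
      case nz: False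
      obtain c where c: "c \<noteq> 0" "poly d t = c\<^sup>2" using sq[OF tEx nz] by blast
      have "c * c ^ (?p - 1) = c * 1"
        using M(3) pow_CARD[of c] by (subst power_Suc[symmetric]) simp
      then have "c ^ (?p - 1) = 1" using c(1) by simp
      then have "poly d t ^ m = 1" unfolding c(2) m_def power_mult[symmetric] M(2) .
      then show ?thesis unfolding poly_add hgv using two_neq_0[where ?'a='a] by simp
    qed
    have ExN: "\<exists>t. t \<notin> Ex"
    proof (rule ccontr)
      assume "\<not> ?thesis"
      then have "Ex = UNIV" by blast
      then show False using few M(3) unfolding Ex_def[symmetric] by simp
    qed
    have nz: "1 + hg d \<noteq> 0" using g1 ExN by force
    have ord: "6 \<le> order t (evE d T) + 3 * order t d" if "t \<notin> Ex" for t
    proof -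
      have "[:- t, 1:] dvd monom 1 ?p - [:0, 1:]"
        by (simp add: poly_eq_0_iff_dvd[symmetric] poly_monom)
      then have "[:- t, 1:] ^ 6 dvd evE d T * (1 + hg d) ^ 6 * d ^ 3"
        using T(4) dvd_power_same dvd_trans by blast
      moreover have nz3: "evE d T * (1 + hg d) ^ 6 * d ^ 3 \<noteq> 0" using R nz dd by simp
      ultimately have "6 \<le> order t (evE d T * (1 + hg d) ^ 6 * d ^ 3)" using order_divides by blast
      also have "\<dots> = order t (evE d T) + order t ((1 + hg d) ^ 6) + order t (d ^ 3)"
        using nz3 by (simp add: order_mult)
      also have "order t ((1 + hg d) ^ 6) = 0" using g1[OF that] by (intro order_0I) simp
      also have "order t (d ^ 3) = 3 * order t d"
        using dd by (simp add: eval_nat_numeral order_mult)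
      finally show ?thesis by simp
    qed
    \<comment> \<open>Zeros of d may lower the order of the auxiliary polynomial, but by at most 3
      deg d = 24 in total.\<close>
    have "(\<Sum>t\<in>UNIV - Ex. 6) \<le> (\<Sum>t\<in>UNIV - Ex. order t (evE d T) + 3 * order t d)"
      by (rule sum_mono) (use ord in auto)
    also have "\<dots> \<le> (\<Sum>t\<in>UNIV. order t (evE d T) + 3 * order t d)"
      by (rule sum_mono2) auto
    also have "\<dots> \<le> degree (evE d T) + 3 * degree d"
      using sum_order_UNIV_le_degree[OF R] sum_order_UNIV_le_degree[OF dd(2)]
      by (simp add: sum.distrib sum_distrib_left[symmetric])
    finally have le: "6 * card (UNIV - Ex) \<le> degree (evE d T) + 24" using dd by simp
    have cEx: "card (UNIV - Ex) + 4 \<ge> ?p"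
      using few unfolding Ex_def[symmetric] by (simp add: card_Diff_subset)
    have "degree (evE d T) \<le> ?M + ?p * 5"
    proof -
      have "degree (poly (fst T) (monom 1 ?p)) \<le> ?M + ?p * 5"
        using T(1) by (intro degree_frob_subst_le) (auto simp: bipolys_def cdeg_le_def)
      moreover have "degree (poly (snd T) (monom 1 ?p) * d * hg d) \<le> ?M + ?p * 5"
      proof -
        have 1: "degree (poly (snd T) (monom 1 ?p)) \<le> (?M - 4) + ?p * 1"
          using T(2) by (intro degree_frob_subst_le) (auto simp: bipolys_def cdeg_le_def)
        have 2: "degree (hg d) \<le> 8 * ?M"
          unfolding hg_def by (rule order_trans[OF degree_power_le mult_right_mono[OF dd(1)]]) simp
        have "degree (poly (snd T) (monom 1 ?p) * d * hg d) \<le> (?M - 4) + ?p * 1 + 8 + 8 * ?M"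
          by (intro order_trans[OF degree_mult_le] add_mono 1 2 dd(1))
        also have "\<dots> = ?M + ?p * 5"
        proof -
          have "(m - 4) + q * 1 + 8 + 8 * m = m + q * 5" if "2 * m = q - 1" "51 \<le> m" "101 < q" for m q :: nat
            using that by linarith
          then show ?thesis using M by blast
        qed
        finally show ?thesis .
      qed
      ultimately show ?thesis unfolding evE_def by (rule degree_add_le)
    qed
    moreover have False if "2 * m = q - 1" "101 < q" "6 * c \<le> e + 24" "q \<le> c + 4" "e \<le> m + q * 5"
      for m q c e :: nat using that by linarith
    ultimately have False using le cEx M by blast
    then show ?thesis by blast
  qed
qed

lemma square_values:
  fixes D :: "'a :: big_prime_field poly"
  assumes "degree D \<le> 8" "\<And>t. \<exists>s. poly D t = s\<^sup>2"
  shows "\<exists>h. D = h\<^sup>2"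
proof -
  have "{t. \<exists>s. s \<noteq> 0 \<and> poly (smult nonsq D) t = s\<^sup>2} = {}"
  proof -
    have False if "s \<noteq> 0" "poly (smult nonsq D) t = s\<^sup>2" for s t
    proof -
      obtain r where "poly D t = r\<^sup>2" using assms(2) by blast
      then have "s\<^sup>2 = nonsq * r\<^sup>2" using that(2) by simp
      then show False using nonsq_norm_eq_0 that(1) by blast
    qed
    then show ?thesis by blast
  qed
  then have "card {t. \<exists>s. s \<noteq> 0 \<and> poly (smult nonsq D) t = s\<^sup>2} \<le> 4" by (simp only: card.empty)
  then obtain h where "smult nonsq D = smult nonsq (h\<^sup>2)"
    using mostly_nonsquare_values[of "smult nonsq D"] assms(1) by force
  then have "smult (inverse nonsq) (smult nonsq D) = smult (inverse nonsq) (smult nonsq (h\<^sup>2))" by simp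
  then show ?thesis by auto
qed

section \<open>Frobenius and roots of cubics in the algebraic closure\<close>

abbreviation acp :: "'a :: field poly \<Rightarrow> 'a alg_closure poly"
  where "acp P \<equiv> map_poly to_ac P"

lemma acp_pCons: "acp (pCons a P) = pCons (to_ac a) (acp P)"
  by (rule map_poly_pCons) simp

lemma acp_add: "acp (P + Q) = acp P + acp Q"
  by (intro poly_eqI) (simp add: coeff_map_poly)

lemma acp_diff: "acp (P - Q) = acp P - acp Q"
  by (intro poly_eqI) (simp add: coeff_map_poly)

lemma acp_smult: "acp (smult c P) = smult (to_ac c) (acp P)"
  by (intro poly_eqI) (simp add: coeff_map_poly)

lemma acp_mult: "acp (P * Q) = acp P * acp Q"
  by (intro poly_eqI) (simp add: coeff_map_poly coeff_mult to_ac_sum)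

lemma acp_power: "acp (P ^ n) = acp P ^ n"
  by (induction n) (simp_all add: acp_mult)

lemma degree_acp [simp]: "degree (acp P) = degree P"
  by (rule degree_map_poly) simp

lemma poly_acp_to_ac [simp]: "poly (acp P) (to_ac x) = to_ac (poly P x)"
  by (induction P) (simp_all add: acp_pCons)

lemma frob_ac_add: "(x + y :: 'a :: big_prime_field alg_closure) ^ CARD('a) = x ^ CARD('a) + y ^ CARD('a)"
  by (rule frobenius_add) (simp only: CHAR_alg_closure CHAR_eq_CARD)

lemma frob_ac_uminus: "(- x :: 'a :: big_prime_field alg_closure) ^ CARD('a) = - (x ^ CARD('a))"
  using odd_CARD[where ?'a='a] by simp

lemma frob_ac_diff: "(x - y :: 'a :: big_prime_field alg_closure) ^ CARD('a) = x ^ CARD('a) - y ^ CARD('a)"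
  using frob_ac_add[of x "- y"] by (simp add: frob_ac_uminus)

lemma frob_ac_inj: "x ^ CARD('a) = y ^ CARD('a) \<Longrightarrow> x = (y :: 'a :: big_prime_field alg_closure)"
  using frob_ac_diff[of x y] CARD_gt[where ?'a='a] by simp

lemma poly_acp_frob:
  "poly (acp P) (x ^ CARD('a)) = poly (acp P) (x :: 'a :: big_prime_field alg_closure) ^ CARD('a)"
proof (induction P)
  case 0
  show ?case using CARD_gt[where ?'a='a] by (simp add: zero_power)
next
  case (pCons a P)
  then show ?case
    by (simp add: acp_pCons frob_ac_add power_mult_distrib to_ac_power[symmetric] del: to_ac_power)
qed

text \<open>X^p - X has at most p roots, and the p elements of the prime field are roots
  already.\<close>

lemma frob_fixed_in_range:
  fixes x :: "'a :: big_prime_field alg_closure"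
  assumes "x ^ CARD('a) = x"
  shows "\<exists>a. x = to_ac a"
proof (rule ccontr)
  assume n: "\<not> ?thesis"
  define P :: "'a alg_closure poly" where "P = monom 1 CARD('a) + [:0, - 1:]"
  have degP: "degree P = CARD('a)"
    unfolding P_def using CARD_gt[where ?'a='a]
    by (subst degree_add_eq_left) (simp_all add: degree_monom_eq)
  then have "P \<noteq> 0" using CARD_gt[where ?'a='a] by auto
  have "insert x (range to_ac) \<subseteq> {y. poly P y = 0}"
    using assms by (auto simp: P_def poly_monom to_ac_power[symmetric] simp del: to_ac_power)
  then have "card (insert x (range to_ac)) \<le> card {y. poly P y = 0}"
    using poly_roots_finite[OF \<open>P \<noteq> 0\<close>] by (rule card_mono[rotated])
  also have "\<dots> \<le> CARD('a)" using card_poly_roots_bound[OF \<open>P \<noteq> 0\<close>] degP by simp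
  finally show False
    using n by (simp add: card_image[OF inj_to_ac] image_iff)
qed

lemma degree_le_1_eq:
  assumes "degree r \<le> 1"
  shows "r = [:coeff r 0, coeff r 1:]"
  using assms by (intro poly_eqI) (auto simp: coeff_pCons coeff_eq_0 split: nat.splits)

text \<open>A cubic without a root is irreducible; \<rho> generates the field with p^3 elements, and
  c is its minimal polynomial up to a constant.\<close>

context
  fixes c :: "'a :: big_prime_field poly" and \<rho> :: "'a alg_closure"
  assumes deg_c: "degree c = 3" and no_root: "\<And>x. poly c x \<noteq> 0" and root: "poly (acp c) \<rho> = 0"
begin

lemma cubic_root_degree_1:
  assumes "degree r \<le> 1" "poly (acp r) \<rho> = 0"
  shows "r = 0"
proof (rule ccontr)
  assume "r \<noteq> 0"
  define r0 r1 where "r0 = coeff r 0" "r1 = coeff r 1"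
  have r: "r = [:r0, r1:]"
    using degree_le_1_eq[OF assms(1)] by (simp only: r0_r1_def)
  have eq: "to_ac r0 + \<rho> * to_ac r1 = 0" using assms(2) by (simp add: r acp_pCons)
  have "r1 \<noteq> 0" using eq \<open>r \<noteq> 0\<close> r by auto
  then have "\<rho> = to_ac (- r0 / r1)" using eq by (simp add: field_simps eq_neg_iff_add_eq_0)
  then have "to_ac (poly c (- r0 / r1)) = 0" using root by (simp only: poly_acp_to_ac)
  then show False using no_root by simp
qed

text \<open>A quadratic that kills \<rho> would divide c, and its linear cofactor would have a root
  in the prime field.\<close>

lemma cubic_root_degree_2:
  assumes "degree r \<le> 2" "poly (acp r) \<rho> = 0"
  shows "r = 0"
proof (rule ccontr)
  assume nz: "r \<noteq> 0"
  have deg: "degree r = 2"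
    using cubic_root_degree_1[of r] assms nz by (cases "degree r \<le> 1") auto
  have "c = r * (c div r) + c mod r" by simp
  moreover have "degree (c mod r) \<le> 1" using degree_mod_less'[OF nz, of c] deg by (cases "c mod r = 0") auto
  moreover have "poly (acp (c mod r)) \<rho> = 0"
  proof -
    have "acp c = acp r * acp (c div r) + acp (c mod r)"
      unfolding acp_mult[symmetric] acp_add[symmetric] by simp
    then show ?thesis using root assms(2) by simp
  qed
  ultimately have eq: "c = r * (c div r)" using cubic_root_degree_1[of "c mod r"] by (metis add.right_neutral)
  have "c \<noteq> 0" using deg_c by auto
  then have "c div r \<noteq> 0" using eq by (metis mult_zero_right)
  then have "3 = 2 + degree (c div r)"
    using degree_mult_eq[OF nz] eq deg deg_c by (metis (no_types))
  then have d1: "degree (c div r) = 1" by simp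
  define a b where "a = coeff (c div r) 0" "b = coeff (c div r) 1"
  have l: "c div r = [:a, b:]" using degree_le_1_eq[of "c div r"] d1 by (simp add: a_b_def)
  have "b \<noteq> 0" using d1 l by (auto split: if_splits)
  then have "poly (c div r) (- a / b) = 0" unfolding l by simp
  then have "poly (r * (c div r)) (- a / b) = 0" by simp
  then show False using no_root eq by metis
qed

lemma cubic_dvd_if_root:
  assumes "poly (acp P) \<rho> = 0"
  shows "c dvd P"
proof -
  have c0: "c \<noteq> 0" using deg_c by auto
  have "acp P = acp c * acp (P div c) + acp (P mod c)"
    unfolding acp_mult[symmetric] acp_add[symmetric] by simp
  then have "poly (acp (P mod c)) \<rho> = 0" using assms root by simp
  moreover have "degree (P mod c) \<le> 2"
    using degree_mod_less'[OF c0, of P] deg_c by (cases "P mod c = 0") auto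
  ultimately have "P mod c = 0" by (rule cubic_root_degree_2[rotated])
  then show ?thesis by auto
qed

lemma cubic_conjugates:
  shows "\<rho> ^ CARD('a) \<noteq> \<rho>" and "(\<rho> ^ CARD('a)) ^ CARD('a) \<noteq> \<rho>"
    and "(\<rho> ^ CARD('a)) ^ CARD('a) \<noteq> \<rho> ^ CARD('a)" and "((\<rho> ^ CARD('a)) ^ CARD('a)) ^ CARD('a) = \<rho>"
proof -
  let ?f = "\<lambda>x :: 'a alg_closure. x ^ CARD('a)"
  show 1: "?f \<rho> \<noteq> \<rho>"
  proof
    assume "?f \<rho> = \<rho>"
    then obtain a where "\<rho> = to_ac a" using frob_fixed_in_range by blast
    then show False using root no_root by simp
  qed
  show 2: "?f (?f \<rho>) \<noteq> \<rho>"
  proof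
    assume a: "?f (?f \<rho>) = \<rho>"
    have "?f (\<rho> + ?f \<rho>) = \<rho> + ?f \<rho>" using a by (simp add: frob_ac_add add.commute)
    then obtain s where s: "\<rho> + ?f \<rho> = to_ac s" using frob_fixed_in_range by blast
    have "?f (\<rho> * ?f \<rho>) = \<rho> * ?f \<rho>" using a by (simp add: power_mult_distrib mult.commute)
    then obtain m where m: "\<rho> * ?f \<rho> = to_ac m" using frob_fixed_in_range by blast
    have "poly (acp [:m, - s, 1:]) \<rho> = 0"
      by (simp add: acp_pCons s[symmetric] m[symmetric] algebra_simps)
    then have "[:m, - s, 1:] = 0" by (rule cubic_root_degree_2[rotated]) simp
    then show False by simp
  qed
  show 3: "?f (?f \<rho>) \<noteq> ?f \<rho>" using 1 frob_ac_inj by blast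
  have r: "poly (acp c) (?f \<rho>) = 0" "poly (acp c) (?f (?f \<rho>)) = 0" "poly (acp c) (?f (?f (?f \<rho>))) = 0"
    using root CARD_gt[where ?'a='a] by (simp_all add: poly_acp_frob zero_power)
  show "?f (?f (?f \<rho>)) = \<rho>"
  proof (rule ccontr)
    assume n: "?f (?f (?f \<rho>)) \<noteq> \<rho>"
    have "?f (?f (?f \<rho>)) \<noteq> ?f \<rho>" "?f (?f (?f \<rho>)) \<noteq> ?f (?f \<rho>)" using 2 3 frob_ac_inj by blast+
    then have "card {\<rho>, ?f \<rho>, ?f (?f \<rho>), ?f (?f (?f \<rho>))} = 4" using 1 2 3 n by auto
    moreover have "acp c \<noteq> 0" using deg_c degree_acp[of c] by (metis degree_0 zero_neq_numeral)
    then have "card {\<rho>, ?f \<rho>, ?f (?f \<rho>), ?f (?f (?f \<rho>))} \<le> card {x. poly (acp c) x = 0}"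
      using r root poly_roots_finite by (intro card_mono) auto
    moreover have "card {x. poly (acp c) x = 0} \<le> 3"
      using card_poly_roots_bound[OF \<open>acp c \<noteq> 0\<close>] deg_c by simp
    ultimately show False by simp
  qed
qed

text \<open>A nonsquare stays a nonsquare in an extension of odd degree: a square root \<sigma>
  would change sign under Frobenius, yet be fixed by its third power because \<rho> is.\<close>

lemma cubic_root_norm:
  assumes "(poly (acp d) \<rho>)\<^sup>2 = to_ac nonsq * (poly (acp h) \<rho>)\<^sup>2"
  shows "poly (acp d) \<rho> = 0 \<and> poly (acp h) \<rho> = 0"
proof (cases "poly (acp h) \<rho> = 0")
  case True
  then show ?thesis using assms by simp
next
  case False
  let ?f = "\<lambda>x :: 'a alg_closure. x ^ CARD('a)"
  define \<sigma> where "\<sigma> = poly (acp d) \<rho> / poly (acp h) \<rho>"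
  have sq: "\<sigma>\<^sup>2 = to_ac nonsq" using assms False by (simp add: \<sigma>_def field_simps)
  have "?f (\<sigma>\<^sup>2) = \<sigma>\<^sup>2" unfolding sq to_ac_power[symmetric] by simp
  then have "(?f \<sigma>)\<^sup>2 = \<sigma>\<^sup>2" by (simp add: power_mult[symmetric] mult.commute)
  then have "?f \<sigma> = \<sigma> \<or> ?f \<sigma> = - \<sigma>" by (simp add: power2_eq_iff)
  then show ?thesis
  proof
    assume "?f \<sigma> = \<sigma>"
    then obtain a where "\<sigma> = to_ac a" using frob_fixed_in_range by blast
    then have "nonsq = a\<^sup>2" using sq by (metis to_ac_eq_iff to_ac_power)
    then show ?thesis using nonsq by blast
  next
    assume m: "?f \<sigma> = - \<sigma>"
    have "?f (?f (?f \<sigma>)) = \<sigma>"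
      unfolding \<sigma>_def power_divide poly_acp_frob[symmetric] cubic_conjugates(4) ..
    then have "- \<sigma> = \<sigma>" by (simp add: m frob_ac_uminus)
    then have "2 * \<sigma> = 0" by (metis add.right_inverse mult_2)
    moreover have "(2 :: 'a alg_closure) \<noteq> 0"
      using two_neq_0[where ?'a='a] by (metis to_ac_eq_0_iff to_ac_numeral)
    ultimately have "\<sigma> = 0" by simp
    then show ?thesis using sq by simp
  qed
qed

end

lemma ac_root_exists:
  assumes "degree (c :: 'a :: field poly) > 0"
  shows "\<exists>\<rho>. poly (acp c) \<rho> = 0"
  using alg_closed_imp_poly_has_root[of "acp c"] assms by simp

text \<open>A multiple root makes the discriminant 0. If there is no root, Frobenius permutes the
  three roots cyclically; a 3-cycle is even, so it fixes the product \<Delta> of the root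
  differences, whose square is the discriminant.\<close>

lemma cubic_discriminant_square:
  fixes q e :: "'a :: big_prime_field"
  assumes "\<And>x. x ^ 3 + q * x + e = 0 \<Longrightarrow> 3 * x\<^sup>2 + q = 0"
  shows "\<exists>s. - 4 * q ^ 3 - 27 * e\<^sup>2 = s\<^sup>2"
proof (cases "\<exists>x. x ^ 3 + q * x + e = 0")
  case True
  then obtain x where x: "x ^ 3 + q * x + e = 0" by blast
  then have "q = - (3 * x\<^sup>2)" using assms by (metis add.commute add_eq_0_iff2 minus_unique)
  moreover from this have "e = 2 * x ^ 3" using x by (simp add: algebra_simps power2_eq_square power3_eq_cube)
  ultimately have "- 4 * q ^ 3 - 27 * e\<^sup>2 = 0\<^sup>2" by (simp add: power_mult_distrib flip: power_mult)
  then show ?thesis by blast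
next
  case False
  let ?f = "\<lambda>x :: 'a alg_closure. x ^ CARD('a)"
  define c where "c = [:e, q, 0, 1:]"
  have dc: "degree c = 3" by (simp add: c_def)
  have nr: "poly c x \<noteq> 0" for x using False by (simp add: c_def algebra_simps power3_eq_cube) (metis mult.commute)
  obtain \<rho> where r: "poly (acp c) \<rho> = 0" using ac_root_exists[of c] dc by auto
  define x where "x = \<rho>" define y where "y = ?f x" define z where "z = ?f y"
  note conj = cubic_conjugates[OF dc nr r, folded x_def, folded y_def, folded z_def]
  define Q where "Q = to_ac q" define E where "E = to_ac e"
  have rt: "t ^ 3 + Q * t + E = 0" if "poly (acp c) t = 0" for t
    using that by (simp add: c_def acp_pCons Q_def E_def algebra_simps power3_eq_cube)
  have rx: "x ^ 3 + Q * x + E = 0" using rt r x_def by simp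
  have ry: "y ^ 3 + Q * y + E = 0"
    using rt r CARD_gt[where ?'a='a] by (simp add: y_def x_def poly_acp_frob zero_power)
  have rz: "z ^ 3 + Q * z + E = 0"
    using rt r CARD_gt[where ?'a='a] by (simp add: z_def y_def x_def poly_acp_frob zero_power)
  have fac: "(u - w) * (u\<^sup>2 + u * w + w\<^sup>2 + Q) = (u ^ 3 + Q * u + E) - (w ^ 3 + Q * w + E)" for u w
    by (simp add: algebra_simps power2_eq_square power3_eq_cube)
  have "(x - y) * (x\<^sup>2 + x * y + y\<^sup>2 + Q) = 0" using fac[of x y] rx ry by simp
  then have 1: "x\<^sup>2 + x * y + y\<^sup>2 + Q = 0" using conj(1) by auto
  have "(x - z) * (x\<^sup>2 + x * z + z\<^sup>2 + Q) = 0" using fac[of x z] rx rz by simp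
  then have 2: "x\<^sup>2 + x * z + z\<^sup>2 + Q = 0" using conj(2) by auto
  have "(y - z) * (x + y + z) = (x\<^sup>2 + x * y + y\<^sup>2 + Q) - (x\<^sup>2 + x * z + z\<^sup>2 + Q)"
    by (simp add: algebra_simps power2_eq_square)
  then have "(y - z) * (x + y + z) = 0" using 1 2 by simp
  then have "x + y + z = 0" using conj(3) by (metis mult_eq_0_iff right_minus_eq)
  moreover have "z = (x + y + z) - x - y" by simp
  ultimately have 3: "z = - x - y" by simp
  have "Q = (x\<^sup>2 + x * y + y\<^sup>2 + Q) - (x\<^sup>2 + x * y + y\<^sup>2)" by simp
  then have Q: "Q = - (x\<^sup>2 + x * y + y\<^sup>2)" unfolding 1 by (metis diff_0)
  have "E = (x ^ 3 + Q * x + E) - x ^ 3 - Q * x" by simp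
  then have E: "E = x * y * (x + y)" unfolding rx unfolding Q
    by (simp add: algebra_simps power2_eq_square power3_eq_cube)
  define \<Delta> where "\<Delta> = (x - y) * (y - z) * (z - x)"
  have "?f \<Delta> = (y - z) * (z - x) * (x - y)"
    unfolding \<Delta>_def power_mult_distrib frob_ac_diff using conj(4) by (simp add: y_def z_def)
  then have "?f \<Delta> = \<Delta>" by (simp add: \<Delta>_def)
  then obtain s where s: "\<Delta> = to_ac s" using frob_fixed_in_range by blast
  have "- 4 * Q ^ 3 - 27 * E\<^sup>2 = \<Delta>\<^sup>2" unfolding \<Delta>_def 3 Q E
    by (simp add: algebra_simps power2_eq_square power3_eq_cube)
  then have "to_ac (- 4 * q ^ 3 - 27 * e\<^sup>2) = to_ac (s\<^sup>2)" by (simp add: Q_def E_def s)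
  then show ?thesis using to_ac_eq_iff by blast
qed

text \<open>A nonzero square as discriminant in x would give two simple roots, so the discriminant
  is nonsq h^2 and 4 c e = d^2 - nonsq h^2 is a norm from the quadratic extension. A factor of odd
  degree can divide such a norm only by dividing both d and h. The singularity in the direction of t
  extends this to all of c.\<close>

lemma quadratic_family:
  fixes c d e :: "'a :: big_prime_field poly"
  assumes deg: "degree c = 3" "degree d \<le> 4" "degree e \<le> 5"
    and sing: "\<And>x t. poly c t * x\<^sup>2 + poly d t * x + poly e t = 0 \<Longrightarrow>
      2 * poly c t * x + poly d t = 0 \<and>
      poly (pderiv c) t * x\<^sup>2 + poly (pderiv d) t * x + poly (pderiv e) t = 0"
  obtains b1 b2 where "degree b1 \<le> 1" "degree b2 \<le> 1" "d = smult 2 (c * b1)"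
    "e = c * (b1\<^sup>2 - smult nonsq (b2\<^sup>2))" "\<And>r. poly c r = 0 \<Longrightarrow> poly (pderiv c) r = 0"
proof -
  have n2: "(2 :: 'a) \<noteq> 0" "(4 :: 'a) \<noteq> 0" by simp_all
  define \<delta> where "\<delta> = d\<^sup>2 - smult 4 (c * e)"
  \<comment> \<open>Otherwise the equation at t would be linear in x with a simple root.\<close>
  have d0: "poly d t = 0" if "poly c t = 0" for t
  proof (rule ccontr)
    assume nz: "poly d t \<noteq> 0"
    have "poly c t * (- poly e t / poly d t)\<^sup>2 + poly d t * (- poly e t / poly d t) + poly e t = 0"
      using that nz by simp
    from sing[OF this] show False using that nz by simp
  qed
  have none: False if "s \<noteq> 0" "poly \<delta> t = s\<^sup>2" for s t
  proof (cases "poly c t = 0")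
    case True
    then show False using that d0[OF True] by (simp add: \<delta>_def)
  next
    case False
    define x where "x = (s - poly d t) / (2 * poly c t)"
    have x: "2 * poly c t * x = s - poly d t" using False by (simp add: x_def)
    have "4 * poly c t * (poly c t * x\<^sup>2 + poly d t * x + poly e t) =
        (2 * poly c t * x + poly d t)\<^sup>2 - poly \<delta> t"
      by (simp add: \<delta>_def algebra_simps power2_eq_square)
    also have "\<dots> = 0" using x that(2) by simp
    finally have "poly c t * x\<^sup>2 + poly d t * x + poly e t = 0" using False by simp
    from sing[OF this] show False using x that(1) by simp
  qed
  have "degree \<delta> \<le> 8"
  proof -
    have "degree (d\<^sup>2) \<le> 8" using degree_power_le[of d 2] deg(2) by linarith
    moreover have "degree (c * e) \<le> 8" using degree_mult_le[of c e] deg by linarith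
    ultimately show ?thesis unfolding \<delta>_def by (intro degree_diff_le) auto
  qed
  moreover have "{t. \<exists>s. s \<noteq> 0 \<and> poly \<delta> t = s\<^sup>2} = {}" using none by blast
  then have "card {t. \<exists>s. s \<noteq> 0 \<and> poly \<delta> t = s\<^sup>2} \<le> 4" by (simp only: card.empty)
  ultimately obtain h where h: "\<delta> = smult nonsq (h\<^sup>2)" using mostly_nonsquare_values by blast
  then have eq: "d\<^sup>2 - smult nonsq (h\<^sup>2) = smult 4 (c * e)" unfolding \<delta>_def by (simp add: algebra_simps)
  have degh: "degree h \<le> 4"
  proof (cases "h = 0")
    case False
    then have "degree \<delta> = 2 * degree h" unfolding h by (simp add: degree_power_eq)
    then show ?thesis using \<open>degree \<delta> \<le> 8\<close> by simp
  qed simp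
  have c0: "c \<noteq> 0" using deg by auto
  have h0: "poly h t = 0" if "poly c t = 0" for t
  proof -
    have "poly (d\<^sup>2 - smult nonsq (h\<^sup>2)) t = 0" unfolding eq using that by simp
    then show ?thesis using d0[OF that] by simp
  qed
  have split: "\<exists>q. P = [:- r, 1:] * q" if "poly P r = 0" for P :: "'a poly" and r
    using that by (simp add: poly_eq_0_iff_dvd dvd_def)
  \<comment> \<open>With c, d, e all zero at r, every x gives a zero, so the derivative in t is a
    quadratic in x that vanishes identically.\<close>
  have vanish: "poly (pderiv c) r = 0 \<and> poly (pderiv e) r = 0" if "poly c r = 0" "poly e r = 0" for r
  proof -
    have *: "poly (pderiv c) r * x\<^sup>2 + poly (pderiv d) r * x + poly (pderiv e) r = 0" for x
      using sing[where x=x and t=r] that d0[OF that(1)] by simp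
    have "2 * poly (pderiv c) r = 0" using *[of 1] *[of "-1"] *[of 0] by (simp add: algebra_simps) algebra
    then show ?thesis using *[of 0] n2 by simp
  qed
  have pd: "poly (pderiv ([:- r, 1:] * q)) r = poly q r" for q :: "'a poly" and r
    by (simp only: pderiv_mult poly_add poly_mult) (simp add: pderiv_pCons)
  \<comment> \<open>At a simple root r of c, one factor t - r can be cancelled from d^2 - nonsq h^2
    = 4 c e, which leaves e(r) = 0 and contradicts \<open>vanish\<close>.\<close>
  have mult: "poly (pderiv c) r = 0" if r: "poly c r = 0" for r
  proof (rule ccontr)
    assume nz: "poly (pderiv c) r \<noteq> 0"
    define L where "L = [:- r, 1:]"
    have L: "L \<noteq> 0" "poly L r = 0" by (simp_all add: L_def)
    obtain c1 d1 h1 where s: "c = L * c1" "d = L * d1" "h = L * h1"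
      using split[where r=r, folded L_def] r d0[OF r] h0[OF r] by metis
    have c1: "poly c1 r \<noteq> 0" using nz pd[of r c1] s(1) by (simp add: L_def)
    have "L * (L * (d1\<^sup>2 - smult nonsq (h1\<^sup>2))) = L * smult 4 (c1 * e)"
      using eq unfolding s by (simp add: algebra_simps power2_eq_square smult_diff_right)
    then have "L * (d1\<^sup>2 - smult nonsq (h1\<^sup>2)) = smult 4 (c1 * e)"
      using L(1) mult_left_cancel by blast
    from arg_cong[OF this, of "\<lambda>P. poly P r"]
    have "poly (smult 4 (c1 * e)) r = 0" using L(2) by simp
    then have "poly e r = 0" using c1 n2 by simp
    then show False using vanish r nz by blast
  qed
  have "c dvd d \<and> c dvd h"
  proof (cases "\<exists>r. poly c r = 0")
    case False
    then have nr: "poly c x \<noteq> 0" for x by blast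
    obtain \<rho> where rho: "poly (acp c) \<rho> = 0" using ac_root_exists[of c] deg by auto
    have "acp d ^ 2 - smult (to_ac nonsq) (acp h ^ 2) = smult (to_ac 4) (acp c * acp e)"
      using arg_cong[OF eq, of acp] by (simp only: acp_diff acp_smult acp_mult acp_power)
    from arg_cong[OF this, of "\<lambda>P. poly P \<rho>"]
    have "(poly (acp d) \<rho>)\<^sup>2 = to_ac nonsq * (poly (acp h) \<rho>)\<^sup>2" using rho by simp
    from cubic_root_norm[OF deg(1) nr rho this] show ?thesis
      using cubic_dvd_if_root[OF deg(1) nr rho] by blast
  next
    case True
    \<comment> \<open>All roots of c in the prime field are multiple, so having one makes c a
      constant times L^3. Then L is split off from d and h three times.\<close>
    then obtain r where r: "poly c r = 0" by blast
    define L where "L = [:- r, 1:]"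
    have L0: "L \<noteq> 0" by (simp add: L_def)
    note splitL = split[where r=r, folded L_def]
    obtain c1 d1 h1 where s1: "c = L * c1" "d = L * d1" "h = L * h1"
      using splitL r d0[OF r] h0[OF r] by metis
    have "poly c1 r = 0" using mult[OF r] pd[of r c1] s1(1) by (simp add: L_def)
    then obtain c2 where c2: "c1 = L * c2" using splitL by blast
    have "c2 \<noteq> 0" using c0 s1(1) c2 by auto
    then have "degree c2 = 1"
      using deg(1) unfolding s1(1) c2 using L0 by (simp add: degree_mult_eq) (simp add: L_def)
    define a b where "a = coeff c2 0" "b = coeff c2 1"
    have c2l: "c2 = [:a, b:]" using degree_le_1_eq[of c2] \<open>degree c2 = 1\<close> by (simp add: a_b_def)
    have b0: "b \<noteq> 0" using \<open>degree c2 = 1\<close> c2l by (auto split: if_splits)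
    define r2 where "r2 = - a / b"
    have "poly c2 r2 = 0" using b0 by (simp add: c2l r2_def)
    then have "poly c r2 = 0" by (simp add: s1(1) c2)
    have c2': "c2 = smult b [:- r2, 1:]" using b0 by (simp add: c2l r2_def)
    have "c = [:- r2, 1:] * smult b (L * L)" unfolding s1(1) c2 c2' by (simp only: mult_smult_right mult_smult_left mult_ac)
    then have "poly (L * L) r2 * b = 0"
      using mult[OF \<open>poly c r2 = 0\<close>] pd[of r2 "smult b (L * L)"] by (simp add: mult.commute)
    then have "poly L r2 = 0" using b0 by simp
    then have "r2 = r" by (simp add: L_def)
    then have "c2 = smult b L" using c2' by (simp only: L_def)
    then have c: "c = smult b (L * L * L)" by (simp add: s1(1) c2 mult_ac)
    have can: "P = Q" if "L * P = L * Q" for P Q :: "'a poly" using that L0 by simp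
    have e1: "d1\<^sup>2 - smult nonsq (h1\<^sup>2) = L * smult (4 * b) e"
      by (rule can, rule can) (use eq in \<open>simp add: s1(2,3) c algebra_simps power2_eq_square smult_diff_right\<close>)
    have zero: "poly P r = 0 \<and> poly Q r = 0" if "poly (P\<^sup>2 - smult nonsq (Q\<^sup>2)) r = 0" for P Q :: "'a poly"
      using that nonsq_norm_eq_0[of "poly P r" "poly Q r"] by simp
    have Lr: "poly L r = 0" by (simp add: L_def)
    have "poly d1 r = 0 \<and> poly h1 r = 0" by (rule zero) (simp add: e1 Lr)
    then obtain d2 h2 where s2: "d1 = L * d2" "h1 = L * h2" using splitL by metis
    have e2: "L * (d2\<^sup>2 - smult nonsq (h2\<^sup>2)) = smult (4 * b) e"
      by (rule can) (use e1 in \<open>simp add: s2 algebra_simps power2_eq_square smult_diff_right\<close>)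
    have "poly (smult (4 * b) e) r = 0" unfolding e2[symmetric] by (simp add: Lr)
    then have "poly e r = 0" using b0 n2 by simp
    \<comment> \<open>The norm argument gives only two factors L; the third comes from the double
      zero of e.\<close>
    then have "poly (pderiv e) r = 0" using vanish r by blast
    then have "poly (pderiv (smult (4 * b) e)) r = 0" by (simp add: pderiv_smult)
    then have "poly (d2\<^sup>2 - smult nonsq (h2\<^sup>2)) r = 0"
      unfolding e2[symmetric] L_def pd .
    then obtain d3 h3 where s3: "d2 = L * d3" "h2 = L * h3" using zero splitL by metis
    have "L * L * L dvd d" "L * L * L dvd h" by (simp_all add: s1 s2 s3 mult_ac)
    then show ?thesis unfolding c using b0 by (simp add: smult_dvd_iff)
  qed
  then obtain b k where bk: "d = c * b" "h = c * k" by blast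
  have "c * (c * (b\<^sup>2 - smult nonsq (k\<^sup>2))) = c * smult 4 e"
    using eq unfolding bk by (simp add: algebra_simps power2_eq_square smult_diff_right)
  then have "c * (b\<^sup>2 - smult nonsq (k\<^sup>2)) = smult 4 e" using c0 mult_left_cancel by blast
  then have e: "e = smult (1 / 4) (c * (b\<^sup>2 - smult nonsq (k\<^sup>2)))" using n2 by (simp only: smult_smult) simp
  have db: "degree b \<le> 1"
    using deg(1,2) c0 unfolding bk by (cases "b = 0") (auto simp: degree_mult_eq)
  have dk: "degree k \<le> 1"
    using deg(1) degh c0 unfolding bk by (cases "k = 0") (auto simp: degree_mult_eq)
  show ?thesis
  proof (rule that[of "smult (1 / 2) b" "smult (1 / 2) k"])
    show "d = smult 2 (c * smult (1 / 2) b)" using n2 by (simp add: bk)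
    show "e = c * ((smult (1 / 2) b)\<^sup>2 - smult nonsq ((smult (1 / 2) k)\<^sup>2))"
      unfolding e by (simp add: power2_eq_square algebra_simps smult_diff_right)
  qed (use db dk mult in auto)
qed

section \<open>Nonzero square values in degree ten\<close>

text \<open>The bound on the X-degree may vary with the power of Y, so that the total degree allowed
  can be exhausted.\<close>

definition tribox :: "nat \<Rightarrow> (nat \<Rightarrow> nat) \<Rightarrow> 'a :: {comm_ring_1, finite} poly poly set"
  where "tribox k f = {P. degree P \<le> k \<and> (\<forall>j. degree (coeff P j) \<le> f j)}"

lemma card_tribox:
  "finite (tribox k f :: 'a :: {comm_ring_1, finite} poly poly set) \<and>
   card (tribox k f :: 'a poly poly set) = CARD('a) ^ (\<Sum>j\<le>k. Suc (f j))"
proof (induction k arbitrary: f)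
  case 0
  have "(tribox 0 f :: 'a poly poly set) = (\<lambda>a. [:a:]) ` {P. degree P \<le> f 0}"
  proof (intro equalityI subsetI)
    fix P :: "'a poly poly" assume "P \<in> tribox 0 f"
    then have *: "degree P = 0" "degree (coeff P 0) \<le> f 0" unfolding tribox_def by auto
    then obtain a where "P = [:a:]" by (auto elim: degree_eq_zeroE)
    then show "P \<in> (\<lambda>a. [:a:]) ` {P. degree P \<le> f 0}" using * by auto
  qed (auto simp: tribox_def coeff_pCons split: nat.splits)
  moreover have "inj_on (\<lambda>a :: 'a poly. [:a:]) S" for S by (auto simp: inj_on_def)
  ultimately show ?case using card_degree_le[where ?'a='a, of "f 0"] by (simp add: card_image)
next
  case (Suc k)
  let ?f = "\<lambda>j. f (Suc j)"
  have "(tribox (Suc k) f :: 'a poly poly set) =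
      (\<lambda>(a, P). pCons a P) ` ({P. degree P \<le> f 0} \<times> tribox k ?f)"
  proof (intro equalityI subsetI)
    fix P :: "'a poly poly" assume *: "P \<in> tribox (Suc k) f"
    obtain a Q where P: "P = pCons a Q" by (cases P)
    have "degree a \<le> f 0" using * P unfolding tribox_def by (metis (mono_tags) coeff_pCons_0 mem_Collect_eq)
    moreover have "degree (coeff Q j) \<le> f (Suc j)" for j
      using * P unfolding tribox_def by (metis (mono_tags) coeff_pCons_Suc mem_Collect_eq)
    moreover have "degree Q \<le> k" using * P unfolding tribox_def by (auto split: if_splits)
    ultimately show "P \<in> (\<lambda>(a, P). pCons a P) ` ({P. degree P \<le> f 0} \<times> tribox k ?f)"
      using P unfolding tribox_def by auto
  qed (auto simp: tribox_def degree_pCons_eq_if coeff_pCons split: nat.splits)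
  moreover have "inj_on (\<lambda>(a, P). pCons a P) S" for S :: "('a poly \<times> 'a poly poly) set"
    by (auto simp: inj_on_def)
  ultimately show ?case using Suc.IH[of ?f] card_degree_le[where ?'a='a, of "f 0"]
    by (simp add: card_image card_cartesian_product power_add sum.atMost_Suc_shift del: sum.atMost_Suc)
qed

lemma tribox_diff: "P \<in> tribox k f \<Longrightarrow> Q \<in> tribox k f \<Longrightarrow> P - Q \<in> tribox k f"
  unfolding tribox_def by (auto intro: degree_diff_le)

lemma tdeg_le_tribox:
  assumes "P \<in> tribox k f" "\<And>j. j \<le> k \<Longrightarrow> f j + j \<le> N"
  shows "tdeg_le N P"
  unfolding tdeg_le_def
proof (intro allI impI)
  fix j assume "coeff P j \<noteq> 0"
  then have "j \<le> k" using le_degree[of P j] assms(1) unfolding tribox_def by simp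
  moreover have "degree (coeff P j) \<le> f j" using assms(1) unfolding tribox_def by simp
  ultimately show "degree (coeff P j) + j \<le> N" using assms(2)[of j] by simp
qed

lemma card_kernel_list:
  fixes cs :: "(('b :: ab_group_add \<Rightarrow> 'a :: {comm_ring_1, finite} poly) \<times> nat) list"
  assumes "finite G" "\<And>x y. x \<in> G \<Longrightarrow> y \<in> G \<Longrightarrow> x - y \<in> G" "card G \<ge> CARD('a) ^ u"
    and "\<And>c k x y. (c, k) \<in> set cs \<Longrightarrow> c (x - y) = c x - c y"
    and "\<And>c k x. (c, k) \<in> set cs \<Longrightarrow> x \<in> G \<Longrightarrow> degree (c x) \<le> k"
    and "(\<Sum>c\<leftarrow>cs. Suc (snd c)) \<le> u"
  shows "card {x \<in> G. \<forall>c\<in>set cs. fst c x = 0} \<ge> CARD('a) ^ (u - (\<Sum>c\<leftarrow>cs. Suc (snd c)))"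
  using assms
proof (induction cs)
  case (Cons ck cs)
  obtain c k where ck: "ck = (c, k)" by (cases ck)
  let ?G = "{x \<in> G. \<forall>c\<in>set cs. fst c x = 0}"
  have lin: "c' (x - y) = c' x - c' y" if "(c', k') \<in> set cs" for c' k' x y
    by (rule Cons.prems(4)[of c' k']) (simp add: that)
  have deg: "degree (c' x) \<le> k'" if "(c', k') \<in> set cs" "x \<in> G" for c' k' x
    by (rule Cons.prems(5)[of c' k']) (simp_all add: that)
  have IH: "card ?G \<ge> CARD('a) ^ (u - (\<Sum>c\<leftarrow>cs. Suc (snd c)))"
  proof (rule Cons.IH[OF Cons.prems(1-3)])
    show "c' (x - y) = c' x - c' y" if "(c', k') \<in> set cs" for c' k' x y using lin that by blast
    show "degree (c' x) \<le> k'" if "(c', k') \<in> set cs" "x \<in> G" for c' k' x using deg that by blast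
  qed (use Cons.prems(6) in auto)
  have "CARD('a) ^ (u - (\<Sum>c\<leftarrow>cs. Suc (snd c)) - Suc k) \<le> card {x \<in> ?G. c x = 0}"
  proof (rule card_kernel_step)
    show "finite ?G" using Cons.prems(1) by simp
    show "x - y \<in> ?G" if "x \<in> ?G" "y \<in> ?G" for x y
      using that Cons.prems(2) lin by force
    show "c (x - y) = c x - c y" for x y by (rule Cons.prems(4)[of c k]) (simp add: ck)
    show "degree (c x) \<le> k" if "x \<in> ?G" for x
      by (rule Cons.prems(5)[of c k]) (use that in \<open>simp_all add: ck\<close>)
    show "CARD('a) ^ (u - (\<Sum>c\<leftarrow>cs. Suc (snd c))) \<le> card ?G" by (rule IH)
    show "Suc k \<le> u - (\<Sum>c\<leftarrow>cs. Suc (snd c))" using Cons.prems(6) by (simp add: ck)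
  qed
  moreover have "{x \<in> ?G. c x = 0} = {x \<in> G. \<forall>c\<in>set (ck # cs). fst c x = 0}"
    by (auto simp: ck)
  moreover have "u - (\<Sum>c\<leftarrow>cs. Suc (snd c)) - Suc k = u - (\<Sum>c\<leftarrow>ck # cs. Suc (snd c))"
    by (simp add: ck)
  ultimately show ?case by metis
qed simp

text \<open>With more unknowns than conditions the common kernel has at least p > 1
  elements.\<close>

lemma nonzero_kernel_element:
  fixes cs :: "(('b :: ab_group_add \<Rightarrow> 'a :: big_prime_field poly) \<times> nat) list"
  assumes "finite G" "\<And>x y. x \<in> G \<Longrightarrow> y \<in> G \<Longrightarrow> x - y \<in> G" "card G \<ge> CARD('a) ^ u"
    and "\<And>x y. \<forall>c\<in>set cs. fst c (x - y) = fst c x - fst c y"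
    and "\<And>x. x \<in> G \<Longrightarrow> \<forall>c\<in>set cs. degree (fst c x) \<le> snd c"
    and "(\<Sum>c\<leftarrow>cs. Suc (snd c)) < u"
  shows "\<exists>x\<in>G. x \<noteq> 0 \<and> (\<forall>c\<in>set cs. fst c x = 0)"
proof -
  let ?S = "{x \<in> G. \<forall>c\<in>set cs. fst c x = 0}"
  have "card ?S \<ge> CARD('a) ^ (u - (\<Sum>c\<leftarrow>cs. Suc (snd c)))"
  proof (rule card_kernel_list[OF assms(1-3)])
    show "c (x - y) = c x - c y" if "(c, k) \<in> set cs" for c k x y using assms(4)[of x y] that by fastforce
    show "degree (c x) \<le> k" if "(c, k) \<in> set cs" "x \<in> G" for c k x using assms(5)[of x] that by fastforce
  qed (use assms(6) in auto)
  moreover have "CARD('a) ^ (u - (\<Sum>c\<leftarrow>cs. Suc (snd c))) \<ge> CARD('a) ^ 1"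
    using assms(6) CARD_gt[where ?'a='a] by (intro power_increasing) auto
  ultimately have "card ?S > 1" using CARD_gt[where ?'a='a] by simp
  then have "\<exists>x\<in>?S. \<exists>y\<in>?S. x \<noteq> y"
    using card_le_Suc0_iff_eq[of ?S] assms(1) by fastforce
  then obtain x y where "x \<in> ?S" "y \<in> ?S" "x \<noteq> y" by blast
  then have "\<exists>z\<in>?S. z \<noteq> 0" by (cases "x = 0") auto
  then show ?thesis by blast
qed

lemma hE_tdeg10:
  assumes "degree d \<le> 10" "tdeg_le (N + 10) (fst T)" "tdeg_le N (snd T)"
  shows "degree (cE d T) \<le> N + 10" "tdeg_le (N + 9) (fst (hE d T))" "tdeg_le (N + 9) (snd (hE d T))"
proof -
  have 1: "tdeg_le (N + 10) (fst T + snd T * hds d)"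
    unfolding hds_def using assms by (intro tdeg_le_add tdeg_le_mult tdeg_le_lift)
  have 2: "tdeg_le (N + 10) (fst T + snd T * [:d:])"
    using assms by (intro tdeg_le_add tdeg_le_mult tdeg_le_const)
  show "degree (cE d T) \<le> N + 10" unfolding cE_def by (rule degree_diagonal_le[OF 2])
  show "tdeg_le (N + 9) (fst (hE d T))" "tdeg_le (N + 9) (snd (hE d T))"
    using tdeg_le_diag_div[OF 1] tdeg_le_diag_div[OF 2] by (simp_all add: hE_def add.commute)
qed

lemma hO_tdeg10:
  assumes "degree d \<le> 10" "tdeg_le (N + 9) (fst T)" "tdeg_le (N + 9) (snd T)"
  shows "degree (cO T) \<le> N + 9" "tdeg_le (N + 8 + 10) (fst (hO d T))" "tdeg_le (N + 8) (snd (hO d T))"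
proof -
  have 1: "tdeg_le (N + 9 + 10) (fst T * [:d:] + snd T * hds d)"
    unfolding hds_def using assms by (intro tdeg_le_add tdeg_le_mult tdeg_le_lift tdeg_le_const)
  have 2: "tdeg_le (N + 9) (fst T + snd T)"
    using assms by (intro tdeg_le_add)
  show "degree (cO T) \<le> N + 9" unfolding cO_def by (rule degree_diagonal_le[OF 2])
  show "tdeg_le (N + 8 + 10) (fst (hO d T))" "tdeg_le (N + 8) (snd (hO d T))"
    using tdeg_le_diag_div[OF 1] tdeg_le_diag_div[OF 2] by (simp_all add: hO_def add.commute)
qed

text \<open>13M - 36 unknowns face 9N + 223 = 9M + 160 conditions, N = M - 7; the strict inequality
  holds exactly from M = 50 on. In the first box M + 3 - j comes from the total degree N + 10 and M
  from the bound 2M < p needed for specialisation. Five steps \<open>hE\<close> and four steps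
  \<open>hO\<close> give the exponents 9 and 4.\<close>

lemma auxiliary_pair_10:
  fixes d :: "'a :: big_prime_field poly"
  assumes d: "degree d \<le> 10" and M: "M \<ge> 50"
  obtains T where "T \<noteq> 0" "fst T \<in> tribox 8 (\<lambda>j. min M (M + 3 - j))" "snd T \<in> tribox 3 (\<lambda>j. M - 7 - j)"
    "(monom 1 CARD('a) - [:0, 1:]) ^ 9 dvd evE d T * (1 + hg d) ^ 9 * d ^ 4"
proof -
  define N where "N = M - 7"
  define f1 where "f1 T = hE d T" for T
  define f2 where "f2 T = hO d (f1 T)" for T
  define f3 where "f3 T = hE d (f2 T)" for T
  define f4 where "f4 T = hO d (f3 T)" for T
  define f5 where "f5 T = hE d (f4 T)" for T
  define f6 where "f6 T = hO d (f5 T)" for T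
  define f7 where "f7 T = hE d (f6 T)" for T
  define f8 where "f8 T = hO d (f7 T)" for T
  define f9 where "f9 T = hE d (f8 T)" for T
  note fdefs = f1_def f2_def f3_def f4_def f5_def f6_def f7_def f8_def f9_def
  define G :: "('a poly poly \<times> 'a poly poly) set"
    where "G = tribox 8 (\<lambda>j. min M (M + 3 - j)) \<times> tribox 3 (\<lambda>j. M - 7 - j)"
  have diffs: "f1 (S - T) = f1 S - f1 T" "f2 (S - T) = f2 S - f2 T" "f3 (S - T) = f3 S - f3 T"
    "f4 (S - T) = f4 S - f4 T" "f5 (S - T) = f5 S - f5 T" "f6 (S - T) = f6 S - f6 T"
    "f7 (S - T) = f7 S - f7 T" "f8 (S - T) = f8 S - f8 T" for S T
    by (simp_all add: fdefs hE_diff hO_diff)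
  define cs where "cs = [(cE d, N + 10), (\<lambda>T. cO (f1 T), N + 9), (\<lambda>T. cE d (f2 T), N + 8 + 10),
    (\<lambda>T. cO (f3 T), N + 8 + 9), (\<lambda>T. cE d (f4 T), N + 8 + 8 + 10), (\<lambda>T. cO (f5 T), N + 8 + 8 + 9),
    (\<lambda>T. cE d (f6 T), N + 8 + 8 + 8 + 10), (\<lambda>T. cO (f7 T), N + 8 + 8 + 8 + 9), (\<lambda>T. cE d (f8 T), N + 8 + 8 + 8 + 8 + 10)]"
  have "\<exists>T\<in>G. T \<noteq> 0 \<and> (\<forall>c\<in>set cs. fst c T = 0)"
  proof (rule nonzero_kernel_element[of G "13 * M - 36" cs])
    show "finite G" unfolding G_def by (intro finite_cartesian_product) (simp_all add: card_tribox)
    show "x - y \<in> G" if "x \<in> G" "y \<in> G" for x y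
      using that unfolding G_def by (cases x; cases y) (simp add: tribox_diff)
    have "(\<Sum>j\<le>8. Suc (min M (M + 3 - j))) + (\<Sum>j\<le>3. Suc (M - 7 - j)) = 13 * M - 36"
    proof -
      have "(\<Sum>j\<le>8. Suc (min M (M + 3 - j))) = 9 * M - 6"
        using M by (simp add: atMost_nat_numeral)
      moreover have "(\<Sum>j\<le>3. Suc (M - 7 - j)) = 4 * M - 30"
        using M by (simp add: atMost_nat_numeral)
      ultimately show ?thesis using M by simp
    qed
    then show "CARD('a) ^ (13 * M - 36) \<le> card G"
      unfolding G_def card_cartesian_product by (simp add: card_tribox power_add[symmetric])
    show "\<forall>c\<in>set cs. fst c (x - y) = fst c x - fst c y" for x y
      unfolding cs_def by (simp add: diffs cE_diff cO_diff)
    show "\<forall>c\<in>set cs. degree (fst c x) \<le> snd c" if "x \<in> G" for x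
    proof -
      have 0: "tdeg_le (N + 10) (fst x)" "tdeg_le N (snd x)"
      proof -
        have "min M (M + 3 - j) + j \<le> N + 10" if "j \<le> 8" for j using that M unfolding N_def by linarith
        moreover have "M - 7 - j + j \<le> N" if "j \<le> 3" for j using that M unfolding N_def by linarith
        moreover have "fst x \<in> tribox 8 (\<lambda>j. min M (M + 3 - j))" "snd x \<in> tribox 3 (\<lambda>j. M - 7 - j)"
          using \<open>x \<in> G\<close> unfolding G_def mem_Times_iff by blast+
        ultimately show "tdeg_le (N + 10) (fst x)" "tdeg_le N (snd x)"
          by (blast intro: tdeg_le_tribox)+
      qed
      note 1 = hE_tdeg10[OF d 0, folded f1_def]
      note 2 = hO_tdeg10[OF d 1(2,3), folded f2_def]
      note 3 = hE_tdeg10[OF d 2(2,3), folded f3_def]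
      note 4 = hO_tdeg10[OF d 3(2,3), folded f4_def]
      note 5 = hE_tdeg10[OF d 4(2,3), folded f5_def]
      note 6 = hO_tdeg10[OF d 5(2,3), folded f6_def]
      note 7 = hE_tdeg10[OF d 6(2,3), folded f7_def]
      note 8 = hO_tdeg10[OF d 7(2,3), folded f8_def]
      note 9 = hE_tdeg10[OF d 8(2,3), folded f9_def]
      show ?thesis using 1(1) 2(1) 3(1) 4(1) 5(1) 6(1) 7(1) 8(1) 9(1) unfolding cs_def by simp
    qed
    show "(\<Sum>c\<leftarrow>cs. Suc (snd c)) < 13 * M - 36" using M unfolding cs_def N_def by simp
  qed
  then obtain T where T: "T \<in> G" "T \<noteq> 0" "\<forall>c\<in>set cs. fst c T = 0" by blast
  have z: "cE d T = 0" "cO (f1 T) = 0" "cE d (f2 T) = 0" "cO (f3 T) = 0" "cE d (f4 T) = 0"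
    "cO (f5 T) = 0" "cE d (f6 T) = 0" "cO (f7 T) = 0" "cE d (f8 T) = 0"
    using T(3) unfolding cs_def by simp_all
  define w where "w = monom 1 CARD('a) - [:0, 1 :: 'a:]"
  define g where "g = 1 + hg d"
  have r: "evE d T * g = w * evO d (f1 T)" "evO d (f1 T) * g * d = w * evE d (f2 T)"
    "evE d (f2 T) * g = w * evO d (f3 T)" "evO d (f3 T) * g * d = w * evE d (f4 T)"
    "evE d (f4 T) * g = w * evO d (f5 T)" "evO d (f5 T) * g * d = w * evE d (f6 T)"
    "evE d (f6 T) * g = w * evO d (f7 T)" "evO d (f7 T) * g * d = w * evE d (f8 T)"
    "evE d (f8 T) * g = w * evO d (f9 T)"
    using hE_ev[OF z(1)] hO_ev[OF z(2)] hE_ev[OF z(3)] hO_ev[OF z(4)] hE_ev[OF z(5)] hO_ev[OF z(6)]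
      hE_ev[OF z(7)] hO_ev[OF z(8)] hE_ev[OF z(9)]
    by (simp_all add: fdefs w_def g_def)
  have two: "x * (g ^ 2 * d) = w ^ 2 * z" if "x * g = w * y" "y * g * d = w * z" for x y z
  proof -
    have "x * (g ^ 2 * d) = (x * g) * g * d" by (simp add: power2_eq_square mult_ac)
    also have "\<dots> = w * (y * g * d)" unfolding that(1) by (simp only: mult_ac)
    also have "\<dots> = w ^ 2 * z" unfolding that(2) by (simp only: mult_ac power2_eq_square)
    finally show ?thesis .
  qed
  define q where "q = g ^ 2 * d"
  note two = two[OF r(1,2), folded q_def] two[OF r(3,4), folded q_def] two[OF r(5,6), folded q_def] two[OF r(7,8), folded q_def]
  have "evE d T * g ^ 9 * d ^ 4 = (evE d T * q) * q * q * q * g"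
    unfolding q_def by (simp add: eval_nat_numeral mult_ac)
  also have "\<dots> = w\<^sup>2 * (evE d (f2 T) * q) * q * q * g" unfolding two(1) by (simp only: mult_ac)
  also have "\<dots> = w\<^sup>2 * w\<^sup>2 * (evE d (f4 T) * q) * q * g" unfolding two(2) by (simp only: mult_ac)
  also have "\<dots> = w\<^sup>2 * w\<^sup>2 * w\<^sup>2 * (evE d (f6 T) * q) * g" unfolding two(3) by (simp only: mult_ac)
  also have "\<dots> = w\<^sup>2 * w\<^sup>2 * w\<^sup>2 * w\<^sup>2 * (evE d (f8 T) * g)" unfolding two(4) by (simp only: mult_ac)
  also have "\<dots> = w ^ 9 * evO d (f9 T)" unfolding r(9) by (simp add: eval_nat_numeral mult_ac)
  finally have "w ^ 9 dvd evE d T * g ^ 9 * d ^ 4" by simp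
  then show ?thesis using that T(1,2) unfolding G_def w_def g_def mem_Times_iff by blast
qed

lemma poly_const_root_bound:
  fixes B :: "'a :: {finite, idom} poly poly"
  assumes "B \<noteq> 0" "degree B < CARD('a)"
  shows "\<exists>s. poly B [:s:] \<noteq> 0"
proof (rule ccontr)
  assume "\<not> ?thesis"
  then have "(\<lambda>s. [:s:]) ` (UNIV :: 'a set) \<subseteq> {x. poly B x = 0}" by auto
  moreover have "inj (\<lambda>s :: 'a. [:s:])" by (auto simp: inj_on_def)
  ultimately have "CARD('a) \<le> card {x. poly B x = 0}"
    using card_mono[OF poly_roots_finite[OF assms(1)]] by (metis card_image)
  then show False using card_poly_roots_bound[OF assms(1)] assms(2) by linarith
qed

text \<open>d has no zeros, so the auxiliary polynomial has order 9 at all p points although its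
  degree is at most M + 8p. It is therefore 0, and squaring and specialising as in
  \<open>auxiliary_pair_eq_0\<close> applies.\<close>

theorem nonzero_square_values_10:
  fixes d :: "'a :: big_prime_field poly"
  assumes deg: "degree d \<le> 10" and sq: "\<And>t. \<exists>s. s \<noteq> 0 \<and> poly d t = s\<^sup>2"
  shows "\<exists>h. d = h\<^sup>2"
proof -
  let ?p = "CARD('a)" and ?M = "(CARD('a) - 1) div 2" and ?F = "monom 1 CARD('a) :: 'a poly"
  have p101: "?p > 101" by (rule CARD_gt)
  moreover obtain k where k: "?p = 2 * k + 1" using odd_CARD[where ?'a='a] by (auto elim: oddE)
  ultimately have M: "?M \<ge> 50" "2 * ?M = ?p - 1" "?p > 101" by simp_all
  obtain T where T: "T \<noteq> 0" "fst T \<in> tribox 8 (\<lambda>j. min ?M (?M + 3 - j))" "snd T \<in> tribox 3 (\<lambda>j. ?M - 7 - j)"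
    "(?F - [:0, 1:]) ^ 9 dvd evE d T * (1 + hg d) ^ 9 * d ^ 4"
    by (rule auxiliary_pair_10[OF deg M(1)])
  have c1: "cdeg_le ?M (fst T)" "degree (fst T) \<le> 8"
    using T(2) unfolding tribox_def cdeg_le_def by auto
  have c2: "cdeg_le (?M - 7) (snd T)" "degree (snd T) \<le> 3"
    using T(3) unfolding tribox_def cdeg_le_def by (auto intro: order_trans)
  have ev: "evE d T = 0"
  proof (rule ccontr)
    assume R: "evE d T \<noteq> 0"
    define m where "m = ?M"
    have g1: "poly (1 + hg d) t \<noteq> 0" for t
    proof -
      obtain c where c: "c \<noteq> 0" "poly d t = c\<^sup>2" using sq by blast
      have "c * c ^ (?p - 1) = c * 1"
        using M(3) pow_CARD[of c] by (subst power_Suc[symmetric]) simp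
      then have "c ^ (?p - 1) = 1" using c(1) by simp
      then have "poly d t ^ ?M = 1" unfolding c(2) power_mult[symmetric] M(2) .
      then show ?thesis unfolding poly_add hg_def poly_power using two_neq_0[where ?'a='a] by simp
    qed
    have d0: "poly d t \<noteq> 0" for t using sq[of t] by auto
    have nz: "1 + hg d \<noteq> 0" "d \<noteq> 0" using g1 d0 by fastforce+
    have ord: "9 \<le> order t (evE d T)" for t
    proof -
      have "[:- t, 1:] dvd ?F - [:0, 1:]"
        by (simp add: poly_eq_0_iff_dvd[symmetric] poly_monom)
      then have "[:- t, 1:] ^ 9 dvd evE d T * (1 + hg d) ^ 9 * d ^ 4"
        using T(4) dvd_power_same dvd_trans by blast
      moreover have nz3: "evE d T * (1 + hg d) ^ 9 * d ^ 4 \<noteq> 0" using R nz by simp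
      ultimately have "9 \<le> order t (evE d T * (1 + hg d) ^ 9 * d ^ 4)" using order_divides by blast
      also have "\<dots> = order t (evE d T) + order t ((1 + hg d) ^ 9) + order t (d ^ 4)"
        using nz3 by (simp add: order_mult)
      also have "order t ((1 + hg d) ^ 9) = 0" using g1 by (intro order_0I) simp
      also have "order t (d ^ 4) = 0" using d0 by (intro order_0I) simp
      finally show ?thesis by simp
    qed
    have "(\<Sum>t\<in>(UNIV :: 'a set). 9) \<le> (\<Sum>t\<in>UNIV. order t (evE d T))"
      by (rule sum_mono) (use ord in auto)
    also have "\<dots> \<le> degree (evE d T)" by (rule sum_order_UNIV_le_degree[OF R])
    finally have le: "9 * ?p \<le> degree (evE d T)" by simp
    have "degree (evE d T) \<le> ?M + ?p * 8"
    proof -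
      have "degree (poly (fst T) ?F) \<le> ?M + ?p * 8"
        using c1 by (intro degree_frob_subst_le)
      moreover have "degree (poly (snd T) ?F * d * hg d) \<le> ?M + ?p * 8"
      proof -
        have 1: "degree (poly (snd T) ?F) \<le> (?M - 7) + ?p * 3"
          using c2 by (intro degree_frob_subst_le)
        have 2: "degree (hg d) \<le> 10 * ?M"
          unfolding hg_def by (rule order_trans[OF degree_power_le mult_right_mono[OF deg]]) simp
        have "degree (poly (snd T) ?F * d * hg d) \<le> (?M - 7) + ?p * 3 + 10 + 10 * ?M"
          by (intro order_trans[OF degree_mult_le] add_mono 1 2 deg)
        also have "\<dots> \<le> ?M + ?p * 8"
        proof -
          have "(m - 7) + q * 3 + 10 + 10 * m \<le> m + q * 8" if "2 * m = q - 1" "50 \<le> m" "101 < q" for m q :: nat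
            using that by linarith
          then show ?thesis using M by blast
        qed
        finally show ?thesis .
      qed
      ultimately show ?thesis unfolding evE_def by (rule degree_add_le)
    qed
    moreover have False if "2 * m = q - 1" "101 < q" "9 * q \<le> e" "e \<le> m + q * 8"
      for m q e :: nat using that by linarith
    ultimately show False using le M by blast
  qed
  define A where "A = fst T" define B where "B = snd T"
  have "A * A - B * B * [:d:] * hds d = 0"
  proof (rule frob_subst_eq_0)
    have "cdeg_le (?M + ?M) (A * A)"
      using c1(1) unfolding A_def by (intro cdeg_le_mult)
    moreover have "cdeg_le (?M - 7 + (?M - 7) + 10 + 0) (B * B * [:d:] * hds d)"
      using c2(1) deg unfolding hds_def B_def
      by (intro cdeg_le_mult cdeg_le_const cdeg_le_lift)
    then have "cdeg_le (?M + ?M) (B * B * [:d:] * hds d)"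
    proof -
      have "m - 7 + (m - 7) + 10 + 0 \<le> m + m" if "50 \<le> m" for m :: nat using that by linarith
      then have "?M - 7 + (?M - 7) + 10 + 0 \<le> ?M + ?M" using M(1) by blast
      then show ?thesis using \<open>cdeg_le (?M - 7 + (?M - 7) + 10 + 0) _\<close> unfolding cdeg_le_def
        using order_trans by blast
    qed
    ultimately have "cdeg_le (?M + ?M) (A * A - B * B * [:d:] * hds d)"
      using cdeg_le_diff by blast
    moreover have "?M + ?M < ?p"
    proof -
      have "m + m < q" if "2 * m = q - 1" "101 < q" for m q :: nat using that by linarith
      then show ?thesis using M by blast
    qed
    ultimately show "degree (coeff (A * A - B * B * [:d:] * hds d) j) < ?p" for j
      unfolding cdeg_le_def by (meson le_less_trans)
    have "poly A ?F = - (poly B ?F * d * hg d)"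
      using ev unfolding evE_def A_def B_def by (simp add: eq_neg_iff_add_eq_0)
    then have "poly A ?F * poly A ?F = (poly B ?F * d * hg d) * (poly B ?F * d * hg d)" by simp
    then show "poly (A * A - B * B * [:d:] * hds d) ?F = 0"
      by (simp add: poly_hds_frob power2_eq_square mult_ac)
  qed
  then have eq: "A * A = B * B * [:d:] * hds d" by simp
  have "B \<noteq> 0"
  proof
    assume "B = 0"
    then have "A = 0" using eq by simp
    then show False using T(1) \<open>B = 0\<close> unfolding A_def B_def by (simp add: prod_eq_iff)
  qed
  moreover have "degree B < ?p" using c2(2) M(3) unfolding B_def by linarith
  ultimately obtain s where s: "poly B [:s:] \<noteq> 0" using poly_const_root_bound by blast
  obtain c where c: "c \<noteq> 0" "poly d s = c\<^sup>2" using sq by blast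
  define a where "a = poly A [:s:]" define b where "b = poly B [:s:]"
  have "poly (A * A) [:s:] = poly (B * B * [:d:] * hds d) [:s:]" using eq by simp
  moreover have "pcompose r [:s:] = [:poly r s:]" for r :: "'a poly"
    by (induction r) (simp_all add: pcompose_pCons)
  then have "poly (hds d) [:s:] = [:c\<^sup>2:]"
    by (simp add: poly_hds c(2)[symmetric])
  ultimately have ab: "a\<^sup>2 = b\<^sup>2 * smult (c\<^sup>2) d"
    by (simp add: a_def b_def power2_eq_square mult_ac)
  then have "b\<^sup>2 dvd a\<^sup>2" by (metis dvd_triv_left)
  then have "b dvd a" by simp
  then obtain h where "a = b * h" by blast
  then have "b\<^sup>2 * h\<^sup>2 = b\<^sup>2 * smult (c\<^sup>2) d" using ab by (simp add: power_mult_distrib)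
  moreover have "b\<^sup>2 \<noteq> 0" using s b_def by simp
  ultimately have "h\<^sup>2 = smult (c\<^sup>2) d" using mult_left_cancel by blast
  then have "d = smult (inverse (c\<^sup>2)) (h\<^sup>2)" using c(1) by simp
  also have "\<dots> = (smult (inverse c) h)\<^sup>2" by (simp add: power2_eq_square)
  finally show ?thesis by blast
qed


section \<open>Stepanov's method for cubes\<close>

text \<open>In base n the exponents of different powers of Y occupy disjoint blocks, and the highest
  block decides.\<close>

lemma degree_frob_subst:
  fixes P :: "'a :: idom poly poly"
  assumes "P \<noteq> 0" "\<And>j. degree (coeff P j) < n"
  shows "degree (poly P (monom 1 n)) = degree (lead_coeff P) + n * degree P"
  using assms
proof (induction P)
  case (pCons a P)
  show ?case
  proof (cases "P = 0")
    case False
    have "degree (coeff P j) < n" for j using pCons.prems(2)[of "Suc j"] by simp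
    then have IH: "degree (poly P (monom 1 n)) = degree (lead_coeff P) + n * degree P"
      using pCons.IH False by blast
    have a: "degree a < n" using pCons.prems(2)[of 0] by simp
    have nz: "poly P (monom 1 n) \<noteq> 0"
      using frob_subst_eq_0[of P n] False \<open>\<And>j. degree (coeff P j) < n\<close> by blast
    then have "degree (monom 1 n * poly P (monom 1 n)) = n + degree (poly P (monom 1 n))"
      by (simp add: degree_mult_eq degree_monom_eq)
    then have "degree (a + monom 1 n * poly P (monom 1 n)) = n + degree (poly P (monom 1 n))"
      using a by (subst degree_add_eq_right) auto
    then show ?thesis using False IH by simp
  qed simp
qed simp

lemma sum_of_distinct_degrees_neq_0:
  fixes a b c :: "'a :: comm_ring_1 poly"
  assumes "a \<noteq> 0 \<or> b \<noteq> 0 \<or> c \<noteq> 0" "a \<noteq> 0 \<Longrightarrow> b \<noteq> 0 \<Longrightarrow> degree a \<noteq> degree b"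
    "a \<noteq> 0 \<Longrightarrow> c \<noteq> 0 \<Longrightarrow> degree a \<noteq> degree c" "b \<noteq> 0 \<Longrightarrow> c \<noteq> 0 \<Longrightarrow> degree b \<noteq> degree c"
  shows "a + b + c \<noteq> 0"
proof -
  have two: "a + b \<noteq> 0 \<and> (degree (a + b) = degree a \<or> degree (a + b) = degree b)"
    if "a \<noteq> 0" "b \<noteq> 0" "degree a \<noteq> degree b" for a b :: "'a poly"
  proof (cases "degree a < degree b")
    case True
    then have "degree (a + b) = degree b" by (rule degree_add_eq_right)
    then show ?thesis using True by force
  next
    case False
    then have "degree b < degree a" using that by simp
    then have "degree (a + b) = degree a" by (rule degree_add_eq_left)
    then show ?thesis using \<open>degree b < degree a\<close> by force
  qed
  have two': "x + y \<noteq> 0" if "x \<noteq> 0 \<or> y \<noteq> 0" "x \<noteq> 0 \<Longrightarrow> y \<noteq> 0 \<Longrightarrow> degree x \<noteq> degree y" for x y :: "'a poly"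
  proof (cases "x = 0 \<or> y = 0")
    case True
    then show ?thesis using that(1) by auto
  next
    case False
    then show ?thesis using two[of x y] that(2) by blast
  qed
  consider "a = 0" | "b = 0" | "a \<noteq> 0" "b \<noteq> 0" by blast
  then show ?thesis
  proof cases
    case 1
    then have "b + c \<noteq> 0" using assms(1,4) by (intro two') auto
    then show ?thesis using 1 by simp
  next
    case 2
    then have "a + c \<noteq> 0" using assms(1,3) by (intro two') auto
    then show ?thesis using 2 by simp
  next
    case 3
    then have *: "a + b \<noteq> 0" "degree (a + b) = degree a \<or> degree (a + b) = degree b"
      using two[OF 3 assms(2)[OF 3]] by blast+
    have "degree (a + b) \<noteq> degree c" if "c \<noteq> 0" using *(2) assms(3)[OF 3(1) that] assms(4)[OF 3(2) that] by metis
    then show ?thesis using *(1) by (intro two') auto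
  qed
qed

text \<open>Cubing the 3P nonzero elements has fibres of size at most 3, so the image has at least P
  elements. It lies among the at most P roots of y^P = 1 and fills them.\<close>

lemma cubic_residue:
  fixes y :: "'a :: big_prime_field"
  assumes p: "CARD('a) = 3 * P + 1" and y: "y ^ P = 1"
  shows "\<exists>x. y = x ^ 3"
proof -
  have P: "P > 0" using p CARD_gt[where ?'a='a] by simp
  let ?U = "UNIV - {0 :: 'a}" and ?R = "{y :: 'a. y ^ P = 1}"
  have U: "card ?U = 3 * P" using p by (simp add: card_Diff_subset)
  have R: "finite ?R" "card ?R \<le> P"
  proof -
    have *: "monom 1 P - 1 \<noteq> (0 :: 'a poly)"
    proof
      assume "monom 1 P - 1 = (0 :: 'a poly)"
      then have "coeff (monom 1 P - 1 :: 'a poly) P = 0" by simp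
      then show False using P by simp
    qed
    have "?R = {y. poly (monom 1 P - 1) y = 0}" by (simp add: poly_monom)
    moreover have "degree (monom 1 P - 1 :: 'a poly) \<le> P"
      by (intro degree_diff_le degree_monom_le) simp
    ultimately show "finite ?R" "card ?R \<le> P"
      using card_poly_roots_bound[OF *] by (simp_all add: le_trans)
  qed
  have sub: "(\<lambda>x. x ^ 3) ` ?U \<subseteq> ?R"
  proof safe
    fix x :: 'a assume "x \<notin> {}" "x \<noteq> 0"
    have "x * x ^ (3 * P) = x * 1" using pow_CARD[of x] p by simp
    then have "x ^ (3 * P) = 1" using \<open>x \<noteq> 0\<close> by simp
    then show "(x ^ 3) ^ P = 1" by (simp add: power_mult)
  qed
  have fib: "card {x \<in> ?U. x ^ 3 = z} \<le> 3" for z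
  proof -
    have *: "monom 1 3 - [:z:] \<noteq> 0"
    proof
      assume "monom 1 3 - [:z:] = 0"
      then have "coeff (monom 1 3 - [:z:]) 3 = 0" by simp
      then show False by (simp add: coeff_pCons eval_nat_numeral)
    qed
    have "{x \<in> ?U. x ^ 3 = z} \<subseteq> {x. poly (monom 1 3 - [:z:]) x = 0}" by (auto simp: poly_monom)
    then have "card {x \<in> ?U. x ^ 3 = z} \<le> degree (monom 1 3 - [:z:])"
      using card_mono[of "{x. poly (monom 1 3 - [:z:]) x = 0}"] card_poly_roots_bound[OF *] by (meson finite le_trans)
    also have "\<dots> \<le> 3" by (intro degree_diff_le degree_monom_le) simp
    finally show ?thesis .
  qed
  have "card ?U = (\<Sum>z\<in>(\<lambda>x. x ^ 3) ` ?U. card {x \<in> ?U. x ^ 3 = z})"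
    using sum.image_gen[of ?U "\<lambda>_. 1 :: nat" "\<lambda>x. x ^ 3"] by simp
  also have "\<dots> \<le> (\<Sum>z\<in>(\<lambda>x. x ^ 3) ` ?U. 3)" by (rule sum_mono) (rule fib)
  finally have "P \<le> card ((\<lambda>x. x ^ 3) ` ?U)" using U by simp
  then have "(\<lambda>x. x ^ 3) ` ?U = ?R" using R sub by (intro card_seteq) auto
  then show ?thesis using y by force
qed

context
  fixes e :: "'a :: big_prime_field poly" and P :: nat
begin

text \<open>The analogue of \<open>hE\<close> and \<open>hO\<close> for cubes: g = e^P and e(X^p) =
  e g^3. The shapes A + B e g + C e g^2, A + B g + C e g^2 and A g + B g^2 + C of
  \<open>kev0\<close>, \<open>kev1\<close>, \<open>kev2\<close> pass into each other cyclically on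
  multiplication by g - 1, with one extra factor e at the third step. The step functions divide the
  three new coefficients by Y - X.\<close>

fun kstep0 kstep1 kstep2 :: "'a poly poly \<times> 'a poly poly \<times> 'a poly poly \<Rightarrow> 'a poly poly \<times> 'a poly poly \<times> 'a poly poly" where
  "kstep0 (A, B, C) = (diag_div (C * hds e - A), diag_div (A - B * [:e:]), diag_div (B - C))"
| "kstep1 (A, B, C) = (diag_div (A - B), diag_div (B - C * [:e:]), diag_div (C * hds e - A))"
| "kstep2 (A, B, C) = (diag_div (B * hds e - C * [:e:]), diag_div (C - A), diag_div (A - B))"

text \<open>On the diagonal the three new coefficients satisfy a linear relation, so two conditions
  per step suffice.\<close>

fun ucond0 ucond1 ucond2 wcond0 wcond1 wcond2 :: "'a poly poly \<times> 'a poly poly \<times> 'a poly poly \<Rightarrow> 'a poly" where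
  "ucond0 (A, B, C) = poly (A - B * [:e:]) [:0, 1:]"
| "wcond0 (A, B, C) = poly (B - C) [:0, 1:]"
| "ucond1 (A, B, C) = poly (A - B) [:0, 1:]"
| "wcond1 (A, B, C) = poly (B - C * [:e:]) [:0, 1:]"
| "ucond2 (A, B, C) = poly (C - A) [:0, 1:]"
| "wcond2 (A, B, C) = poly (A - B) [:0, 1:]"

fun kev0 kev1 kev2 :: "'a poly poly \<times> 'a poly poly \<times> 'a poly poly \<Rightarrow> 'a poly" where
  "kev0 (A, B, C) = poly A (monom 1 CARD('a)) + poly B (monom 1 CARD('a)) * e * e ^ P
     + poly C (monom 1 CARD('a)) * e * (e ^ P)\<^sup>2"
| "kev1 (A, B, C) = poly A (monom 1 CARD('a)) + poly B (monom 1 CARD('a)) * e ^ P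
     + poly C (monom 1 CARD('a)) * e * (e ^ P)\<^sup>2"
| "kev2 (A, B, C) = poly A (monom 1 CARD('a)) * e ^ P + poly B (monom 1 CARD('a)) * (e ^ P)\<^sup>2
     + poly C (monom 1 CARD('a))"

lemma k_diff:
  "kstep0 (S - T) = kstep0 S - kstep0 T" "kstep1 (S - T) = kstep1 S - kstep1 T" "kstep2 (S - T) = kstep2 S - kstep2 T"
proof -
  obtain A B C A2 B2 C2 where *: "S = (A, B, C)" "T = (A2, B2, C2)" by (cases S, cases T)
  show "kstep0 (S - T) = kstep0 S - kstep0 T" "kstep1 (S - T) = kstep1 S - kstep1 T" "kstep2 (S - T) = kstep2 S - kstep2 T"
    unfolding * diff_Pair kstep0.simps kstep1.simps kstep2.simps synthetic_div_diff[symmetric]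
    by (simp_all only: algebra_simps)
qed

lemma uw_diff:
  "ucond0 (S - T) = ucond0 S - ucond0 T" "ucond1 (S - T) = ucond1 S - ucond1 T" "ucond2 (S - T) = ucond2 S - ucond2 T"
  "wcond0 (S - T) = wcond0 S - wcond0 T" "wcond1 (S - T) = wcond1 S - wcond1 T" "wcond2 (S - T) = wcond2 S - wcond2 T"
proof -
  obtain A B C A2 B2 C2 where *: "S = (A, B, C)" "T = (A2, B2, C2)" by (cases S, cases T)
  show "ucond0 (S - T) = ucond0 S - ucond0 T" "ucond1 (S - T) = ucond1 S - ucond1 T" "ucond2 (S - T) = ucond2 S - ucond2 T"
    "wcond0 (S - T) = wcond0 S - wcond0 T" "wcond1 (S - T) = wcond1 S - wcond1 T" "wcond2 (S - T) = wcond2 S - wcond2 T"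
    unfolding * diff_Pair ucond0.simps ucond1.simps ucond2.simps wcond0.simps wcond1.simps wcond2.simps poly_diff poly_mult
    by (simp_all only: algebra_simps)
qed

context
  assumes p: "CARD('a) = 3 * P + 1"
begin

lemma poly_hds_frob3: "poly (hds e) (monom 1 CARD('a)) = e * (e ^ P) ^ 3"
proof -
  have "poly (hds e) (monom 1 CARD('a)) = e ^ CARD('a)" by (simp add: poly_hds poly_pow_CARD)
  also have "\<dots> = e * (e ^ P) ^ 3" unfolding p by (simp add: power_mult[symmetric] mult.commute)
  finally show ?thesis .
qed

lemma k0_ev:
  assumes "ucond0 T = 0" "wcond0 T = 0"
  shows "(monom 1 CARD('a) - [:0, 1:]) * kev1 (kstep0 T) = kev0 T * (e ^ P - 1)"
proof -
  obtain A B C where T: "T = (A, B, C)" by (cases T)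
  define g where "g = e ^ P"
  have c2: "poly (A - B * [:e:]) [:0, 1:] = 0" and c3: "poly (B - C) [:0, 1:] = 0"
    using assms unfolding T by (simp_all only: ucond0.simps wcond0.simps)
  have c1: "poly (C * hds e - A) [:0, 1:] = 0"
  proof -
    have "poly (C * hds e - A) [:0, 1:] = - (poly (A - B * [:e:]) [:0, 1:] + poly (B - C) [:0, 1:] * e)"
      by (simp add: hds_diag algebra_simps)
    then show ?thesis unfolding c2 c3 by simp
  qed
  have "(monom 1 CARD('a) - [:0, 1:]) * kev1 (kstep0 T) = poly (C * hds e - A) (monom 1 CARD('a))
    + poly (A - B * [:e:]) (monom 1 CARD('a)) * g + poly (B - C) (monom 1 CARD('a)) * e * g\<^sup>2"
    unfolding diag_div_frob[OF c1] diag_div_frob[OF c2] diag_div_frob[OF c3] T kstep0.simps kev1.simps g_def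
    by (simp only: algebra_simps)
  also have "\<dots> = kev0 T * (e ^ P - 1)"
    by (simp add: T poly_hds_frob3 g_def[symmetric] algebra_simps power2_eq_square power3_eq_cube)
  finally show ?thesis .
qed

lemma k1_ev:
  assumes "ucond1 T = 0" "wcond1 T = 0"
  shows "(monom 1 CARD('a) - [:0, 1:]) * kev2 (kstep1 T) = kev1 T * (e ^ P - 1)"
proof -
  obtain A B C where T: "T = (A, B, C)" by (cases T)
  define g where "g = e ^ P"
  have c1: "poly (A - B) [:0, 1:] = 0" and c2: "poly (B - C * [:e:]) [:0, 1:] = 0"
    using assms unfolding T by (simp_all only: ucond1.simps wcond1.simps)
  have c3: "poly (C * hds e - A) [:0, 1:] = 0"
  proof -
    have "poly (C * hds e - A) [:0, 1:] = - (poly (A - B) [:0, 1:] + poly (B - C * [:e:]) [:0, 1:])"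
      by (simp add: hds_diag algebra_simps)
    then show ?thesis unfolding c1 c2 by simp
  qed
  have "(monom 1 CARD('a) - [:0, 1:]) * kev2 (kstep1 T) = poly (A - B) (monom 1 CARD('a)) * g
    + poly (B - C * [:e:]) (monom 1 CARD('a)) * g\<^sup>2 + poly (C * hds e - A) (monom 1 CARD('a))"
    unfolding diag_div_frob[OF c1] diag_div_frob[OF c2] diag_div_frob[OF c3] T kstep1.simps kev2.simps g_def
    by (simp only: algebra_simps)
  also have "\<dots> = kev1 T * (e ^ P - 1)"
    by (simp add: T poly_hds_frob3 g_def[symmetric] algebra_simps power2_eq_square power3_eq_cube)
  finally show ?thesis .
qed

lemma k2_ev:
  assumes "ucond2 T = 0" "wcond2 T = 0"
  shows "(monom 1 CARD('a) - [:0, 1:]) * kev0 (kstep2 T) = kev2 T * (e ^ P - 1) * e"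
proof -
  obtain A B C where T: "T = (A, B, C)" by (cases T)
  define g where "g = e ^ P"
  have c2: "poly (C - A) [:0, 1:] = 0" and c3: "poly (A - B) [:0, 1:] = 0"
    using assms unfolding T by (simp_all only: ucond2.simps wcond2.simps)
  have c1: "poly (B * hds e - C * [:e:]) [:0, 1:] = 0"
  proof -
    have "poly (B * hds e - C * [:e:]) [:0, 1:] = - (poly (C - A) [:0, 1:] + poly (A - B) [:0, 1:]) * e"
      by (simp add: hds_diag algebra_simps)
    then show ?thesis unfolding c2 c3 by simp
  qed
  have "(monom 1 CARD('a) - [:0, 1:]) * kev0 (kstep2 T) = poly (B * hds e - C * [:e:]) (monom 1 CARD('a))
    + poly (C - A) (monom 1 CARD('a)) * e * g + poly (A - B) (monom 1 CARD('a)) * e * g\<^sup>2"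
    unfolding diag_div_frob[OF c1] diag_div_frob[OF c2] diag_div_frob[OF c3] T kstep2.simps kev0.simps g_def
    by (simp only: algebra_simps)
  also have "\<dots> = kev2 T * (e ^ P - 1) * e"
    by (simp add: T poly_hds_frob3 g_def[symmetric] algebra_simps power2_eq_square power3_eq_cube)
  finally show ?thesis .
qed

end

definition tdeg3 :: "nat \<Rightarrow> nat \<Rightarrow> nat \<Rightarrow> 'a poly poly \<times> 'a poly poly \<times> 'a poly poly \<Rightarrow> bool" where
  "tdeg3 a b c T \<longleftrightarrow> tdeg_le a (fst T) \<and> tdeg_le b (fst (snd T)) \<and> tdeg_le c (snd (snd T))"

text \<open>A period of three steps raises the bounds by 2 = 5 - 3: one multiplication by e and
  three divisions by Y - X.\<close>

lemma k_tdeg: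
  assumes e: "degree e \<le> 5"
  shows "tdeg3 (m + 6) (m + 1) (m + 1) T \<Longrightarrow>
      degree (ucond0 T) \<le> m + 6 \<and> degree (wcond0 T) \<le> m + 1 \<and> tdeg3 (m + 5) (m + 5) m (kstep0 T)"
    and "tdeg3 (m + 5) (m + 5) m T \<Longrightarrow>
      degree (ucond1 T) \<le> m + 5 \<and> degree (wcond1 T) \<le> m + 5 \<and> tdeg3 (m + 4) (m + 4) (m + 4) (kstep1 T)"
    and "tdeg3 (m + 4) (m + 4) (m + 4) T \<Longrightarrow>
      degree (ucond2 T) \<le> m + 4 \<and> degree (wcond2 T) \<le> m + 4 \<and> tdeg3 (m + 2 + 6) (m + 2 + 1) (m + 2 + 1) (kstep2 T)"
proof -
  obtain A B C where T: "T = (A, B, C)" by (cases T)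
  have es: "tdeg_le 5 (hds e)" "tdeg_le 5 [:e:]"
    unfolding hds_def using e by (simp_all add: tdeg_le_lift tdeg_le_const)
  have m5: "m + 6 = m + 1 + 5" "m + 4 + 5 = m + 9" by simp_all
  {
    assume "tdeg3 (m + 6) (m + 1) (m + 1) T"
    then have *: "tdeg_le (m + 6) A" "tdeg_le (m + 1) B" "tdeg_le (m + 1) C" by (simp_all add: tdeg3_def T)
    have 1: "tdeg_le (m + 6) (C * hds e - A)" "tdeg_le (m + 6) (A - B * [:e:])" "tdeg_le (m + 1) (B - C)"
      using * es tdeg_le_mult[OF *(3) es(1)] tdeg_le_mult[OF *(2) es(2)] by (auto intro!: tdeg_le_diff simp: m5)
    show "degree (ucond0 T) \<le> m + 6 \<and> degree (wcond0 T) \<le> m + 1 \<and> tdeg3 (m + 5) (m + 5) m (kstep0 T)"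
      using degree_diagonal_le[OF 1(2)] degree_diagonal_le[OF 1(3)]
        tdeg_le_diag_div[OF 1(1)] tdeg_le_diag_div[OF 1(2)] tdeg_le_diag_div[OF 1(3)]
      unfolding T ucond0.simps wcond0.simps kstep0.simps tdeg3_def fst_conv snd_conv by (simp add: add.commute del: poly_diff poly_mult)
  }
  {
    assume "tdeg3 (m + 5) (m + 5) m T"
    then have *: "tdeg_le (m + 5) A" "tdeg_le (m + 5) B" "tdeg_le m C" by (simp_all add: tdeg3_def T)
    have 1: "tdeg_le (m + 5) (A - B)" "tdeg_le (m + 5) (B - C * [:e:])" "tdeg_le (m + 5) (C * hds e - A)"
      using * es tdeg_le_mult[OF *(3) es(1)] tdeg_le_mult[OF *(3) es(2)] by (auto intro!: tdeg_le_diff)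
    show "degree (ucond1 T) \<le> m + 5 \<and> degree (wcond1 T) \<le> m + 5 \<and> tdeg3 (m + 4) (m + 4) (m + 4) (kstep1 T)"
      using degree_diagonal_le[OF 1(1)] degree_diagonal_le[OF 1(2)]
        tdeg_le_diag_div[OF 1(1)] tdeg_le_diag_div[OF 1(2)] tdeg_le_diag_div[OF 1(3)]
      unfolding T ucond1.simps wcond1.simps kstep1.simps tdeg3_def fst_conv snd_conv by (simp add: add.commute del: poly_diff poly_mult)
  }
  {
    assume "tdeg3 (m + 4) (m + 4) (m + 4) T"
    then have *: "tdeg_le (m + 4) A" "tdeg_le (m + 4) B" "tdeg_le (m + 4) C" by (simp_all add: tdeg3_def T)
    have 1: "tdeg_le (m + 9) (B * hds e - C * [:e:])" "tdeg_le (m + 4) (C - A)" "tdeg_le (m + 4) (A - B)"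
      using * tdeg_le_mult[OF *(2) es(1)] tdeg_le_mult[OF *(3) es(2)]
      unfolding m5 by (simp_all add: tdeg_le_diff)
    show "degree (ucond2 T) \<le> m + 4 \<and> degree (wcond2 T) \<le> m + 4 \<and> tdeg3 (m + 2 + 6) (m + 2 + 1) (m + 2 + 1) (kstep2 T)"
      using degree_diagonal_le[OF 1(2)] degree_diagonal_le[OF 1(3)]
        tdeg_le_diag_div[OF 1(1)] tdeg_le_diag_div[OF 1(2)] tdeg_le_diag_div[OF 1(3)]
      unfolding T ucond2.simps wcond2.simps kstep2.simps tdeg3_def fst_conv snd_conv by (simp add: add.commute numeral_3_eq_3 del: poly_diff poly_mult)
  }
qed

text \<open>17P - 45 unknowns face 14m + 91 = 14P + 35 conditions, m = P - 4; this needs P \<ge> 27.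
  The caps P and P - 4 and the bound P - 3 on the degrees in X are what the nonvanishing argument in
  \<open>cubic_residue_values\<close> can bear.\<close>

lemma kummer_auxiliary:
  assumes p: "CARD('a) = 3 * P + 1" and e: "degree e \<le> 5" and P: "P \<ge> 27"
  obtains A B C where "(A, B, C) \<noteq> 0" "A \<in> tribox 6 (\<lambda>j. min P (P + 2 - j))"
    "B \<in> tribox 5 (\<lambda>j. min (P - 4) (P - 3 - j))" "C \<in> tribox 3 (\<lambda>j. P - 3 - j)"
    "(monom 1 CARD('a) - [:0, 1:]) ^ 7 dvd kev0 (A, B, C) * (e ^ P - 1) ^ 7 * e ^ 2"
proof -
  define m where "m = P - 4"
  define f1 where "f1 T = kstep0 T" for T
  define f2 where "f2 T = kstep1 (f1 T)" for T
  define f3 where "f3 T = kstep2 (f2 T)" for T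
  define f4 where "f4 T = kstep0 (f3 T)" for T
  define f5 where "f5 T = kstep1 (f4 T)" for T
  define f6 where "f6 T = kstep2 (f5 T)" for T
  define f7 where "f7 T = kstep0 (f6 T)" for T
  note fdefs = f1_def f2_def f3_def f4_def f5_def f6_def f7_def
  define G :: "('a poly poly \<times> 'a poly poly \<times> 'a poly poly) set"
    where "G = tribox 6 (\<lambda>j. min P (P + 2 - j)) \<times> tribox 5 (\<lambda>j. min (P - 4) (P - 3 - j)) \<times> tribox 3 (\<lambda>j. P - 3 - j)"
  have diffs: "f1 (S - T) = f1 S - f1 T" "f2 (S - T) = f2 S - f2 T" "f3 (S - T) = f3 S - f3 T"
    "f4 (S - T) = f4 S - f4 T" "f5 (S - T) = f5 S - f5 T" "f6 (S - T) = f6 S - f6 T" for S T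
    by (simp_all add: fdefs k_diff)
  define cs where "cs = [(ucond0, m + 6), (wcond0, m + 1), (\<lambda>T. ucond1 (f1 T), m + 5), (\<lambda>T. wcond1 (f1 T), m + 5),
    (\<lambda>T. ucond2 (f2 T), m + 4), (\<lambda>T. wcond2 (f2 T), m + 4),
    (\<lambda>T. ucond0 (f3 T), m + 2 + 6), (\<lambda>T. wcond0 (f3 T), m + 2 + 1), (\<lambda>T. ucond1 (f4 T), m + 2 + 5), (\<lambda>T. wcond1 (f4 T), m + 2 + 5),
    (\<lambda>T. ucond2 (f5 T), m + 2 + 4), (\<lambda>T. wcond2 (f5 T), m + 2 + 4),
    (\<lambda>T. ucond0 (f6 T), m + 2 + 2 + 6), (\<lambda>T. wcond0 (f6 T), m + 2 + 2 + 1)]"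
  have "\<exists>T\<in>G. T \<noteq> 0 \<and> (\<forall>c\<in>set cs. fst c T = 0)"
  proof (rule nonzero_kernel_element[of G "17 * P - 45" cs])
    show "finite G" unfolding G_def by (intro finite_cartesian_product) (simp_all add: card_tribox)
    show "x - y \<in> G" if "x \<in> G" "y \<in> G" for x y
      using that unfolding G_def by (cases x; cases y) (simp add: tribox_diff)
    have "(\<Sum>j\<le>6. Suc (min P (P + 2 - j))) + ((\<Sum>j\<le>5. Suc (min (P - 4) (P - 3 - j))) + (\<Sum>j\<le>3. Suc (P - 3 - j))) = 17 * P - 45"
    proof -
      have "(\<Sum>j\<le>6. Suc (min P (P + 2 - j))) = 7 * P - 3"
        using P by (simp add: atMost_nat_numeral)
      moreover have "(\<Sum>j\<le>5. Suc (min (P - 4) (P - 3 - j))) = 6 * P - 28"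
        using P by (simp add: atMost_nat_numeral)
      moreover have "(\<Sum>j\<le>3. Suc (P - 3 - j)) = 4 * P - 14"
        using P by (simp add: atMost_nat_numeral)
      ultimately show ?thesis using P by simp
    qed
    then show "CARD('a) ^ (17 * P - 45) \<le> card G"
      unfolding G_def card_cartesian_product by (simp add: card_tribox power_add[symmetric])
    show "\<forall>c\<in>set cs. fst c (x - y) = fst c x - fst c y" for x y
      unfolding cs_def by (simp add: diffs uw_diff)
    show "\<forall>c\<in>set cs. degree (fst c x) \<le> snd c" if "x \<in> G" for x
    proof -
      have 0: "tdeg3 (m + 6) (m + 1) (m + 1) x"
      proof -
        have "min P (P + 2 - j) + j \<le> m + 6" if "j \<le> 6" for j using that P unfolding m_def by linarith
        moreover have "min (P - 4) (P - 3 - j) + j \<le> m + 1" if "j \<le> 5" for j using that P unfolding m_def by linarith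
        moreover have "P - 3 - j + j \<le> m + 1" if "j \<le> 3" for j using that P unfolding m_def by linarith
        ultimately show ?thesis
          using \<open>x \<in> G\<close> unfolding G_def tdeg3_def mem_Times_iff by (meson tdeg_le_tribox)
      qed
      note 1 = k_tdeg(1)[OF e 0, folded f1_def]
      note 2 = k_tdeg(2)[OF e 1[THEN conjunct2, THEN conjunct2], folded f2_def]
      note 3 = k_tdeg(3)[OF e 2[THEN conjunct2, THEN conjunct2], folded f3_def]
      note 4 = k_tdeg(1)[OF e 3[THEN conjunct2, THEN conjunct2], folded f4_def]
      note 5 = k_tdeg(2)[OF e 4[THEN conjunct2, THEN conjunct2], folded f5_def]
      note 6 = k_tdeg(3)[OF e 5[THEN conjunct2, THEN conjunct2], folded f6_def]
      note 7 = k_tdeg(1)[OF e 6[THEN conjunct2, THEN conjunct2], folded f7_def]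
      show ?thesis using 1 2 3 4 5 6 7 unfolding cs_def by simp
    qed
    show "(\<Sum>c\<leftarrow>cs. Suc (snd c)) < 17 * P - 45" using P unfolding cs_def m_def by simp
  qed
  then obtain T where T: "T \<in> G" "T \<noteq> 0" "\<forall>c\<in>set cs. fst c T = 0" by blast
  have z: "ucond0 T = 0" "wcond0 T = 0" "ucond1 (f1 T) = 0" "wcond1 (f1 T) = 0" "ucond2 (f2 T) = 0" "wcond2 (f2 T) = 0"
    "ucond0 (f3 T) = 0" "wcond0 (f3 T) = 0" "ucond1 (f4 T) = 0" "wcond1 (f4 T) = 0" "ucond2 (f5 T) = 0" "wcond2 (f5 T) = 0"
    "ucond0 (f6 T) = 0" "wcond0 (f6 T) = 0"
    using T(3) unfolding cs_def by simp_all
  define w where "w = monom 1 CARD('a) - [:0, 1 :: 'a:]"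
  define g where "g = e ^ P - 1"
  have r: "kev0 T * g = w * kev1 (f1 T)" "kev1 (f1 T) * g = w * kev2 (f2 T)" "kev2 (f2 T) * g * e = w * kev0 (f3 T)"
    "kev0 (f3 T) * g = w * kev1 (f4 T)" "kev1 (f4 T) * g = w * kev2 (f5 T)" "kev2 (f5 T) * g * e = w * kev0 (f6 T)"
    "kev0 (f6 T) * g = w * kev1 (f7 T)"
    using k0_ev[OF p z(1,2)] k1_ev[OF p z(3,4)] k2_ev[OF p z(5,6)] k0_ev[OF p z(7,8)] k1_ev[OF p z(9,10)]
      k2_ev[OF p z(11,12)] k0_ev[OF p z(13,14)]
    by (simp_all add: fdefs w_def g_def)
  have three: "x * (g ^ 3 * e) = w ^ 3 * z'" if "x * g = w * y" "y * g = w * z" "z * g * e = w * z'" for x y z z'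
  proof -
    have "x * (g ^ 3 * e) = (x * g) * g * g * e" by (simp add: power3_eq_cube mult_ac)
    also have "\<dots> = w * (y * g) * g * e" unfolding that(1) by (simp only: mult_ac)
    also have "\<dots> = w * w * (z * g * e)" unfolding that(2) by (simp only: mult_ac)
    also have "\<dots> = w ^ 3 * z'" unfolding that(3) by (simp only: mult_ac power3_eq_cube)
    finally show ?thesis .
  qed
  define q where "q = g ^ 3 * e"
  note three = three[OF r(1,2,3), folded q_def] three[OF r(4,5,6), folded q_def]
  have "kev0 T * g ^ 7 * e ^ 2 = (kev0 T * q) * q * g"
    unfolding q_def by (simp add: eval_nat_numeral mult_ac)
  also have "\<dots> = w ^ 3 * (kev0 (f3 T) * q) * g" unfolding three(1) by (simp only: mult_ac)
  also have "\<dots> = w ^ 3 * w ^ 3 * (kev0 (f6 T) * g)" unfolding three(2) by (simp only: mult_ac)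
  also have "\<dots> = w ^ 7 * kev1 (f7 T)" unfolding r(7) by (simp add: eval_nat_numeral mult_ac)
  finally have *: "w ^ 7 dvd kev0 T * g ^ 7 * e ^ 2" by simp
  obtain A B C where T': "T = (A, B, C)" by (cases T)
  show ?thesis
  proof (rule that[of A B C])
    show "(A, B, C) \<noteq> 0" using T(2) unfolding T' .
    show "A \<in> tribox 6 (\<lambda>j. min P (P + 2 - j))" "B \<in> tribox 5 (\<lambda>j. min (P - 4) (P - 3 - j))" "C \<in> tribox 3 (\<lambda>j. P - 3 - j)"
      using T(1) unfolding T' G_def mem_Sigma_iff by blast+
    show "(monom 1 CARD('a) - [:0, 1:]) ^ 7 dvd kev0 (A, B, C) * (e ^ P - 1) ^ 7 * e ^ 2"
      using * unfolding T' w_def g_def .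
  qed
qed

end

text \<open>e^P is never 1, so the auxiliary polynomial a + b + c has order 7 at all p points,
  although its degree is below 7p. It is not 0 because its summands have different degrees: three
  times the degree is modulo p a number below p of the form 3i, 3i + 10 or 3i + 5. This uses that
  deg e = 5 is prime to 3.\<close>

theorem cubic_residue_values:
  fixes e :: "'a :: big_prime_field poly"
  assumes e: "degree e = 5" and no: "\<And>v x. x ^ 3 \<noteq> poly e v"
  shows False
proof -
  let ?p = "CARD('a)" and ?F = "monom 1 CARD('a) :: 'a poly"
  obtain P where p: "?p = 3 * P + 1"
  proof -
    have pr: "prime ?p" by (rule prime_CARD)
    have "?p mod 3 = 0 \<or> ?p mod 3 = 1 \<or> ?p mod 3 = 2" by arith
    moreover have "?p mod 3 \<noteq> 0"
    proof
      assume "?p mod 3 = 0"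
      then have "3 dvd ?p" by presburger
      then have "?p = 3" using pr primes_dvd_imp_eq[of 3 ?p] by simp
      then show False using CARD_gt[where ?'a='a] by simp
    qed
    moreover have "?p mod 3 \<noteq> 2"
    proof
      assume "?p mod 3 = 2"
      define P where "P = ?p div 3"
      have p: "?p = 3 * P + 2" using \<open>?p mod 3 = 2\<close> unfolding P_def by presburger
      define y where "y = poly e 0"
      have y: "y ^ (3 * P + 2) = y" using pow_CARD[of y] unfolding p .
      \<comment> \<open>If p = 3P + 2 every element is a cube: 3(2P + 1) = 2(p - 1) + 1, so 2P + 1
        inverts cubing on exponents.\<close>
      have "y ^ (3 * P + 2 + (3 * P + 1)) = y ^ (3 * P + 2) * y ^ (3 * P + 1)" by (rule power_add)
      also have "\<dots> = y * y ^ (3 * P + 1)" unfolding y ..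
      also have "\<dots> = y ^ (3 * P + 2)" by simp
      finally have "y ^ (3 * P + 2 + (3 * P + 1)) = y" unfolding y .
      moreover have "3 * P + 2 + (3 * P + 1) = (2 * P + 1) * 3" by simp
      ultimately have "(y ^ (2 * P + 1)) ^ 3 = y" by (simp only: power_mult)
      then show False using no[of "y ^ (2 * P + 1)" 0] unfolding y_def by simp
    qed
    ultimately have "?p mod 3 = 1" by blast
    then have "?p = 3 * (?p div 3) + 1" by presburger
    then show ?thesis using that by blast
  qed
  have P: "P \<ge> 27" using p CARD_gt[where ?'a='a] by simp
  obtain A B C where T: "(A, B, C) \<noteq> 0" "A \<in> tribox 6 (\<lambda>j. min P (P + 2 - j))"
    "B \<in> tribox 5 (\<lambda>j. min (P - 4) (P - 3 - j))" "C \<in> tribox 3 (\<lambda>j. P - 3 - j)"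
    "(?F - [:0, 1:]) ^ 7 dvd kev0 e P (A, B, C) * (e ^ P - 1) ^ 7 * e ^ 2"
    by (rule kummer_auxiliary[OF p _ P, of e]) (simp_all add: e)
  define a b c where "a = poly A ?F" and "b = poly B ?F * e * e ^ P" and "c = poly C ?F * e * (e ^ P)\<^sup>2"
  have enz: "e \<noteq> 0" using e by auto
  have cA: "cdeg_le P A" and cB: "cdeg_le (P - 4) B" and cC: "cdeg_le (P - 3) C"
    using T(2-4) unfolding tribox_def cdeg_le_def by (auto intro: order_trans)
  have small: "degree (coeff A j) < ?p" "degree (coeff B j) < ?p" "degree (coeff C j) < ?p" for j
  proof -
    have "P < ?p" "P - 4 < ?p" "P - 3 < ?p" unfolding p by simp_all
    then show "degree (coeff A j) < ?p" "degree (coeff B j) < ?p" "degree (coeff C j) < ?p"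
      using cA cB cC unfolding cdeg_le_def by (blast intro: le_less_trans)+
  qed
  have da: "a \<noteq> 0 \<Longrightarrow> \<exists>i j. i \<le> P \<and> j \<le> 6 \<and> degree a = i + ?p * j"
  proof -
    assume "a \<noteq> 0"
    then have "A \<noteq> 0" unfolding a_def by auto
    then have "degree a = degree (lead_coeff A) + ?p * degree A"
      unfolding a_def by (rule degree_frob_subst) (rule small)
    moreover have "degree (lead_coeff A) \<le> P" "degree A \<le> 6" using cA T(2) unfolding cdeg_le_def tribox_def by auto
    ultimately show ?thesis by blast
  qed
  have db: "b \<noteq> 0 \<Longrightarrow> \<exists>i j. i \<le> P - 4 \<and> j \<le> 5 \<and> degree b = i + ?p * j + 5 + 5 * P"
  proof -
    assume b0: "b \<noteq> 0"
    then have "B \<noteq> 0" unfolding b_def by auto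
    then have "degree (poly B ?F) = degree (lead_coeff B) + ?p * degree B"
      by (rule degree_frob_subst) (rule small)
    moreover have "degree b = degree (poly B ?F) + 5 + 5 * P"
      using b0 enz e unfolding b_def by (simp add: degree_mult_eq degree_power_eq)
    moreover have "degree (lead_coeff B) \<le> P - 4" "degree B \<le> 5" using cB T(3) unfolding cdeg_le_def tribox_def by auto
    ultimately show ?thesis by metis
  qed
  have dc: "c \<noteq> 0 \<Longrightarrow> \<exists>i j. i \<le> P - 3 \<and> j \<le> 3 \<and> degree c = i + ?p * j + 5 + 10 * P"
  proof -
    assume c0: "c \<noteq> 0"
    then have "C \<noteq> 0" unfolding c_def by auto
    then have "degree (poly C ?F) = degree (lead_coeff C) + ?p * degree C"
      by (rule degree_frob_subst) (rule small)
    moreover have "degree c = degree (poly C ?F) + 5 + 10 * P"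
      using c0 enz e unfolding c_def by (simp add: degree_mult_eq degree_power_eq)
    moreover have "degree (lead_coeff C) \<le> P - 3" "degree C \<le> 3" using cC T(4) unfolding cdeg_le_def tribox_def by auto
    ultimately show ?thesis by metis
  qed
  have base: "x = x'" if "x + (3 * P + 1) * y = x' + (3 * P + 1) * y'" "x < 3 * P + 1" "x' < 3 * P + 1" for x x' y y' :: nat
  proof -
    have "(x + (3 * P + 1) * y) mod (3 * P + 1) = x" "(x' + (3 * P + 1) * y') mod (3 * P + 1) = x'"
      using that(2,3) by (simp_all only: mod_mult_self2 mod_less)
    then show ?thesis using that(1) by simp
  qed
  have nz: "a + b + c \<noteq> 0"
  proof (rule sum_of_distinct_degrees_neq_0)
    show "a \<noteq> 0 \<or> b \<noteq> 0 \<or> c \<noteq> 0"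
    proof (rule ccontr)
      assume "\<not> ?thesis"
      then have "poly A ?F = 0" "poly B ?F = 0" "poly C ?F = 0"
        using enz unfolding a_def b_def c_def by auto
      then have "A = 0" "B = 0" "C = 0" using frob_subst_eq_0 small by blast+
      then show False using T(1) by (simp add: zero_prod_def)
    qed
    show "degree a \<noteq> degree b" if nz1: "a \<noteq> 0" and nz2: "b \<noteq> 0"
    proof
      assume eq: "degree a = degree b"
      obtain i j i' j' where *: "i \<le> P" "i' \<le> P - 4" "i + ?p * j = i' + ?p * j' + 5 + 5 * P"
        using da[OF nz1] db[OF nz2] eq by metis
      \<comment> \<open>Tripling turns 5P into 5(p - 1), so both sides become expansions x + p y
        with x < p, and the digits x can be compared modulo 3.\<close>
      have "3 * i + (3 * P + 1) * (3 * j) = (3 * i' + 10) + (3 * P + 1) * (3 * j' + 5)"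
        using *(3) unfolding p by (simp add: algebra_simps)
      moreover have "3 * i < 3 * P + 1" "3 * i' + 10 < 3 * P + 1" using *(1,2) P by linarith+
      ultimately have "3 * i = 3 * i' + 10" by (rule base)
      then show False by presburger
    qed
    show "degree a \<noteq> degree c" if nz1: "a \<noteq> 0" and nz2: "c \<noteq> 0"
    proof
      assume eq: "degree a = degree c"
      obtain i j i' j' where *: "i \<le> P" "i' \<le> P - 3" "i + ?p * j = i' + ?p * j' + 5 + 10 * P"
        using da[OF nz1] dc[OF nz2] eq by metis
      have "3 * i + (3 * P + 1) * (3 * j) = (3 * i' + 5) + (3 * P + 1) * (3 * j' + 10)"
        using *(3) unfolding p by (simp add: algebra_simps)
      moreover have "3 * i < 3 * P + 1" "3 * i' + 5 < 3 * P + 1" using *(1,2) P by linarith+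
      ultimately have "3 * i = 3 * i' + 5" by (rule base)
      then show False by presburger
    qed
    show "degree b \<noteq> degree c" if nz1: "b \<noteq> 0" and nz2: "c \<noteq> 0"
    proof
      assume eq: "degree b = degree c"
      obtain i j i' j' where *: "i \<le> P - 4" "i' \<le> P - 3" "i + ?p * j + 5 + 5 * P = i' + ?p * j' + 5 + 10 * P"
        using db[OF nz1] dc[OF nz2] eq by metis
      have "(3 * i + 10) + (3 * P + 1) * (3 * j + 5) = (3 * i' + 5) + (3 * P + 1) * (3 * j' + 10)"
        using *(3) unfolding p by (simp add: algebra_simps)
      moreover have "3 * i + 10 < 3 * P + 1" "3 * i' + 5 < 3 * P + 1" using *(1,2) P by linarith+
      ultimately have "3 * i + 10 = 3 * i' + 5" by (rule base)
      then show False by presburger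
    qed
  qed
  have R: "kev0 e P (A, B, C) = a + b + c" by (simp add: a_def b_def c_def)
  have "degree (a + b + c) < 7 * ?p"
  proof -
    have "degree a < 7 * ?p" "degree b < 7 * ?p" "degree c < 7 * ?p"
    proof -
      show "degree a < 7 * ?p"
      proof (cases "a = 0")
        case False
        then obtain i j where *: "i \<le> P" "j \<le> 6" "degree a = i + ?p * j" using da by blast
        have "?p * j \<le> ?p * 6" using *(2) by simp
        then show ?thesis using *(1,3) p by linarith
      qed (use p in simp)
      show "degree b < 7 * ?p"
      proof (cases "b = 0")
        case False
        then obtain i j where *: "i \<le> P - 4" "j \<le> 5" "degree b = i + ?p * j + 5 + 5 * P" using db by blast
        have "?p * j \<le> ?p * 5" using *(2) by simp
        then show ?thesis using *(1,3) p P by linarith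
      qed (use p in simp)
      show "degree c < 7 * ?p"
      proof (cases "c = 0")
        case False
        then obtain i j where *: "i \<le> P - 3" "j \<le> 3" "degree c = i + ?p * j + 5 + 10 * P" using dc by blast
        have "?p * j \<le> ?p * 3" using *(2) by simp
        then show ?thesis using *(1,3) p P by linarith
      qed (use p in simp)
    qed
    then show ?thesis by (intro degree_add_less)
  qed
  moreover have "7 \<le> order t (a + b + c)" for t
  proof -
    have e0: "poly e t \<noteq> 0" using no[of 0 t] by auto
    have g1: "poly (e ^ P - 1) t \<noteq> 0" using cubic_residue[OF p, of "poly e t"] no[of _ t] by fastforce
    have "[:- t, 1:] dvd ?F - [:0, 1:]"
      by (simp add: poly_eq_0_iff_dvd[symmetric] poly_monom)
    then have "[:- t, 1:] ^ 7 dvd (a + b + c) * (e ^ P - 1) ^ 7 * e ^ 2"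
      using T(5) dvd_power_same dvd_trans unfolding R by blast
    moreover have nz3: "(a + b + c) * (e ^ P - 1) ^ 7 * e ^ 2 \<noteq> 0"
    proof -
      have "e ^ P - 1 \<noteq> 0" using g1 by force
      then show ?thesis using nz enz by simp
    qed
    ultimately have "7 \<le> order t ((a + b + c) * (e ^ P - 1) ^ 7 * e ^ 2)" using order_divides by blast
    also have "\<dots> = order t (a + b + c) + order t ((e ^ P - 1) ^ 7) + order t (e ^ 2)"
      using nz3 by (simp add: order_mult)
    also have "order t ((e ^ P - 1) ^ 7) = 0" using g1 by (intro order_0I) simp
    also have "order t (e ^ 2) = 0" using e0 by (intro order_0I) simp
    finally show ?thesis by simp
  qed
  then have "(\<Sum>t\<in>(UNIV :: 'a set). 7) \<le> (\<Sum>t\<in>UNIV. order t (a + b + c))"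
    by (intro sum_mono) auto
  then have "7 * ?p \<le> degree (a + b + c)" using sum_order_UNIV_le_degree[OF nz] by simp
  ultimately show False by simp
qed

section \<open>Families of cubic polynomials with a zero\<close>

text \<open>A prime factor of B does not divide A, so its whole multiplicity in q^3 falls to B. The
  induction strips f^3 from B and f from q.\<close>

lemma coprime_factors_of_cube:
  fixes A B q :: "'a :: big_prime_field poly"
  assumes "A * B = smult k (q ^ 3)" "k \<noteq> 0" "q \<noteq> 0" "coprime A B"
  shows "3 dvd degree B"
  using assms
proof (induction "degree B" arbitrary: B q rule: less_induct)
  case less
  have nz: "A \<noteq> 0" "B \<noteq> 0" using less.prems by auto
  show ?case
  proof (cases "degree B = 0")
    case False
    then have "\<not> is_unit B" by (auto simp: is_unit_iff_degree nz)
    then obtain f where f: "f dvd B" "prime f" using prime_divisor_exists nz by blast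
    have fA: "\<not> f dvd A" using f less.prems(4) by (meson coprime_common_divisor not_prime_unit)
    have "f dvd smult k (q ^ 3)" using f(1) less.prems(1) by (metis dvd_mult)
    then have "f dvd q ^ 3" using less.prems(2) by (simp add: dvd_smult_iff)
    then have "f dvd q" using f(2) by (meson prime_dvd_power)
    then obtain q' where q: "q = f * q'" by blast
    have pe: "prime_elem f" using f(2) by simp
    then have f0: "f \<noteq> 0" by auto
    have step: "f dvd x" if "A * x = f * y" for x y
      using prime_elem_dvd_multD[OF pe, of A x] that fA by (metis dvd_triv_left)
    obtain B1 where B1: "B = f * B1" using f(1) by blast
    have "f * (A * B1) = f * (f * smult k (f * q' ^ 3))"
      using less.prems(1) unfolding B1 q by (simp add: power3_eq_cube mult_ac)
    then have e1: "A * B1 = f * smult k (f * q' ^ 3)" using f0 mult_left_cancel by blast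
    then obtain B2 where B2: "B1 = f * B2" using step by blast
    have "f * (A * B2) = f * (f * smult k (q' ^ 3))" using e1 unfolding B2 by (simp add: mult_ac)
    then have e2: "A * B2 = f * smult k (q' ^ 3)" using f0 mult_left_cancel by blast
    then obtain B3 where B3: "B2 = f * B3" using step by blast
    have "f * (A * B3) = f * smult k (q' ^ 3)" using e2 unfolding B3 by (simp add: mult_ac)
    then have e3: "A * B3 = smult k (q' ^ 3)" using f0 mult_left_cancel by blast
    have BB: "B = f ^ 3 * B3" unfolding B1 B2 B3 by (simp add: power3_eq_cube mult_ac)
    then have B30: "B3 \<noteq> 0" using nz by auto
    have q'0: "q' \<noteq> 0" using q less.prems(3) by auto
    have degB: "degree B = 3 * degree f + degree B3"
      unfolding BB using f0 B30 by (simp add: degree_mult_eq degree_power_eq)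
    have "degree f > 0"
    proof (rule ccontr)
      assume "\<not> ?thesis"
      then have "is_unit f" using f0 by (simp add: is_unit_iff_degree)
      then show False using f(2) not_prime_unit by blast
    qed
    moreover have "coprime A B3" using less.prems(4) unfolding BB by simp
    ultimately have "3 dvd degree B3"
      using less.hyps[of B3 q'] degB e3 less.prems(2) q'0 by simp
    then show ?thesis unfolding degB by simp
  qed simp
qed

lemma degree_1_root:
  fixes f :: "'a :: field poly"
  assumes "degree f = 1"
  shows "\<exists>t. f = smult (lead_coeff f) [:- t, 1:]"
proof -
  define a b where "a = coeff f 0" and "b = coeff f 1"
  have f: "f = [:a, b:]" unfolding a_def b_def
    using assms by (intro poly_eqI) (auto simp: coeff_pCons coeff_eq_0 split: nat.splits)
  have "b \<noteq> 0" using assms unfolding f by (auto split: if_splits)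
  then have "f = smult (lead_coeff f) [:- (- a / b), 1:]" unfolding f by simp
  then show ?thesis by blast
qed

text \<open>f(t) = k y^3 is solvable in t when b^2 - 4ac + 4ak y^3 is a square. This has odd degree
  in y, so it is not nonsq times a square and must take a nonzero square value.\<close>

lemma quadratic_value_cube:
  fixes f :: "'a :: big_prime_field poly"
  assumes "degree f = 2" "k \<noteq> 0"
  shows "\<exists>t y. poly f t = k * y ^ 3"
proof -
  define c b a where "c = coeff f 0" and "b = coeff f 1" and "a = coeff f 2"
  have f: "f = [:c, b, a:]" unfolding a_def b_def c_def
    using assms by (intro poly_eqI) (auto simp: coeff_pCons coeff_eq_0 numeral_2_eq_2 split: nat.splits)
  have a: "a \<noteq> 0" using assms unfolding a_def by (metis leading_coeff_0_iff degree_0 zero_neq_numeral)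
  define \<delta> where "\<delta> = [:b\<^sup>2 - 4 * a * c, 0, 0, 4 * a * k:]"
  have deg: "degree \<delta> = 3" using a assms(2) by (simp add: \<delta>_def)
  have "{t. \<exists>s. s \<noteq> 0 \<and> poly \<delta> t = s\<^sup>2} \<noteq> {}"
  proof
    assume "{t. \<exists>s. s \<noteq> 0 \<and> poly \<delta> t = s\<^sup>2} = {}"
    then have "card {t. \<exists>s. s \<noteq> 0 \<and> poly \<delta> t = s\<^sup>2} \<le> 4" by (simp only: card.empty)
    then obtain h where h: "\<delta> = smult nonsq (h\<^sup>2)"
      using mostly_nonsquare_values[of \<delta>] deg by auto
    have "degree \<delta> = 2 * degree h \<or> degree \<delta> = 0"
      unfolding h by (cases "h = 0") (simp_all add: degree_power_eq)
    then show False using deg by presburger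
  qed
  then obtain y s where s: "poly \<delta> y = s\<^sup>2" by blast
  have "poly f ((s - b) / (2 * a)) = k * y ^ 3"
  proof -
    have s2: "s\<^sup>2 = b\<^sup>2 - 4 * a * c + 4 * a * k * y ^ 3" using s by (simp add: \<delta>_def power3_eq_cube algebra_simps)
    define t where "t = (s - b) / (2 * a)"
    have "2 * a * t = s - b" unfolding t_def using a by simp
    then have "(2 * a * t + b)\<^sup>2 = s\<^sup>2" by simp
    then have "4 * a * (c + b * t + a * t\<^sup>2) = 4 * a * (k * y ^ 3)" unfolding s2 by (simp add: power2_eq_square algebra_simps)
    then have "c + b * t + a * t\<^sup>2 = k * y ^ 3" using a by simp
    then show ?thesis unfolding t_def[symmetric] f by (simp add: power2_eq_square algebra_simps)
  qed
  then show ?thesis by blast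
qed

text \<open>Without a zero, the discriminant is a nonzero square for every v, hence a square h^2,
  and (h - i e)(h + i e) = - 4 q^3 with i^2 = - 27. One factor has degree 5, no multiple of 3, so
  the two have a common prime factor f. It has no root, since a common root of q and e gives the
  zero x = 0, and it has degree 2. Depending on which factor contains f twice, Cardano's formula
  yields a zero or q and e share a root.\<close>

theorem depressed_cubic_family:
  fixes q e :: "'a :: big_prime_field poly"
  assumes q: "degree q \<le> 3" and e: "degree e = 5" and no: "\<And>v x. x ^ 3 + poly q v * x + poly e v \<noteq> 0"
  shows False
proof (cases "q = 0")
  case True
  show False
  proof (rule cubic_residue_values[of "- e"])
    show "x ^ 3 \<noteq> poly (- e) v" for v x
      using no[of x v] True by (simp add: eq_neg_iff_add_eq_0)
  qed (simp add: e)
next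
  case q0: False
  define \<Delta> where "\<Delta> = smult (- 4) (q ^ 3) + smult (- 27) (e\<^sup>2)"
  have enz: "e \<noteq> 0" using e by auto
  have d3: "degree (q ^ 3) = 3 * degree q" using q0 by (simp add: degree_power_eq)
  have d10: "degree (smult (- 27) (e\<^sup>2)) = 10" using enz e by (simp add: degree_power_eq)
  have common: "\<not> (poly q t = 0 \<and> poly e t = 0)" for t using no[of 0 t] by auto
  have deg\<Delta>: "degree \<Delta> = 10" "lead_coeff \<Delta> = - 27 * (lead_coeff e)\<^sup>2"
  proof -
    have lt: "degree (smult (- 4) (q ^ 3)) < degree (smult (- 27) (e\<^sup>2))" using d3 d10 q by simp
    show "degree \<Delta> = 10" unfolding \<Delta>_def using degree_add_eq_right[OF lt] d10 by simp
    show "lead_coeff \<Delta> = - 27 * (lead_coeff e)\<^sup>2" unfolding \<Delta>_def using lead_coeff_add_le[OF lt] by (simp add: lead_coeff_power)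
  qed
  have "\<exists>s. s \<noteq> 0 \<and> poly \<Delta> t = s\<^sup>2" for t
  proof -
    have "\<exists>s. - 4 * poly q t ^ 3 - 27 * (poly e t)\<^sup>2 = s\<^sup>2"
      by (rule cubic_discriminant_square) (use no[of _ t] in blast)
    then obtain s where s: "poly \<Delta> t = s\<^sup>2" by (auto simp: \<Delta>_def)
    have "s \<noteq> 0"
    proof
      assume "s = 0"
      then have z: "4 * poly q t ^ 3 + 27 * (poly e t)\<^sup>2 = 0" using s
        by (simp add: \<Delta>_def) (metis add.inverse_inverse add_eq_0_iff neg_eq_iff_add_eq_0 minus_diff_eq add_uminus_conv_diff)
      have "poly q t \<noteq> 0" using z common[of t] by auto
      \<comment> \<open>When 4 q^3 + 27 e^2 = 0, the cubic has the rational root 3e/q.\<close>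
      have "(3 * poly e t / poly q t) ^ 3 + poly q t * (3 * poly e t / poly q t) + poly e t
          = poly e t * (4 * poly q t ^ 3 + 27 * (poly e t)\<^sup>2) / poly q t ^ 3"
        using \<open>poly q t \<noteq> 0\<close> by (simp add: field_simps power3_eq_cube power2_eq_square)
      also have "\<dots> = 0" unfolding z by simp
      finally show False using no by blast
    qed
    then show ?thesis using s by blast
  qed
  then obtain h where h: "\<Delta> = h\<^sup>2" using nonzero_square_values_10[of \<Delta>] deg\<Delta>(1) by auto
  have h0: "h \<noteq> 0" using h deg\<Delta>(1) by auto
  have dh: "degree h = 5" using deg\<Delta>(1) h0 unfolding h by (simp add: degree_power_eq)
  \<comment> \<open>The leading terms of h^2 = - 4 q^3 - 27 e^2 show that - 27 is a square in the
    prime field, because deg q^3 \<le> 9.\<close>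
  define i where "i = lead_coeff h / lead_coeff e"
  have le: "lead_coeff e \<noteq> 0" using enz by simp
  have i2: "i\<^sup>2 = - 27"
  proof -
    have "(lead_coeff h)\<^sup>2 = - 27 * (lead_coeff e)\<^sup>2" using deg\<Delta>(2) unfolding h by (simp add: lead_coeff_power)
    then show ?thesis unfolding i_def power_divide using le by simp
  qed
  have i0: "i \<noteq> 0" using h0 enz unfolding i_def by simp
  define A where "A = h - smult i e"
  define B where "B = h + smult i e"
  have AB: "A * B = smult (- 4) (q ^ 3)"
  proof -
    have "A * B = h\<^sup>2 - smult (i\<^sup>2) (e\<^sup>2)" unfolding A_def B_def by (simp add: algebra_simps power2_eq_square)
    also have "\<dots> = smult (- 4) (q ^ 3)" unfolding h[symmetric] \<Delta>_def i2 by simp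
    finally show ?thesis .
  qed
  have eAB: "poly e t = 0" if "poly A t = 0" "poly B t = 0" for t
  proof -
    have "2 * i * poly e t = poly B t - poly A t" unfolding A_def B_def by (simp add: algebra_simps)
    then show ?thesis using that i0 two_neq_0[where ?'a='a] by simp
  qed
  have nzAB: "A \<noteq> 0" "B \<noteq> 0" using AB q0 by auto
  have dA: "degree A \<le> 4"
  proof -
    have "degree A < 5"
    proof (rule degree_lessI)
      show "\<forall>k\<ge>5. coeff A k = 0"
      proof (intro allI impI)
        fix k :: nat assume "5 \<le> k"
        show "coeff A k = 0"
        proof (cases "k = 5")
          case True
          have "coeff h 5 = i * coeff e 5" using le e dh unfolding i_def by simp
          then show ?thesis using True unfolding A_def by simp
        qed (use \<open>5 \<le> k\<close> e dh in \<open>simp add: A_def coeff_eq_0\<close>)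
      qed
    qed simp
    then show ?thesis by simp
  qed
  have dB: "degree B = 5"
  proof -
    have two: "smult 2 h = h + h" using smult_add_left[of 1 1 h] by simp
    have "B = smult 2 h + (- A)" unfolding two A_def B_def by simp
    moreover have "degree (- A) < degree (smult 2 h)" using dA dh two_neq_0[where ?'a='a] by simp
    ultimately have "degree B = degree (smult 2 h)" by (simp only: degree_add_eq_left)
    then show ?thesis using dh two_neq_0[where ?'a='a] by simp
  qed
  have dAB: "degree A + 5 = 3 * degree q"
    using arg_cong[OF AB, of degree] nzAB dB d3 by (simp add: degree_mult_eq)
  have "\<not> coprime A B"
  proof
    assume "coprime A B"
    then have "3 dvd degree B" using coprime_factors_of_cube[OF AB _ q0] by simp
    then show False using dB by presburger
  qed
  then obtain c where c: "c dvd A" "c dvd B" "\<not> is_unit c" by (auto simp: coprime_def)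
  then have "c \<noteq> 0" using nzAB by auto
  then obtain f where f: "f dvd c" "prime f" using c(3) prime_divisor_exists by blast
  have fA: "f dvd A" and fB: "f dvd B" using f c dvd_trans by blast+
  have pe: "prime_elem f" using f(2) by simp
  then have f0: "f \<noteq> 0" by auto
  have "f dvd smult (- 4) (q ^ 3)" using fA AB by (metis dvd_mult2)
  then have "f dvd q ^ 3" by (simp add: dvd_smult_iff)
  then have fq: "f dvd q" using f(2) by (meson prime_dvd_power)
  obtain q1 A1 B1 where q1: "q = f * q1" and A1: "A = f * A1" and B1: "B = f * B1"
    using fq fA fB by blast
  have noroot: "poly f t \<noteq> 0" for t
    using common[of t] eAB[of t] unfolding q1 A1 B1 by auto
  have df: "degree f \<ge> 2"
  proof (rule ccontr)
    assume "\<not> ?thesis"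
    then have "degree f = 0 \<or> degree f = 1" by linarith
    moreover have "degree f \<noteq> 0"
    proof
      assume "degree f = 0"
      then have "is_unit f" using f0 by (simp add: is_unit_iff_degree)
      then show False using f(2) not_prime_unit by blast
    qed
    ultimately obtain t where t: "f = smult (lead_coeff f) [:- t, 1:]" using degree_1_root by blast
    have "poly f t = 0" by (subst t) simp
    then show False using noroot by blast
  qed
  have nz1: "q1 \<noteq> 0" "A1 \<noteq> 0" "B1 \<noteq> 0" using q0 nzAB q1 A1 B1 by auto
  have dq: "degree q = degree f + degree q1" and dA1: "degree A = degree f + degree A1" and dB1: "degree B = degree f + degree B1"
    unfolding q1 A1 B1 using f0 nz1 by (simp_all add: degree_mult_eq)
  have e1: "A1 * B1 = f * smult (- 4) (q1 ^ 3)"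
  proof -
    have "(f * f) * (A1 * B1) = (f * f) * (f * smult (- 4) (q1 ^ 3))"
      using AB unfolding q1 A1 B1 by (simp add: power3_eq_cube mult_ac)
    moreover have "f * f \<noteq> 0" using f0 by simp
    ultimately show ?thesis using mult_left_cancel by blast
  qed
  then have "f dvd A1 * B1" by (rule dvdI)
  then consider "f dvd A1" | "f dvd B1" using prime_elem_dvd_multD[OF pe] by blast
  then show False
  proof cases
    case 1
    then obtain A2 where A2: "A1 = f * A2" by blast
    have nz2: "A2 \<noteq> 0" using nz1 A2 by auto
    have "degree A1 = degree f + degree A2" unfolding A2 using f0 nz2 by (simp add: degree_mult_eq)
    then have *: "degree f = 2" "degree A2 = 0" "degree A = 4" using dA dA1 df by linarith+
    then have "degree q = 3" using dAB by simp
    then have dq1: "degree q1 = 1" using dq * by simp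
    obtain c where c: "A2 = [:c:]" using *(2) by (auto elim: degree_eq_zeroE)
    have c0: "c \<noteq> 0" using c nz2 by auto
    have "f * (A2 * B1) = f * smult (- 4) (q1 ^ 3)" using e1 unfolding A2 by (simp add: mult_ac)
    then have "A2 * B1 = smult (- 4) (q1 ^ 3)" using f0 mult_left_cancel by blast
    then have "smult (inverse c) (smult c B1) = smult (inverse c) (smult (- 4) (q1 ^ 3))" unfolding c by simp
    then have B1': "B1 = smult (- 4 / c) (q1 ^ 3)" using c0 by (simp add: field_simps)
    define c' where "c' = - 4 / c"
    have c'0: "c' \<noteq> 0" "c = - 4 / c'" using c0 by (simp_all add: c'_def)
    define k where "k = - 2 * i / c'"
    have k0: "k \<noteq> 0" unfolding k_def using i0 c'0 two_neq_0[where ?'a='a] by simp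
    obtain t y where ty: "poly f t = k * y ^ 3" using quadratic_value_cube[OF *(1) k0] by blast
    define F L where "F = poly f t" and "L = poly q1 t"
    have F: "F = k * y ^ 3" "F \<noteq> 0" using ty noroot[of t] unfolding F_def by auto
    have y0: "y \<noteq> 0" using F by auto
    have At: "poly A t = c * F\<^sup>2" unfolding A1 A2 c F_def by (simp add: power2_eq_square)
    have Bt: "poly B t = c' * F * L ^ 3" unfolding B1 B1' F_def L_def c'_def by simp
    have qt: "poly q t = F * L" unfolding q1 F_def L_def by simp
    have et: "2 * i * poly e t = c' * F * L ^ 3 - c * F\<^sup>2"
      unfolding At[symmetric] Bt[symmetric] A_def B_def by (simp add: algebra_simps)
    \<comment> \<open>Cardano: x = u + w with u = yL and w = - F/(3y), so that 3uw = - q. The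
      constant k was chosen to give u^3 + w^3 = - e.\<close>
    define x where "x = y * L - F / (3 * y)"
    have "2 * i * (x ^ 3 + poly q t * x + poly e t) = 0"
    proof -
      have "x ^ 3 + F * L * x = y ^ 3 * L ^ 3 - F ^ 3 / (27 * y ^ 3)"
        unfolding x_def using y0 by (simp add: field_simps power3_eq_cube)
      also have "y ^ 3 = F / k" using F(1) k0 by simp
      also have "F / k * L ^ 3 - F ^ 3 / (27 * (F / k)) = F * L ^ 3 / k - k * F\<^sup>2 / 27"
        using k0 F(2) by (simp add: field_simps power3_eq_cube power2_eq_square)
      finally have xx: "x ^ 3 + poly q t * x = F * L ^ 3 / k - k * F\<^sup>2 / 27" unfolding qt .
      have "2 * i * (x ^ 3 + poly q t * x + poly e t) =
          2 * i * (F * L ^ 3 / k - k * F\<^sup>2 / 27) + (c' * F * L ^ 3 - c * F\<^sup>2)"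
        unfolding xx et[symmetric] by (rule distrib_left)
      moreover have "2 * i / k = - c'" unfolding k_def using i0 c'0 two_neq_0[where ?'a='a] by (simp add: field_simps)
      moreover have "2 * i * k / 27 = - c"
      proof -
        have "2 * i * k / 27 = - 4 * i\<^sup>2 / (27 * c')" unfolding k_def by (simp add: power2_eq_square)
        also have "\<dots> = - c" unfolding i2 c'0(2) using c'0(1) by (simp add: frac_eq_eq)
        finally show ?thesis .
      qed
      moreover have "2 * i * (F * L ^ 3 / k - k * F\<^sup>2 / 27) = (2 * i / k) * F * L ^ 3 - (2 * i * k / 27) * F\<^sup>2"
        by (simp add: algebra_simps)
      ultimately show ?thesis by simp
    qed
    then show False using no[of x t] i0 two_neq_0[where ?'a='a] by simp
  next
    case 2
    then obtain B2 where B2: "B1 = f * B2" by blast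
    have nz2: "B2 \<noteq> 0" using nz1 B2 by auto
    have "degree B1 = degree f + degree B2" unfolding B2 using f0 nz2 by (simp add: degree_mult_eq)
    then have s5: "2 * degree f + degree B2 = 5" using dB dB1 by simp
    then have f2: "degree f = 2" using df by presburger
    then have *: "degree f = 2" "degree B2 = 1" using s5 by simp_all
    have "f * (A1 * B2) = f * smult (- 4) (q1 ^ 3)" using e1 unfolding B2 by (simp add: mult_ac)
    then have e2: "A1 * B2 = smult (- 4) (q1 ^ 3)" using f0 mult_left_cancel by blast
    have "degree A1 + 1 = 3 * degree q1"
      using arg_cong[OF e2, of degree] nz1 nz2 * by (simp add: degree_mult_eq degree_power_eq)
    moreover have "degree q1 \<le> 1" using dq * q by simp
    ultimately have dq1: "degree q1 = 1" by linarith
    \<comment> \<open>In A1 B2 = - 4 q1^3 both B2 and q1 are linear, so they share the root r and A1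
      vanishes there too. Hence A, B and q vanish at r, and with them e.\<close>
    obtain r where r: "q1 = smult (lead_coeff q1) [:- r, 1:]" using degree_1_root[OF dq1] by blast
    obtain r' where r': "B2 = smult (lead_coeff B2) [:- r', 1:]" using degree_1_root[OF *(2)] by blast
    have "poly B2 r' = 0" by (subst r') simp
    then have "poly (smult (- 4) (q1 ^ 3)) r' = 0" unfolding e2[symmetric] by simp
    then have "poly q1 r' = 0" by simp
    moreover have "poly q1 r' = lead_coeff q1 * (r' - r)" by (subst r) (simp add: algebra_simps)
    ultimately have rr: "r' = r" using nz1 by simp
    define Lr where "Lr = [:- r, 1:]"
    have "Lr * smult (lead_coeff B2) A1 = Lr * smult (- 4 * lead_coeff q1 ^ 3) (Lr\<^sup>2)"
    proof -
      have "Lr * smult (lead_coeff B2) A1 = A1 * B2" using r'[unfolded rr, folded Lr_def] by (metis mult.commute mult_smult_left mult_smult_right)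
      also have "\<dots> = smult (- 4) ((smult (lead_coeff q1) Lr) ^ 3)" unfolding e2 using r[folded Lr_def] by simp
      also have "\<dots> = Lr * smult (- 4 * lead_coeff q1 ^ 3) (Lr\<^sup>2)" by (simp add: smult_power[symmetric] power3_eq_cube power2_eq_square mult_ac)
      finally show ?thesis .
    qed
    moreover have "Lr \<noteq> 0" by (simp add: Lr_def)
    ultimately have "smult (lead_coeff B2) A1 = smult (- 4 * lead_coeff q1 ^ 3) (Lr\<^sup>2)" using mult_left_cancel by blast
    then have "poly (smult (lead_coeff B2) A1) r = 0" by (simp add: Lr_def)
    then have "poly A1 r = 0" using nz2 by simp
    moreover have "poly B2 r = 0" using \<open>poly B2 r' = 0\<close> rr by simp
    moreover have "poly q1 r = 0" using \<open>poly q1 r' = 0\<close> rr by simp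
    ultimately have "poly e r = 0" "poly q r = 0" using eAB[of r] unfolding A1 B1 B2 q1 by simp_all
    then show False using common by blast
  qed
qed

text \<open>The Tschirnhaus substitution x = k y + c/3 after multiplication by k^2 removes the
  quadratic term. The new contributions to the constant term have degree at most 4, so its degree
  stays 5.\<close>

theorem cubic_family:
  fixes c d e :: "'a :: big_prime_field poly"
  assumes k: "k \<noteq> 0" and c: "degree c \<le> 1" and d: "degree d \<le> 3" and e: "degree e = 5"
  shows "\<exists>v x. k * x ^ 3 + poly c v * x\<^sup>2 + poly d v * x + poly e v = 0"
proof (rule ccontr)
  assume no: "\<not> ?thesis"
  define c3 where "c3 = smult (1 / 3) c"
  have c3: "degree c3 \<le> 1" unfolding c3_def using c by (intro order_trans[OF degree_smult_le])
  have cc: "poly c v = 3 * poly c3 v" for v by (simp add: c3_def)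
  define q where "q = smult k d - smult 3 (c3\<^sup>2)"
  define r where "r = smult 2 (c3 ^ 3) - smult k (c3 * d)"
  have "degree (smult 3 (c3\<^sup>2)) \<le> 3"
    using degree_power_le[of c3 2] c3 by (intro order_trans[OF degree_smult_le]) linarith
  then have dq: "degree q \<le> 3" unfolding q_def using d
    by (intro degree_diff_le) (auto intro: order_trans[OF degree_smult_le])
  have "degree (smult 2 (c3 ^ 3)) \<le> 4"
    using degree_power_le[of c3 3] c3 by (intro order_trans[OF degree_smult_le]) linarith
  moreover have "degree (smult k (c3 * d)) \<le> 4"
    using degree_mult_le[of c3 d] c3 d by (intro order_trans[OF degree_smult_le]) linarith
  ultimately have dr: "degree r \<le> 4" unfolding r_def by (intro degree_diff_le)
  have de: "degree (smult (k\<^sup>2) e) = 5" using e k by simp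
  have "degree (smult (k\<^sup>2) e + r) = 5" using dr de by (subst degree_add_eq_left) auto
  then show False
  proof (rule depressed_cubic_family[OF dq])
    fix v x
    define y where "y = (x - poly c3 v) / k"
    have x: "x = k * y + poly c3 v" using k by (simp add: y_def)
    have "x ^ 3 + poly q v * x + poly (smult (k\<^sup>2) e + r) v =
        k\<^sup>2 * (k * y ^ 3 + poly c v * y\<^sup>2 + poly d v * y + poly e v)"
      unfolding x q_def r_def cc by (simp add: algebra_simps power2_eq_square power3_eq_cube)
    then show "x ^ 3 + poly q v * x + poly (smult (k\<^sup>2) e + r) v \<noteq> 0"
      using no k by simp
  qed
qed

section \<open>The Chevalley-Warning theorem\<close>

text \<open>Polynomial functions of degree at most D in m variables, generated as functions so that
  sums over all points can be treated by induction.\<close>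

inductive monomial_span :: "nat \<Rightarrow> nat \<Rightarrow> ((nat \<Rightarrow> 'a :: comm_ring_1) \<Rightarrow> 'a) \<Rightarrow> bool" for m where
  monomial: "(\<Sum>i<m. e i) \<le> D \<Longrightarrow> monomial_span m D (\<lambda>x. c * (\<Prod>i<m. x i ^ e i))"
| add: "monomial_span m D G \<Longrightarrow> monomial_span m D H \<Longrightarrow> monomial_span m D (\<lambda>x. G x + H x)"

lemma monomial_span_const: "monomial_span m D (\<lambda>x. c)"
  using monomial_span.monomial[where m = m and e = "\<lambda>_. 0" and D = D and c = c] by simp

lemma monomial_span_coord:
  assumes "i < m" shows "monomial_span m 1 (\<lambda>x. c * x i)"
proof -
  have "(\<Prod>j<m. x j ^ (if j = i then 1 else 0)) = x i" for x :: "nat \<Rightarrow> 'a"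
  proof -
    have "(\<Prod>j<m. x j ^ (if j = i then 1 else 0)) = (\<Prod>j<m. if j = i then x j else 1)"
      by (intro prod.cong) auto
    then show ?thesis using assms by simp
  qed
  moreover have "(\<Sum>j<m. if j = i then 1 else 0 :: nat) \<le> 1" by simp
  ultimately show ?thesis using monomial_span.monomial[where m = m and e = "\<lambda>j. if j = i then 1 else 0" and D = 1 and c = c] by simp
qed

lemma monomial_span_mult:
  assumes "monomial_span m D G" "monomial_span m E H"
  shows "monomial_span m (D + E) (\<lambda>x. G x * H x)"
  using assms
proof (induction arbitrary: H rule: monomial_span.induct)
  case (monomial e D c)
  from monomial(2) show ?case
  proof (induction rule: monomial_span.induct)
    case (monomial e' E c')
    have "monomial_span m (D + E) (\<lambda>x. (c * c') * (\<Prod>i<m. x i ^ (e i + e' i)))"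
      using monomial \<open>(\<Sum>i<m. e i) \<le> D\<close> by (intro monomial_span.monomial) (simp add: sum.distrib)
    then show ?case by (simp add: power_add prod.distrib mult_ac)
  next
    case (add E G H)
    show ?case unfolding distrib_left by (rule monomial_span.add) (use add in auto)
  qed
next
  case (add D G' H')
  show ?case unfolding distrib_right by (rule monomial_span.add) (use add in auto)
qed

lemma monomial_span_sum:
  "(\<And>i. i \<in> A \<Longrightarrow> monomial_span m D (G i)) \<Longrightarrow> monomial_span m D (\<lambda>x. \<Sum>i\<in>A. G i x)"
  by (induction A rule: infinite_finite_induct)
    (auto intro: monomial_span_const monomial_span.add)

lemma monomial_span_power: "monomial_span m D G \<Longrightarrow> monomial_span m (k * D) (\<lambda>x. G x ^ k)"
  by (induction k) (auto intro: monomial_span_const monomial_span_mult)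

text \<open>Multiplication by g permutes the field and multiplies the sum by g^e. A nonzero g with
  g^e \<noteq> 1 exists because X^e - 1 has at most e < p - 1 roots. For e = 0 the sum is p, as 0^0
  = 1.\<close>

lemma sum_powers_eq_0:
  assumes "e < CARD('a :: big_prime_field) - 1"
  shows "(\<Sum>t\<in>(UNIV :: 'a set). t ^ e) = 0"
proof -
  define S where "S = (\<Sum>t\<in>(UNIV :: 'a set). t ^ e)"
  have "\<exists>g :: 'a. g \<noteq> 0 \<and> (e = 0 \<or> g ^ e \<noteq> 1)"
  proof (rule ccontr)
    assume no: "\<not> ?thesis"
    then have e: "e \<noteq> 0" by (metis one_neq_zero)
    have *: "monom 1 e - 1 \<noteq> (0 :: 'a poly)"
    proof
      assume "monom 1 e - 1 = (0 :: 'a poly)"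
      then have "coeff (monom 1 e - 1 :: 'a poly) e = 0" by simp
      then show False using e by simp
    qed
    have "UNIV - {0 :: 'a} \<subseteq> {g. poly (monom 1 e - 1) g = 0}" using no by (auto simp: poly_monom)
    then have "card (UNIV - {0 :: 'a}) \<le> card {g. poly (monom 1 e - 1 :: 'a poly) g = 0}"
      by (intro card_mono) auto
    also have "\<dots> \<le> degree (monom 1 e - 1 :: 'a poly)" by (rule card_poly_roots_bound[OF *])
    also have "\<dots> \<le> e" by (intro degree_diff_le degree_monom_le) simp
    finally show False using assms by (simp add: card_Diff_subset)
  qed
  then obtain g :: 'a where g: "g \<noteq> 0" "e = 0 \<or> g ^ e \<noteq> 1" by blast
  show ?thesis
  proof (cases "e = 0")
    case True
    have "(\<Sum>t\<in>(UNIV :: 'a set). t ^ e) = of_nat (CARD('a))" using True by simp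
    also have "\<dots> = 0" using of_nat_CHAR[where ?'a='a] CHAR_eq_CARD[where ?'a='a] by simp
    finally show ?thesis .
  next
    case False
    have "bij (\<lambda>t. g * t)"
      by (rule bij_betw_byWitness[where f' = "\<lambda>t. t / g"]) (use g in auto)
    then have "S = (\<Sum>t\<in>UNIV. (g * t) ^ e)"
      unfolding S_def by (rule sum.reindex_bij_betw[symmetric])
    also have "\<dots> = g ^ e * S" unfolding S_def by (simp add: power_mult_distrib sum_distrib_left)
    finally have "(g ^ e - 1) * S = 0" by (simp add: algebra_simps)
    then show ?thesis using g(2) False unfolding S_def by simp
  qed
qed

text \<open>In a monomial of degree below m(p - 1) some exponent is below p - 1, and the sum over
  that variable vanishes.\<close>

lemma sum_monomial_span_eq_0:
  fixes G :: "(nat \<Rightarrow> 'a :: big_prime_field) \<Rightarrow> 'a"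
  assumes "monomial_span m D G" "D < m * (CARD('a) - 1)"
  shows "(\<Sum>x\<in>PiE {..<m} (\<lambda>_. UNIV). G x) = 0"
  using assms
proof (induction rule: monomial_span.induct)
  case (monomial e D c)
  have "\<exists>i<m. e i < CARD('a) - 1"
  proof (rule ccontr)
    assume "\<not> ?thesis"
    then have "(\<Sum>i<m. CARD('a) - 1) \<le> (\<Sum>i<m. e i)" by (intro sum_mono) auto
    then show False using monomial by simp
  qed
  then obtain i where i: "i < m" "e i < CARD('a) - 1" by blast
  have "(\<Sum>x\<in>PiE {..<m} (\<lambda>_. UNIV). \<Prod>i<m. x i ^ e i) = (\<Prod>i<m. \<Sum>t\<in>(UNIV :: 'a set). t ^ e i)"
    by (rule prod_sum_PiE[symmetric]) auto
  also have "\<dots> = 0" using i sum_powers_eq_0 by (intro prod_zero) auto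
  finally show ?case by (simp add: sum_distrib_left[symmetric])
qed (simp add: sum.distrib)

text \<open>Dimension at least 6, stated as a cardinality so that extending independent families
  becomes a counting argument.\<close>

locale big_space = vector_space scale for scale :: "'a :: big_prime_field \<Rightarrow> 'v :: {ab_group_add, finite} \<Rightarrow> 'v" (infixr "*s" 75) +
  assumes card_ge: "CARD('v) \<ge> CARD('a) ^ 6"
begin

definition comb :: "nat \<Rightarrow> (nat \<Rightarrow> 'v) \<Rightarrow> (nat \<Rightarrow> 'a) \<Rightarrow> 'v" where
  "comb m b x = (\<Sum>i<m. x i *s b i)"

definition indep :: "nat \<Rightarrow> (nat \<Rightarrow> 'v) \<Rightarrow> bool" where
  "indep m b \<longleftrightarrow> (\<forall>x. comb m b x = 0 \<longrightarrow> (\<forall>i<m. x i = 0))"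

text \<open>Polynomial functions of degree at most D without fixing a basis: every parametrisation
  by finitely many vectors must give a polynomial in the parameters.\<close>

definition polyfun :: "nat \<Rightarrow> ('v \<Rightarrow> 'a) \<Rightarrow> bool" where
  "polyfun D F \<longleftrightarrow> (\<forall>m b. monomial_span m D (\<lambda>x. F (comb m b x)))"

lemma comb_linear:
  assumes "\<And>x y. l (x + y) = l x + l y" "\<And>c x. l (c *s x) = c * l x"
  shows "l (comb m b x) = (\<Sum>i<m. x i * l (b i))"
proof -
  have "l 0 = 0" using assms(2)[of 0 0] by simp
  then have "l (sum f A) = (\<Sum>i\<in>A. l (f i))" for f :: "nat \<Rightarrow> 'v" and A
    by (induction A rule: infinite_finite_induct) (simp_all add: assms)
  then show ?thesis unfolding comb_def by (simp add: assms)
qed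

lemma polyfun_diagonal:
  assumes "\<And>x y v. T (x + y) v = T x v + T y v" "\<And>c x v. T (c *s x) v = c * T x v"
    and "\<And>u. polyfun D (T u)"
  shows "polyfun (Suc D) (\<lambda>y. T y y)"
  unfolding polyfun_def
proof (intro allI)
  fix m b
  have eq: "T (comb m b x) (comb m b x) = (\<Sum>i<m. (1 * x i) * T (b i) (comb m b x))" for x
    using comb_linear[of "\<lambda>y. T y (comb m b x)" m b x] assms(1,2) by simp
  have "monomial_span m (1 + D) (\<lambda>x. \<Sum>i<m. (1 * x i) * T (b i) (comb m b x))"
    using assms(3) unfolding polyfun_def
    by (intro monomial_span_sum monomial_span_mult monomial_span_coord) auto
  then show "monomial_span m (Suc D) (\<lambda>x. T (comb m b x) (comb m b x))" unfolding eq by simp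
qed

lemma polyfun_const: "polyfun D (\<lambda>_. c)"
  unfolding polyfun_def by (simp add: monomial_span_const)

lemma polyfun_linear:
  assumes "\<And>x y. l (x + y) = l x + l y" "\<And>c x. l (c *s x) = c * l x"
  shows "polyfun (Suc 0) l"
  using polyfun_diagonal[of "\<lambda>x _. l x" 0] assms polyfun_const by simp

text \<open>The product \<open>G\<close> of the factors 1 - F^(p-1) is the indicator function of the
  common zeros. Its sum over all x vanishes for degree reasons, but would be 1 if the origin were
  the only zero.\<close>

lemma chevalley:
  assumes fs: "\<And>F d. (F, d) \<in> set fs \<Longrightarrow> polyfun d F \<and> F 0 = 0"
    and b: "indep m b" and deg: "(\<Sum>f\<leftarrow>fs. snd f) < m"
  shows "\<exists>x. comb m b x \<noteq> 0 \<and> (\<forall>f\<in>set fs. fst f (comb m b x) = 0)"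
proof (rule ccontr)
  assume no: "\<not> ?thesis"
  define p where "p = CARD('a)"
  have p1: "p - 1 > 0" using CARD_gt[where ?'a='a] unfolding p_def by simp
  define G :: "(('v \<Rightarrow> 'a) \<times> nat) list \<Rightarrow> (nat \<Rightarrow> 'a) \<Rightarrow> 'a" where "G gs x = (\<Prod>f\<leftarrow>gs. 1 - fst f (comb m b x) ^ (p - 1))" for gs x
  have "monomial_span m ((p - 1) * (\<Sum>f\<leftarrow>gs. snd f)) (G gs)" if "set gs \<subseteq> set fs" for gs
    using that
  proof (induction gs)
    case Nil
    then show ?case unfolding G_def by (simp add: monomial_span_const)
  next
    case (Cons f gs)
    have "monomial_span m (snd f) (\<lambda>x. fst f (comb m b x))"
      using fs[of "fst f" "snd f"] Cons.prems unfolding polyfun_def by simp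
    then have "monomial_span m ((p - 1) * snd f) (\<lambda>x. 1 + (- 1) * (fst f (comb m b x) ^ (p - 1)))"
      using monomial_span_mult[OF monomial_span_const[of m 0 "- 1"] monomial_span_power]
      by (intro monomial_span.add monomial_span_const) fastforce
    then have "monomial_span m ((p - 1) * snd f + (p - 1) * (\<Sum>f\<leftarrow>gs. snd f))
        (\<lambda>x. (1 + (- 1) * (fst f (comb m b x) ^ (p - 1))) * G gs x)"
      using Cons by (intro monomial_span_mult) auto
    moreover have "(\<lambda>x. (1 + (- 1) * (fst f (comb m b x) ^ (p - 1))) * G gs x) = G (f # gs)"
      unfolding G_def by (intro ext) simp
    moreover have "(p - 1) * snd f + (p - 1) * (\<Sum>f\<leftarrow>gs. snd f) = (p - 1) * (\<Sum>f\<leftarrow>f # gs. snd f)"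
      by (simp add: distrib_left)
    ultimately show ?case by simp
  qed
  then have ms: "monomial_span m ((p - 1) * (\<Sum>f\<leftarrow>fs. snd f)) (G fs)" by simp
  have "(p - 1) * (\<Sum>f\<leftarrow>fs. snd f) < m * (p - 1)" using deg p1 by (simp add: mult.commute)
  then have z: "(\<Sum>x\<in>PiE {..<m} (\<lambda>_. UNIV). G fs x) = 0"
    using sum_monomial_span_eq_0[OF ms] unfolding p_def by simp
  define o' where "o' = (\<lambda>i\<in>{..<m}. 0 :: 'a)"
  have o': "o' \<in> PiE {..<m} (\<lambda>_. UNIV)" unfolding o'_def by auto
  have co: "comb m b o' = 0" unfolding comb_def o'_def by simp
  have one: "c ^ (p - 1) = 1" if "c \<noteq> 0" for c :: 'a
  proof -
    have "c * c ^ (p - 1) = c * 1" using pow_CARD[of c] p1 unfolding p_def by (subst power_Suc[symmetric]) simp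
    then show ?thesis using that by simp
  qed
  have "G fs x = 0" if x: "x \<in> PiE {..<m} (\<lambda>_. UNIV) - {o'}" for x
  proof -
    have "comb m b x \<noteq> 0"
    proof
      assume "comb m b x = 0"
      then have "x i = 0" if "i < m" for i using b that unfolding indep_def by blast
      then have "x = o'" using x unfolding o'_def by (intro ext) (auto simp: PiE_def extensional_def)
      then show False using x by blast
    qed
    then obtain f where f: "f \<in> set fs" "fst f (comb m b x) \<noteq> 0" using no by blast
    then have "1 - fst f (comb m b x) ^ (p - 1) = 0" using one by simp
    then have "0 \<in> set (map (\<lambda>f. 1 - fst f (comb m b x) ^ (p - 1)) fs)" using f(1) by force
    then show ?thesis unfolding G_def by (simp add: prod_list_zero_iff)
  qed
  then have "(\<Sum>x\<in>PiE {..<m} (\<lambda>_. UNIV). G fs x) = (\<Sum>x\<in>{o'}. G fs x)"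
    using o' by (intro sum.mono_neutral_right finite_PiE) auto
  moreover have "G fs o' = 1"
  proof -
    have A: "map (\<lambda>f. 1 - fst f (comb m b o') ^ (p - 1)) fs = map (\<lambda>_. 1) fs"
    proof (rule map_cong)
      fix f assume "f \<in> set fs"
      then have "fst f 0 = 0" using fs[of "fst f" "snd f"] by simp
      then show "1 - fst f (comb m b o') ^ (p - 1) = 1" unfolding co using p1 by simp
    qed simp
    have "prod_list (map (\<lambda>_. 1 :: 'a) fs) = 1" by (induction fs) simp_all
    then show ?thesis unfolding G_def A .
  qed
  ultimately show False using z by simp
qed

lemma indep_extend:
  assumes b: "indep m b" and m: "m < 6"
  shows "\<exists>c. indep (Suc m) (b(m := c))"
proof -
  have "card (comb m b ` PiE {..<m} (\<lambda>_. UNIV)) \<le> card (PiE {..<m} (\<lambda>_. UNIV :: 'a set))"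
    by (intro card_image_le finite_PiE) auto
  also have "\<dots> = CARD('a) ^ m" by (simp add: card_PiE)
  also have "\<dots> < CARD('a) ^ 6" using m CARD_gt[where ?'a='a] by (intro power_strict_increasing) auto
  also have "\<dots> \<le> CARD('v)" by (rule card_ge)
  finally have "comb m b ` PiE {..<m} (\<lambda>_. UNIV) \<noteq> UNIV" by auto
  then obtain c where c: "c \<notin> comb m b ` PiE {..<m} (\<lambda>_. UNIV)" by blast
  have c': "c \<noteq> comb m b x" for x
  proof
    assume "c = comb m b x"
    also have "\<dots> = comb m b (restrict x {..<m})" unfolding comb_def by simp
    finally show False using c by auto
  qed
  have "indep (Suc m) (b(m := c))" unfolding indep_def
  proof (intro allI impI)
    fix x i assume x: "comb (Suc m) (b(m := c)) x = 0" and i: "i < Suc m"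
    have "comb (Suc m) (b(m := c)) x = comb m b x + x m *s c"
      unfolding comb_def by simp
    then have eq: "x m *s c = - comb m b x" using x by (simp add: eq_neg_iff_add_eq_0 add.commute)
    have "x m = 0"
    proof (rule ccontr)
      assume "x m \<noteq> 0"
      then have "c = inverse (x m) *s (x m *s c)" by simp
      also have "\<dots> = comb m b (\<lambda>i. - (inverse (x m) * x i))"
        unfolding eq comb_def by (simp add: scale_sum_right sum_negf)
      finally show False using c' by blast
    qed
    then have "comb m b x = 0" using eq by simp
    then show "x i = 0" using b i \<open>x m = 0\<close> unfolding indep_def by (cases "i = m") auto
  qed
  then show ?thesis by blast
qed

lemma indep_extend_6:
  assumes "indep k u" "k \<le> 6"
  shows "\<exists>b. indep 6 b \<and> (\<forall>i<k. b i = u i)"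
  using assms
proof (induction "6 - k" arbitrary: k u)
  case 0
  then show ?case by (intro exI[of _ u]) (metis diff_is_0_eq le_antisym)
next
  case (Suc n)
  then have "k < 6" by simp
  then obtain c where c: "indep (Suc k) (u(k := c))" using indep_extend Suc.prems by blast
  have "n = 6 - Suc k" "Suc k \<le> 6" using Suc by auto
  then obtain b where b: "indep 6 b" "\<forall>i<Suc k. b i = (u(k := c)) i" using Suc.hyps(1)[OF _ c] by blast
  then show ?case by (intro exI[of _ b]) auto
qed

text \<open>Complete u to six independent vectors and apply \<open>chevalley\<close> to the span of
  the new ones, which meets the span of u only in 0. Each avoided dimension costs one unit of
  degree.\<close>

lemma chevalley_outside:
  assumes fs: "\<And>F d. (F, d) \<in> set fs \<Longrightarrow> polyfun d F \<and> F 0 = 0"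
    and u: "indep k u" "k \<le> 6" and deg: "(\<Sum>f\<leftarrow>fs. snd f) + k < 6"
  obtains z where "\<And>x. z \<noteq> comb k u x" "\<And>F d. (F, d) \<in> set fs \<Longrightarrow> F z = 0"
proof -
  obtain b where b: "indep 6 b" "\<forall>i<k. b i = u i" using indep_extend_6[OF u] by blast
  define b' where "b' i = b (k + i)" for i
  have split: "comb 6 b x = comb k u x + comb (6 - k) b' (\<lambda>i. x (k + i))" for x
  proof -
    have "comb 6 b x = (\<Sum>i<k. x i *s b i) + (\<Sum>i=k..<6. x i *s b i)"
      unfolding comb_def using u(2) by (metis lessThan_atLeast0 le0 sum.atLeastLessThan_concat)
    also have "(\<Sum>i=k..<6. x i *s b i) = comb (6 - k) b' (\<lambda>i. x (k + i))"
      unfolding comb_def b'_def by (rule sum.reindex_bij_witness[of _ "\<lambda>i. k + i" "\<lambda>i. i - k"]) auto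
    also have "(\<Sum>i<k. x i *s b i) = comb k u x" unfolding comb_def using b(2) by simp
    finally show ?thesis .
  qed
  have ind: "indep (6 - k) b'" unfolding indep_def
  proof (intro allI impI)
    fix x i assume x: "comb (6 - k) b' x = 0" and i: "i < 6 - k"
    define y where "y j = (if j < k then 0 else x (j - k))" for j
    have "comb k u y = 0" unfolding comb_def y_def by simp
    then have "comb 6 b y = 0" unfolding split using x by (simp add: y_def)
    then have "y (k + i) = 0" using b(1) i unfolding indep_def by auto
    then show "x i = 0" by (simp add: y_def)
  qed
  have "(\<Sum>f\<leftarrow>fs. snd f) < 6 - k" using deg by simp
  then obtain x where x: "comb (6 - k) b' x \<noteq> 0" "\<forall>f\<in>set fs. fst f (comb (6 - k) b' x) = 0"
    using chevalley[OF fs ind] by blast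
  show ?thesis
  proof (rule that[of "comb (6 - k) b' x"])
    show "comb (6 - k) b' x \<noteq> comb k u y" for y
    proof
      assume eq: "comb (6 - k) b' x = comb k u y"
      define w where "w j = (if j < k then - y j else x (j - k))" for j
      have "comb k u w = - comb k u y" unfolding comb_def w_def by (simp add: sum_negf)
      then have "comb 6 b w = 0" unfolding split using eq by (simp add: w_def)
      then have "w (k + i) = 0" if "i < 6 - k" for i using b(1) that unfolding indep_def by auto
      then have "x i = 0" if "i < 6 - k" for i using that by (simp add: w_def)
      then have "comb (6 - k) b' x = 0" unfolding comb_def by simp
      then show False using x(1) by blast
    qed
    show "F (comb (6 - k) b' x) = 0" if "(F, d) \<in> set fs" for F d using x(2) that by force
  qed
qed

end

lemma poly_eq_0_if_all_values_0:
  fixes q :: "'a :: big_prime_field poly"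
  assumes "\<And>t. poly q t = 0" "degree q \<le> 101"
  shows "q = 0"
proof (rule ccontr)
  assume "q \<noteq> 0"
  then have "card {t. poly q t = 0} \<le> degree q" by (rule card_poly_roots_bound)
  then show False using assms CARD_gt[where ?'a='a] by simp
qed

lemma quadratic_eq_0:
  fixes a0 a1 a2 :: "'a :: big_prime_field"
  assumes "\<And>t. a2 * t\<^sup>2 + a1 * t + a0 = 0"
  shows "a0 = 0 \<and> a1 = 0 \<and> a2 = 0"
proof -
  have "poly [:a0, a1, a2:] t = 0" for t using assms[of t] by (simp add: power2_eq_square algebra_simps)
  moreover have "degree [:a0, a1, a2:] \<le> 101" by (simp add: degree_pCons_eq_if)
  ultimately have "[:a0, a1, a2:] = 0" by (rule poly_eq_0_if_all_values_0)
  then show ?thesis by simp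
qed

lemma cubic_eq_0:
  fixes a0 a1 a2 a3 :: "'a :: big_prime_field"
  assumes "\<And>t. a3 * t ^ 3 + a2 * t\<^sup>2 + a1 * t + a0 = 0"
  shows "a0 = 0 \<and> a1 = 0 \<and> a2 = 0 \<and> a3 = 0"
proof -
  have "poly [:a0, a1, a2, a3:] t = 0" for t using assms[of t] by (simp add: power2_eq_square power3_eq_cube algebra_simps)
  moreover have "degree [:a0, a1, a2, a3:] \<le> 101" by (simp add: degree_pCons_eq_if)
  ultimately have "[:a0, a1, a2, a3:] = 0" by (rule poly_eq_0_if_all_values_0)
  then show ?thesis by simp
qed

lemma quartic_eq_0:
  fixes a0 a1 a2 a3 a4 :: "'a :: big_prime_field"
  assumes "\<And>t. a4 * t ^ 4 + a3 * t ^ 3 + a2 * t\<^sup>2 + a1 * t + a0 = 0"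
  shows "a0 = 0 \<and> a1 = 0 \<and> a2 = 0 \<and> a3 = 0 \<and> a4 = 0"
proof -
  have "poly [:a0, a1, a2, a3, a4:] t = 0" for t using assms[of t] by (simp add: eval_nat_numeral algebra_simps)
  moreover have "degree [:a0, a1, a2, a3, a4:] \<le> 101" by (simp add: degree_pCons_eq_if)
  ultimately have "[:a0, a1, a2, a3, a4:] = 0" by (rule poly_eq_0_if_all_values_0)
  then show ?thesis by simp
qed

lemma quintic_eq_0:
  fixes a0 a1 a2 a3 a4 a5 :: "'a :: big_prime_field"
  assumes "\<And>t. a5 * t ^ 5 + a4 * t ^ 4 + a3 * t ^ 3 + a2 * t\<^sup>2 + a1 * t + a0 = 0"
  shows "a0 = 0 \<and> a1 = 0 \<and> a2 = 0 \<and> a3 = 0 \<and> a4 = 0 \<and> a5 = 0"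
proof -
  have "poly [:a0, a1, a2, a3, a4, a5:] t = 0" for t using assms[of t] by (simp add: eval_nat_numeral algebra_simps)
  moreover have "degree [:a0, a1, a2, a3, a4, a5:] \<le> 101" by (simp add: degree_pCons_eq_if)
  ultimately have "[:a0, a1, a2, a3, a4, a5:] = 0" by (rule poly_eq_0_if_all_values_0)
  then show ?thesis by simp
qed

section \<open>Quintic forms all of whose zeros are singular\<close>

locale quintic_form = vector_space scale
  for scale :: "'a :: big_prime_field \<Rightarrow> 'v :: ab_group_add \<Rightarrow> 'v" (infixr "*s" 75) +
  fixes \<Phi> :: "'v \<Rightarrow> 'v \<Rightarrow> 'v \<Rightarrow> 'v \<Rightarrow> 'v \<Rightarrow> 'a"
  assumes sym1: "\<Phi> x y c d e = \<Phi> y x c d e" and sym2: "\<Phi> b x y d e = \<Phi> b y x d e"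
    and sym3: "\<Phi> b c x y e = \<Phi> b c y x e" and sym4: "\<Phi> b c d x y = \<Phi> b c d y x"
    and add1: "\<Phi> (x + y) b c d e = \<Phi> x b c d e + \<Phi> y b c d e"
    and scale1: "\<Phi> (k *s x) b c d e = k * \<Phi> x b c d e"
begin

lemma add2: "\<Phi> b (x + y) c d e = \<Phi> b x c d e + \<Phi> b y c d e"
  using add1[of x y b c d e] by (simp only: sym1[of b])
lemma add3: "\<Phi> b c (x + y) d e = \<Phi> b c x d e + \<Phi> b c y d e"
  using add2[of b x y c d e] by (simp only: sym2[of b c])
lemma add4: "\<Phi> b c d (x + y) e = \<Phi> b c d x e + \<Phi> b c d y e"
  using add3[of b c x y d e] by (simp only: sym3[of b c d])
lemma add5: "\<Phi> b c d e (x + y) = \<Phi> b c d e x + \<Phi> b c d e y"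
  using add4[of b c d x y e] by (simp only: sym4[of b c d e])
lemma scale2: "\<Phi> b (k *s x) c d e = k * \<Phi> b x c d e"
  using scale1[of k x b c d e] by (simp only: sym1[of b])
lemma scale3: "\<Phi> b c (k *s x) d e = k * \<Phi> b c x d e"
  using scale2[of b k x c d e] by (simp only: sym2[of b c])
lemma scale4: "\<Phi> b c d (k *s x) e = k * \<Phi> b c d x e"
  using scale3[of b c k x d e] by (simp only: sym3[of b c d])
lemma scale5: "\<Phi> b c d e (k *s x) = k * \<Phi> b c d e x"
  using scale4[of b c d k x e] by (simp only: sym4[of b c d e])

lemmas multilinear = add1 add2 add3 add4 add5 scale1 scale2 scale3 scale4 scale5

lemma zero [simp]: "\<Phi> 0 b c d e = 0" "\<Phi> b 0 c d e = 0" "\<Phi> b c 0 d e = 0" "\<Phi> b c d 0 e = 0" "\<Phi> b c d e 0 = 0"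
  using scale1[of 0 0 b c d e] scale2[of b 0 0 c d e] scale3[of b c 0 0 d e] scale4[of b c d 0 0 e] scale5[of b c d e 0 0]
  by simp_all

lemma expand2: "\<Phi> b c d (t *s u + v) (t *s u + v) = t\<^sup>2 * \<Phi> b c d u u + 2 * t * \<Phi> b c d u v + \<Phi> b c d v v"
  by (simp add: multilinear sym4[of b c d v u] power2_eq_square algebra_simps)

lemma expand3: "\<Phi> b c (t *s u + v) (t *s u + v) (t *s u + v) =
    t ^ 3 * \<Phi> b c u u u + 3 * t\<^sup>2 * \<Phi> b c u u v + 3 * t * \<Phi> b c u v v + \<Phi> b c v v v"
proof -
  define w where "w = t *s u + v"
  have s: "\<Phi> b c v u u = \<Phi> b c u u v" "\<Phi> b c v u v = \<Phi> b c u v v" by (metis sym3 sym4)+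
  have "\<Phi> b c w w w = t * \<Phi> b c u w w + \<Phi> b c v w w"
    by (subst (1) w_def) (simp only: add3 scale3)
  then show ?thesis unfolding w_def expand2 s
    by (simp add: power2_eq_square power3_eq_cube algebra_simps)
qed

lemma expand4: "\<Phi> b (t *s u + v) (t *s u + v) (t *s u + v) (t *s u + v) =
    t ^ 4 * \<Phi> b u u u u + 4 * t ^ 3 * \<Phi> b u u u v + 6 * t\<^sup>2 * \<Phi> b u u v v + 4 * t * \<Phi> b u v v v + \<Phi> b v v v v"
proof -
  have "\<Phi> b v u u u = \<Phi> b u u u v" "\<Phi> b v u u v = \<Phi> b u u v v" "\<Phi> b v u v v = \<Phi> b u v v v"
    by (metis sym2 sym3 sym4)+
  note s = this
  define w where "w = t *s u + v"
  have "\<Phi> b w w w w = t * \<Phi> b u w w w + \<Phi> b v w w w"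
    by (subst (1) w_def) (simp only: add2 scale2)
  then show ?thesis unfolding w_def expand3 s
    by (simp add: eval_nat_numeral algebra_simps)
qed

lemma expand5: "\<Phi> (t *s u + v) (t *s u + v) (t *s u + v) (t *s u + v) (t *s u + v) =
    t ^ 5 * \<Phi> u u u u u + 5 * t ^ 4 * \<Phi> u u u u v + 10 * t ^ 3 * \<Phi> u u u v v + 10 * t\<^sup>2 * \<Phi> u u v v v
      + 5 * t * \<Phi> u v v v v + \<Phi> v v v v v"
proof -
  have "\<Phi> v u u u u = \<Phi> u u u u v" "\<Phi> v u u u v = \<Phi> u u u v v" "\<Phi> v u u v v = \<Phi> u u v v v" "\<Phi> v u v v v = \<Phi> u v v v v"
    by (metis sym1 sym2 sym3 sym4)+
  note s = this
  define w where "w = t *s u + v"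
  have "\<Phi> w w w w w = t * \<Phi> u w w w w + \<Phi> v w w w w"
    by (subst (1) w_def) (simp only: add1 scale1)
  then show ?thesis unfolding w_def expand4 s
    by (simp add: eval_nat_numeral algebra_simps)
qed

lemma expand4_1: "\<Phi> (t *s u + v) (t *s u + v) (t *s u + v) (t *s u + v) b =
    t ^ 4 * \<Phi> u u u u b + 4 * t ^ 3 * \<Phi> u u u v b + 6 * t\<^sup>2 * \<Phi> u u v v b + 4 * t * \<Phi> u v v v b + \<Phi> v v v v b"
proof -
  have s: "\<Phi> w x y z b = \<Phi> b w x y z" for w x y z by (metis sym1 sym2 sym3 sym4)
  show ?thesis unfolding s by (rule expand4)
qed

lemma polarize2:
  assumes "\<And>y. \<Phi> b c d y y = 0" shows "\<Phi> b c d x y = 0"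
proof -
  have "\<Phi> b c d (1 *s x + y) (1 *s x + y) = 0" by (rule assms)
  then have "2 * \<Phi> b c d x y = 0" unfolding expand2 assms by simp
  then show ?thesis using two_neq_0[where ?'a='a] by simp
qed

lemma polarize3:
  assumes "\<And>y. \<Phi> b c y y y = 0" shows "\<Phi> b c x y z = 0"
proof (rule polarize2)
  fix y
  have "\<Phi> b c y y y * t ^ 3 + (3 * \<Phi> b c y y x) * t\<^sup>2 + (3 * \<Phi> b c y x x) * t + \<Phi> b c x x x = 0" for t
    using assms[of "t *s y + x"] unfolding expand3 by (simp add: mult_ac)
  then have "3 * \<Phi> b c y y x = 0" using cubic_eq_0 by blast
  then have "\<Phi> b c y y x = 0" by simp
  then show "\<Phi> b c x y y = 0" by (metis sym3 sym4)
qed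

text \<open>The identity holds along every line in t, and its degree is small against p, so each
  coefficient in t vanishes; the binomial factors are invertible.\<close>

lemma polarize4:
  assumes "\<And>y. \<Phi> b y y y y = 0" shows "\<Phi> b w x y z = 0"
proof (rule polarize3)
  fix y
  have "\<Phi> b y y y y * t ^ 4 + (4 * \<Phi> b y y y w) * t ^ 3 + (6 * \<Phi> b y y w w) * t\<^sup>2 + (4 * \<Phi> b y w w w) * t + \<Phi> b w w w w = 0" for t
    using assms[of "t *s y + w"] unfolding expand4 by (simp add: mult_ac)
  then have "4 * \<Phi> b y y y w = 0" using quartic_eq_0 by blast
  then have "\<Phi> b y y y w = 0" by simp
  then show "\<Phi> b w y y y = 0" by (metis sym2 sym3 sym4)
qed

end

text \<open>The situation to be refuted: a non-degenerate quintic form in at least six variables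
  without nonsingular zeros. \<open>inconsistent\<close> derives the contradiction.\<close>

locale quintic = big_space scale + quintic_form scale \<Phi>
  for scale :: "'a :: big_prime_field \<Rightarrow> 'v :: {ab_group_add, finite} \<Rightarrow> 'v" (infixr "*s" 75)
    and \<Phi> :: "'v \<Rightarrow> 'v \<Rightarrow> 'v \<Rightarrow> 'v \<Rightarrow> 'v \<Rightarrow> 'a" +
  assumes nondegenerate: "(\<And>w x y z. \<Phi> v w x y z = 0) \<Longrightarrow> v = 0"
    and singular: "\<Phi> x x x x x = 0 \<Longrightarrow> \<Phi> x x x x z = 0"
begin

lemma vertex_eq_0: "(\<And>y. \<Phi> v y y y y = 0) \<Longrightarrow> v = 0"
  using nondegenerate polarize4 by blast

lemma polyfun_1: "polyfun 1 (\<lambda>y. \<Phi> b c d e y)"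
  unfolding One_nat_def by (rule polyfun_linear) (rule add5 scale5)+

lemma polyfun_2: "polyfun 2 (\<lambda>y. \<Phi> b c d y y)"
  unfolding numeral_2_eq_2
  by (rule polyfun_diagonal[of "\<lambda>x y. \<Phi> b c d x y"]) (rule add4 scale4 polyfun_1[unfolded One_nat_def])+

lemma polyfun_3: "polyfun 3 (\<lambda>y. \<Phi> b c y y y)"
proof -
  have "polyfun (Suc 2) (\<lambda>y. \<Phi> b c y y y)"
    by (rule polyfun_diagonal[of "\<lambda>x y. \<Phi> b c x y y"]) (rule add3 scale3 polyfun_2)+
  then show ?thesis by simp
qed

lemma polyfun_5: "polyfun 5 (\<lambda>y. \<Phi> y y y y y)"
proof -
  have 4: "polyfun (Suc 3) (\<lambda>y. \<Phi> b y y y y)" for b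
    by (rule polyfun_diagonal[of "\<lambda>x y. \<Phi> b x y y y"]) (rule add2 scale2 polyfun_3)+
  have "polyfun (Suc (Suc 3)) (\<lambda>y. \<Phi> y y y y y)"
    by (rule polyfun_diagonal[of "\<lambda>x y. \<Phi> x y y y y"]) (rule add1 scale1 4)+
  then show ?thesis by simp
qed

lemma singular_zero:
  assumes "\<Phi> a a a a a = 0"
  shows "\<Phi> a a a a z = 0" "\<Phi> (x *s a + y) (x *s a + y) (x *s a + y) (x *s a + y) (x *s a + y) =
      10 * x ^ 3 * \<Phi> a a a y y + 10 * x\<^sup>2 * \<Phi> a a y y y + 5 * x * \<Phi> a y y y y + \<Phi> y y y y y"
    "\<Phi> (x *s a + y) (x *s a + y) (x *s a + y) (x *s a + y) a =
      6 * x\<^sup>2 * \<Phi> a a a y y + 4 * x * \<Phi> a a y y y + \<Phi> a y y y y"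
proof -
  show z: "\<Phi> a a a a z = 0" for z by (rule singular[OF assms])
  show "\<Phi> (x *s a + y) (x *s a + y) (x *s a + y) (x *s a + y) (x *s a + y) =
      10 * x ^ 3 * \<Phi> a a a y y + 10 * x\<^sup>2 * \<Phi> a a y y y + 5 * x * \<Phi> a y y y y + \<Phi> y y y y y"
    unfolding expand5 by (simp add: z)
  have s: "\<Phi> a a a y a = \<Phi> a a a a y" "\<Phi> a a y y a = \<Phi> a a a y y" "\<Phi> a y y y a = \<Phi> a a y y y" "\<Phi> y y y y a = \<Phi> a y y y y"
    by (metis sym1 sym2 sym3 sym4)+
  show "\<Phi> (x *s a + y) (x *s a + y) (x *s a + y) (x *s a + y) a =
      6 * x\<^sup>2 * \<Phi> a a a y y + 4 * x * \<Phi> a a y y y + \<Phi> a y y y y"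
    unfolding expand4_1 s by (simp add: z)
qed

text \<open>Along a line of vectors isotropic for \<open>\<lambda>y. \<Phi> a a a y y\<close> the form is quadratic in the coefficient of
  \<open>a\<close>.\<close>

lemma isotropic_line:
  assumes a: "\<Phi> a a a a a = 0" and q: "\<Phi> a a a y y = 0" "\<Phi> a a a y z = 0" "\<Phi> a a a z z = 0"
    and c: "\<Phi> a a y y y \<noteq> 0"
  obtains \<beta>0 \<beta>1 n0 n1 where
    "\<And>t. \<Phi> a (t *s y + z) (t *s y + z) (t *s y + z) (t *s y + z) = 4 * \<Phi> a a (t *s y + z) (t *s y + z) (t *s y + z) * (\<beta>0 + \<beta>1 * t)"
    "\<And>t. \<Phi> (t *s y + z) (t *s y + z) (t *s y + z) (t *s y + z) (t *s y + z) =
      10 * \<Phi> a a (t *s y + z) (t *s y + z) (t *s y + z) * ((\<beta>0 + \<beta>1 * t)\<^sup>2 - nonsq * (n0 + n1 * t)\<^sup>2)"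
    "\<Phi> a y y y y = 4 * \<Phi> a a y y y * \<beta>1" "\<Phi> a y y y z = \<Phi> a a y y y * \<beta>0 + 3 * \<Phi> a a y y z * \<beta>1"
    "\<Phi> y y y y y = 10 * \<Phi> a a y y y * (\<beta>1\<^sup>2 - nonsq * n1\<^sup>2)"
    "\<beta>0 = 0 \<Longrightarrow> \<beta>1 = 0 \<Longrightarrow> \<Phi> y y y y z = - 2 * nonsq * (2 * \<Phi> a a y y y * n1 * n0 + 3 * \<Phi> a a y y z * n1\<^sup>2)"
    "\<beta>0 = 0 \<Longrightarrow> \<beta>1 = 0 \<Longrightarrow> \<Phi> y y y z z =
      - nonsq * (\<Phi> a a y y y * n0\<^sup>2 + 6 * \<Phi> a a y y z * n1 * n0 + 3 * \<Phi> a a y z z * n1\<^sup>2)"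
    "\<Phi> a a z z z = 0 \<Longrightarrow> \<Phi> a a y y z = 0 \<and> \<Phi> a a y z z = 0"
proof -
  define C D E where "C = [:10 * \<Phi> a a z z z, 30 * \<Phi> a a y z z, 30 * \<Phi> a a y y z, 10 * \<Phi> a a y y y:]"
    and "D = [:5 * \<Phi> a z z z z, 20 * \<Phi> a y z z z, 30 * \<Phi> a y y z z, 20 * \<Phi> a y y y z, 5 * \<Phi> a y y y y:]"
    and "E = [:\<Phi> z z z z z, 5 * \<Phi> y z z z z, 10 * \<Phi> y y z z z, 10 * \<Phi> y y y z z, 5 * \<Phi> y y y y z, \<Phi> y y y y y:]"
  have pC: "poly C t = 10 * \<Phi> a a (t *s y + z) (t *s y + z) (t *s y + z)" for t
    unfolding expand3 C_def by (simp add: eval_nat_numeral algebra_simps)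
  have pD: "poly D t = 5 * \<Phi> a (t *s y + z) (t *s y + z) (t *s y + z) (t *s y + z)" for t
    unfolding expand4 D_def by (simp add: eval_nat_numeral algebra_simps)
  have pE: "poly E t = \<Phi> (t *s y + z) (t *s y + z) (t *s y + z) (t *s y + z) (t *s y + z)" for t
    unfolding expand5 E_def by (simp add: eval_nat_numeral algebra_simps)
  have Q: "\<Phi> a a a (t *s y + z) (t *s y + z) = 0" for t unfolding expand2 using q by simp
  have sing: "2 * poly C t * x + poly D t = 0 \<and> poly (pderiv C) t * x\<^sup>2 + poly (pderiv D) t * x + poly (pderiv E) t = 0"
    if "poly C t * x\<^sup>2 + poly D t * x + poly E t = 0" for x t
  proof -
    define w where "w = t *s y + z"
    define v where "v = x *s a + w"
    have "\<Phi> v v v v v = 0"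
      unfolding v_def singular_zero(2)[OF a] w_def Q using that unfolding pC pD pE by (simp add: algebra_simps)
    then have 1: "\<Phi> v v v v a = 0" "\<Phi> v v v v y = 0" using singular by blast+
    have "5 * \<Phi> v v v v a = 2 * poly C t * x + poly D t"
      unfolding v_def singular_zero(3)[OF a] w_def Q pC pD by (simp add: algebra_simps)
    \<comment> \<open>This is the derivative in t of the form at x a + t y + z.\<close>
    moreover have "5 * \<Phi> v v v v y = poly (pderiv C) t * x\<^sup>2 + poly (pderiv D) t * x + poly (pderiv E) t"
    proof -
      have s: "\<Phi> a a a w y = 0" "\<Phi> a a w w y = \<Phi> y a a w w" "\<Phi> a w w w y = \<Phi> y a w w w" "\<Phi> w w w w y = \<Phi> y w w w w"
        using q unfolding w_def by (simp add: multilinear sym4[of a a a z y]) (metis sym1 sym2 sym3 sym4)+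
      have e1: "\<Phi> v v v v y = 6 * x\<^sup>2 * \<Phi> y a a w w + 4 * x * \<Phi> y a w w w + \<Phi> y w w w w"
        unfolding v_def expand4_1 singular_zero(1)[OF a] s by simp
      have s': "\<Phi> y a a b c = \<Phi> a a y b c" "\<Phi> y a b c d = \<Phi> a y b c d" for b c d by (metis sym1 sym2)+
      show ?thesis
        unfolding e1 unfolding w_def unfolding expand4 unfolding expand3 unfolding expand2
        unfolding s'(1) unfolding s'(2) unfolding C_def D_def E_def
        by (simp add: pderiv_pCons eval_nat_numeral algebra_simps)
    qed
    ultimately show ?thesis using 1 by simp
  qed
  have deg: "degree C = 3" "degree D \<le> 4" "degree E \<le> 5"
    using c by (simp_all add: C_def D_def E_def degree_pCons_eq_if)
  obtain b1 b2 where b: "degree b1 \<le> 1" "degree b2 \<le> 1" "D = smult 2 (C * b1)"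
    "E = C * (b1\<^sup>2 - smult nonsq (b2\<^sup>2))" "\<And>r. poly C r = 0 \<Longrightarrow> poly (pderiv C) r = 0"
    using quadratic_family[OF deg sing] by metis
  obtain \<beta>0 \<beta>1 where b1: "b1 = [:\<beta>0, \<beta>1:]" using degree_le_1_eq[OF b(1)] by blast
  obtain n0 n1 where b2: "b2 = [:n0, n1:]" using degree_le_1_eq[OF b(2)] by blast
  have five: "x = x'" if "5 * x = 5 * x'" for x x' :: 'a using that by simp
  have Dt: "poly D t = 2 * (poly C t * (\<beta>0 + \<beta>1 * t))" for t unfolding b(3) b1 by (simp add: algebra_simps)
  have Et: "poly E t = poly C t * ((\<beta>0 + \<beta>1 * t)\<^sup>2 - nonsq * (n0 + n1 * t)\<^sup>2)" for t
    unfolding b(4) b1 b2 by (simp add: algebra_simps power2_eq_square)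
  have cD: "coeff D k = coeff (smult 2 (C * b1)) k" for k using b(3) by simp
  have cE: "coeff E k = coeff (C * (b1\<^sup>2 - smult nonsq (b2\<^sup>2))) k" for k using b(4) by simp
  show ?thesis
  proof (rule that[of \<beta>0 \<beta>1 n0 n1])
    show "\<Phi> a (t *s y + z) (t *s y + z) (t *s y + z) (t *s y + z) =
        4 * \<Phi> a a (t *s y + z) (t *s y + z) (t *s y + z) * (\<beta>0 + \<beta>1 * t)" for t
    proof -
      have "5 * \<Phi> a (t *s y + z) (t *s y + z) (t *s y + z) (t *s y + z) =
        5 * (4 * \<Phi> a a (t *s y + z) (t *s y + z) (t *s y + z) * (\<beta>0 + \<beta>1 * t))"
        using Dt[of t] unfolding pC pD by (simp add: mult_ac)
      then show ?thesis by (rule five)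
    qed
    show "\<Phi> (t *s y + z) (t *s y + z) (t *s y + z) (t *s y + z) (t *s y + z) =
      10 * \<Phi> a a (t *s y + z) (t *s y + z) (t *s y + z) * ((\<beta>0 + \<beta>1 * t)\<^sup>2 - nonsq * (n0 + n1 * t)\<^sup>2)" for t
      using Et[of t] unfolding pC pE .
    have twenty: "x = x'" if "20 * x = 20 * x'" for x x' :: 'a using that by simp
    have ten: "x = x'" if "10 * x = 10 * x'" for x x' :: 'a using that by simp
    show "\<Phi> a y y y y = 4 * \<Phi> a a y y y * \<beta>1"
      by (rule five) (use cD[of 4] in \<open>simp add: C_def D_def b1 eval_nat_numeral algebra_simps\<close>)
    show "\<Phi> a y y y z = \<Phi> a a y y y * \<beta>0 + 3 * \<Phi> a a y y z * \<beta>1"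
      by (rule twenty) (use cD[of 3] in \<open>simp add: C_def D_def b1 eval_nat_numeral algebra_simps\<close>)
    show "\<Phi> y y y y y = 10 * \<Phi> a a y y y * (\<beta>1\<^sup>2 - nonsq * n1\<^sup>2)"
      using cE[of 5] by (simp add: C_def E_def b1 b2 eval_nat_numeral algebra_simps)
    show "\<Phi> y y y y z = - 2 * nonsq * (2 * \<Phi> a a y y y * n1 * n0 + 3 * \<Phi> a a y y z * n1\<^sup>2)" if "\<beta>0 = 0" "\<beta>1 = 0"
      by (rule five) (use cE[of 4] that in \<open>simp add: C_def E_def b1 b2 eval_nat_numeral algebra_simps\<close>)
    show "\<Phi> y y y z z = - nonsq * (\<Phi> a a y y y * n0\<^sup>2 + 6 * \<Phi> a a y y z * n1 * n0 + 3 * \<Phi> a a y z z * n1\<^sup>2)" if "\<beta>0 = 0" "\<beta>1 = 0"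
      by (rule ten) (use cE[of 3] that in \<open>simp add: C_def E_def b1 b2 eval_nat_numeral algebra_simps\<close>)
    show "\<Phi> a a y y z = 0 \<and> \<Phi> a a y z z = 0" if z0: "\<Phi> a a z z z = 0"
    proof -
      have 1: "\<Phi> a a y z z = 0" using b(5)[of 0] z0 by (simp add: C_def pderiv_pCons)
      \<comment> \<open>Now 0 is a double root of C and r is the remaining one. Every root of C is
        multiple, so r = 0 or its numerator vanishes.\<close>
      define r where "r = - 3 * \<Phi> a a y y z / \<Phi> a a y y y"
      have r: "r * \<Phi> a a y y y = - 3 * \<Phi> a a y y z" using c by (simp add: r_def)
      have "poly C r = 10 * r\<^sup>2 * (3 * \<Phi> a a y y z + r * \<Phi> a a y y y)"
        using 1 z0 by (simp add: C_def power2_eq_square algebra_simps)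
      then have "poly C r = 0" unfolding r by simp
      then have "poly (pderiv C) r = 0" by (rule b(5))
      moreover have "poly (pderiv C) r = 30 * r * (2 * \<Phi> a a y y z + r * \<Phi> a a y y y)"
        using 1 by (simp add: C_def pderiv_pCons algebra_simps)
      ultimately have "r * \<Phi> a a y y z = 0" unfolding r by simp
      then have "r = 0 \<or> \<Phi> a a y y z = 0" by simp
      then show ?thesis using 1 r by auto
    qed
  qed
qed


lemmas [simp] = polyfun_1[unfolded One_nat_def] polyfun_2 polyfun_3 polyfun_5

lemma chevalley_zero:
  assumes "\<forall>f\<in>set fs. polyfun (snd f) (fst f) \<and> fst f 0 = 0" "(\<Sum>f\<leftarrow>fs. snd f) < 6"
  shows "\<exists>z. z \<noteq> 0 \<and> (\<forall>f\<in>set fs. fst f z = 0)"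
proof -
  have "indep 0 (\<lambda>_. 0)" by (simp add: indep_def)
  then obtain z where "\<And>x. z \<noteq> comb 0 (\<lambda>_. 0) x" "\<And>F d. (F, d) \<in> set fs \<Longrightarrow> F z = 0"
    by (rule chevalley_outside[of fs 0 "\<lambda>_. 0", rotated]) (use assms in force)+
  then show ?thesis by (intro exI[of _ z]) (force simp: comb_def)
qed

lemma chevalley_avoid1:
  assumes "\<forall>f\<in>set fs. polyfun (snd f) (fst f) \<and> fst f 0 = 0" "(\<Sum>f\<leftarrow>fs. snd f) < 5" "u \<noteq> 0"
  shows "\<exists>z. (\<forall>c. z \<noteq> c *s u) \<and> (\<forall>f\<in>set fs. fst f z = 0)"
proof -
  have "indep 1 (\<lambda>_. u)" using assms(3) by (simp add: indep_def comb_def)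
  then obtain z where z: "\<And>x. z \<noteq> comb 1 (\<lambda>_. u) x" "\<And>F d. (F, d) \<in> set fs \<Longrightarrow> F z = 0"
    by (rule chevalley_outside[of fs 1 "\<lambda>_. u", rotated]) (use assms in force)+
  have "z \<noteq> c *s u" for c using z(1)[of "\<lambda>_. c"] by (simp add: comb_def)
  then show ?thesis using z(2) by (intro exI[of _ z]) force
qed

lemma chevalley_avoid2:
  assumes "\<forall>f\<in>set fs. polyfun (snd f) (fst f) \<and> fst f 0 = 0" "(\<Sum>f\<leftarrow>fs. snd f) < 4"
    and "\<And>c d. c *s u + d *s v = 0 \<Longrightarrow> c = 0 \<and> d = 0"
  shows "\<exists>z. (\<forall>c d. z \<noteq> c *s u + d *s v) \<and> (\<forall>f\<in>set fs. fst f z = 0)"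
proof -
  let ?b = "\<lambda>i. if i = 0 then u else v"
  have c2: "comb 2 ?b x = x 0 *s u + x 1 *s v" for x by (simp add: comb_def numeral_2_eq_2)
  have "indep 2 ?b" unfolding indep_def c2 using assms(3) by (auto simp: less_2_cases_iff)
  then obtain z where z: "\<And>x. z \<noteq> comb 2 ?b x" "\<And>F d. (F, d) \<in> set fs \<Longrightarrow> F z = 0"
    by (rule chevalley_outside[of fs 2 ?b, rotated]) (use assms in force)+
  have "z \<noteq> c *s u + d *s v" for c d using z(1)[of "\<lambda>i. if i = 0 then c else d"] unfolding c2 by simp
  then show ?thesis using z(2) by (intro exI[of _ z]) force
qed

lemma chevalley_avoid3:
  assumes "\<forall>f\<in>set fs. polyfun (snd f) (fst f) \<and> fst f 0 = 0" "(\<Sum>f\<leftarrow>fs. snd f) < 3"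
    and "\<And>c d e. c *s u + d *s v + e *s w = 0 \<Longrightarrow> c = 0 \<and> d = 0 \<and> e = 0"
  shows "\<exists>z. (\<forall>c d e. z \<noteq> c *s u + d *s v + e *s w) \<and> (\<forall>f\<in>set fs. fst f z = 0)"
proof -
  let ?b = "\<lambda>i. if i = 0 then u else if i = Suc 0 then v else w"
  have c3: "comb 3 ?b x = x 0 *s u + x 1 *s v + x 2 *s w" for x by (simp add: comb_def eval_nat_numeral)
  have "indep 3 ?b" unfolding indep_def c3
  proof (intro allI impI)
    fix x :: "nat \<Rightarrow> 'a" and i assume "x 0 *s u + x 1 *s v + x 2 *s w = 0" "i < (3 :: nat)"
    moreover from this(2) have "i = 0 \<or> i = 1 \<or> i = 2" by linarith
    ultimately show "x i = 0" using assms(3) by blast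
  qed
  then obtain z where z: "\<And>x. z \<noteq> comb 3 ?b x" "\<And>F d. (F, d) \<in> set fs \<Longrightarrow> F z = 0"
    by (rule chevalley_outside[of fs 3 ?b, rotated]) (use assms in force)+
  have "z \<noteq> c *s u + d *s v + e *s w" for c d e
    using z(1)[of "\<lambda>i. if i = 0 then c else if i = 1 then d else e"] unfolding c3 by simp
  then show ?thesis using z(2) by (intro exI[of _ z]) force
qed

text \<open>Otherwise the form at x a + y is quadratic in x, with leading coefficient 10
  \<open>\<Phi> a a y y y\<close>. On a suitable hyperplane \<open>isotropic_line\<close> reduces it
  to k \<open>\<Phi> a a z z z\<close> m(z)^2 with m linear. A common zero of the hyperplane, m and
  \<open>\<Phi> a a z z z\<close>, of degrees 1 + 1 + 3 = 5, turns out to be a vertex.\<close>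

lemma not_isotropic:
  assumes a: "\<Phi> a a a a a = 0" and a0: "a \<noteq> 0"
  shows "\<exists>y. \<Phi> a a a y y \<noteq> 0"
proof (rule ccontr)
  assume "\<not> ?thesis"
  then have Q: "\<Phi> a a a y z = 0" for y z using polarize2 by blast
  have aaaa: "\<Phi> a a a a z = 0" for z by (rule Q)
  have "\<exists>y. \<Phi> a a y y y \<noteq> 0"
  proof (rule ccontr)
    assume "\<not> ?thesis"
    then have C: "\<Phi> a a y y y = 0" for y by blast
    have "\<Phi> a y y y y = 0" for y
    proof (rule ccontr)
      assume D: "\<Phi> a y y y y \<noteq> 0"
      define x where "x = - \<Phi> y y y y y / (5 * \<Phi> a y y y y)"
      define w where "w = x *s a + y"
      have "\<Phi> w w w w w = 0" unfolding w_def singular_zero(2)[OF a] Q C using D by (simp add: x_def)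
      then have "\<Phi> w w w w a = 0" by (rule singular)
      then show False unfolding w_def singular_zero(3)[OF a] Q C using D by simp
    qed
    then show False using vertex_eq_0 a0 by blast
  qed
  then obtain y1 where y1: "\<Phi> a a y1 y1 y1 \<noteq> 0" by blast
  have Cshift: "\<Phi> a a (s *s a + y) (s *s a + y) (s *s a + y) = \<Phi> a a y y y" for s y
    unfolding expand3 by (simp add: Q)
  have Dshift: "\<Phi> a (s *s a + y) (s *s a + y) (s *s a + y) (s *s a + y) = 4 * s * \<Phi> a a y y y + \<Phi> a y y y y" for s y
    unfolding expand4 by (simp add: Q)
  \<comment> \<open>The shift along a that kills the linear coefficient in x.\<close>
  define y2 where "y2 = (- \<Phi> a y1 y1 y1 y1 / (4 * \<Phi> a a y1 y1 y1)) *s a + y1"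
  have y2: "\<Phi> a a y2 y2 y2 \<noteq> 0" "\<Phi> a y2 y2 y2 y2 = 0"
    unfolding y2_def Cshift Dshift using y1 by simp_all
  have "\<exists>y0. \<Phi> a a y0 y0 y0 \<noteq> 0 \<and> \<Phi> a y0 y0 y0 y0 = 0 \<and>
    (\<exists>k m. (\<forall>x y. m (x + y) = m x + m y) \<and> (\<forall>c x. m (c *s x) = c * m x) \<and>
      (\<forall>z. \<Phi> a y0 y0 y0 z = 0 \<longrightarrow> \<Phi> a z z z z = 0 \<and> \<Phi> z z z z z = k * \<Phi> a a z z z * (m z)\<^sup>2))"
  proof (cases "\<exists>y. \<Phi> a a y y y \<noteq> 0 \<and> \<Phi> a y y y y = 0 \<and> \<Phi> y y y y y \<noteq> 0")
    case True
    then obtain y where y: "\<Phi> a a y y y \<noteq> 0" "\<Phi> a y y y y = 0" "\<Phi> y y y y y \<noteq> 0" by blast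
    \<comment> \<open>N is n1^2 and m(z) is n1 n0 in the notation of \<open>isotropic_line\<close>,
      expressed through \<Phi> so that m is visibly linear in z.\<close>
    define N where "N = - \<Phi> y y y y y / (10 * nonsq * \<Phi> a a y y y)"
    define m where "m z = (- \<Phi> y y y y z / (2 * nonsq) - 3 * \<Phi> a a y y z * N) / (2 * \<Phi> a a y y y)" for z
    have m: "m (z + z') = m z + m z'" "m (c *s z) = c * m z" for z z' c
      unfolding m_def by (simp_all add: multilinear algebra_simps add_divide_distrib diff_divide_distrib)
    have "\<Phi> a z z z z = 0 \<and> \<Phi> z z z z z = (- 10 * nonsq / N) * \<Phi> a a z z z * (m z)\<^sup>2" if z: "\<Phi> a y y y z = 0" for z
    proof -
      obtain \<beta>0 \<beta>1 n0 n1 where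
        1: "\<And>t. \<Phi> a (t *s y + z) (t *s y + z) (t *s y + z) (t *s y + z) = 4 * \<Phi> a a (t *s y + z) (t *s y + z) (t *s y + z) * (\<beta>0 + \<beta>1 * t)"
        "\<And>t. \<Phi> (t *s y + z) (t *s y + z) (t *s y + z) (t *s y + z) (t *s y + z) =
          10 * \<Phi> a a (t *s y + z) (t *s y + z) (t *s y + z) * ((\<beta>0 + \<beta>1 * t)\<^sup>2 - nonsq * (n0 + n1 * t)\<^sup>2)"
        and 2: "\<Phi> a y y y y = 4 * \<Phi> a a y y y * \<beta>1" "\<Phi> a y y y z = \<Phi> a a y y y * \<beta>0 + 3 * \<Phi> a a y y z * \<beta>1"
        "\<Phi> y y y y y = 10 * \<Phi> a a y y y * (\<beta>1\<^sup>2 - nonsq * n1\<^sup>2)"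
        and 3: "\<beta>0 = 0 \<Longrightarrow> \<beta>1 = 0 \<Longrightarrow> \<Phi> y y y y z = - 2 * nonsq * (2 * \<Phi> a a y y y * n1 * n0 + 3 * \<Phi> a a y y z * n1\<^sup>2)"
        using isotropic_line[OF a Q Q Q y(1), of z] by metis
      have b1: "\<beta>1 = 0" using 2(1) y by simp
      have b0: "\<beta>0 = 0" using 2(2) z y b1 by simp
      have N: "N = n1\<^sup>2" unfolding N_def 2(3) b1 using y(1) nonsq_neq_0 by simp
      have n1: "n1 \<noteq> 0" using y(3) 2(3) b1 by auto
      have mz: "m z = n1 * n0" unfolding m_def N 3[OF b0 b1] using y(1) nonsq_neq_0 by (simp add: field_simps)
      have "(- 10 * nonsq / N) * \<Phi> a a z z z * (m z)\<^sup>2 = - 10 * nonsq * \<Phi> a a z z z * n0\<^sup>2"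
        unfolding N mz using n1 by (simp add: power_mult_distrib)
      then show ?thesis using 1[of 0] b0 b1 by simp
    qed
    then show ?thesis using y m by (intro exI[of _ y] conjI exI[of _ "- 10 * nonsq / N"] exI[of _ m]) auto
  next
    \<comment> \<open>Here the form vanishes at every vector with nonzero quadratic and vanishing
      linear coefficient, so k = 0 will do.\<close>
    case False
    have "\<Phi> a z z z z = 0 \<and> \<Phi> z z z z z = 0" if z: "\<Phi> a y2 y2 y2 z = 0" for z
    proof -
      obtain \<beta>0 \<beta>1 n0 n1 where
        1: "\<And>t. \<Phi> a (t *s y2 + z) (t *s y2 + z) (t *s y2 + z) (t *s y2 + z) = 4 * \<Phi> a a (t *s y2 + z) (t *s y2 + z) (t *s y2 + z) * (\<beta>0 + \<beta>1 * t)"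
        "\<And>t. \<Phi> (t *s y2 + z) (t *s y2 + z) (t *s y2 + z) (t *s y2 + z) (t *s y2 + z) =
          10 * \<Phi> a a (t *s y2 + z) (t *s y2 + z) (t *s y2 + z) * ((\<beta>0 + \<beta>1 * t)\<^sup>2 - nonsq * (n0 + n1 * t)\<^sup>2)"
        and 2: "\<Phi> a y2 y2 y2 y2 = 4 * \<Phi> a a y2 y2 y2 * \<beta>1" "\<Phi> a y2 y2 y2 z = \<Phi> a a y2 y2 y2 * \<beta>0 + 3 * \<Phi> a a y2 y2 z * \<beta>1"
        using isotropic_line[OF a Q Q Q y2(1), of z] by metis
      have b1: "\<beta>1 = 0" using 2(1) y2 by simp
      have b0: "\<beta>0 = 0" using 2(2) z y2 b1 by simp
      have "\<Phi> a z z z z = 0" using 1(1)[of 0] b0 b1 by simp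
      moreover have "\<Phi> z z z z z = 0"
      proof (cases "\<Phi> a a z z z = 0")
        case True
        then show ?thesis using 1(2)[of 0] by simp
      qed (use False \<open>\<Phi> a z z z z = 0\<close> in blast)
      ultimately show ?thesis by blast
    qed
    then show ?thesis using y2 by (intro exI[of _ y2] conjI exI[of _ 0] exI[of _ "\<lambda>_. 0"]) auto
  qed
  then obtain y0 k m where y0: "\<Phi> a a y0 y0 y0 \<noteq> 0" "\<Phi> a y0 y0 y0 y0 = 0"
    and m: "\<And>x y. m (x + y) = m x + m y" "\<And>c x. m (c *s x) = c * m x"
    and k': "\<forall>z. \<Phi> a y0 y0 y0 z = 0 \<longrightarrow> \<Phi> a z z z z = 0 \<and> \<Phi> z z z z z = k * \<Phi> a a z z z * (m z)\<^sup>2"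
    by blast
  have k: "\<Phi> a z z z z = 0" "\<Phi> z z z z z = k * \<Phi> a a z z z * (m z)\<^sup>2" if "\<Phi> a y0 y0 y0 z = 0" for z
    using k' that by blast+
  have "m 0 = 0" using m(2)[of 0 0] by simp
  then obtain z where z0: "z \<noteq> 0" and z1: "\<Phi> a y0 y0 y0 z = 0" and z2: "m z = 0" and z3: "\<Phi> a a z z z = 0"
    using polyfun_linear[of m, OF m] chevalley_zero[of "[(\<lambda>z. \<Phi> a y0 y0 y0 z, 1), (m, 1), (\<lambda>z. \<Phi> a a z z z, 3)]"] by auto
  have v1: "\<Phi> a a y y z = 0" if "\<Phi> a a y y y \<noteq> 0" for y
    using isotropic_line[OF a Q Q Q that, of z] z3 by metis
  \<comment> \<open>Known where \<open>\<Phi> a a y y y\<close> \<noteq> 0; along the line y + t y0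
    this cubic is a nonzero polynomial in t and can be cancelled.\<close>
  have "\<Phi> a a y y z = 0" for y
  proof -
    define A where "A = [:\<Phi> a a y y y, 3 * \<Phi> a a y0 y y, 3 * \<Phi> a a y0 y0 y, \<Phi> a a y0 y0 y0:]"
    define B where "B = [:\<Phi> a a z y y, 2 * \<Phi> a a z y0 y, \<Phi> a a z y0 y0:]"
    have s: "\<Phi> a a x x z = \<Phi> a a z x x" for x by (metis sym3 sym4)
    have pA: "poly A t = \<Phi> a a (t *s y0 + y) (t *s y0 + y) (t *s y0 + y)" for t
      unfolding expand3 A_def by (simp add: power2_eq_square power3_eq_cube algebra_simps)
    have pB: "poly B t = \<Phi> a a z (t *s y0 + y) (t *s y0 + y)" for t
      unfolding expand2 B_def by (simp add: power2_eq_square algebra_simps)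
    have "poly (A * B) t = 0" for t
      using v1[of "t *s y0 + y"] unfolding poly_mult pA pB s by auto
    moreover have "degree (A * B) \<le> 101"
    proof -
      have "degree A \<le> 3" "degree B \<le> 2" unfolding A_def B_def by (simp_all add: degree_pCons_eq_if)
      then show ?thesis using degree_mult_le[of A B] by linarith
    qed
    ultimately have "A * B = 0" by (rule poly_eq_0_if_all_values_0)
    moreover have "A \<noteq> 0" using y0 by (simp add: A_def)
    ultimately have "B = 0" by simp
    then show ?thesis unfolding B_def s by simp
  qed
  then have "\<Phi> a a z y y = 0" for y by (metis sym3 sym4)
  then have v: "\<Phi> a a z x y = 0" for x y by (rule polarize2)
  have Cz: "\<Phi> a a (s *s z + y) (s *s z + y) (s *s z + y) = \<Phi> a a y y y" for s y
    unfolding expand3 by (simp add: v)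
  \<comment> \<open>Write y = \<beta> a + y' with y' in the hyperplane. The expansion at a involves
    only quantities at y' that do not change when s z is added.\<close>
  have key: "\<Phi> (s *s z + y) (s *s z + y) (s *s z + y) (s *s z + y) (s *s z + y) = \<Phi> y y y y y" for s y
  proof -
    define \<beta> where "\<beta> = \<Phi> a y0 y0 y0 y / \<Phi> a a y0 y0 y0"
    define y' where "y' = (- \<beta>) *s a + y"
    have yy: "y = \<beta> *s a + y'" by (simp add: y'_def scale_minus_left)
    have s: "\<Phi> a y0 y0 y0 a = \<Phi> a a y0 y0 y0" by (metis sym1 sym2 sym3 sym4)
    have b: "\<Phi> a y0 y0 y0 y' = 0" unfolding y'_def add5 scale5 s \<beta>_def using y0 by simp
    have b': "\<Phi> a y0 y0 y0 (s *s z + y') = 0" using b z1 by (simp add: multilinear)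
    have m': "m (s *s z + y') = m y'" using m z2 by simp
    have 1: "\<Phi> (s *s z + y') (s *s z + y') (s *s z + y') (s *s z + y') (s *s z + y') = \<Phi> y' y' y' y' y'"
      unfolding k(2)[OF b] k(2)[OF b'] m' Cz ..
    have eq: "s *s z + y = \<beta> *s a + (s *s z + y')" by (subst yy) (simp add: add_ac)
    have "\<Phi> (s *s z + y) (s *s z + y) (s *s z + y) (s *s z + y) (s *s z + y) =
        10 * \<beta>\<^sup>2 * \<Phi> a a y' y' y' + \<Phi> y' y' y' y' y'"
      unfolding eq unfolding singular_zero(2)[OF a] 1 Cz k(1)[OF b'] Q by simp
    moreover have "\<Phi> y y y y y = 10 * \<beta>\<^sup>2 * \<Phi> a a y' y' y' + \<Phi> y' y' y' y' y'"
      using singular_zero(2)[OF a, of \<beta> "y'"] unfolding yy[symmetric] k(1)[OF b] Q by simp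
    ultimately show ?thesis by simp
  qed
  have "\<Phi> z y y y y = 0" for y
  proof -
    have "\<Phi> z z z z z * t ^ 5 + (5 * \<Phi> z z z z y) * t ^ 4 + (10 * \<Phi> z z z y y) * t ^ 3 + (10 * \<Phi> z z y y y) * t\<^sup>2
      + (5 * \<Phi> z y y y y) * t + 0 = 0" for t
      using key[of t y] unfolding expand5 by (simp add: mult_ac)
    then have "5 * \<Phi> z y y y y = 0" using quintic_eq_0 by blast
    then show ?thesis by simp
  qed
  then show False using vertex_eq_0 z0 by blast
qed

end

section \<open>Cubic norms and affine plane cubics\<close>

text \<open>The norm of k0 \<theta>^2 + k1 \<theta> + k2, where \<theta>^3 + q \<theta> + e = 0;
  \<open>cubic_norm_roots\<close> shows it as the product over the three roots.\<close>

definition cubic_norm :: "'a :: comm_ring_1 \<Rightarrow> 'a \<Rightarrow> 'a \<Rightarrow> 'a \<Rightarrow> 'a \<Rightarrow> 'a" where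
  "cubic_norm q e k0 k1 k2 = e\<^sup>2 * k0 ^ 3 - e * q * k0\<^sup>2 * k1 + q\<^sup>2 * k0\<^sup>2 * k2 + 3 * e * k0 * k1 * k2
    - 2 * q * k0 * k2\<^sup>2 - e * k1 ^ 3 + q * k1\<^sup>2 * k2 + k2 ^ 3"

lemma cubic_norm_roots:
  fixes a b c :: "'a :: comm_ring_1"
  assumes "a + b + c = 0" "q = a * b + a * c + b * c" "e = - (a * b * c)"
  shows "cubic_norm q e k0 k1 k2 = (k0 * a\<^sup>2 + k1 * a + k2) * (k0 * b\<^sup>2 + k1 * b + k2) * (k0 * c\<^sup>2 + k1 * c + k2)"
proof -
  have c: "c = - a - b" using assms(1) by (simp add: algebra_simps eq_neg_iff_add_eq_0)
  show ?thesis unfolding cubic_norm_def assms(2,3) unfolding c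
    by (simp add: power2_eq_square power3_eq_cube algebra_simps)
qed

lemma cubic_norm_scale: "cubic_norm q e (s * k0) (s * k1) (s * k2) = s ^ 3 * cubic_norm q e k0 k1 k2"
  by (simp add: cubic_norm_def power2_eq_square power3_eq_cube algebra_simps)

text \<open>One of the three factors vanishes at its root \<theta>, and a root of an irreducible
  cubic satisfies no nonzero equation of degree at most 2.\<close>

lemma cubic_norm_eq_0D:
  fixes q e :: "'a :: big_prime_field"
  assumes no: "\<And>x. x ^ 3 + q * x + e \<noteq> 0" and N: "cubic_norm q e k0 k1 k2 = 0"
  shows "k0 = 0 \<and> k1 = 0 \<and> k2 = 0"
proof -
  define c where "c = [:e, q, 0, 1:]"
  have c: "degree c = 3" "\<And>x. poly c x \<noteq> 0"
    using no by (simp_all add: c_def power3_eq_cube algebra_simps)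
  obtain \<rho> where \<rho>: "poly (acp c) \<rho> = 0" using ac_root_exists[of c] c(1) by auto
  define r where "r = [:k2, k1, k0:]"
  define E Q where "E = to_ac e" and "Q = to_ac q"
  have r3: "\<rho> ^ 3 + Q * \<rho> + E = 0" using \<rho> by (simp add: c_def acp_pCons E_def Q_def power3_eq_cube algebra_simps)
  obtain \<sigma> where \<sigma>: "\<sigma>\<^sup>2 + \<rho> * \<sigma> + (\<rho>\<^sup>2 + Q) = 0"
    using alg_closed_imp_poly_has_root[of "[:\<rho>\<^sup>2 + Q, \<rho>, 1:]"] by (auto simp: power2_eq_square algebra_simps)
  define \<tau> where "\<tau> = - \<rho> - \<sigma>"
  have Q: "Q = \<rho> * \<sigma> + \<rho> * \<tau> + \<sigma> * \<tau>" using \<sigma> unfolding \<tau>_def by (simp add: power2_eq_square algebra_simps eq_neg_iff_add_eq_0)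
  have E: "E = - (\<rho> * \<sigma> * \<tau>)"
  proof -
    have "E = - (\<rho> ^ 3 + Q * \<rho>)" using r3 by (simp only: add_eq_0_iff)
    also have "\<dots> = - (\<rho> * \<sigma> * \<tau>)" unfolding Q \<tau>_def by (simp add: power2_eq_square power3_eq_cube algebra_simps)
    finally show ?thesis .
  qed
  have s0: "\<rho> + \<sigma> + \<tau> = 0" by (simp add: \<tau>_def)
  have root: "poly (acp c) x = 0" if "x = \<rho> \<or> x = \<sigma> \<or> x = \<tau>" for x
  proof -
    have "poly (acp c) x = (x - \<rho>) * (x - \<sigma>) * (x - \<tau>)"
      unfolding c_def acp_pCons E_def[symmetric] Q_def[symmetric] E Q \<tau>_def
      by (simp add: algebra_simps)
    then show ?thesis using that by auto
  qed
  have "to_ac (cubic_norm q e k0 k1 k2) = cubic_norm Q E (to_ac k0) (to_ac k1) (to_ac k2)"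
    by (simp add: cubic_norm_def Q_def E_def)
  then have "poly (acp r) \<rho> * poly (acp r) \<sigma> * poly (acp r) \<tau> = 0"
    using cubic_norm_roots[OF s0 Q E, of "to_ac k0" "to_ac k1" "to_ac k2"] N
    by (simp add: r_def acp_pCons power2_eq_square algebra_simps)
  then obtain x where x: "x = \<rho> \<or> x = \<sigma> \<or> x = \<tau>" "poly (acp r) x = 0" by auto
  have "degree r \<le> 2" by (simp add: r_def degree_pCons_eq_if)
  then have "r = 0" using cubic_root_degree_2[OF c root[OF x(1)] _ x(2)] by blast
  then show ?thesis by (simp add: r_def)
qed

text \<open>A and B have no common root, so each root of Q^3 belongs with its full multiplicity, at
  least 3, to one of them. The bound 3 on the degrees then assigns one root to each.\<close>

lemma cardano_factors:
  fixes A B Q :: "'b :: alg_closed_field poly"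
  assumes AB: "A * B = smult k (Q ^ 3)" and k: "k \<noteq> 0" and Q: "degree Q = 2"
    and A: "degree A \<le> 3" and B: "degree B \<le> 3" and cop: "\<And>x. \<not> (poly A x = 0 \<and> poly B x = 0)"
  shows "\<exists>r1 r2 \<alpha> \<beta>. Q = smult (lead_coeff Q) ([:- r1, 1:] * [:- r2, 1:]) \<and>
     A = smult \<alpha> ([:- r1, 1:] ^ 3) \<and> B = smult \<beta> ([:- r2, 1:] ^ 3)"
proof -
  have Q0: "Q \<noteq> 0" using Q by auto
  have nz: "A \<noteq> 0" "B \<noteq> 0" using AB k Q0 by auto
  obtain r where r: "poly Q r = 0" using alg_closed_imp_poly_has_root[of Q] Q by auto
  then obtain Q1 where Q1: "Q = [:- r, 1:] * Q1" by (meson poly_eq_0_iff_dvd dvdE)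
  have Q10: "Q1 \<noteq> 0" using Q1 Q0 by auto
  have "degree Q = 1 + degree Q1" unfolding Q1 using Q10 by (subst degree_mult_eq) auto
  then have "degree Q1 = 1" using Q by simp
  then obtain s where s: "Q1 = smult (lead_coeff Q1) [:- s, 1:]" using degree_1_root by blast
  define L1 L2 where "L1 = [:- r, 1:]" and "L2 = [:- s, 1:]"
  define c where "c = lead_coeff Q1"
  have Q1': "Q1 = smult c L2" using s unfolding c_def L2_def .
  have QQ: "Q = smult c (L1 * L2)" unfolding Q1[folded L1_def] Q1' by (simp only: mult_smult_right)
  have c: "c = lead_coeff Q" unfolding QQ lead_coeff_smult lead_coeff_mult L1_def L2_def by simp
  have cube2: "[:- x, 1:] ^ n dvd C" if "[:- x, 1:] ^ n dvd C * D" "poly D x \<noteq> 0" "C \<noteq> 0" for x n and C D :: "'b poly"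
  proof -
    have D0: "D \<noteq> 0" using that(2) by auto
    then have "n \<le> order x (C * D)" using that by (subst (asm) order_divides) auto
    also have "\<dots> = order x C" using that D0 by (simp add: order_mult order_0I)
    finally show ?thesis using that(3) by (subst order_divides) auto
  qed
  have cube: "[:- x, 1:] ^ n dvd A" if "[:- x, 1:] ^ n dvd A * B" "poly B x \<noteq> 0" for x n
    using cube2[OF that] nz by blast
  have cube': "[:- x, 1:] ^ n dvd B" if "[:- x, 1:] ^ n dvd A * B" "poly A x \<noteq> 0" for x n
    using cube2[of x n B A] that nz by (simp add: mult.commute)
  have AB': "A * B = smult (k * c ^ 3) (L1 ^ 3 * L2 ^ 3)"
    unfolding AB QQ by (simp add: power3_eq_cube mult_ac)
  have d1: "L1 ^ 3 dvd A * B" "L2 ^ 3 dvd A * B" unfolding AB' by (simp_all add: dvd_smult)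
  have zero: "poly A r = 0 \<or> poly B r = 0" "poly A s = 0 \<or> poly B s = 0"
  proof -
    have "poly (A * B) r = 0" "poly (A * B) s = 0" unfolding AB' L1_def L2_def by simp_all
    then show "poly A r = 0 \<or> poly B r = 0" "poly A s = 0 \<or> poly B s = 0" by auto
  qed
  have both: False if C: "\<And>n x. [:- x, 1:] ^ n dvd A * B \<Longrightarrow> poly C x = 0 \<Longrightarrow> [:- x, 1:] ^ n dvd C"
    "poly C r = 0" "poly C s = 0" "C \<noteq> 0" "degree C \<le> 3" for C
  proof -
    have "L1 ^ 3 * L2 ^ 3 dvd C"
    proof (cases "r = s")
      case True
      then have "[:- r, 1:] ^ 6 dvd A * B" unfolding AB' L1_def L2_def by (simp add: dvd_smult flip: power_add)
      then have "[:- r, 1:] ^ 6 dvd C" using C(1,2) by blast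
      then show ?thesis using True unfolding L1_def L2_def by (simp flip: power_add)
    next
      case False
      have d: "L1 ^ 3 dvd C" "L2 ^ 3 dvd C" using C(1-3) d1 unfolding L1_def L2_def by blast+
      then obtain u where u: "C = u * L1 ^ 3" by (metis dvdE mult.commute)
      have "u \<noteq> 0" using u C(4) by auto
      moreover have "poly (L1 ^ 3) s \<noteq> 0" using False by (simp add: L1_def)
      ultimately have "L2 ^ 3 dvd u" using cube2[of s 3 u "L1 ^ 3"] d(2) unfolding u L2_def by blast
      then show ?thesis unfolding u by (metis mult.commute mult_dvd_mono dvd_refl)
    qed
    then have "degree (L1 ^ 3 * L2 ^ 3) \<le> degree C" using C(4) by (rule dvd_imp_degree_le)
    moreover have "degree (L1 ^ 3 * L2 ^ 3) = 6"
      unfolding L1_def L2_def by (simp add: degree_mult_eq degree_power_eq)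
    ultimately show False using C(5) by simp
  qed
  have notA: "\<not> (poly A r = 0 \<and> poly A s = 0)" using both[of A] cube cop nz A by blast
  have notB: "\<not> (poly B r = 0 \<and> poly B s = 0)" using both[of B] cube' cop nz B by blast
  have single: "\<exists>\<alpha>. C = smult \<alpha> ([:- x, 1:] ^ 3)" if dC: "[:- x, 1:] ^ 3 dvd C" "degree C \<le> 3" "C \<noteq> 0" for C :: "'b poly" and x
  proof -
    obtain u where u: "C = [:- x, 1:] ^ 3 * u" using dC(1) by blast
    then have "u \<noteq> 0" using dC(3) by auto
    then have "degree C = 3 + degree u" unfolding u by (simp add: degree_mult_eq degree_power_eq)
    then have "degree u = 0" using dC(2) by simp
    then obtain y where "u = [:y:]" by (auto elim: degree_eq_zeroE)
    then show ?thesis unfolding u by (intro exI[of _ y]) simp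
  qed
  show ?thesis
  proof (cases "poly A r = 0")
    case True
    then have "poly B r \<noteq> 0" "poly A s \<noteq> 0" using cop notA by blast+
    then have "L1 ^ 3 dvd A" "L2 ^ 3 dvd B" using cube cube' d1 unfolding L1_def L2_def by blast+
    then show ?thesis using single A B nz QQ c unfolding L1_def L2_def by metis
  next
    case False
    then have "poly B s \<noteq> 0" using zero notB by blast
    then have "L2 ^ 3 dvd A" "L1 ^ 3 dvd B" using cube cube' d1 False unfolding L1_def L2_def by blast+
    then show ?thesis using single A B nz QQ c unfolding L1_def L2_def by (metis mult.commute)
  qed
qed

text \<open>With u = a(t - r) and v = b(t - s), the cubic x^3 - 3uvx - u^3 - v^3 is the product of
  three lines x = \<omega> u + \<omega>^2 v, one for each cube root of unity \<omega>. The
  hypotheses list its coefficients after the shift of x by k.\<close>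

lemma cardano_norm_identity:
  fixes a b r s k :: "'b :: field"
  assumes q: "q = - 3 * a * b" and e: "e = - (a ^ 3 + b ^ 3)" and k1: "k1 = 3 * a * b * (r + s)"
    and k2: "k2 = k * q + 3 * (a ^ 3 * r + b ^ 3 * s)" and l0: "l0 = 3 * k\<^sup>2 - 3 * a * b * r * s"
    and m: "m = k * l0 - 2 * k ^ 3 + a ^ 3 * r ^ 3 + b ^ 3 * s ^ 3"
  shows "cubic_norm q e (3 * k) k1 k2 = m * (4 * q ^ 3 + 27 * e\<^sup>2)"
  unfolding cubic_norm_def m l0 k2 k1 e q
  by (simp add: power2_eq_square power3_eq_cube algebra_simps)

text \<open>The cubic splits into three lines x - \<theta> t + \<mu>, one for each root \<theta> of
  \<theta>^3 + q \<theta> + e. Its quadratic part at (\<theta>, 1) is \<mu> (3 \<theta>^2 + q); the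
  product over the roots is the claim, since m is the product of the \<mu> and 3 \<theta>^2 + q has
  norm 4 q^3 + 27 e^2. A rational zero must be a common point of the lines; without one, the
  discriminant in x is a square and Cardano's formula gives the lines.\<close>

theorem plane_cubic_norm:
  fixes q e k0 k1 k2 l0 l1 m :: "'a :: big_prime_field"
  defines "P \<equiv> \<lambda>x t. x ^ 3 + q * x * t\<^sup>2 + e * t ^ 3 + (k0 * x\<^sup>2 + k1 * x * t + k2 * t\<^sup>2) + (l0 * x + l1 * t) + m"
  assumes q: "q \<noteq> 0" and no: "\<And>x. x ^ 3 + q * x + e \<noteq> 0"
    and sing: "\<And>x t. P x t = 0 \<Longrightarrow> 3 * x\<^sup>2 + q * t\<^sup>2 + 2 * k0 * x + k1 * t + l0 = 0 \<and>
      2 * q * x * t + 3 * e * t\<^sup>2 + k1 * x + 2 * k2 * t + l1 = 0"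
  shows "cubic_norm q e k0 k1 k2 = m * (4 * q ^ 3 + 27 * e\<^sup>2)"
proof (cases "\<exists>x t. P x t = 0")
  case True
  then obtain x0 t0 where P0: "P x0 t0 = 0" by blast
  define \<kappa> where "\<kappa> x t = (3 * x0 + k0) * x\<^sup>2 + (2 * q * t0 + k1) * x * t + (q * x0 + 3 * e * t0 + k2) * t\<^sup>2" for x t
  define g where "g x t = x ^ 3 + q * x * t\<^sup>2 + e * t ^ 3" for x t
  define X0 T0 where "X0 = 3 * x0\<^sup>2 + q * t0\<^sup>2 + 2 * k0 * x0 + k1 * t0 + l0"
    and "T0 = 2 * q * x0 * t0 + 3 * e * t0\<^sup>2 + k1 * x0 + 2 * k2 * t0 + l1"
  have z: "X0 = 0" "T0 = 0" using sing[OF P0] by (simp_all add: X0_def T0_def)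
  have aniso: "g x t \<noteq> 0" if "x \<noteq> 0 \<or> t \<noteq> 0" for x t
  proof (cases "t = 0")
    case False
    have "g x t = t ^ 3 * ((x / t) ^ 3 + q * (x / t) + e)" using False by (simp add: g_def field_simps power2_eq_square power3_eq_cube)
    moreover have "(x / t) ^ 3 + q * (x / t) + e \<noteq> 0" by (rule no)
    ultimately show ?thesis using False by simp
  qed (use that in \<open>simp add: g_def\<close>)
  \<comment> \<open>On a line through the singular point the cubic is s^2 (\<kappa> + s g). If
    \<kappa> \<noteq> 0, then s = - \<kappa>/g is a further zero, and a simple one on this
    line.\<close>
  have \<kappa>: "\<kappa> x t = 0" for x t
  proof (rule ccontr)
    assume k: "\<kappa> x t \<noteq> 0"
    then have "x \<noteq> 0 \<or> t \<noteq> 0" by (auto simp: \<kappa>_def)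
    then have g: "g x t \<noteq> 0" by (rule aniso)
    define s where "s = - \<kappa> x t / g x t"
    have s: "s * g x t = - \<kappa> x t" "s \<noteq> 0" using g k by (simp_all add: s_def)
    have "P (x0 + s * x) (t0 + s * t) = P x0 t0 + s * (x * X0 + t * T0) + s\<^sup>2 * (\<kappa> x t + s * g x t)"
      unfolding P_def X0_def T0_def \<kappa>_def g_def by (simp add: power2_eq_square power3_eq_cube algebra_simps)
    then have "P (x0 + s * x) (t0 + s * t) = 0" unfolding P0 z s by simp
    from sing[OF this] have "x * (3 * (x0 + s * x)\<^sup>2 + q * (t0 + s * t)\<^sup>2 + 2 * k0 * (x0 + s * x) + k1 * (t0 + s * t) + l0)
      + t * (2 * q * (x0 + s * x) * (t0 + s * t) + 3 * e * (t0 + s * t)\<^sup>2 + k1 * (x0 + s * x) + 2 * k2 * (t0 + s * t) + l1) = 0"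
      by simp
    also have "x * (3 * (x0 + s * x)\<^sup>2 + q * (t0 + s * t)\<^sup>2 + 2 * k0 * (x0 + s * x) + k1 * (t0 + s * t) + l0)
      + t * (2 * q * (x0 + s * x) * (t0 + s * t) + 3 * e * (t0 + s * t)\<^sup>2 + k1 * (x0 + s * x) + 2 * k2 * (t0 + s * t) + l1)
      = x * X0 + t * T0 + s * (2 * \<kappa> x t + 3 * (s * g x t))"
      unfolding X0_def T0_def \<kappa>_def g_def by (simp add: power2_eq_square power3_eq_cube algebra_simps)
    finally have "s * \<kappa> x t = 0" unfolding z s by simp
    then show False using k s(2) by simp
  qed
  have k0: "k0 = - 3 * x0" using \<kappa>[of 1 0] by (simp add: \<kappa>_def eq_neg_iff_add_eq_0 add.commute)
  have "k2 + (q * x0 + 3 * e * t0) = 0" using \<kappa>[of 0 1] by (simp add: \<kappa>_def add_ac)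
  then have k2: "k2 = - (q * x0 + 3 * e * t0)" by (simp only: eq_neg_iff_add_eq_0)
  have "k1 + (2 * q * t0) = 0" using \<kappa>[of 1 1] k0 k2 by (simp add: \<kappa>_def add_ac)
  then have k1: "k1 = - (2 * q * t0)" by (simp only: eq_neg_iff_add_eq_0)
  have "l0 + (3 * x0\<^sup>2 + q * t0\<^sup>2 + 2 * k0 * x0 + k1 * t0) = 0" using z(1) by (simp add: X0_def add_ac)
  then have l0: "l0 = - (3 * x0\<^sup>2 + q * t0\<^sup>2 + 2 * k0 * x0 + k1 * t0)" by (simp only: eq_neg_iff_add_eq_0)
  have "l1 + (2 * q * x0 * t0 + 3 * e * t0\<^sup>2 + k1 * x0 + 2 * k2 * t0) = 0" using z(2) by (simp add: T0_def add_ac)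
  then have l1: "l1 = - (2 * q * x0 * t0 + 3 * e * t0\<^sup>2 + k1 * x0 + 2 * k2 * t0)" by (simp only: eq_neg_iff_add_eq_0)
  have "m + (x0 ^ 3 + q * x0 * t0\<^sup>2 + e * t0 ^ 3 + (k0 * x0\<^sup>2 + k1 * x0 * t0 + k2 * t0\<^sup>2) + (l0 * x0 + l1 * t0)) = 0" using P0 by (simp add: P_def add_ac)
  then have m: "m = - (x0 ^ 3 + q * x0 * t0\<^sup>2 + e * t0 ^ 3 + (k0 * x0\<^sup>2 + k1 * x0 * t0 + k2 * t0\<^sup>2) + (l0 * x0 + l1 * t0))" by (simp only: eq_neg_iff_add_eq_0)
  have m': "m = - (x0 ^ 3 + q * x0 * t0\<^sup>2 + e * t0 ^ 3)"
    unfolding m l1 l0 k1 k2 k0 by (simp add: power2_eq_square power3_eq_cube algebra_simps)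
  show ?thesis unfolding m' cubic_norm_def k0 k1 k2 by (simp add: power2_eq_square power3_eq_cube algebra_simps)
next
  case False
  define k where "k = k0 / 3"
  have k0: "k0 = 3 * k" by (simp add: k_def)
  define Q E where "Q = [:l0 - 3 * k\<^sup>2, k1, q:]" and "E = [:m - k * l0 + 2 * k ^ 3, l1 - k * k1, k2 - k * q, e:]"
  have PQE: "P (x - k) t = x ^ 3 + poly Q t * x + poly E t" for x t
    unfolding P_def Q_def E_def k0 by (simp add: power2_eq_square power3_eq_cube algebra_simps)
  have e0: "e \<noteq> 0" using no[of 0] by simp
  have dQ: "degree Q = 2" and dE: "degree E = 3" using q e0 by (simp_all add: Q_def E_def)
  have Eroot: "poly E t \<noteq> 0" for t using PQE[of 0 t] False by auto
  define \<Delta> where "\<Delta> = smult (- 4) (Q ^ 3) + smult (- 27) (E\<^sup>2)"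
  have "degree \<Delta> \<le> 6" unfolding \<Delta>_def
  proof (rule degree_add_le)
    show "degree (smult (- 4) (Q ^ 3)) \<le> 6"
      using degree_power_le[of Q 3] dQ by (intro order_trans[OF degree_smult_le]) linarith
    show "degree (smult (- 27) (E\<^sup>2)) \<le> 6"
      using degree_power_le[of E 2] dE by (intro order_trans[OF degree_smult_le]) linarith
  qed
  then have d8: "degree \<Delta> \<le> 8" by simp
  have "\<exists>s. poly \<Delta> t = s\<^sup>2" for t
  proof -
    have "x ^ 3 + poly Q t * x + poly E t \<noteq> 0" for x using PQE[of x t] False by metis
    then have "\<exists>s. - 4 * poly Q t ^ 3 - 27 * (poly E t)\<^sup>2 = s\<^sup>2"
      by (intro cubic_discriminant_square) blast
    then show ?thesis by (simp add: \<Delta>_def)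
  qed
  then obtain h where h: "\<Delta> = h\<^sup>2" using square_values[OF d8] by blast
  have dh: "degree h \<le> 3"
  proof (cases "h = 0")
    case False
    then show ?thesis using \<open>degree \<Delta> \<le> 6\<close> unfolding h by (simp add: degree_power_eq)
  qed simp
  obtain i :: "'a alg_closure" where i: "i\<^sup>2 = - 27"
    using alg_closed_imp_poly_has_root[of "[:27, 0, 1 :: 'a alg_closure:]"]
    by (auto simp: power2_eq_square eq_neg_iff_add_eq_0 add.commute)
  have n27: "(27 :: 'a alg_closure) \<noteq> 0" "(2 :: 'a alg_closure) \<noteq> 0" "(3 :: 'a alg_closure) \<noteq> 0" "(4 :: 'a alg_closure) \<noteq> 0"
  proof -
    have "to_ac x \<noteq> (0 :: 'a alg_closure)" if "x \<noteq> 0" for x :: 'a using that by simp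
    from this[of 27] this[of 2] this[of 3] this[of 4] two_neq_0[where ?'a='a]
    show "(27 :: 'a alg_closure) \<noteq> 0" "(2 :: 'a alg_closure) \<noteq> 0" "(3 :: 'a alg_closure) \<noteq> 0" "(4 :: 'a alg_closure) \<noteq> 0"
      by simp_all
  qed
  have i0: "i \<noteq> 0" using i n27(1) by auto
  define A B where "A = acp h - smult i (acp E)" and "B = acp h + smult i (acp E)"
  have AB: "A * B = smult (- 4) (acp Q ^ 3)"
  proof -
    have "A * B = acp (h\<^sup>2) - smult (i\<^sup>2) (acp (E\<^sup>2))"
      unfolding A_def B_def acp_power by (simp add: algebra_simps power2_eq_square)
    also have "\<dots> = smult (- 4) (acp Q ^ 3)"
      unfolding h[symmetric] \<Delta>_def i acp_add acp_smult acp_power by simp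
    finally show ?thesis .
  qed
  have EAB: "smult (2 * i) (acp E) = B - A" unfolding A_def B_def
    by (simp add: algebra_simps flip: smult_add_left) 
  have cop: "\<not> (poly A x = 0 \<and> poly B x = 0)" for x
  proof
    assume *: "poly A x = 0 \<and> poly B x = 0"
    then have "poly (smult (2 * i) (acp E)) x = 0" unfolding EAB by simp
    then have Ex: "poly (acp E) x = 0" using i0 n27 by simp
    have "poly (smult (- 4) (acp Q ^ 3)) x = 0" unfolding AB[symmetric] using * by simp
    then have "poly (acp Q) x = 0" using n27(4) by simp
    then have "Q = 0" using cubic_root_degree_2[OF dE Eroot Ex] dQ by simp
    then show False using dQ by simp
  qed
  have dA: "degree A \<le> 3" "degree B \<le> 3"
    unfolding A_def B_def using dh dE
    by (auto intro!: degree_diff_le degree_add_le intro: order_trans[OF degree_smult_le])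
  have four: "- 4 \<noteq> (0 :: 'a alg_closure)" using n27(4) by simp
  obtain r1 r2 \<alpha> \<beta> where f: "acp Q = smult (lead_coeff (acp Q)) ([:- r1, 1:] * [:- r2, 1:])"
     "A = smult \<alpha> ([:- r1, 1:] ^ 3)" "B = smult \<beta> ([:- r2, 1:] ^ 3)"
    using cardano_factors[OF AB four _ dA cop] dQ by auto
  define q' where "q' = to_ac q"
  have q'0: "q' \<noteq> 0" using q by (simp add: q'_def)
  have Qc: "acp Q = smult q' ([:- r1, 1:] * [:- r2, 1:])"
    using f(1) dQ by (simp add: Q_def coeff_map_poly q'_def numeral_2_eq_2)
  have ab: "\<alpha> * \<beta> = - 4 * q' ^ 3"
  proof -
    have "lead_coeff (A * B) = \<alpha> * \<beta>" 
      unfolding f(2,3) lead_coeff_mult lead_coeff_smult lead_coeff_power by simp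
    moreover have "lead_coeff (A * B) = - 4 * q' ^ 3" 
      unfolding AB Qc lead_coeff_smult lead_coeff_power lead_coeff_mult by simp
    ultimately show ?thesis by simp
  qed
  then have \<alpha>0: "\<alpha> \<noteq> 0" using q'0 four by auto
  \<comment> \<open>a is a cube root of \<alpha>/(2i) and b is fixed by q' = - 3ab; the value of b^3
    then follows from \<alpha> \<beta> = - 4 q'^3.\<close>
  obtain a where a: "a ^ 3 = \<alpha> / (2 * i)"
    using alg_closed_imp_poly_has_root[of "[:- (\<alpha> / (2 * i)), 0, 0, 1:]"]
    by (auto simp: power3_eq_cube mult.assoc)
  have a0: "a \<noteq> 0" using a \<alpha>0 i0 n27 by auto
  define b where "b = - q' / (3 * a)"
  have qab: "q' = - 3 * a * b" using a0 n27 by (simp add: b_def)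
  have b3: "b ^ 3 = - \<beta> / (2 * i)"
  proof -
    have "27 * (a ^ 3 * b ^ 3) = - (q' ^ 3)" unfolding qab by (simp add: power3_eq_cube algebra_simps)
    then have "27 * (\<alpha> * b ^ 3) = - (q' ^ 3) * (2 * i)" unfolding a using i0 n27 by (simp add: field_simps)
    then have "4 * (27 * (\<alpha> * b ^ 3)) = (\<alpha> * \<beta>) * (2 * i)" unfolding ab by simp
    then have "\<alpha> * (4 * 27 * b ^ 3) = \<alpha> * (\<beta> * (2 * i))" by (simp add: mult_ac)
    then have "4 * 27 * b ^ 3 = \<beta> * (2 * i)" using \<alpha>0 mult_left_cancel by blast
    then have "(2 * i) * (4 * 27 * b ^ 3) = \<beta> * (4 * i\<^sup>2)" by (simp add: power2_eq_square mult_ac)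
    then have "(4 * 27) * (2 * i * b ^ 3) = (4 * 27) * (- \<beta>)" unfolding i by (simp add: mult_ac)
    moreover have "(4 * 27 :: 'a alg_closure) \<noteq> 0" using four n27 by (simp only: neg_equal_0_iff_equal mult_eq_0_iff simp_thms)
    ultimately have "2 * i * b ^ 3 = - \<beta>" using mult_left_cancel by blast
    then show ?thesis using i0 n27 by (simp add: field_simps)
  qed
  have Ec: "acp E = - smult (a ^ 3) ([:- r1, 1:] ^ 3) - smult (b ^ 3) ([:- r2, 1:] ^ 3)"
  proof -
    have "acp E = smult (inverse (2 * i)) (smult (2 * i) (acp E))" using i0 n27 by simp
    also have "\<dots> = - smult (a ^ 3) ([:- r1, 1:] ^ 3) - smult (b ^ 3) ([:- r2, 1:] ^ 3)"
      unfolding EAB f(2,3) a b3 by (simp add: smult_diff_right field_simps)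
    finally show ?thesis .
  qed
  define kk where "kk = to_ac k"
  have "cubic_norm q' (to_ac e) (3 * kk) (to_ac k1) (to_ac k2) = to_ac m * (4 * q' ^ 3 + 27 * (to_ac e)\<^sup>2)"
  proof (rule cardano_norm_identity[OF qab])
    have cQ: "coeff (acp Q) j = coeff (smult q' ([:- r1, 1:] * [:- r2, 1:])) j" for j using Qc by simp
    have cE: "coeff (acp E) j = coeff (- smult (a ^ 3) ([:- r1, 1:] ^ 3) - smult (b ^ 3) ([:- r2, 1:] ^ 3)) j" for j using Ec by simp
    show "to_ac e = - (a ^ 3 + b ^ 3)"
      using cE[of 3] by (simp add: E_def acp_pCons eval_nat_numeral algebra_simps)
    show "to_ac k1 = 3 * a * b * (r1 + r2)"
      using cQ[of 1] by (simp add: Q_def acp_pCons qab algebra_simps)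
    have "to_ac k2 - kk * q' = 3 * (a ^ 3 * r1 + b ^ 3 * r2)"
      using cE[of 2] by (simp add: E_def acp_pCons eval_nat_numeral algebra_simps kk_def q'_def)
    then show "to_ac k2 = kk * q' + 3 * (a ^ 3 * r1 + b ^ 3 * r2)" by (simp add: algebra_simps)
    have "to_ac l0 - 3 * kk\<^sup>2 = - 3 * a * b * r1 * r2"
      using cQ[of 0] by (simp add: Q_def acp_pCons qab algebra_simps kk_def)
    then show l0: "to_ac l0 = 3 * kk\<^sup>2 - 3 * a * b * r1 * r2" by (simp add: algebra_simps)
    have "to_ac m - kk * to_ac l0 + 2 * kk ^ 3 = a ^ 3 * r1 ^ 3 + b ^ 3 * r2 ^ 3"
      using cE[of 0] by (simp add: E_def acp_pCons eval_nat_numeral algebra_simps kk_def)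
    then show "to_ac m = kk * to_ac l0 - 2 * kk ^ 3 + a ^ 3 * r1 ^ 3 + b ^ 3 * r2 ^ 3" by (simp add: algebra_simps)
  qed
  then have "to_ac (cubic_norm q e k0 k1 k2) = to_ac (m * (4 * q ^ 3 + 27 * e\<^sup>2))"
    unfolding k0 by (simp add: cubic_norm_def q'_def kk_def)
  then show ?thesis by (simp only: to_ac_eq_iff)
qed

lemma coeff_mult_bound:
  assumes "degree p \<le> a" "degree q \<le> b"
  shows "coeff (p * q) (a + b) = coeff p a * coeff q b"
proof -
  have "coeff (p * q) (a + b) = (\<Sum>i\<le>a + b. coeff p i * coeff q (a + b - i))" by (simp add: coeff_mult)
  also have "\<dots> = (\<Sum>i\<in>{a}. coeff p i * coeff q (a + b - i))"
  proof (rule sum.mono_neutral_right)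
    show "\<forall>i\<in>{..a + b} - {a}. coeff p i * coeff q (a + b - i) = 0"
    proof
      fix i assume i: "i \<in> {..a + b} - {a}"
      show "coeff p i * coeff q (a + b - i) = 0"
      proof (cases "i < a")
        case True
        then have "coeff q (a + b - i) = 0" using assms by (intro coeff_eq_0) linarith
        then show ?thesis by simp
      next
        case False
        then have "coeff p i = 0" using assms i by (intro coeff_eq_0) auto
        then show ?thesis by simp
      qed
    qed
  qed auto
  finally show ?thesis by simp
qed

text \<open>The norm is a cubic form in its last three arguments with constant coefficients, so the
  top coefficient of the norm is the norm of the top coefficients.\<close>

lemma coeff_cubic_norm_bound:
  fixes A B C :: "'a :: comm_ring_1 poly"
  assumes d: "degree A \<le> d" "degree B \<le> d" "degree C \<le> d"
  shows "degree (cubic_norm [:q:] [:e:] A B C) \<le> 3 * d"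
    and "coeff (cubic_norm [:q:] [:e:] A B C) (3 * d) = cubic_norm q e (coeff A d) (coeff B d) (coeff C d)"
proof -
  have deg3: "degree (x * y * z) \<le> 3 * d" if "degree x \<le> d" "degree y \<le> d" "degree z \<le> d" for x y z :: "'a poly"
    using degree_mult_le[of "x * y" z] degree_mult_le[of x y] that by linarith
  have coef3: "coeff (x * y * z) (3 * d) = coeff x d * coeff y d * coeff z d"
    if "degree x \<le> d" "degree y \<le> d" "degree z \<le> d" for x y z :: "'a poly"
  proof -
    have "degree (x * y) \<le> d + d" using degree_mult_le[of x y] that by linarith
    then have "coeff (x * y * z) ((d + d) + d) = coeff (x * y) (d + d) * coeff z d" using that by (intro coeff_mult_bound)
    also have "coeff (x * y) (d + d) = coeff x d * coeff y d" using that by (intro coeff_mult_bound)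
    finally have c3: "coeff (x * y * z) (d + d + d) = coeff x d * coeff y d * coeff z d" .
    have "3 * d = d + d + d" by simp
    then show ?thesis using c3 by metis
  qed
  have eq: "cubic_norm [:q:] [:e:] A B C = smult (e\<^sup>2) (A * A * A) - smult (e * q) (A * A * B) + smult (q\<^sup>2) (A * A * C)
     + smult (3 * e) (A * B * C) - smult (2 * q) (A * C * C) - smult e (B * B * B) + smult q (B * B * C) + C * C * C"
  proof -
    have n: "(3 :: 'a poly) = [:3:]" "(2 :: 'a poly) = [:2:]" by (simp_all add: numeral_poly)
    show ?thesis unfolding cubic_norm_def n by (simp add: power2_eq_square power3_eq_cube mult_ac)
  qed
  show "degree (cubic_norm [:q:] [:e:] A B C) \<le> 3 * d"
    unfolding eq using d by (intro degree_add_le degree_diff_le order_trans[OF degree_smult_le] deg3)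
  show "coeff (cubic_norm [:q:] [:e:] A B C) (3 * d) = cubic_norm q e (coeff A d) (coeff B d) (coeff C d)"
    unfolding eq coeff_add coeff_diff coeff_smult coef3[OF d(1) d(1) d(1)] coef3[OF d(1) d(1) d(2)] coef3[OF d(1) d(1) d(3)]
      coef3[OF d] coef3[OF d(1) d(3) d(3)] coef3[OF d(2) d(2) d(2)] coef3[OF d(2) d(2) d(3)] coef3[OF d(3) d(3) d(3)]
    by (simp add: cubic_norm_def power2_eq_square power3_eq_cube mult_ac)
qed

lemma degree_mult3_le: "degree x \<le> a \<Longrightarrow> degree y \<le> b \<Longrightarrow> degree z \<le> c \<Longrightarrow> degree (x * y * z) \<le> a + b + c"
  using degree_mult_le[of "x * y" z] degree_mult_le[of x y] by linarith

section \<open>Planes of zeros\<close>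

context quintic
begin

abbreviation f :: "'v \<Rightarrow> 'a" where "f v \<equiv> \<Phi> v v v v v"

definition zero_plane :: "'v \<Rightarrow> 'v \<Rightarrow> bool" where
  "zero_plane a b \<longleftrightarrow> (\<forall>x t. f (x *s a + t *s b) = 0)"

definition indep2 :: "'v \<Rightarrow> 'v \<Rightarrow> bool" where
  "indep2 a b \<longleftrightarrow> (\<forall>x t. x *s a + t *s b = 0 \<longrightarrow> x = 0 \<and> t = 0)"

lemma swap23: "\<Phi> u v w y z = \<Phi> y z u v w"
proof -
  have "\<Phi> u v w y z = \<Phi> y u v w z" by (metis sym1 sym2 sym3)
  also have "\<dots> = \<Phi> y z u v w" by (metis sym2 sym3 sym4)
  finally show ?thesis .
qed

lemma zero_plane_span:
  assumes "zero_plane a b"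
  shows "zero_plane (x *s a + t *s b) (x' *s a + t' *s b)"
  unfolding zero_plane_def
proof (intro allI)
  fix r s
  have "r *s (x *s a + t *s b) + s *s (x' *s a + t' *s b) = (r * x + s * x') *s a + (r * t + s * t') *s b"
    by (simp add: scale_right_distrib scale_left_distrib algebra_simps)
  then show "f (r *s (x *s a + t *s b) + s *s (x' *s a + t' *s b)) = 0"
    using assms unfolding zero_plane_def by simp
qed

lemma zero_planeD:
  assumes "zero_plane a b"
  shows "f a = 0" "f b = 0" "\<Phi> a a a a y = 0" "\<Phi> a a a b y = 0" "\<Phi> a a b b y = 0" "\<Phi> a b b b y = 0" "\<Phi> b b b b y = 0"
proof -
  have z: "f (x *s a + t *s b) = 0" for x t using assms unfolding zero_plane_def by blast
  show "f a = 0" "f b = 0" using z[of 1 0] z[of 0 1] by simp_all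
  have "\<Phi> a a a a y * t ^ 4 + (4 * \<Phi> a a a b y) * t ^ 3 + (6 * \<Phi> a a b b y) * t\<^sup>2 + (4 * \<Phi> a b b b y) * t + \<Phi> b b b b y = 0" for t
    using singular[OF z[of t 1], of y] unfolding scale_one expand4_1 by (simp add: mult_ac)
  then have "\<Phi> b b b b y = 0 \<and> 4 * \<Phi> a b b b y = 0 \<and> 6 * \<Phi> a a b b y = 0 \<and> 4 * \<Phi> a a a b y = 0 \<and> \<Phi> a a a a y = 0"
    by (rule quartic_eq_0)
  then show "\<Phi> a a a a y = 0" "\<Phi> a a a b y = 0" "\<Phi> a a b b y = 0" "\<Phi> a b b b y = 0" "\<Phi> b b b b y = 0" by simp_all
qed

text \<open>For fixed y, u -> \<open>\<Phi> u u u y y\<close> is a binary cubic form on the plane.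
  Here a zero of it is shown to be double; the next two lemmas make it triple and then the form
  identically 0. The reason is the last part of \<open>isotropic_line\<close> in the direction b,
  where \<open>\<Phi> a a b b b\<close> = 0.\<close>

lemma zero_plane_double:
  assumes ab: "zero_plane a b" and y: "\<Phi> a a a y y = 0"
  shows "\<Phi> a a b y y = 0"
proof (rule ccontr)
  assume M: "\<Phi> a a b y y \<noteq> 0"
  note d = zero_planeD[OF ab]
  have s: "\<Phi> a a b b b = 0" "\<Phi> a a b b y = 0" "\<Phi> a a a b y = 0" "\<Phi> a a a y b = 0" "\<Phi> a a a b b = 0" using d sym4 by metis+
  have C: "\<Phi> a a (l *s b + y) (l *s b + y) (l *s b + y) = 3 * l * \<Phi> a a b y y + \<Phi> a a y y y" for l
    unfolding expand3 s by simp
  \<comment> \<open>\<open>isotropic_line\<close> needs a nonzero leading coefficient; adding a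
    multiple of b to y provides it.\<close>
  obtain l where l: "\<Phi> a a (l *s b + y) (l *s b + y) (l *s b + y) \<noteq> 0"
  proof (cases "\<Phi> a a y y y = 0")
    case True
    then show ?thesis using that[of 1] M unfolding C by simp
  next
    case False
    then show ?thesis using that[of 0] unfolding C by simp
  qed
  define y' where "y' = l *s b + y"
  have q: "\<Phi> a a a y' y' = 0" "\<Phi> a a a y' b = 0"
    unfolding y'_def expand2 using y s by (simp_all add: multilinear)
  have "\<Phi> a a y' y' b = 0 \<and> \<Phi> a a y' b b = 0"
    using isotropic_line[OF d(1) q s(5) l[folded y'_def]] s(1) by metis
  then have "\<Phi> a a b y' y' = 0" by (metis sym3 sym4)
  then show False unfolding y'_def expand2 using M s by simp
qed

text \<open>A double zero at a leaves the binary cubic one further rational zero, u = m a - 3n b. It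
  would be double as well, and a binary cubic cannot have two different double zeros.\<close>

lemma zero_plane_triple:
  assumes ab: "zero_plane a b" and y: "\<Phi> a a a y y = 0"
  shows "\<Phi> a a b y y = 0" "\<Phi> a b b y y = 0"
proof -
  show 1: "\<Phi> a a b y y = 0" by (rule zero_plane_double[OF ab y])
  show "\<Phi> a b b y y = 0"
  proof (rule ccontr)
    assume n2: "\<Phi> a b b y y \<noteq> 0"
    define n where "n = \<Phi> a b b y y"
    define m where "m = \<Phi> b b b y y"
    define r where "r = - 3 * n"
    define u where "u = m *s a + r *s b"
    have s: "\<Phi> b a a y y = 0" "\<Phi> b b a y y = n" "\<Phi> b a b y y = n" "\<Phi> a b a y y = 0" "\<Phi> a b b y y = n" "\<Phi> b b b y y = m" "\<Phi> a a b y y = 0" "\<Phi> a a a y y = 0"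
      using 1 y unfolding n_def m_def by (metis sym1 sym2)+
    have "\<Phi> u u u y y = 3 * m * r * r * n + r * r * r * m" unfolding u_def by (simp add: multilinear s algebra_simps)
    then have "\<Phi> u u u y y = 0" unfolding r_def by simp
    moreover have "zero_plane u a" using zero_plane_span[OF ab, of m r 1 0] unfolding u_def by simp
    ultimately have "\<Phi> u u a y y = 0" by (rule zero_plane_double[rotated])
    moreover have "\<Phi> u u a y y = r * r * n" unfolding u_def by (simp add: multilinear s algebra_simps)
    ultimately show False using n2 unfolding n_def r_def by simp
  qed
qed

text \<open>Suppose k \<noteq> 0 and \<open>\<Phi> a a a z z\<close> \<noteq> 0. For v = w y + z and
  u = x a + b, \<open>\<Phi> u u u v v\<close> is quadratic in w with leading coefficient k. Each
  zero is triple in u, so the binary cubic of v is lam times a cube; this forces lam x = - g1 and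
  the quartic condition R(w) = 0. Hence the discriminant \<delta> in w is a nonzero square for at
  most four x and equals nonsq times a square. Comparing coefficients contradicts
  \<open>\<Phi> a a a z z\<close> \<noteq> 0.\<close>

lemma zero_plane_vanish:
  assumes ab: "zero_plane a b" and a0: "a \<noteq> 0" and y: "\<Phi> a a a y y = 0"
  shows "\<Phi> b b b y y = 0"
proof (rule ccontr)
  define k where "k = \<Phi> b b b y y"
  assume "\<Phi> b b b y y \<noteq> 0"
  then have k0: "k \<noteq> 0" by (simp add: k_def)
  note n12 = zero_plane_triple[OF ab y]
  have "\<Phi> a a a z z = 0" for z
  proof (rule ccontr)
    assume z3: "\<Phi> a a a z z \<noteq> 0"
    define m0 m1 m2 m3 where "m0 = \<Phi> b b b y z" and "m1 = 3 * \<Phi> a b b y z" and "m2 = 3 * \<Phi> a a b y z" and "m3 = \<Phi> a a a y z"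
    define c0 c1 c2 c3 where "c0 = \<Phi> b b b z z" and "c1 = 3 * \<Phi> a b b z z" and "c2 = 3 * \<Phi> a a b z z" and "c3 = \<Phi> a a a z z"
    define \<delta> where "\<delta> = [:m0, m1, m2, m3:] * [:m0, m1, m2, m3:] - smult k [:c0, c1, c2, c3:]"
    define lam where "lam w = 2 * w * m3 + c3" for w
    define g1 where "g1 w = 2 * w * \<Phi> a a b y z + \<Phi> a a b z z" for w
    define g3 where "g3 w = k * w\<^sup>2 + 2 * w * m0 + c0" for w
    define R where "R = [:c3, 2 * m3:] * [:c3, 2 * m3:] * [:c0, 2 * m0, k:]
      - [:\<Phi> a a b z z, 2 * \<Phi> a a b y z:] * [:\<Phi> a a b z z, 2 * \<Phi> a a b y z:] * [:\<Phi> a a b z z, 2 * \<Phi> a a b y z:]"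
    have pR: "poly R w = (lam w)\<^sup>2 * g3 w - g1 w ^ 3" for w
      unfolding R_def lam_def g1_def g3_def by (simp add: power2_eq_square power3_eq_cube algebra_simps)
    have R0: "R \<noteq> 0"
    proof
      assume "R = 0"
      then have z: "coeff R 4 = 0" "coeff R 3 = 0" "coeff R 2 = 0" by simp_all
      have "4 * m3 * m3 * k = 0" using z(1) by (simp add: R_def eval_nat_numeral algebra_simps)
      then have m3: "m3 = 0" using k0 by simp
      have "8 * (\<Phi> a a b y z) ^ 3 = 0" using z(2) m3 by (simp add: R_def eval_nat_numeral algebra_simps)
      then have "\<Phi> a a b y z = 0" by simp
      then have "c3 * c3 * k = 0" using z(3) m3 by (simp add: R_def eval_nat_numeral algebra_simps)
      then show False using k0 z3 by (simp add: c3_def)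
    qed
    have dR: "degree R \<le> 4"
    proof -
      have l: "degree [:x, y:] \<le> 1" "degree [:x, y, z:] \<le> 2" for x y z :: 'a by (simp_all add: degree_pCons_eq_if)
      have "degree ([:c3, 2 * m3:] * [:c3, 2 * m3:] * [:c0, 2 * m0, k:]) \<le> 1 + 1 + 2"
        by (intro degree_mult3_le l)
      moreover have "degree ([:x, y:] * [:x, y:] * [:x, y:]) \<le> 1 + 1 + 1" for x y :: 'a by (intro degree_mult3_le l)
      then have "degree ([:x, y:] * [:x, y:] * [:x, y:]) \<le> 1 + 1 + 2" for x y :: 'a by (rule order_trans) simp
      ultimately have "degree R \<le> 1 + 1 + 2" unfolding R_def by (intro degree_diff_le)
      then show ?thesis by simp
    qed
    have key: "lam w * x = - g1 w \<and> poly R w = 0" if "k * w\<^sup>2 + 2 * w * (m0 + m1 * x + m2 * x\<^sup>2 + m3 * x ^ 3) + (c0 + c1 * x + c2 * x\<^sup>2 + c3 * x ^ 3) = 0" for w x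
    proof -
      define v where "v = w *s y + z"
      define u where "u = x *s a + b"
      have e: "\<Phi> a a a v v = lam w" "\<Phi> a a b v v = g1 w" "\<Phi> b b b v v = g3 w"
        "\<Phi> a b b v v = 2 * w * \<Phi> a b b y z + \<Phi> a b b z z"
        unfolding v_def expand2 lam_def g1_def g3_def using y n12
        by (simp_all add: m3_def c3_def k_def m0_def c0_def algebra_simps)
      have s: "\<Phi> b a a v v = \<Phi> a a b v v" "\<Phi> b b a v v = \<Phi> a b b v v" "\<Phi> b a b v v = \<Phi> a b b v v" "\<Phi> a b a v v = \<Phi> a a b v v"
        by (metis sym1 sym2)+
      have u3: "\<Phi> u u u v v = x ^ 3 * \<Phi> a a a v v + 3 * x\<^sup>2 * \<Phi> a a b v v + 3 * x * \<Phi> a b b v v + \<Phi> b b b v v"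
        unfolding u_def by (simp add: multilinear s power2_eq_square power3_eq_cube algebra_simps)
      have uz: "\<Phi> u u u v v = 0"
        unfolding u3 e lam_def g1_def g3_def using that
        by (simp add: m1_def m2_def c1_def c2_def algebra_simps)
      have "zero_plane u a" using zero_plane_span[OF ab, of x 1 1 0] unfolding u_def by simp
      note t = zero_plane_triple[OF this uz]
      have t1: "x * \<Phi> a a a v v + \<Phi> a a b v v = 0" using t(2) unfolding u_def by (simp add: multilinear s algebra_simps)
      have t2: "x\<^sup>2 * \<Phi> a a a v v + 2 * x * \<Phi> a a b v v + \<Phi> a b b v v = 0"
        using t(1) unfolding u_def by (simp add: multilinear s power2_eq_square algebra_simps)
      have A: "\<Phi> a a b v v = - (x * \<Phi> a a a v v)" using t1 by (simp only: add_eq_0_iff)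
      have "\<Phi> a b b v v = - (x\<^sup>2 * \<Phi> a a a v v + 2 * x * \<Phi> a a b v v)" using t2 by (simp only: add_eq_0_iff)
      then have B: "\<Phi> a b b v v = x\<^sup>2 * \<Phi> a a a v v" unfolding A by (simp add: power2_eq_square algebra_simps)
      have "\<Phi> b b b v v = - (x ^ 3 * \<Phi> a a a v v + 3 * x\<^sup>2 * \<Phi> a a b v v + 3 * x * \<Phi> a b b v v)"
        using uz unfolding u3 by (simp only: add_eq_0_iff)
      then have C: "\<Phi> b b b v v = - (x ^ 3 * \<Phi> a a a v v)" unfolding A B by (simp add: power2_eq_square power3_eq_cube algebra_simps)
      have "lam w * x = - g1 w" using A unfolding e by (simp add: mult.commute)
      moreover have "poly R w = 0" unfolding pR e[symmetric] A C by (simp add: power2_eq_square power3_eq_cube algebra_simps)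
      ultimately show ?thesis by blast
    qed
    have "card {x. \<exists>s. s \<noteq> 0 \<and> poly \<delta> x = s\<^sup>2} \<le> 4"
    proof -
      have "{x. \<exists>s. s \<noteq> 0 \<and> poly \<delta> x = s\<^sup>2} \<subseteq> (\<lambda>w. - g1 w / lam w) ` {w. poly R w = 0}"
      proof
        fix x assume "x \<in> {x. \<exists>s. s \<noteq> 0 \<and> poly \<delta> x = s\<^sup>2}"
        then obtain s where s: "s \<noteq> 0" "poly \<delta> x = s\<^sup>2" by blast
        define mx cx where "mx = m0 + m1 * x + m2 * x\<^sup>2 + m3 * x ^ 3" and "cx = c0 + c1 * x + c2 * x\<^sup>2 + c3 * x ^ 3"
        have s2: "s\<^sup>2 = mx\<^sup>2 - k * cx" using s(2) unfolding \<delta>_def mx_def cx_def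
          by (simp add: power2_eq_square power3_eq_cube algebra_simps)
        have root: "k * ((e - mx) / k)\<^sup>2 + 2 * ((e - mx) / k) * mx + cx = 0" if "e\<^sup>2 = s\<^sup>2" for e
        proof -
          have "k * (k * ((e - mx) / k)\<^sup>2 + 2 * ((e - mx) / k) * mx + cx) = e\<^sup>2 - (mx\<^sup>2 - k * cx)"
            using k0 by (simp add: field_simps power2_eq_square)
          then show ?thesis using that s2 k0 by simp
        qed
        define w1 w2 where "w1 = (s - mx) / k" and "w2 = (- s - mx) / k"
        have K: "lam w1 * x = - g1 w1 \<and> poly R w1 = 0" "lam w2 * x = - g1 w2 \<and> poly R w2 = 0"
          using key[of w1 x] key[of w2 x] root[of s] root[of "- s"] unfolding mx_def[symmetric] cx_def[symmetric] w1_def w2_def by simp_all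
        have "w1 - w2 = 2 * s / k" unfolding w1_def w2_def by (simp add: diff_divide_distrib)
        then have ne: "w1 - w2 \<noteq> 0" using s(1) k0 two_neq_0[where ?'a='a] by simp
        \<comment> \<open>lam is a polynomial of degree at most 1 in w, not identically 0 because
          lam(0) = c3, so it vanishes at no more than one of the two roots.\<close>
        have "lam w1 \<noteq> 0 \<or> lam w2 \<noteq> 0"
        proof (rule ccontr)
          assume "\<not> ?thesis"
          then have l: "lam w1 = 0" "lam w2 = 0" by simp_all
          have "2 * m3 * (w1 - w2) = lam w1 - lam w2" unfolding lam_def by (simp add: algebra_simps)
          then have "m3 = 0" using l ne two_neq_0[where ?'a='a] by simp
          then show False using l(1) z3 by (simp add: lam_def c3_def)
        qed
        then obtain w where w: "lam w \<noteq> 0" "lam w * x = - g1 w" "poly R w = 0" using K by blast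
        then have "x = - g1 w / lam w" by (simp add: field_simps)
        then show "x \<in> (\<lambda>w. - g1 w / lam w) ` {w. poly R w = 0}" using w(3) by blast
      qed
      then have "card {x. \<exists>s. s \<noteq> 0 \<and> poly \<delta> x = s\<^sup>2} \<le> card ((\<lambda>w. - g1 w / lam w) ` {w. poly R w = 0})"
        by (intro card_mono) auto
      also have "\<dots> \<le> card {w. poly R w = 0}" by (rule card_image_le) auto
      also have "\<dots> \<le> 4" using card_poly_roots_bound[OF R0] dR by linarith
      finally show ?thesis .
    qed
    moreover have d6: "degree \<delta> \<le> 6" unfolding \<delta>_def
      by (intro degree_diff_le order_trans[OF degree_mult_le] order_trans[OF degree_smult_le]) (auto simp: degree_pCons_eq_if)
    ultimately obtain h where h: "\<delta> = smult nonsq (h\<^sup>2)" using mostly_nonsquare_values[of \<delta>] by auto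
    have "degree h \<le> 3"
    proof (cases "h = 0")
      case False
      then show ?thesis using d6 unfolding h by (simp add: degree_power_eq)
    qed simp
    then obtain h0 h1 h2 h3 where hh: "h = [:h0, h1, h2, h3:]"
      by (intro that[of "coeff h 0" "coeff h 1" "coeff h 2" "coeff h 3"] poly_eqI)
         (auto simp: coeff_pCons coeff_eq_0 eval_nat_numeral split: nat.splits)
    have co: "coeff ([:m0, m1, m2, m3:] * [:m0, m1, m2, m3:] - smult k [:c0, c1, c2, c3:]) j = coeff (smult nonsq ([:h0, h1, h2, h3:] * [:h0, h1, h2, h3:])) j" for j
      using h unfolding \<delta>_def hh by (simp only: power2_eq_square)
    \<comment> \<open>From the top down: in degrees 6 and 4 a square equals nonsq times a square, so
      both vanish, and degree 3 is then left with k c3 = 0.\<close>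
    have "m3\<^sup>2 = nonsq * h3\<^sup>2" using co[of 6] by (simp add: eval_nat_numeral)
    then have 3: "m3 = 0" "h3 = 0" using nonsq_norm_eq_0 by blast+
    have "m2\<^sup>2 = nonsq * h2\<^sup>2" using co[of 4] 3 by (simp add: eval_nat_numeral)
    then have 2: "m2 = 0" "h2 = 0" using nonsq_norm_eq_0 by blast+
    have "k * c3 = 0" using co[of 3] 3 2 by (simp add: eval_nat_numeral)
    then show False using k0 z3 by (simp add: c3_def)
  qed
  then show False using not_isotropic[OF zero_planeD(1)[OF ab] a0] by blast
qed

end

context quintic
begin

lemma indep2_span:
  assumes ab: "indep2 a b" and d: "x * t' - x' * t \<noteq> 0"
  shows "indep2 (x *s a + t *s b) (x' *s a + t' *s b)"
  unfolding indep2_def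
proof (intro allI impI)
  fix r s assume "r *s (x *s a + t *s b) + s *s (x' *s a + t' *s b) = 0"
  then have "(r * x + s * x') *s a + (r * t + s * t') *s b = 0"
    by (simp add: scale_right_distrib scale_left_distrib algebra_simps)
  then have *: "r * x + s * x' = 0" "r * t + s * t' = 0" using ab unfolding indep2_def by blast+
  have "r * (x * t' - x' * t) = t' * (r * x + s * x') - x' * (r * t + s * t')" by (simp add: algebra_simps)
  then have r: "r = 0" unfolding * using d by simp
  have "s * (x * t' - x' * t) = x * (r * t + s * t') - t * (r * x + s * x')" by (simp add: algebra_simps)
  then have "s = 0" unfolding * using d by simp
  then show "r = 0 \<and> s = 0" using r by simp
qed

lemma indep2_nz: "indep2 a b \<Longrightarrow> a \<noteq> 0" "indep2 a b \<Longrightarrow> b \<noteq> 0"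
proof -
  assume ab: "indep2 a b"
  have "1 *s a + 0 *s b = 0 \<longrightarrow> (1 :: 'a) = 0" "0 *s a + 1 *s b = 0 \<longrightarrow> (1 :: 'a) = 0"
    using ab unfolding indep2_def by blast+
  then show "a \<noteq> 0" "b \<noteq> 0" by auto
qed

lemma zero_plane_aniso:
  assumes ab: "zero_plane a b" "indep2 a b" and z: "\<Phi> a a a z z \<noteq> 0" and u: "u = x *s a + t *s b" "u \<noteq> 0"
  shows "\<Phi> u u u z z \<noteq> 0"
proof
  assume "\<Phi> u u u z z = 0"
  moreover have "zero_plane u a" using zero_plane_span[OF ab(1), of x t 1 0] u(1) by simp
  ultimately have "\<Phi> a a a z z = 0" using zero_plane_vanish u(2) by blast
  then show False using z by blast
qed

text \<open>A shear removes the coefficient of x^2 t from the binary cubic of z. If the coefficient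
  of x t^2 vanishes too, the cubic is n0 x^3 + n3 t^3, and the basis a + b1, b1 followed by another
  shear makes it nonzero. This is the hypothesis q \<noteq> 0 of
  \<open>plane_cubic_norm\<close>.\<close>

lemma adapted_basis:
  assumes ab: "zero_plane a b" "indep2 a b" and z: "\<Phi> a a a z z \<noteq> 0" and y: "\<Phi> a a a y y = 0"
  obtains a' b' where "zero_plane a' b'" "indep2 a' b'" "\<Phi> a' a' a' z z \<noteq> 0" "\<Phi> a' a' b' z z = 0"
    "\<Phi> a' b' b' z z \<noteq> 0" "\<Phi> a' a' a' y y = 0"
proof -
  have shear: "\<exists>b'. b' = - (\<Phi> a a b z z / \<Phi> a a a z z) *s a + b \<and> zero_plane a b' \<and> indep2 a b' \<and> \<Phi> a a b' z z = 0 \<and>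
      \<Phi> a b' b' z z = \<Phi> a b b z z - (\<Phi> a a b z z)\<^sup>2 / \<Phi> a a a z z"
    if "zero_plane a b" "indep2 a b" "\<Phi> a a a z z \<noteq> 0" for a b
  proof (intro exI conjI)
    define c where "c = - (\<Phi> a a b z z / \<Phi> a a a z z)"
    let ?b = "c *s a + b"
    show "?b = - (\<Phi> a a b z z / \<Phi> a a a z z) *s a + b" by (simp add: c_def)
    show "zero_plane a ?b" using zero_plane_span[OF that(1), of 1 0 c 1] by simp
    show "indep2 a ?b" using indep2_span[OF that(2), of 1 1 c 0] by simp
    have s: "\<Phi> a b a z z = \<Phi> a a b z z" by (metis sym2)
    show "\<Phi> a a ?b z z = 0" using that(3) by (simp add: multilinear c_def del: scale_minus_left)
    have "\<Phi> a ?b ?b z z = c * c * \<Phi> a a a z z + 2 * c * \<Phi> a a b z z + \<Phi> a b b z z"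
      by (simp add: multilinear s algebra_simps)
    also have "\<dots> = \<Phi> a b b z z - (\<Phi> a a b z z)\<^sup>2 / \<Phi> a a a z z"
      unfolding c_def using that(3) by (simp add: field_simps power2_eq_square)
    finally show "\<Phi> a ?b ?b z z = \<Phi> a b b z z - (\<Phi> a a b z z)\<^sup>2 / \<Phi> a a a z z" .
  qed
  obtain b1 where b1: "zero_plane a b1" "indep2 a b1" "\<Phi> a a b1 z z = 0" using shear[OF ab z] by blast
  show ?thesis
  proof (cases "\<Phi> a b1 b1 z z = 0")
    case False
    then show ?thesis using that[of a b1] b1 z y by blast
  next
    case True
    define n3 where "n3 = \<Phi> b1 b1 b1 z z"
    have n3: "n3 \<noteq> 0" unfolding n3_def
      using zero_plane_aniso[OF b1(1,2) z, of b1 0 1] indep2_nz(2)[OF b1(2)] by simp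
    define a2 where "a2 = 1 *s a + 1 *s b1"
    have s: "\<Phi> b1 a a z z = 0" "\<Phi> a b1 a z z = 0" "\<Phi> b1 b1 a z z = 0" "\<Phi> b1 a b1 z z = 0"
      using b1(3) True by (metis sym1 sym2)+
    have 1: "zero_plane a2 b1" using zero_plane_span[OF b1(1), of 1 1 0 1] unfolding a2_def by simp
    have 2: "indep2 a2 b1" using indep2_span[OF b1(2), of 1 1 0 1] unfolding a2_def by simp
    have v: "\<Phi> a2 a2 a2 z z = \<Phi> a a a z z + n3" "\<Phi> a2 a2 b1 z z = n3" "\<Phi> a2 b1 b1 z z = n3"
      unfolding a2_def by (simp_all add: multilinear s b1(3) True n3_def)
    have a20: "\<Phi> a2 a2 a2 z z \<noteq> 0" using zero_plane_aniso[OF b1(1,2) z a2_def] indep2_nz(1)[OF 2] by blast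
    obtain b2 where b2: "zero_plane a2 b2" "indep2 a2 b2" "\<Phi> a2 a2 b2 z z = 0"
      "\<Phi> a2 b2 b2 z z = \<Phi> a2 b1 b1 z z - (\<Phi> a2 a2 b1 z z)\<^sup>2 / \<Phi> a2 a2 a2 z z" using shear[OF 1 2 a20] by blast
    have "\<Phi> a2 b2 b2 z z * (\<Phi> a a a z z + n3) = n3 * \<Phi> a a a z z"
      using a20 unfolding b2(4) v by (simp add: field_simps power2_eq_square)
    then have "\<Phi> a2 b2 b2 z z \<noteq> 0" using n3 z by auto
    moreover have "\<Phi> a2 a2 a2 y y = 0"
    proof (rule zero_plane_vanish[of a])
      show "zero_plane a a2" using zero_plane_span[OF b1(1), of 1 0 1 1] unfolding a2_def by simp
    qed (use indep2_nz(1)[OF ab(2)] y in auto)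
    ultimately show ?thesis using that[of a2 b2] b2 a20 by blast
  qed
qed

text \<open>For v = w y + z, the form at x a + t b + v is, up to the factor 10 c(w), an affine cubic
  in x and t whose leading form does not depend on w. \<open>plane_cubic_norm\<close> gives an
  identity of polynomials in w: a norm, of degree divisible by 3, against the form at v times
  c(w)^2, of degree 5 or 7 if the form is nonzero at y.\<close>

lemma zero_plane_step:
  assumes ab0: "zero_plane a0 b0" "indep2 a0 b0" and y0: "\<Phi> a0 a0 a0 y y = 0"
  shows "f y = 0"
proof (rule ccontr)
  assume fy: "f y \<noteq> 0"
  obtain z where z0: "\<Phi> a0 a0 a0 z z \<noteq> 0"
    using not_isotropic[OF zero_planeD(1)[OF ab0(1)] indep2_nz(1)[OF ab0(2)]] by blast
  obtain a b where ab: "zero_plane a b" "indep2 a b" and z: "\<Phi> a a a z z \<noteq> 0" and n1: "\<Phi> a a b z z = 0"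
    and n2': "\<Phi> a b b z z \<noteq> 0" and y: "\<Phi> a a a y y = 0" using adapted_basis[OF ab0 z0 y0] by blast
  note d = zero_planeD[OF ab(1)]
  have ab_nz: "a \<noteq> 0" using indep2_nz[OF ab(2)] by blast
  define n0 n2 n3 where "n0 = \<Phi> a a a z z" and "n2 = \<Phi> a b b z z" and "n3 = \<Phi> b b b z z"
  have n0: "n0 \<noteq> 0" and n2: "n2 \<noteq> 0" using z n2' by (simp_all add: n0_def n2_def)
  define q e where "q = 3 * n2 / n0" and "e = n3 / n0"
  have q0: "q \<noteq> 0" using n0 n2 by (simp add: q_def)
  have qn: "n0 * q = 3 * n2" "n0 * e = n3" using n0 by (simp_all add: q_def e_def)
  have s: "\<Phi> b a a v w = \<Phi> a a b v w" "\<Phi> b b a v w = \<Phi> a b b v w" "\<Phi> b a b v w = \<Phi> a b b v w" "\<Phi> a b a v w = \<Phi> a a b v w" for v w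
    by (metis sym1 sym2)+
  have u3: "\<Phi> (x *s a + b) (x *s a + b) (x *s a + b) v w =
      x ^ 3 * \<Phi> a a a v w + 3 * x\<^sup>2 * \<Phi> a a b v w + 3 * x * \<Phi> a b b v w + \<Phi> b b b v w" for x v w
    by (simp add: multilinear s power2_eq_square power3_eq_cube algebra_simps)
  have no: "x ^ 3 + q * x + e \<noteq> 0" for x
  proof -
    have u0: "x *s a + b \<noteq> 0"
    proof
      assume "x *s a + b = 0"
      then have "x *s a + 1 *s b = 0" by simp
      then show False using ab(2) unfolding indep2_def by (metis one_neq_zero)
    qed
    have "\<Phi> (x *s a + b) (x *s a + b) (x *s a + b) z z \<noteq> 0"
      using zero_plane_aniso[OF ab z _ u0, of x 1] by simp
    then have nz: "x ^ 3 * n0 + 3 * x * n2 + n3 \<noteq> 0" unfolding u3 n1 by (simp add: n0_def n2_def n3_def)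
    have "n0 * (x ^ 3 + q * x + e) = x ^ 3 * n0 + (n0 * q) * x + n0 * e" by (simp add: algebra_simps)
    also have "\<dots> = x ^ 3 * n0 + 3 * x * n2 + n3" unfolding qn by (simp add: algebra_simps)
    finally show ?thesis using nz by auto
  qed
  define j where "j = \<Phi> a a a y z"
  have span: "zero_plane a (x *s a + b)" "zero_plane (x *s a + b) a" for x
    using zero_plane_span[OF ab(1), of 1 0 x 1] zero_plane_span[OF ab(1), of x 1 1 0] by simp_all
  \<comment> \<open>The values at u and at a are both affine linear in w, and by
    \<open>zero_plane_vanish\<close> they vanish for the same w, so they are proportional.\<close>
  have proportional: "n0 * \<Phi> u u u y z = j * \<Phi> u u u z z" if u: "u = x *s a + b" for u x
  proof -
    have uy: "\<Phi> u u u y y = 0" using zero_plane_vanish[OF span(1)[of x] ab_nz y] u by simp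
    have e2: "\<Phi> u u u (w *s y + z) (w *s y + z) = 2 * w * \<Phi> u u u y z + \<Phi> u u u z z" for w
      unfolding expand2 uy by simp
    have a2: "\<Phi> a a a (w *s y + z) (w *s y + z) = 2 * w * j + n0" for w
      unfolding expand2 y by (simp add: j_def n0_def)
    show ?thesis
    proof (cases "j = 0")
      case False
      define w where "w = - n0 / (2 * j)"
      have w: "2 * w * j = - n0" using False two_neq_0[where ?'a='a] by (simp add: w_def)
      have "\<Phi> a a a (w *s y + z) (w *s y + z) = 0" unfolding a2 w by simp
      then have "\<Phi> u u u (w *s y + z) (w *s y + z) = 0" using zero_plane_vanish[OF span(1)[of x] ab_nz] u by simp
      then have "j * (2 * w * \<Phi> u u u y z + \<Phi> u u u z z) = 0" unfolding e2 by simp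
      moreover have "j * (2 * w * \<Phi> u u u y z + \<Phi> u u u z z) = (2 * w * j) * \<Phi> u u u y z + j * \<Phi> u u u z z" by (simp add: algebra_simps)
      ultimately show ?thesis unfolding w by simp
    next
      case True
      have "\<Phi> u u u y z = 0"
      proof (rule ccontr)
        assume nz: "\<Phi> u u u y z \<noteq> 0"
        then have "u \<noteq> 0" by auto
        define w where "w = - \<Phi> u u u z z / (2 * \<Phi> u u u y z)"
        have "\<Phi> u u u (w *s y + z) (w *s y + z) = 0" unfolding e2 w_def using nz two_neq_0[where ?'a='a] by simp
        then have "\<Phi> a a a (w *s y + z) (w *s y + z) = 0"
          using zero_plane_vanish[OF span(2)[of x]] u \<open>u \<noteq> 0\<close> by simp
        then show False unfolding a2 using True n0 by simp
      qed
      then show ?thesis using True by simp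
    qed
  qed
  have "(n0 * \<Phi> a a a y z - j * n0) * x ^ 3 + (3 * n0 * \<Phi> a a b y z) * x\<^sup>2 + (3 * (n0 * \<Phi> a b b y z - j * n2)) * x + (n0 * \<Phi> b b b y z - j * n3) = 0" for x
    using proportional[OF refl, of x] unfolding u3 n1 by (simp add: n0_def n2_def n3_def algebra_simps)
  then have "n0 * \<Phi> b b b y z - j * n3 = 0 \<and> 3 * (n0 * \<Phi> a b b y z - j * n2) = 0 \<and> 3 * n0 * \<Phi> a a b y z = 0 \<and> n0 * \<Phi> a a a y z - j * n0 = 0"
    by (rule cubic_eq_0)
  then have j: "n0 * \<Phi> b b b y z = j * n3" "n0 * \<Phi> a b b y z = j * n2" "\<Phi> a a b y z = 0" using n0 by simp_all
  have yt: "\<Phi> a a b y y = 0" "\<Phi> a b b y y = 0" "\<Phi> b b b y y = 0"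
    using zero_plane_triple[OF ab(1) y] zero_plane_vanish[OF ab(1) ab_nz y] by blast+
  define c where "c w = n0 + 2 * j * w" for w
  have N: "\<Phi> a a a (w *s y + z) (w *s y + z) = c w" "\<Phi> a a b (w *s y + z) (w *s y + z) = 0"
    "3 * \<Phi> a b b (w *s y + z) (w *s y + z) = q * c w" "\<Phi> b b b (w *s y + z) (w *s y + z) = e * c w" for w
  proof -
    show "\<Phi> a a a (w *s y + z) (w *s y + z) = c w" "\<Phi> a a b (w *s y + z) (w *s y + z) = 0"
      unfolding expand2 using y yt n1 j by (simp_all add: c_def j_def n0_def algebra_simps)
    have "n0 * (3 * \<Phi> a b b (w *s y + z) (w *s y + z)) = 3 * (2 * w * (n0 * \<Phi> a b b y z) + n0 * n2)"
      unfolding expand2 yt n2_def[symmetric] by (simp add: algebra_simps)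
    also have "\<dots> = (n0 * q) * c w" unfolding j qn c_def by (simp add: algebra_simps)
    finally have "n0 * (3 * \<Phi> a b b (w *s y + z) (w *s y + z)) = n0 * (q * c w)" by (simp only: mult.assoc)
    then show "3 * \<Phi> a b b (w *s y + z) (w *s y + z) = q * c w" using n0 mult_left_cancel by blast
    have "n0 * \<Phi> b b b (w *s y + z) (w *s y + z) = 2 * w * (n0 * \<Phi> b b b y z) + n0 * n3"
      unfolding expand2 yt n3_def[symmetric] by (simp add: algebra_simps)
    also have "\<dots> = (n0 * e) * c w" unfolding j qn c_def by (simp add: algebra_simps)
    finally have "n0 * \<Phi> b b b (w *s y + z) (w *s y + z) = n0 * (e * c w)" by (simp only: mult.assoc)
    then show "\<Phi> b b b (w *s y + z) (w *s y + z) = e * c w" using n0 mult_left_cancel by blast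
  qed
  define \<Delta> where "\<Delta> = 4 * q ^ 3 + 27 * e\<^sup>2"
  have \<Delta>0: "\<Delta> \<noteq> 0"
  proof
    assume "\<Delta> = 0"
    have "(3 * e / q) ^ 3 + q * (3 * e / q) + e = e * \<Delta> / q ^ 3"
      unfolding \<Delta>_def using q0 by (simp add: field_simps power2_eq_square power3_eq_cube)
    then show False using no \<open>\<Delta> = 0\<close> by (metis div_0 mult_zero_right)
  qed
  \<comment> \<open>Dividing the form at x a + t b + v by 10 k, k = c(w), gives a cubic in the
    normal form of \<open>plane_cubic_norm\<close>; clearing denominators leaves k^2 on the
    right.\<close>
  have norm: "10 * cubic_norm q e (\<Phi> a a v v v) (2 * \<Phi> a b v v v) (\<Phi> b b v v v) = f v * (c w)\<^sup>2 * \<Delta>"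
    if v: "v = w *s y + z" and cw: "c w \<noteq> 0" for v w
  proof -
    define k where "k = c w"
    have k0: "k \<noteq> 0" using cw by (simp add: k_def)
    have Nv: "\<Phi> a a a v v = k" "\<Phi> a a b v v = 0" "3 * \<Phi> a b b v v = q * k" "\<Phi> b b b v v = e * k"
      using N[of w] unfolding v k_def by simp_all
    have sb: "\<Phi> b b b a w' = 0" "\<Phi> b b a a w' = 0" "\<Phi> b a a a w' = 0" for w' using d by (metis sym1 sym2 sym3)+
    have sv: "\<Phi> b b a v v = \<Phi> a b b v v" "\<Phi> b a a v v = 0" "\<Phi> b a v v v = \<Phi> a b v v v" using s Nv sym1 by metis+
    have Fb: "\<Phi> w' w' w' w' b = 6 * t\<^sup>2 * \<Phi> b b b v v + 4 * t * (3 * x * \<Phi> a b b v v + \<Phi> b b v v v) + (4 * x * \<Phi> a b v v v + \<Phi> b v v v v)"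
      if "w' = x *s a + (t *s b + v)" for w' x t
    proof -
      have w': "w' = t *s b + (x *s a + v)" using that by (simp add: add_ac)
      show ?thesis unfolding w' unfolding singular_zero(3)[OF d(2)] unfolding expand4 unfolding expand3 unfolding expand2
        unfolding sb sv by simp
    qed
    have Fa: "\<Phi> w' w' w' w' a = 6 * x\<^sup>2 * \<Phi> a a a v v + 4 * x * \<Phi> a a v v v + (6 * t\<^sup>2 * \<Phi> a b b v v + 4 * t * \<Phi> a b v v v + \<Phi> a v v v v)"
      if "w' = x *s a + (t *s b + v)" for w' x t
      unfolding that unfolding singular_zero(3)[OF d(1)] unfolding expand4 unfolding expand3 unfolding expand2
      unfolding d Nv(2) by simp
    have F: "f w' = 10 * x ^ 3 * \<Phi> a a a v v + 10 * x\<^sup>2 * \<Phi> a a v v v + 5 * x * (6 * t\<^sup>2 * \<Phi> a b b v v + 4 * t * \<Phi> a b v v v + \<Phi> a v v v v)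
        + (10 * t ^ 3 * \<Phi> b b b v v + 10 * t\<^sup>2 * \<Phi> b b v v v + 5 * t * \<Phi> b v v v v + f v)"
      if "w' = x *s a + (t *s b + v)" for w' x t
      unfolding that unfolding singular_zero(2)[OF d(1)] unfolding singular_zero(2)[OF d(2)] unfolding expand4 unfolding expand3 unfolding expand2
      unfolding d Nv(2) by simp
    define k0' k1' k2' l0' l1' m' where "k0' = \<Phi> a a v v v / k" and "k1' = 2 * \<Phi> a b v v v / k" and "k2' = \<Phi> b b v v v / k"
      and "l0' = \<Phi> a v v v v / (2 * k)" and "l1' = \<Phi> b v v v v / (2 * k)" and "m' = f v / (10 * k)"
    have eqs: "\<Phi> a a v v v = k * k0'" "2 * \<Phi> a b v v v = k * k1'" "\<Phi> b b v v v = k * k2'"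
      "\<Phi> a v v v v = 2 * k * l0'" "\<Phi> b v v v v = 2 * k * l1'" "f v = 10 * k * m'"
      using k0 two_neq_0[where ?'a='a] by (simp_all add: k0'_def k1'_def k2'_def l0'_def l1'_def m'_def)
    have "cubic_norm q e k0' k1' k2' = m' * (4 * q ^ 3 + 27 * e\<^sup>2)"
    proof (rule plane_cubic_norm[OF q0 no])
      fix x t
      assume 0: "x ^ 3 + q * x * t\<^sup>2 + e * t ^ 3 + (k0' * x\<^sup>2 + k1' * x * t + k2' * t\<^sup>2) + (l0' * x + l1' * t) + m' = 0"
      define w' where "w' = x *s a + (t *s b + v)"
      have "f w' = 10 * x ^ 3 * k + 10 * x\<^sup>2 * (k * k0') + (10 * t\<^sup>2 * x * (3 * \<Phi> a b b v v) + 10 * t * x * (2 * \<Phi> a b v v v) + 5 * x * (2 * k * l0'))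
        + (10 * t ^ 3 * (e * k) + 10 * t\<^sup>2 * (k * k2') + 5 * t * (2 * k * l1') + 10 * k * m')"
        unfolding F[OF w'_def] eqs(1,3,4,5,6) Nv(1,4) by (simp add: algebra_simps)
      also have "\<dots> = 10 * k * (x ^ 3 + q * x * t\<^sup>2 + e * t ^ 3 + (k0' * x\<^sup>2 + k1' * x * t + k2' * t\<^sup>2) + (l0' * x + l1' * t) + m')"
        unfolding eqs(2) Nv(3) by (simp add: algebra_simps)
      also have "\<dots> = 0" unfolding 0 by simp
      finally have fw: "\<Phi> w' w' w' w' x' = 0" for x' by (rule singular)
      have "2 * k * (3 * x\<^sup>2 + q * t\<^sup>2 + 2 * k0' * x + k1' * t + l0') =
         6 * x\<^sup>2 * k + 4 * x * (k * k0') + (2 * t\<^sup>2 * (3 * \<Phi> a b b v v) + 2 * t * (2 * \<Phi> a b v v v) + 2 * k * l0')"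
        unfolding eqs(2) Nv(3) by (simp add: algebra_simps)
      also have "\<dots> = \<Phi> w' w' w' w' a" unfolding Fa[OF w'_def] eqs(1,4) Nv(1) by (simp add: algebra_simps)
      finally have A: "3 * x\<^sup>2 + q * t\<^sup>2 + 2 * k0' * x + k1' * t + l0' = 0" using k0 two_neq_0[where ?'a='a] unfolding fw by simp
      have "2 * k * (2 * q * x * t + 3 * e * t\<^sup>2 + k1' * x + 2 * k2' * t + l1') =
         6 * t\<^sup>2 * (e * k) + 4 * t * (x * (3 * \<Phi> a b b v v) + k * k2') + (2 * x * (2 * \<Phi> a b v v v) + 2 * k * l1')"
        unfolding eqs(2) Nv(3) by (simp add: algebra_simps)
      also have "\<dots> = \<Phi> w' w' w' w' b" unfolding Fb[OF w'_def] eqs(3,5) Nv(4) by (simp add: algebra_simps)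
      finally have "2 * q * x * t + 3 * e * t\<^sup>2 + k1' * x + 2 * k2' * t + l1' = 0" using k0 two_neq_0[where ?'a='a] unfolding fw by simp
      with A show "3 * x\<^sup>2 + q * t\<^sup>2 + 2 * k0' * x + k1' * t + l0' = 0 \<and> 2 * q * x * t + 3 * e * t\<^sup>2 + k1' * x + 2 * k2' * t + l1' = 0" by blast
    qed
    then have "10 * (k ^ 3 * cubic_norm q e k0' k1' k2') = 10 * (k ^ 3 * (m' * \<Delta>))" by (simp add: \<Delta>_def)
    then show ?thesis unfolding eqs cubic_norm_scale k_def[symmetric] by (simp add: power2_eq_square power3_eq_cube mult_ac)
  qed
  define A where "A = [:\<Phi> a a z z z, 3 * \<Phi> a a y z z, 3 * \<Phi> a a y y z, \<Phi> a a y y y:]"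
  define B where "B = [:2 * \<Phi> a b z z z, 6 * \<Phi> a b y z z, 6 * \<Phi> a b y y z, 2 * \<Phi> a b y y y:]"
  define C where "C = [:\<Phi> b b z z z, 3 * \<Phi> b b y z z, 3 * \<Phi> b b y y z, \<Phi> b b y y y:]"
  define E where "E = [:f z, 5 * \<Phi> y z z z z, 10 * \<Phi> y y z z z, 10 * \<Phi> y y y z z, 5 * \<Phi> y y y y z, f y:]"
  have pA: "poly A w = \<Phi> a a (w *s y + z) (w *s y + z) (w *s y + z)" for w
    unfolding expand3 A_def by (simp add: power2_eq_square power3_eq_cube algebra_simps)
  have pB: "poly B w = 2 * \<Phi> a b (w *s y + z) (w *s y + z) (w *s y + z)" for w
    unfolding expand3 B_def by (simp add: power2_eq_square power3_eq_cube algebra_simps)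
  have pC: "poly C w = \<Phi> b b (w *s y + z) (w *s y + z) (w *s y + z)" for w
    unfolding expand3 C_def by (simp add: power2_eq_square power3_eq_cube algebra_simps)
  have pE: "poly E w = f (w *s y + z)" for w
    unfolding expand5 E_def by (simp add: eval_nat_numeral algebra_simps)
  define c1 where "c1 = [:n0, 2 * j:]"
  have pc: "poly c1 w = c w" for w by (simp add: c1_def c_def algebra_simps)
  define U where "U = smult 10 (cubic_norm [:q:] [:e:] A B C)"
  define V where "V = smult \<Delta> (E * c1 * c1)"
  have pN: "poly (cubic_norm [:q:] [:e:] A B C) w = cubic_norm q e (poly A w) (poly B w) (poly C w)" for w
    by (simp add: cubic_norm_def)
  have dA: "degree A \<le> 3" "degree B \<le> 3" "degree C \<le> 3" "degree c1 \<le> 1"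
    by (simp_all add: A_def B_def C_def c1_def degree_pCons_eq_if)
  have dE: "degree E = 5" using fy by (simp add: E_def)
  have c10: "c1 \<noteq> 0" using n0 by (simp add: c1_def)
  have "(U - V) * c1 = 0"
  proof (rule poly_eq_0_if_all_values_0)
    show "poly ((U - V) * c1) w = 0" for w
      using norm[OF refl, of w] unfolding poly_mult poly_diff U_def V_def poly_smult pN pA pB pC pE pc
      by (cases "c w = 0") (simp_all add: power2_eq_square mult_ac)
    have "degree U \<le> 9" unfolding U_def using coeff_cubic_norm_bound(1)[OF dA(1-3), of q e] by (intro order_trans[OF degree_smult_le]) simp
    moreover have "degree V \<le> 9" unfolding V_def using degree_mult3_le[of E 5 c1 1 c1 1] dE dA by (intro order_trans[OF degree_smult_le]) simp
    ultimately have "degree (U - V) \<le> 9" by (intro degree_diff_le)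
    then show "degree ((U - V) * c1) \<le> 101" using degree_mult_le[of "U - V" c1] dA(4) by linarith
  qed
  then have UV: "U = V" using c10 by simp
  have "E \<noteq> 0" using dE by auto
  have V0: "V \<noteq> 0" unfolding V_def using \<open>E \<noteq> 0\<close> c10 \<Delta>0 by simp
  have dV: "degree V = 5 + 2 * degree c1" unfolding V_def using \<open>E \<noteq> 0\<close> c10 \<Delta>0 dE by (simp add: degree_mult_eq)
  \<comment> \<open>The norm has no nontrivial zero, so the coefficients in degree m, the largest of
    the three degrees, do not cancel and the degree is exactly 3m.\<close>
  have "\<exists>m. degree V = 3 * m"
  proof -
    define m where "m = max (degree A) (max (degree B) (degree C))"
    have le: "degree A \<le> m" "degree B \<le> m" "degree C \<le> m" by (simp_all add: m_def)
    have "\<not> (coeff A m = 0 \<and> coeff B m = 0 \<and> coeff C m = 0)"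
    proof
      assume *: "coeff A m = 0 \<and> coeff B m = 0 \<and> coeff C m = 0"
      have lc: "X' = 0" if "degree X' = m" "coeff X' m = 0" for X' :: "'a poly" using that by (metis leading_coeff_0_iff)
      have "m = degree A \<or> m = degree B \<or> m = degree C" unfolding m_def by linarith
      then have "m = 0" using lc[of A] lc[of B] lc[of C] * by auto
      then have "degree A = 0" "degree B = 0" "degree C = 0" using le by simp_all
      then have "A = 0" "B = 0" "C = 0" using lc[of A] lc[of B] lc[of C] * \<open>m = 0\<close> by simp_all
      then have "U = 0" unfolding U_def by (simp add: cubic_norm_def)
      then show False using UV V0 by simp
    qed
    then have "cubic_norm q e (coeff A m) (coeff B m) (coeff C m) \<noteq> 0" using cubic_norm_eq_0D[OF no] by blast
    then have "coeff U (3 * m) \<noteq> 0" unfolding U_def using coeff_cubic_norm_bound(2)[OF le, of q e] by simp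
    moreover have "degree U \<le> 3 * m" unfolding U_def using coeff_cubic_norm_bound(1)[OF le, of q e] by (intro order_trans[OF degree_smult_le])
    ultimately have "degree U = 3 * m" using le_degree by (metis le_antisym)
    then show ?thesis using UV by blast
  qed
  then obtain m where "5 + 2 * degree c1 = 3 * m" using dV by auto
  then show False using dA(4) by presburger
qed

text \<open>\<open>zero_plane_step\<close> enlarges the plane by vectors isotropic for a to a
  four-dimensional space of zeros. For every y the cubic form \<open>\<Phi> y y u u u\<close> has a
  nonzero zero u in it; u lies in a zero plane, so the form vanishes at y. It is then identically 0,
  against non-degeneracy.\<close>

theorem no_zero_plane:
  assumes ab: "zero_plane a b" and ind: "indep2 a b"
  shows False
proof -
  have plane_y: "f (x *s a' + t *s b' + s *s y) = 0" if "zero_plane a' b'" "indep2 a' b'" "\<Phi> a' a' a' y y = 0" for a' b' y x t s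
  proof (rule zero_plane_step[OF that(1,2)])
    note d = zero_planeD[OF that(1)]
    have "\<Phi> a' a' a' b' w = 0" "\<Phi> a' a' a' a' w = 0" "\<Phi> a' a' a' w a' = 0" "\<Phi> a' a' a' w b' = 0" for w using d sym4 by metis+
    then show "\<Phi> a' a' a' (x *s a' + t *s b' + s *s y) (x *s a' + t *s b' + s *s y) = 0"
      using that(3) by (simp add: multilinear)
  qed
  have a0: "a \<noteq> 0" using indep2_nz[OF ind] by blast
  have i2: "c *s a + d *s b = 0 \<Longrightarrow> c = 0 \<and> d = 0" for c d using ind unfolding indep2_def by blast
  obtain y1 where y1: "\<And>c d. y1 \<noteq> c *s a + d *s b" "\<Phi> a a a y1 y1 = 0"
    using chevalley_avoid2[of "[(\<lambda>y. \<Phi> a a a y y, 2)]" a b, OF _ _ i2] by auto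
  have mem: "x *s u + v = 0 \<Longrightarrow> x \<noteq> 0 \<Longrightarrow> u = (- inverse x) *s v" for x u v
  proof -
    assume "x *s u + v = 0" "x \<noteq> 0"
    then have "x *s u = - v" by (simp add: eq_neg_iff_add_eq_0)
    then have "inverse x *s (x *s u) = inverse x *s (- v)" by simp
    then show "u = (- inverse x) *s v" using \<open>x \<noteq> 0\<close> by simp
  qed
  have i3: "c *s a + d *s b + e *s y1 = 0 \<Longrightarrow> c = 0 \<and> d = 0 \<and> e = 0" for c d e
  proof -
    assume h: "c *s a + d *s b + e *s y1 = 0"
    have "e = 0"
    proof (rule ccontr)
      assume "e \<noteq> 0"
      then have "y1 = (- inverse e) *s (c *s a + d *s b)" using mem[of e y1 "c *s a + d *s b"] h by (simp add: add_ac)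
      then show False using y1(1)[of "- inverse e * c" "- inverse e * d"] by (simp add: scale_right_distrib)
    qed
    then show ?thesis using h i2 by simp
  qed
  obtain y2 where y2: "\<And>c d e. y2 \<noteq> c *s a + d *s b + e *s y1" "\<Phi> a a a y2 y2 = 0"
    using chevalley_avoid3[of "[(\<lambda>y. \<Phi> a a a y y, 2)]" a b y1, OF _ _ i3] by auto
  have U3: "f (x *s a + t *s b + s *s y1) = 0" for x t s by (rule plane_y[OF ab ind y1(2)])
  have U4: "f (x *s a + t *s b + s *s y1 + r *s y2) = 0" for x t s r
  proof (cases "t = 0 \<and> s = 0")
    case True
    then show ?thesis using plane_y[OF ab ind y2(2), of x 0 r] by simp
  next
    case False
    \<comment> \<open>a and u span another plane of zeros, and y2 is isotropic for a, so the step
      applies to this plane as well.\<close>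
    define u where "u = t *s b + s *s y1"
    have "zero_plane a u" unfolding zero_plane_def
    proof (intro allI)
      fix c d
      show "f (c *s a + d *s u) = 0" using U3[of c "d * t" "d * s"] unfolding u_def by (simp add: scale_right_distrib add_ac)
    qed
    moreover have "indep2 a u" unfolding indep2_def
    proof (intro allI impI)
      fix c d assume "c *s a + d *s u = 0"
      then have "c *s a + (d * t) *s b + (d * s) *s y1 = 0" unfolding u_def by (simp add: scale_right_distrib add_ac)
      then show "c = 0 \<and> d = 0" using i3[of c "d * t" "d * s"] False by auto
    qed
    ultimately have "f (x *s a + 1 *s u + r *s y2) = 0" using plane_y y2(2) by blast
    then show ?thesis unfolding u_def by (simp add: add_ac)
  qed
  define bs where "bs i = (if i = 0 then a else if i = Suc 0 then b else if i = 2 then y1 else y2)" for i :: nat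
  have cb: "comb 4 bs x = x 0 *s a + x 1 *s b + x 2 *s y1 + x 3 *s y2" for x by (simp add: comb_def bs_def eval_nat_numeral)
  have i4: "indep 4 bs" unfolding indep_def cb
  proof (intro allI impI)
    fix x :: "nat \<Rightarrow> 'a" and i :: nat assume h: "x 0 *s a + x 1 *s b + x 2 *s y1 + x 3 *s y2 = 0" and i: "i < 4"
    have "x 3 = 0"
    proof (rule ccontr)
      assume n: "x 3 \<noteq> 0"
      then have "y2 = (- inverse (x 3)) *s (x 0 *s a + x 1 *s b + x 2 *s y1)"
        using mem[of "x 3" y2 "x 0 *s a + x 1 *s b + x 2 *s y1"] h by (simp add: add_ac)
      then show False using y2(1)[of "- inverse (x 3) * x 0" "- inverse (x 3) * x 1" "- inverse (x 3) * x 2"] by (simp add: scale_right_distrib)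
    qed
    then have "x 0 = 0 \<and> x 1 = 0 \<and> x 2 = 0" using h i3[of "x 0" "x 1" "x 2"] by simp
    moreover have "i = 0 \<or> i = 1 \<or> i = 2 \<or> i = 3" using i by linarith
    ultimately show "x i = 0" using \<open>x 3 = 0\<close> by auto
  qed
  have all: "f y = 0" for y
  proof -
    have "\<exists>x. comb 4 bs x \<noteq> 0 \<and> (\<forall>g\<in>set [(\<lambda>u. \<Phi> y y u u u, 3 :: nat)]. fst g (comb 4 bs x) = 0)"
      by (rule chevalley[OF _ i4]) auto
    then obtain x where x: "comb 4 bs x \<noteq> 0" "\<Phi> y y (comb 4 bs x) (comb 4 bs x) (comb 4 bs x) = 0" by auto
    define u where "u = comb 4 bs x"
    have u: "u \<noteq> 0" "\<Phi> u u u y y = 0" using x swap23[of u u u y y] by (simp_all add: u_def)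
    have zp: "zero_plane u (c *s a + d *s b)" for c d unfolding zero_plane_def
    proof (intro allI)
      fix r s
      show "f (r *s u + s *s (c *s a + d *s b)) = 0"
        using U4[of "r * x 0 + s * c" "r * x 1 + s * d" "r * x 2" "r * x 3"] unfolding u_def cb
        by (simp add: scale_right_distrib scale_left_distrib add_ac)
    qed
    obtain v where v: "zero_plane u v" "indep2 u v"
    proof (cases "\<exists>c. u = c *s a")
      case True
      then obtain c where c: "u = c *s a" by blast
      then have "c \<noteq> 0" using u by auto
      then have "indep2 u b" using indep2_span[OF ind, of c 1 0 0] c by simp
      then show ?thesis using that[of b] zp[of 0 1] by simp
    next
      case False
      have "indep2 u a" unfolding indep2_def
      proof (intro allI impI)
        fix c d assume h: "c *s u + d *s a = 0"
        have "c = 0"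
        proof (rule ccontr)
          assume "c \<noteq> 0"
          then have "u = (- inverse c) *s (d *s a)" using mem h by blast
          then have "u = (- inverse c * d) *s a" by simp
          then show False using False by blast
        qed
        then show "c = 0 \<and> d = 0" using h a0 by simp
      qed
      then show ?thesis using that[of a] zp[of 1 0] by simp
    qed
    show ?thesis by (rule zero_plane_step[OF v u(2)])
  qed
  have "\<Phi> a y y y y = 0" for y using singular[OF all, of y a] by (metis sym1 sym2 sym3 sym4)
  then show False using vertex_eq_0 a0 by blast
qed

end

section \<open>Pairs of linearly independent zeros\<close>

text \<open>Completing squares leaves A s^2 = M - B t^2. If the right side divided by A were never a
  square in t, it would be nonsq h^2 with h linear, but the root of h gives the square 0.\<close>

lemma affine_conic_zero:
  fixes A B l1 l2 m :: "'a :: big_prime_field"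
  assumes A: "A \<noteq> 0" and B: "B \<noteq> 0"
  shows "\<exists>s t. A * s\<^sup>2 + l1 * s + B * t\<^sup>2 + l2 * t + m = 0"
proof -
  define M where "M = l1\<^sup>2 / (4 * A) + l2\<^sup>2 / (4 * B) - m"
  define \<delta> where "\<delta> = [:M / A, 0, - B / A:]"
  have p\<delta>: "A * poly \<delta> t = M - B * t\<^sup>2" for t using A by (simp add: \<delta>_def field_simps power2_eq_square)
  have "\<exists>t s. poly \<delta> t = s\<^sup>2"
  proof (rule ccontr)
    assume no: "\<not> ?thesis"
    then have e: "{t. \<exists>s. s \<noteq> 0 \<and> poly \<delta> t = s\<^sup>2} = {}" by blast
    have "card {t. \<exists>s. s \<noteq> 0 \<and> poly \<delta> t = s\<^sup>2} \<le> 4" unfolding e by simp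
    moreover have d2: "degree \<delta> = 2" using A B by (simp add: \<delta>_def)
    ultimately obtain h where h: "\<delta> = smult nonsq (h\<^sup>2)" using mostly_nonsquare_values[of \<delta>] by auto
    then have h0: "h \<noteq> 0" using d2 by auto
    have "degree h = 1" using d2 h0 unfolding h by (simp add: degree_power_eq)
    then obtain t where t: "h = smult (lead_coeff h) [:- t, 1:]" using degree_1_root by blast
    have "poly h t = 0" by (subst t) simp
    then have "poly \<delta> t = 0\<^sup>2" unfolding h by simp
    then show False using no by blast
  qed
  then obtain t s where ts: "poly \<delta> t = s\<^sup>2" by blast
  then have M: "A * s\<^sup>2 + B * t\<^sup>2 = M" using p\<delta>[of t] by simp
  define s' t' where "s' = s - l1 / (2 * A)" and "t' = t - l2 / (2 * B)"
  have four: "(4 :: 'a) \<noteq> 0" "(2 :: 'a) \<noteq> 0" using two_neq_0[where ?'a='a] by simp_all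
  have 1: "A * s'\<^sup>2 + l1 * s' = A * s\<^sup>2 - l1\<^sup>2 / (4 * A)"
  proof -
    define u where "u = l1 / (2 * A)"
    have l: "l1 = 2 * A * u" using A four by (simp add: u_def)
    show ?thesis unfolding s'_def u_def[symmetric] unfolding l using A four by (simp add: power2_eq_square algebra_simps)
  qed
  have 2: "B * t'\<^sup>2 + l2 * t' = B * t\<^sup>2 - l2\<^sup>2 / (4 * B)"
  proof -
    define u where "u = l2 / (2 * B)"
    have l: "l2 = 2 * B * u" using B four by (simp add: u_def)
    show ?thesis unfolding t'_def u_def[symmetric] unfolding l using B four by (simp add: power2_eq_square algebra_simps)
  qed
  have "A * s'\<^sup>2 + l1 * s' + B * t'\<^sup>2 + l2 * t' + m = (A * s'\<^sup>2 + l1 * s') + (B * t'\<^sup>2 + l2 * t') + m" by (simp add: add_ac)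
  also have "\<dots> = (A * s\<^sup>2 + B * t\<^sup>2) - M" unfolding 1 2 M_def by (simp add: algebra_simps)
  finally show ?thesis unfolding M by (intro exI[of _ s'] exI[of _ t']) simp
qed

context quintic
begin

lemma indep2I:
  assumes "a \<noteq> 0" "\<And>c. y \<noteq> c *s a"
  shows "indep2 a y"
  unfolding indep2_def
proof (intro allI impI)
  fix x t assume h: "x *s a + t *s y = 0"
  have "t = 0"
  proof (rule ccontr)
    assume t: "t \<noteq> 0"
    have "t *s y = - (x *s a)" using h by (simp add: eq_neg_iff_add_eq_0 add.commute)
    then have "inverse t *s (t *s y) = inverse t *s (- (x *s a))" by simp
    then have "y = (- (inverse t * x)) *s a" using t by simp
    then show False using assms(2) by blast
  qed
  then show "x = 0 \<and> t = 0" using h assms(1) by simp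
qed

lemma no_flat:
  assumes "f a = 0" "indep2 a y" "\<Phi> a a a y y = 0" "\<Phi> a a y y y = 0" "\<Phi> a y y y y = 0" "f y = 0"
  shows False
proof (rule no_zero_plane[OF _ assms(2)])
  show "zero_plane a y" unfolding zero_plane_def singular_zero(2)[OF assms(1)]
    using assms(3-6) by (simp add: multilinear)
qed

text \<open>On the line through a and b the form is 10 x^3 \<open>\<Phi> a a a b b\<close> + 10 x^2
  \<open>\<Phi> a a b b b\<close>. Two nonzero coefficients give a simple zero x \<noteq> 0, two
  zero ones a plane of zeros. So each pair of independent zeros carries an orientation.\<close>

lemma edge_cases:
  assumes a: "f a = 0" and b: "f b = 0" and i: "indep2 a b"
  shows "\<Phi> a a a b b = 0 \<and> \<Phi> a a b b b \<noteq> 0 \<or> \<Phi> a a a b b \<noteq> 0 \<and> \<Phi> a a b b b = 0"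
proof -
  have ab: "\<Phi> a b b b b = 0" using singular[OF b, of a] by (metis sym1 sym2 sym3 sym4)
  have "\<not> (\<Phi> a a a b b = 0 \<and> \<Phi> a a b b b = 0)" using no_flat[OF a i _ _ ab b] by blast
  moreover have "\<not> (\<Phi> a a a b b \<noteq> 0 \<and> \<Phi> a a b b b \<noteq> 0)"
  proof
    assume h: "\<Phi> a a a b b \<noteq> 0 \<and> \<Phi> a a b b b \<noteq> 0"
    define x where "x = - \<Phi> a a b b b / \<Phi> a a a b b"
    have x: "x * \<Phi> a a a b b = - \<Phi> a a b b b" "x \<noteq> 0" using h by (simp_all add: x_def)
    define w where "w = x *s a + b"
    have "f w = 10 * x\<^sup>2 * (x * \<Phi> a a a b b + \<Phi> a a b b b)"
      unfolding w_def singular_zero(2)[OF a] using ab b by (simp add: power2_eq_square power3_eq_cube algebra_simps)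
    then have "f w = 0" unfolding x by simp
    then have "\<Phi> w w w w a = 0" by (rule singular)
    moreover have "\<Phi> w w w w a = x * (6 * (x * \<Phi> a a a b b) + 4 * \<Phi> a a b b b)"
      unfolding w_def singular_zero(3)[OF a] ab by (simp add: power2_eq_square algebra_simps)
    ultimately have "x * (- 2 * \<Phi> a a b b b) = 0" unfolding x by simp
    then show False using x(2) h two_neq_0[where ?'a='a] by simp
  qed
  ultimately show ?thesis by blast
qed

text \<open>In \<open>isotropic_line\<close> with y = b, the zero b forces \<beta>1 = n1 = 0 and
  orthogonality forces \<beta>0 = 0. On the line the form is then - 10 nonsq n0^2 times
  \<open>\<Phi> a a\<close> of the cube. If n0 or \<open>\<Phi> a a z z z\<close> vanished, there
  would be a plane of zeros.\<close>

lemma edge_isotropic: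
  assumes a: "f a = 0" and b: "f b = 0" and e: "\<Phi> a a a b b = 0" "\<Phi> a a b b b \<noteq> 0"
    and z: "\<Phi> a a a z z = 0" "\<Phi> a a a b z = 0" "\<Phi> a b b b z = 0" "\<And>c. z \<noteq> c *s b"
  shows "\<Phi> a a z z z \<noteq> 0" "\<Phi> a z z z z = 0" "f z \<noteq> 0" "\<exists>n. n \<noteq> 0 \<and> \<Phi> b b b z z = - nonsq * \<Phi> a a b b b * n\<^sup>2"
proof -
  have ab: "\<Phi> a b b b b = 0" using singular[OF b, of a] by (metis sym1 sym2 sym3 sym4)
  obtain \<beta>0 \<beta>1 n0 n1 where
    1: "\<And>t. \<Phi> a (t *s b + z) (t *s b + z) (t *s b + z) (t *s b + z) = 4 * \<Phi> a a (t *s b + z) (t *s b + z) (t *s b + z) * (\<beta>0 + \<beta>1 * t)"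
    "\<And>t. f (t *s b + z) = 10 * \<Phi> a a (t *s b + z) (t *s b + z) (t *s b + z) * ((\<beta>0 + \<beta>1 * t)\<^sup>2 - nonsq * (n0 + n1 * t)\<^sup>2)"
    and 2: "\<Phi> a b b b b = 4 * \<Phi> a a b b b * \<beta>1" "\<Phi> a b b b z = \<Phi> a a b b b * \<beta>0 + 3 * \<Phi> a a b b z * \<beta>1"
      "f b = 10 * \<Phi> a a b b b * (\<beta>1\<^sup>2 - nonsq * n1\<^sup>2)"
    and 3: "\<beta>0 = 0 \<Longrightarrow> \<beta>1 = 0 \<Longrightarrow> \<Phi> b b b z z = - nonsq * (\<Phi> a a b b b * n0\<^sup>2 + 6 * \<Phi> a a b b z * n1 * n0 + 3 * \<Phi> a a b z z * n1\<^sup>2)"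
    using isotropic_line[OF a e(1) z(2,1) e(2)] by metis
  have b1: "\<beta>1 = 0" using 2(1) ab e by simp
  have b0: "\<beta>0 = 0" using 2(2) z(3) e b1 by simp
  have n1: "n1 = 0" using 2(3) b b1 e by simp
  have bz: "\<Phi> b b b z z = - nonsq * \<Phi> a a b b b * n0\<^sup>2" using 3[OF b0 b1] n1 by simp
  show D: "\<Phi> a z z z z = 0" using 1(1)[of 0] b0 b1 by simp
  have fz: "f z = - 10 * nonsq * \<Phi> a a z z z * n0\<^sup>2" using 1(2)[of 0] b0 b1 n1 by simp
  have a0: "a \<noteq> 0" and bn: "b \<noteq> 0" using e by auto
  show C: "\<Phi> a a z z z \<noteq> 0"
  proof
    assume C: "\<Phi> a a z z z = 0"
    have "z \<noteq> c *s a" for c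
    proof
      assume zc: "z = c *s a"
      have "\<Phi> a b b b a = \<Phi> a a b b b" by (metis sym1 sym2 sym3 sym4)
      then have "c = 0" using z(3) e(2) unfolding zc by (simp add: multilinear)
      then show False using zc z(4)[of 0] by simp
    qed
    then show False using no_flat[OF a indep2I[OF a0] z(1) C D] fz C by simp
  qed
  have n0: "n0 \<noteq> 0"
  proof
    assume n0: "n0 = 0"
    have "f b * t ^ 5 + (5 * \<Phi> b b b b z) * t ^ 4 + (10 * \<Phi> b b b z z) * t ^ 3 + (10 * \<Phi> b b z z z) * t\<^sup>2 + (5 * \<Phi> b z z z z) * t + f z = 0" for t
      using 1(2)[of t] b0 b1 n1 n0 unfolding expand5 by (simp add: mult_ac)
    then have "f z = 0 \<and> 5 * \<Phi> b z z z z = 0 \<and> 10 * \<Phi> b b z z z = 0 \<and> 10 * \<Phi> b b b z z = 0 \<and> 5 * \<Phi> b b b b z = 0 \<and> f b = 0"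
      by (rule quintic_eq_0)
    then show False using no_flat[OF b indep2I[OF bn z(4)]] by simp
  qed
  show "f z \<noteq> 0" unfolding fz using C n0 by simp
  show "\<exists>n. n \<noteq> 0 \<and> \<Phi> b b b z z = - nonsq * \<Phi> a a b b b * n\<^sup>2" using bz n0 by blast
qed

text \<open>Let p run over the points s^2 e1 + s e2 + e3. Comparing coefficients in s makes
  \<open>\<Phi> e1 e1 e1 p p\<close> a constant \<alpha> and \<open>\<Phi> e1 e1 p p p\<close> the
  quadratic \<alpha> s^2 + 3 \<gamma> s + \<beta>. By \<open>edge_cases\<close> exactly one of them
  vanishes for each s; \<alpha> \<noteq> 0 would make a quadratic with leading coefficient \<alpha>
  vanish everywhere. The result is not symmetric in e1 and e3, which is what
  \<open>Y0_orthogonal\<close> exploits.\<close>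

lemma conic_half:
  assumes e1: "f e1 = 0" and p: "\<And>s. f (s\<^sup>2 *s e1 + (s *s e2 + e3)) = 0"
    and i: "\<And>s. indep2 e1 (s\<^sup>2 *s e1 + (s *s e2 + e3))"
  shows "\<Phi> e1 e1 e1 e3 e3 = 0" "\<Phi> e1 e1 e3 e3 e3 \<noteq> 0"
proof -
  define b320 b311 \<alpha> where "b320 = \<Phi> e1 e1 e1 e2 e2" and "b311 = \<Phi> e1 e1 e1 e2 e3" and "\<alpha> = \<Phi> e1 e1 e1 e3 e3"
  define b230 b221 \<gamma> \<beta> where "b230 = \<Phi> e1 e1 e2 e2 e2" and "b221 = \<Phi> e1 e1 e2 e2 e3" and "\<gamma> = \<Phi> e1 e1 e2 e3 e3" and "\<beta> = \<Phi> e1 e1 e3 e3 e3"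
  define b140 b131 b122 b113 b104 where "b140 = \<Phi> e1 e2 e2 e2 e2" and "b131 = \<Phi> e1 e2 e2 e2 e3" and "b122 = \<Phi> e1 e2 e2 e3 e3"
    and "b113 = \<Phi> e1 e2 e3 e3 e3" and "b104 = \<Phi> e1 e3 e3 e3 e3"
  define b050 b041 b032 b023 b014 b005 where "b050 = f e2" and "b041 = \<Phi> e2 e2 e2 e2 e3" and "b032 = \<Phi> e2 e2 e2 e3 e3"
    and "b023 = \<Phi> e2 e2 e3 e3 e3" and "b014 = \<Phi> e2 e3 e3 e3 e3" and "b005 = f e3"
  note bs = b320_def b311_def \<alpha>_def b230_def b221_def \<gamma>_def \<beta>_def b140_def b131_def b122_def b113_def b104_def
    b050_def b041_def b032_def b023_def b014_def b005_def
  have v2: "\<Phi> e1 e1 e1 (s *s e2 + e3) (s *s e2 + e3) = s\<^sup>2 * b320 + 2 * s * b311 + \<alpha>" for s unfolding expand2 bs ..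
  have v3: "\<Phi> e1 e1 (s *s e2 + e3) (s *s e2 + e3) (s *s e2 + e3) = s ^ 3 * b230 + 3 * s\<^sup>2 * b221 + 3 * s * \<gamma> + \<beta>" for s unfolding expand3 bs ..
  have v4: "\<Phi> e1 (s *s e2 + e3) (s *s e2 + e3) (s *s e2 + e3) (s *s e2 + e3) =
      s ^ 4 * b140 + 4 * s ^ 3 * b131 + 6 * s\<^sup>2 * b122 + 4 * s * b113 + b104" for s unfolding expand4 bs ..
  have v5: "f (s *s e2 + e3) = s ^ 5 * b050 + 5 * s ^ 4 * b041 + 10 * s ^ 3 * b032 + 10 * s\<^sup>2 * b023 + 5 * s * b014 + b005" for s
    unfolding expand5 bs ..
  define F where "F = [:b005, 5 * b014, 10 * b023 + 5 * b104, 10 * b032 + 20 * b113, 5 * b041 + 30 * b122 + 10 * \<beta>,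
    b050 + 20 * b131 + 30 * \<gamma>, 5 * b140 + 30 * b221 + 10 * \<alpha>, 10 * b230 + 20 * b311, 10 * b320:]"
  define G where "G = [:b104, 4 * b113, 6 * b122 + 4 * \<beta>, 4 * b131 + 12 * \<gamma>, b140 + 12 * b221 + 6 * \<alpha>, 4 * b230 + 12 * b311, 6 * b320:]"
  have "poly F s = 0" for s
    using p[of s] unfolding singular_zero(2)[OF e1] v2 v3 v4 v5 by (simp add: F_def eval_nat_numeral algebra_simps)
  moreover have "degree F \<le> 101" by (simp add: F_def degree_pCons_eq_if)
  ultimately have F: "F = 0" by (rule poly_eq_0_if_all_values_0)
  have "poly G s = 0" for s
    using singular[OF p[of s], of e1] unfolding singular_zero(3)[OF e1] v2 v3 v4 by (simp add: G_def eval_nat_numeral algebra_simps)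
  moreover have "degree G \<le> 101" by (simp add: G_def degree_pCons_eq_if)
  ultimately have G: "G = 0" by (rule poly_eq_0_if_all_values_0)
  \<comment> \<open>The coefficients of s^6, s^7, s^8 in F and of s^4, s^5 in G.\<close>
  have r: "5 * b140 + 30 * b221 + 10 * \<alpha> = 0" "10 * b230 + 20 * b311 = 0" "10 * b320 = 0"
    "b140 + 12 * b221 + 6 * \<alpha> = 0" "4 * b230 + 12 * b311 = 0"
    using F G by (simp_all add: F_def G_def)
  have z320: "b320 = 0" using r(3) by simp
  have "20 * b311 = 10 * (4 * b230 + 12 * b311) - 4 * (10 * b230 + 20 * b311) - 20 * b311" by (simp add: algebra_simps)
  then have "20 * b311 = - (20 * b311)" unfolding r by simp
  then have "40 * b311 = 0" by (simp add: eq_neg_iff_add_eq_0 flip: distrib_right)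
  then have z311: "b311 = 0" by simp
  have z230: "b230 = 0" using r(2) z311 by simp
  have "5 * (b140 + 12 * b221 + 6 * \<alpha>) - (5 * b140 + 30 * b221 + 10 * \<alpha>) = 10 * (3 * b221 + 2 * \<alpha>)" by (simp add: algebra_simps)
  then have "10 * (3 * b221 + 2 * \<alpha>) = 0" unfolding r by simp
  moreover have "x = 0" if "10 * x = (0 :: 'a)" for x using that by simp
  ultimately have "3 * b221 + 2 * \<alpha> = 0" by blast
  then have z221: "3 * b221 = - (2 * \<alpha>)" by (simp only: eq_neg_iff_add_eq_0)
  have P2: "\<Phi> e1 e1 e1 q q = \<alpha>" and P3: "\<Phi> e1 e1 q q q = \<alpha> * s\<^sup>2 + 3 * \<gamma> * s + \<beta>" if q: "q = s\<^sup>2 *s e1 + (s *s e2 + e3)" for q s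
  proof -
    have z: "\<Phi> e1 e1 e1 e1 w = 0" for w by (rule singular[OF e1])
    show "\<Phi> e1 e1 e1 q q = \<alpha>" unfolding q expand2[of e1 e1 e1 "s\<^sup>2"] z v2 using z320 z311 by simp
    have "\<Phi> e1 e1 q q q = 3 * s\<^sup>2 * \<alpha> + (s\<^sup>2 * (3 * b221) + 3 * s * \<gamma> + \<beta>)"
      unfolding q expand3[of e1 e1 "s\<^sup>2"] z v2 v3 using z320 z311 z230 by (simp add: algebra_simps)
    then show "\<Phi> e1 e1 q q q = \<alpha> * s\<^sup>2 + 3 * \<gamma> * s + \<beta>" unfolding z221 by (simp add: algebra_simps)
  qed
  have ec: "\<alpha> = 0 \<and> \<alpha> * s\<^sup>2 + 3 * \<gamma> * s + \<beta> \<noteq> 0 \<or> \<alpha> \<noteq> 0 \<and> \<alpha> * s\<^sup>2 + 3 * \<gamma> * s + \<beta> = 0" for s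
    using edge_cases[OF e1 p[of s] i[of s]] unfolding P2[OF refl] P3[OF refl] .
  have \<alpha>0: "\<alpha> = 0"
  proof (rule ccontr)
    assume "\<alpha> \<noteq> 0"
    then have "\<alpha> * s\<^sup>2 + 3 * \<gamma> * s + \<beta> = 0" for s using ec by blast
    then have "\<beta> = 0 \<and> 3 * \<gamma> = 0 \<and> \<alpha> = 0" by (rule quadratic_eq_0)
    then show False using \<open>\<alpha> \<noteq> 0\<close> by blast
  qed
  then show "\<Phi> e1 e1 e1 e3 e3 = 0" by (simp add: \<alpha>_def)
  have "\<beta> \<noteq> 0" using ec[of 0] \<alpha>0 by simp
  then show "\<Phi> e1 e1 e3 e3 e3 \<noteq> 0" by (simp add: \<beta>_def)
qed

section \<open>Isotropic vectors and the radical of the quadratic form at a zero\<close>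

context
  fixes a y
  assumes fa: "f a = 0" and q0: "\<Phi> a a a y y = 0" and c0: "\<Phi> a a y y y \<noteq> 0" and d0: "\<Phi> a y y y y = 0" and e0: "f y \<noteq> 0"
begin

text \<open>In the notation of \<open>isotropic_line\<close> this is - 20 nonsq
  \<open>\<Phi> a a y y y\<close>^2 n1 n0: the combination cancels the terms with n1^2 and shows
  that n0 depends linearly on w.\<close>

definition \<phi> :: "'v \<Rightarrow> 'a" where "\<phi> w = 5 * \<Phi> a a y y y * \<Phi> y y y y w - 3 * f y * \<Phi> a a y y w"

text \<open>The second and third conditions say \<beta>0 = 0 and n0 = 0 for isotropic w, the first
  one that \<open>isotropic_line\<close> applies. Isotropic vectors of this subspace are therefore
  zeros.\<close>

definition Y0 :: "'v \<Rightarrow> bool" where "Y0 w \<longleftrightarrow> \<Phi> a a a y w = 0 \<and> \<Phi> a y y y w = 0 \<and> \<phi> w = 0"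

lemma \<phi>_linear: "\<phi> (u + v) = \<phi> u + \<phi> v" "\<phi> (c *s u) = c * \<phi> u"
  by (simp_all add: \<phi>_def multilinear algebra_simps)

lemma polyfun_\<phi>: "polyfun (Suc 0) \<phi>" "\<phi> 0 = 0"
  by (rule polyfun_linear) (simp_all add: \<phi>_linear, simp add: \<phi>_def)

lemma Y0_linear: "Y0 u \<Longrightarrow> Y0 v \<Longrightarrow> Y0 (u + v)" "Y0 u \<Longrightarrow> Y0 (c *s u)"
  by (simp_all add: Y0_def \<phi>_linear multilinear)

lemma Y0_zero:
  assumes w: "Y0 w" "\<Phi> a a a w w = 0"
  shows "f w = 0"
proof -
  have w': "\<Phi> a a a y w = 0" "\<Phi> a y y y w = 0" "\<phi> w = 0" using w(1) by (simp_all add: Y0_def)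
  obtain \<beta>0 \<beta>1 n0 n1 where
    1: "\<And>t. f (t *s y + w) = 10 * \<Phi> a a (t *s y + w) (t *s y + w) (t *s y + w) * ((\<beta>0 + \<beta>1 * t)\<^sup>2 - nonsq * (n0 + n1 * t)\<^sup>2)"
    and 2: "\<Phi> a y y y y = 4 * \<Phi> a a y y y * \<beta>1" "\<Phi> a y y y w = \<Phi> a a y y y * \<beta>0 + 3 * \<Phi> a a y y w * \<beta>1"
      "f y = 10 * \<Phi> a a y y y * (\<beta>1\<^sup>2 - nonsq * n1\<^sup>2)"
    and 3: "\<beta>0 = 0 \<Longrightarrow> \<beta>1 = 0 \<Longrightarrow> \<Phi> y y y y w = - 2 * nonsq * (2 * \<Phi> a a y y y * n1 * n0 + 3 * \<Phi> a a y y w * n1\<^sup>2)"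
    using isotropic_line[OF fa q0 w'(1) w(2) c0] by metis
  have b1: "\<beta>1 = 0" using 2(1) d0 c0 by simp
  have b0: "\<beta>0 = 0" using 2(2) w'(2) c0 b1 by simp
  have fy: "f y = - 10 * nonsq * \<Phi> a a y y y * n1\<^sup>2" using 2(3) b1 by simp
  have "\<phi> w = - 20 * nonsq * (\<Phi> a a y y y)\<^sup>2 * n1 * n0"
    unfolding \<phi>_def 3[OF b0 b1] fy by (simp add: power2_eq_square algebra_simps)
  moreover have "n1 \<noteq> 0" using e0 fy by auto
  ultimately have "n0 = 0" using w'(3) c0 by simp
  then show ?thesis using 1[of 0] b0 by simp
qed

text \<open>Otherwise e belongs to a hyperbolic pair e, e3. Five linear conditions leave a nonzero
  e2 in the subspace orthogonal to both. If e2 is isotropic, e and e2 span a plane of zeros; if not,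
  there is a conic of zeros, and \<open>conic_half\<close> applied from its two ends is
  contradictory.\<close>

lemma Y0_orthogonal:
  assumes e: "Y0 e" "\<Phi> a a a e e = 0" "e \<noteq> 0" and w: "Y0 w"
  shows "\<Phi> a a a e w = 0"
proof (rule ccontr)
  define g where "g = \<Phi> a a a e w"
  assume "\<Phi> a a a e w \<noteq> 0"
  then have g: "g \<noteq> 0" by (simp add: g_def)
  \<comment> \<open>Makes e3 isotropic without changing its product with e.\<close>
  define c where "c = - \<Phi> a a a w w / (2 * g)"
  define e3 where "e3 = c *s e + w"
  have e3: "Y0 e3" "\<Phi> a a a e e3 = g" "\<Phi> a a a e3 e = g"
    unfolding e3_def using e w sym4[of a a a w e] by (simp_all add: Y0_linear multilinear g_def)
  have e33: "\<Phi> a a a e3 e3 = 0"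
    unfolding e3_def expand2 g_def[symmetric] c_def using e(2) g two_neq_0[where ?'a='a] by simp
  obtain e2 where e2: "e2 \<noteq> 0" "\<Phi> a a a y e2 = 0" "\<Phi> a y y y e2 = 0" "\<phi> e2 = 0" "\<Phi> a a a e e2 = 0" "\<Phi> a a a e3 e2 = 0"
    using polyfun_\<phi> chevalley_zero[of "[(\<lambda>w. \<Phi> a a a y w, 1), (\<lambda>w. \<Phi> a y y y w, 1), (\<phi>, 1), (\<lambda>w. \<Phi> a a a e w, 1), (\<lambda>w. \<Phi> a a a e3 w, 1)]"] by auto
  have Y2: "Y0 e2" using e2 by (simp add: Y0_def)
  have s2: "\<Phi> a a a e2 e = 0" "\<Phi> a a a e2 e3 = 0" using e2 sym4 by metis+
  define k where "k = \<Phi> a a a e2 e2"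
  show False
  proof (cases "k = 0")
    case True
    have "zero_plane e e2" unfolding zero_plane_def
    proof (intro allI)
      fix x t
      show "f (x *s e + t *s e2) = 0"
        by (rule Y0_zero) (use e Y2 s2 e2 True in \<open>simp_all add: Y0_linear multilinear k_def\<close>)
    qed
    moreover have "e2 \<noteq> c *s e" for c
    proof
      assume c: "e2 = c *s e"
      then have "c * g = 0" using s2(2) e3(2) by (simp add: multilinear)
      then show False using g c e2(1) by simp
    qed
    ultimately show False using no_zero_plane indep2I e(3) by blast
  next
    case False
    \<comment> \<open>Scales e so that s^2 (2 A g + k) = 0, that is, so that the whole conic is
      isotropic.\<close>
    define A where "A = - k / (2 * g)"
    have A0: "A \<noteq> 0" using False g two_neq_0[where ?'a='a] by (simp add: A_def)
    have Ag: "2 * A * g = - k" using g two_neq_0[where ?'a='a] by (simp add: A_def)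
    define e1 where "e1 = A *s e"
    have e1: "Y0 e1" "\<Phi> a a a e1 e1 = 0" "\<Phi> a a a e1 e2 = 0" "\<Phi> a a a e2 e1 = 0" "\<Phi> a a a e1 e3 = A * g" "\<Phi> a a a e3 e1 = A * g"
      unfolding e1_def using e e2 s2 e3 by (simp_all add: Y0_linear multilinear)
    have n: "e1 \<noteq> 0" "e3 \<noteq> 0" using e1(5) A0 g by auto
    have iso: "\<Phi> a a a (s\<^sup>2 *s u + (s *s e2 + v)) (s\<^sup>2 *s u + (s *s e2 + v)) = s\<^sup>2 * (2 * A * g + k)"
      if "\<Phi> a a a u u = 0" "\<Phi> a a a v v = 0" "\<Phi> a a a u e2 = 0" "\<Phi> a a a e2 v = 0" "\<Phi> a a a e2 u = 0" "\<Phi> a a a v e2 = 0" "\<Phi> a a a u v = A * g" "\<Phi> a a a v u = A * g" for s u v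
      using that by (simp add: multilinear k_def power2_eq_square algebra_simps)
    have p1: "f (s\<^sup>2 *s e1 + (s *s e2 + e3)) = 0" for s
    proof (rule Y0_zero)
      show "Y0 (s\<^sup>2 *s e1 + (s *s e2 + e3))" by (intro Y0_linear e1 Y2 e3)
      show "\<Phi> a a a (s\<^sup>2 *s e1 + (s *s e2 + e3)) (s\<^sup>2 *s e1 + (s *s e2 + e3)) = 0"
        unfolding iso[OF e1(2) e33 e1(3) s2(2) e1(4) e2(6) e1(5,6)] Ag by simp
    qed
    have p3: "f (s\<^sup>2 *s e3 + (s *s e2 + e1)) = 0" for s
    proof (rule Y0_zero)
      show "Y0 (s\<^sup>2 *s e3 + (s *s e2 + e1))" by (intro Y0_linear e1 Y2 e3)
      show "\<Phi> a a a (s\<^sup>2 *s e3 + (s *s e2 + e1)) (s\<^sup>2 *s e3 + (s *s e2 + e1)) = 0"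
        unfolding iso[OF e33 e1(2) e2(6) e1(4) s2(2) e1(3) e1(6,5)] Ag by simp
    qed
    have i1: "indep2 e1 (s\<^sup>2 *s e1 + (s *s e2 + e3))" for s
    proof (rule indep2I[OF n(1)])
      fix c
      have "\<Phi> a a a e1 (s\<^sup>2 *s e1 + (s *s e2 + e3)) = A * g" using e1 by (simp add: multilinear)
      moreover have "\<Phi> a a a e1 (c *s e1) = 0" using e1 by (simp add: multilinear)
      ultimately show "s\<^sup>2 *s e1 + (s *s e2 + e3) \<noteq> c *s e1" using A0 g by (metis mult_eq_0_iff)
    qed
    have i3: "indep2 e3 (s\<^sup>2 *s e3 + (s *s e2 + e1))" for s
    proof (rule indep2I[OF n(2)])
      fix c
      have "\<Phi> a a a e3 (s\<^sup>2 *s e3 + (s *s e2 + e1)) = A * g" using e1 e33 e2 by (simp add: multilinear)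
      moreover have "\<Phi> a a a e3 (c *s e3) = 0" using e33 by (simp add: multilinear)
      ultimately show "s\<^sup>2 *s e3 + (s *s e2 + e1) \<noteq> c *s e3" using A0 g by (metis mult_eq_0_iff)
    qed
    have f13: "f e1 = 0" "f e3 = 0" using Y0_zero e1(1,2) e3(1) e33 by blast+
    have "\<Phi> e1 e1 e3 e3 e3 \<noteq> 0" by (rule conic_half(2)[OF f13(1) p1 i1])
    moreover have "\<Phi> e3 e3 e3 e1 e1 = 0" by (rule conic_half(1)[OF f13(2) p3 i3])
    ultimately show False using swap23[of e3 e3 e3 e1 e1] by simp
  qed
qed

lemma \<phi>_y: "\<phi> y \<noteq> 0"
proof -
  have "\<phi> y = 2 * \<Phi> a a y y y * f y" by (simp add: \<phi>_def algebra_simps)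
  then show ?thesis using c0 e0 two_neq_0[where ?'a='a] by simp
qed

lemma yya: "\<Phi> a y y y a = \<Phi> a a y y y"
  by (metis sym1 sym2 sym3 sym4)

lemma Y0_exists: "\<exists>e. e \<noteq> 0 \<and> Y0 e \<and> \<Phi> a a a e e = 0 \<and> f e = 0 \<and> (\<forall>c. e \<noteq> c *s a)"
proof -
  obtain e where e: "e \<noteq> 0" "\<Phi> a a a y e = 0" "\<Phi> a y y y e = 0" "\<phi> e = 0" "\<Phi> a a a e e = 0"
    using polyfun_\<phi> chevalley_zero[of "[(\<lambda>w. \<Phi> a a a y w, 1), (\<lambda>w. \<Phi> a y y y w, 1), (\<phi>, 1), (\<lambda>w. \<Phi> a a a w w, 2)]"] by auto
  have Y: "Y0 e" using e by (simp add: Y0_def)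
  have "e \<noteq> c *s a" for c
  proof
    assume c: "e = c *s a"
    then have "c = 0" using e(3) c0 by (simp add: multilinear yya)
    then show False using e(1) c by simp
  qed
  then show ?thesis using e(1,5) Y Y0_zero by blast
qed

text \<open>Any v orthogonal to y can be moved into Y0 by multiples of a and y, both orthogonal to
  e, so e is orthogonal to v. Hence \<open>\<Phi> a a a e v\<close> = m
  \<open>\<Phi> a a a y v\<close> for all v, and e - m y lies in the radical.\<close>

lemma radical_vector: "\<exists>r. (\<forall>w. \<Phi> a a a r w = 0) \<and> (\<forall>c. r \<noteq> c *s a)"
proof -
  obtain e where e: "e \<noteq> 0" "Y0 e" "\<Phi> a a a e e = 0" using Y0_exists by blast
  have ey: "\<Phi> a a a y e = 0" "\<Phi> a a a e y = 0" using e(2) sym4[of a a a e y] by (simp_all add: Y0_def)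
  have ea: "\<Phi> a a a e a = 0" "\<Phi> a a a y a = 0" using singular[OF fa] sym4 by metis+
  have ker: "\<Phi> a a a e v = 0" if v: "\<Phi> a a a y v = 0" for v
  proof -
    define v1 where "v1 = (- \<Phi> a y y y v / \<Phi> a a y y y) *s a + v"
    define v2 where "v2 = (- \<phi> v1 / \<phi> y) *s y + v1"
    have 1: "\<Phi> a a a y v1 = 0" "\<Phi> a y y y v1 = 0" unfolding v1_def add5 scale5 using ea v c0 yya by simp_all
    have "Y0 v2" unfolding Y0_def v2_def add5 scale5 \<phi>_linear using 1 q0 d0 \<phi>_y by simp
    then have "\<Phi> a a a e v2 = 0" using Y0_orthogonal e by blast
    then show ?thesis unfolding v2_def v1_def add5 scale5 using ea ey by simp
  qed
  obtain m where m: "\<And>v. \<Phi> a a a e v = m * \<Phi> a a a y v"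
  proof (cases "\<exists>v. \<Phi> a a a y v \<noteq> 0")
    case True
    then obtain v1 where v1: "\<Phi> a a a y v1 \<noteq> 0" by blast
    have "\<Phi> a a a e v = (\<Phi> a a a e v1 / \<Phi> a a a y v1) * \<Phi> a a a y v" for v
    proof -
      have "\<Phi> a a a e ((- \<Phi> a a a y v / \<Phi> a a a y v1) *s v1 + v) = 0"
        by (rule ker) (unfold add5 scale5, use v1 in simp)
      then have "\<Phi> a a a e v = - ((- \<Phi> a a a y v / \<Phi> a a a y v1) * \<Phi> a a a e v1)"
        unfolding add5 scale5 by (simp only: add_eq_0_iff)
      then show ?thesis by simp
    qed
    then show ?thesis using that by blast
  next
    case False
    then have "\<Phi> a a a e v = 0 * \<Phi> a a a y v" for v using ker by simp
    then show ?thesis using that by blast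
  qed
  define r where "r = (- m) *s y + e"
  have "\<Phi> a a a r w = 0" for w unfolding r_def add4 scale4 m by simp
  moreover have "r \<noteq> c *s a" for c
  proof
    assume rc: "r = c *s a"
    have "\<Phi> a y y y r = 0" unfolding r_def add5 scale5 using e(2) d0 by (simp add: Y0_def)
    then have c: "c = 0" unfolding rc scale5 yya using c0 by simp
    then have "\<phi> r = 0" using rc polyfun_\<phi> by simp
    then have "- m * \<phi> y = 0" unfolding r_def \<phi>_linear using e(2) by (simp add: Y0_def)
    then have "m = 0" using \<phi>_y by simp
    then show False using rc c e(1) by (simp add: r_def)
  qed
  ultimately show ?thesis by blast
qed

text \<open>If y is in the radical, Y0 is cut out by two linear conditions. That leaves room for a
  second isotropic vector outside the line of e (1 + 1 + 2 < 5), and the two span a plane of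
  zeros.\<close>

lemma not_radical:
  assumes rad: "\<And>w. \<Phi> a a a y w = 0"
  shows False
proof -
  obtain e where e: "e \<noteq> 0" "Y0 e" "\<Phi> a a a e e = 0" using Y0_exists by blast
  obtain e' where e': "\<And>c. e' \<noteq> c *s e" "\<Phi> a y y y e' = 0" "\<phi> e' = 0" "\<Phi> a a a e' e' = 0"
    using polyfun_\<phi> chevalley_avoid1[of "[(\<lambda>w. \<Phi> a y y y w, 1), (\<phi>, 1), (\<lambda>w. \<Phi> a a a w w, 2)]" e] e(1) by auto
  have Y: "Y0 e'" using e' rad by (simp add: Y0_def)
  have o: "\<Phi> a a a e e' = 0" "\<Phi> a a a e' e = 0" using Y0_orthogonal[OF e(2,3,1) Y] sym4 by metis+
  have "zero_plane e e'" unfolding zero_plane_def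
  proof (intro allI)
    fix x t
    show "f (x *s e + t *s e') = 0"
      by (rule Y0_zero) (use e Y o e' in \<open>simp_all add: Y0_linear multilinear\<close>)
  qed
  then show False using no_zero_plane indep2I[OF e(1) e'(1)] by blast
qed

end


text \<open>On the totally isotropic span of u and v, \<open>\<Phi> b b b z z\<close> / N takes only
  nonzero square values by \<open>edge_isotropic\<close>. As a quadratic polynomial on the line s u
  + v it would be the square of a linear one, which has a root.\<close>

lemma square_free_binary:
  assumes a: "f a = 0" and b: "f b = 0" "\<And>w. \<Phi> a a a b w = 0" "\<Phi> a a b b b \<noteq> 0"
    and u: "\<Phi> a b b b u = 0" "\<Phi> a a a u u = 0" and v: "\<Phi> a b b b v = 0" "\<Phi> a a a v v = 0" and uv: "\<Phi> a a a u v = 0"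
    and i: "\<And>c d k. c *s u + d *s v = k *s b \<Longrightarrow> c = 0 \<and> d = 0"
  shows False
proof -
  define N where "N = - nonsq * \<Phi> a a b b b"
  have N0: "N \<noteq> 0" using b(3) by (simp add: N_def)
  have sq: "\<exists>n. n \<noteq> 0 \<and> \<Phi> b b b z z = N * n\<^sup>2" if "\<Phi> a a a z z = 0" "\<Phi> a b b b z = 0" "\<And>c. z \<noteq> c *s b" for z
    using edge_isotropic(4)[OF a b(1) b(2) b(3) that(1) b(2) that(2,3)] unfolding N_def by blast
  have nu: "u \<noteq> c *s b" for c using i[of 1 0 c] by auto
  define D where "D = [:\<Phi> b b b v v / N, 2 * \<Phi> b b b u v / N, \<Phi> b b b u u / N:]"
  have val: "\<exists>n. n \<noteq> 0 \<and> poly D s = n\<^sup>2" for s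
  proof -
    have z: "\<Phi> a a a (s *s u + v) (s *s u + v) = 0" unfolding expand2 using u v uv by simp
    have h: "\<Phi> a b b b (s *s u + v) = 0" using u v by (simp add: multilinear)
    have "s *s u + v \<noteq> c *s b" for c using i[of s 1 c] by auto
    then obtain n where n: "n \<noteq> 0" "\<Phi> b b b (s *s u + v) (s *s u + v) = N * n\<^sup>2" using sq[OF z h] by blast
    have "N * poly D s = \<Phi> b b b (s *s u + v) (s *s u + v)" unfolding expand2 D_def using N0 by (simp add: field_simps power2_eq_square)
    then have "N * poly D s = N * n\<^sup>2" unfolding n(2) .
    then show ?thesis using n(1) N0 by auto
  qed
  obtain n where "n \<noteq> 0" "\<Phi> b b b u u = N * n\<^sup>2" using sq[OF u(2,1) nu] by blast
  then have d2: "degree D = 2" using N0 by (simp add: D_def)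
  then have "degree D \<le> 8" by simp
  then obtain h where h: "D = h\<^sup>2" using square_values[of D] val by blast
  then have h0: "h \<noteq> 0" using d2 by auto
  have "degree h = 1" using d2 h0 unfolding h by (simp add: degree_power_eq)
  then obtain t where t: "h = smult (lead_coeff h) [:- t, 1:]" using degree_1_root by blast
  have "poly h t = 0" by (subst t) simp
  then have "poly D t = 0" unfolding h by simp
  then show False using val[of t] by auto
qed

text \<open>Inside the hyperplane \<open>\<Phi> a b b b w\<close> = 0 there are a hyperbolic pair e,
  e' and an orthogonal pair g1, g2 that span no isotropic line modulo b. The isotropic vectors (k1
  s^2 + k2 t^2) e + e' + s g1 + t g2 form a paraboloid on which \<open>\<Phi> b b b z z\<close> / N
  takes only nonzero square values. For each t it is the square of a quadratic in s, which up to
  sign is \<epsilon> k1 s^2 + l1 s + \<epsilon> k2 t^2 + l2 t + m. This conic would have no point,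
  contrary to \<open>affine_conic_zero\<close>.\<close>

lemma radical_zero:
  assumes a: "f a = 0" and b: "f b = 0" "\<And>w. \<Phi> a a a b w = 0" "\<Phi> a a b b b \<noteq> 0"
  shows False
proof -
  have bn: "b \<noteq> 0" using b(3) by auto
  have rad: "\<Phi> a a a w b = 0" for w using b(2) sym4 by metis
  obtain e0 where e0: "\<And>c. e0 \<noteq> c *s b" "\<Phi> a b b b e0 = 0" "\<Phi> a a a e0 e0 = 0"
    using chevalley_avoid1[of "[(\<lambda>w. \<Phi> a b b b w, 1), (\<lambda>w. \<Phi> a a a w w, 2)]" b] bn by auto
  have ie: "indep2 b e0" by (rule indep2I[OF bn e0(1)])
  have "\<exists>w. \<Phi> a b b b w = 0 \<and> \<Phi> a a a e0 w \<noteq> 0"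
  proof (rule ccontr)
    assume no: "\<not> ?thesis"
    have ie': "c *s b + d *s e0 = 0 \<Longrightarrow> c = 0 \<and> d = 0" for c d using ie unfolding indep2_def by blast
    obtain e' where e': "\<And>c d. e' \<noteq> c *s b + d *s e0" "\<Phi> a b b b e' = 0" "\<Phi> a a a e' e' = 0"
      using chevalley_avoid2[of "[(\<lambda>w. \<Phi> a b b b w, 1), (\<lambda>w. \<Phi> a a a w w, 2)]" b e0, OF _ _ ie'] by auto
    show False
    proof (rule square_free_binary[OF a b e0(2,3) e'(2,3)])
      show "\<Phi> a a a e0 e' = 0" using no e'(2) by blast
      fix c d k assume h: "c *s e0 + d *s e' = k *s b"
      have "d = 0"
      proof (rule ccontr)
        assume d: "d \<noteq> 0"
        have "d *s e' = k *s b + (- c) *s e0" using h by (simp add: algebra_simps)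
        then have "inverse d *s (d *s e') = inverse d *s (k *s b + (- c) *s e0)" by simp
        then have "e' = (inverse d * k) *s b + (- (inverse d * c)) *s e0" using d by (simp add: scale_right_distrib scale_right_diff_distrib)
        then show False using e'(1) by blast
      qed
      then have "(- k) *s b + c *s e0 = 0" using h by simp
      then show "c = 0 \<and> d = 0" using ie' \<open>d = 0\<close> by blast
    qed
  qed
  then obtain w where w: "\<Phi> a b b b w = 0" "\<Phi> a a a e0 w \<noteq> 0" by blast
  have two: "(2 :: 'a) \<noteq> 0" by (rule two_neq_0)
  \<comment> \<open>The product of e with w becomes - 1/2, so that the coefficient of e on the
    paraboloid is k1 s^2 + k2 t^2 itself.\<close>
  define e where "e = (- 1 / (2 * \<Phi> a a a e0 w)) *s e0"
  have e: "\<Phi> a b b b e = 0" "\<Phi> a a a e e = 0" and ew: "\<Phi> a a a e w = - 1 / 2"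
    unfolding e_def scale5 scale4 using e0 w two by simp_all
  define c where "c = \<Phi> a a a w w"
  define e' where "e' = c *s e + w"
  have e'H: "\<Phi> a b b b e' = 0" unfolding e'_def add5 scale5 using e w by simp
  have ee': "\<Phi> a a a e e' = - 1 / 2" "\<Phi> a a a e' e = - 1 / 2"
    unfolding e'_def add5 scale5 add4 scale4 using e ew sym4[of a a a w e] by simp_all
  have e'e': "\<Phi> a a a e' e' = 0" unfolding e'_def expand2 using e ew two by (simp add: c_def)
  obtain g1 where g1: "\<And>c. g1 \<noteq> c *s b" "\<Phi> a b b b g1 = 0" "\<Phi> a a a e g1 = 0" "\<Phi> a a a e' g1 = 0"
    using chevalley_avoid1[of "[(\<lambda>w. \<Phi> a b b b w, 1), (\<lambda>w. \<Phi> a a a e w, 1), (\<lambda>w. \<Phi> a a a e' w, 1)]" b] bn by auto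
  have ig: "c *s b + d *s g1 = 0 \<Longrightarrow> c = 0 \<and> d = 0" for c d using indep2I[OF bn g1(1)] unfolding indep2_def by blast
  obtain g0 where g0: "\<And>c d. g0 \<noteq> c *s b + d *s g1" "\<Phi> a b b b g0 = 0" "\<Phi> a a a e g0 = 0" "\<Phi> a a a e' g0 = 0"
    using chevalley_avoid2[of "[(\<lambda>w. \<Phi> a b b b w, 1), (\<lambda>w. \<Phi> a a a e w, 1), (\<lambda>w. \<Phi> a a a e' w, 1)]" b g1, OF _ _ ig] by auto
  have aniso: "\<Phi> a a a g g \<noteq> 0" if g: "\<And>c. g \<noteq> c *s b" "\<Phi> a b b b g = 0" "\<Phi> a a a e g = 0" "\<Phi> a a a e' g = 0" for g
  proof
    assume z: "\<Phi> a a a g g = 0"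
    show False
    proof (rule square_free_binary[OF a b e g(2) z g(3)])
      fix c d k assume h: "c *s e + d *s g = k *s b"
      have "\<Phi> a a a e' (c *s e + d *s g) = 0" unfolding h using rad by (simp add: multilinear)
      then have c: "c = 0" unfolding add5 scale5 g(4) ee' using two by simp
      have "d = 0"
      proof (rule ccontr)
        assume d: "d \<noteq> 0"
        have "inverse d *s (d *s g) = inverse d *s (k *s b)" using h c by simp
        then have "g = (inverse d * k) *s b" using d by simp
        then show False using g(1) by blast
      qed
      then show "c = 0 \<and> d = 0" using c by blast
    qed
  qed
  define k1 where "k1 = \<Phi> a a a g1 g1"
  have k1: "k1 \<noteq> 0" unfolding k1_def by (rule aniso[OF g1])
  define d where "d = - \<Phi> a a a g1 g0 / k1"
  define g2 where "g2 = d *s g1 + g0"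
  have g2: "\<Phi> a b b b g2 = 0" "\<Phi> a a a e g2 = 0" "\<Phi> a a a e' g2 = 0" unfolding g2_def add5 scale5 using g1 g0 by simp_all
  have g2b: "g2 \<noteq> c *s b" for c
  proof
    assume "g2 = c *s b"
    then have "g0 = c *s b + (- d) *s g1" unfolding g2_def by (simp add: algebra_simps)
    then show False using g0(1) by blast
  qed
  define k2 where "k2 = \<Phi> a a a g2 g2"
  have k2: "k2 \<noteq> 0" unfolding k2_def by (rule aniso[OF g2b g2])
  have g12: "\<Phi> a a a g1 g2 = 0" "\<Phi> a a a g2 g1 = 0"
  proof -
    show "\<Phi> a a a g1 g2 = 0" unfolding g2_def add5 scale5 d_def using k1 by (simp add: k1_def)
    then show "\<Phi> a a a g2 g1 = 0" using sym4 by metis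
  qed
  have so: "\<Phi> a a a g1 e = 0" "\<Phi> a a a g1 e' = 0" "\<Phi> a a a g2 e = 0" "\<Phi> a a a g2 e' = 0" using g1 g2 sym4 by metis+
  define N where "N = - nonsq * \<Phi> a a b b b"
  have N0: "N \<noteq> 0" using b(3) by (simp add: N_def)
  have sq: "\<exists>n. n \<noteq> 0 \<and> \<Phi> b b b z z = N * n\<^sup>2" if "\<Phi> a a a z z = 0" "\<Phi> a b b b z = 0" "\<And>c. z \<noteq> c *s b" for z
    using edge_isotropic(4)[OF a b(1) b(2) b(3) that(1) b(2) that(2,3)] unfolding N_def by blast
  define P where "P u v = \<Phi> b b b u v / N" for u v
  have P: "P (u + u') v = P u v + P u' v" "P v (u + u') = P v u + P v u'" "P (c *s u) v = c * P u v" "P v (c *s u) = c * P v u" "P u v = P v u" for u u' v c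
    unfolding P_def by (simp_all add: multilinear add_divide_distrib) (metis sym4)
  have sqP: "\<exists>n. n \<noteq> 0 \<and> P z z = n\<^sup>2" if "\<Phi> a a a z z = 0" "\<Phi> a b b b z = 0" "\<And>c. z \<noteq> c *s b" for z
    using sq[OF that] N0 unfolding P_def by auto
  have "e \<noteq> c *s b" for c
  proof
    assume "e = c *s b"
    then have "\<Phi> a a a e w = 0" using b(2) by (simp add: multilinear)
    then show False using ew two by simp
  qed
  then obtain \<epsilon> where \<epsilon>: "\<epsilon> \<noteq> 0" "P e e = \<epsilon>\<^sup>2" using sqP[OF e(2,1)] by blast
  define l1 l2 where "l1 = P e g1 / \<epsilon>" and "l2 = P e g2 / \<epsilon>"
  have l: "P e g1 = \<epsilon> * l1" "P e g2 = \<epsilon> * l2" using \<epsilon> by (simp_all add: l1_def l2_def)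
  \<comment> \<open>The constant term of the square root, read off from the coefficient of s^2 at t
    = 0.\<close>
  define m where "m = (2 * k1 * P e e' + P g1 g1 - l1\<^sup>2) / (2 * \<epsilon> * k1)"
  have m: "2 * \<epsilon> * k1 * m = 2 * k1 * P e e' + P g1 g1 - l1\<^sup>2" using \<epsilon> k1 two by (simp add: m_def)
  have key: "\<epsilon> * k1 * s\<^sup>2 + l1 * s + \<epsilon> * k2 * t\<^sup>2 + l2 * t + m \<noteq> 0" for s t
  proof -
    define z where "z s = (k1 * s\<^sup>2 + k2 * t\<^sup>2) *s e + (e' + (s *s g1 + t *s g2))" for s
    have zz: "\<Phi> a a a (z s) (z s) = 0" for s
    proof -
      have "\<Phi> a a a (z s) (z s) = 2 * (k1 * s\<^sup>2 + k2 * t\<^sup>2) * (- 1 / 2) + (s\<^sup>2 * k1 + t\<^sup>2 * k2)"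
        unfolding z_def expand2 by (simp add: multilinear e ee' e'e' g1 g2 g12 so k1_def k2_def power2_eq_square algebra_simps)
      then show ?thesis using two by (simp add: algebra_simps)
    qed
    have zH: "\<Phi> a b b b (z s) = 0" for s unfolding z_def using e e'H g1 g2 by (simp add: multilinear)
    have zb: "z s \<noteq> c *s b" for s c
    proof
      assume h: "z s = c *s b"
      have "\<Phi> a a a e (z s) = - 1 / 2" unfolding z_def by (simp add: multilinear e ee' g1 g2)
      then show False unfolding h using rad two by (simp add: multilinear)
    qed
    define D where "D = [:P e e * (k2 * t\<^sup>2)\<^sup>2 + 2 * (k2 * t\<^sup>2) * (P e e' + t * P e g2) + P e' e' + 2 * t * P e' g2 + t\<^sup>2 * P g2 g2,
       2 * (k2 * t\<^sup>2) * P e g1 + 2 * P e' g1 + 2 * t * P g1 g2,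
       2 * P e e * k1 * (k2 * t\<^sup>2) + 2 * k1 * (P e e' + t * P e g2) + P g1 g1, 2 * k1 * P e g1, P e e * k1\<^sup>2:]"
    have pD: "poly D s = P (z s) (z s)" for s
      unfolding D_def z_def using P(5)[of e' e] P(5)[of g1 e] P(5)[of g2 e] P(5)[of g1 e'] P(5)[of g2 e'] P(5)[of g2 g1]
      by (simp add: P(1-4) power2_eq_square algebra_simps)
    have val: "\<exists>n. n \<noteq> 0 \<and> poly D s = n\<^sup>2" for s unfolding pD by (rule sqP[OF zz zH zb])
    have dD: "degree D \<le> 8" by (simp add: D_def degree_pCons_eq_if)
    obtain h where h: "D = h\<^sup>2" using square_values[OF dD] val by blast
    have h0: "h \<noteq> 0" using h \<epsilon> k1 by (auto simp: D_def)
    have "degree D = 4" using \<epsilon> k1 by (simp add: D_def)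
    then have "degree h = 2" using h0 unfolding h by (simp add: degree_power_eq)
    then obtain a0 a1 a2 where hh: "h = [:a0, a1, a2:]"
      by (intro that[of "coeff h 0" "coeff h 1" "coeff h 2"] poly_eqI)
         (auto simp: coeff_pCons coeff_eq_0 eval_nat_numeral split: nat.splits)
    have co: "coeff D j = coeff ([:a0, a1, a2:] * [:a0, a1, a2:]) j" for j unfolding h hh by (simp only: power2_eq_square)
    have c4: "(\<epsilon> * k1)\<^sup>2 = a2\<^sup>2" using co[of 4] unfolding D_def \<epsilon> by (simp add: eval_nat_numeral algebra_simps)
    have c3: "2 * k1 * (\<epsilon> * l1) = 2 * a1 * a2" using co[of 3] unfolding D_def l by (simp add: eval_nat_numeral algebra_simps)
    have c2: "2 * \<epsilon>\<^sup>2 * k1 * (k2 * t\<^sup>2) + 2 * k1 * (P e e' + t * (\<epsilon> * l2)) + P g1 g1 = 2 * a0 * a2 + a1\<^sup>2"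
      using co[of 2] unfolding D_def \<epsilon> l by (simp add: eval_nat_numeral algebra_simps)
    \<comment> \<open>The three highest coefficients of D determine its square root up to the sign
      \<sigma>.\<close>
    obtain \<sigma> :: 'a where \<sigma>: "\<sigma> = 1 \<or> \<sigma> = - 1" "a2 = \<sigma> * (\<epsilon> * k1)"
    proof (cases "\<epsilon> * k1 = a2")
      case True
      then show ?thesis using that[of 1] by simp
    next
      case False
      then have "\<epsilon> * k1 = - a2" using c4 by (simp add: power2_eq_iff)
      then show ?thesis using that[of "- 1"] by simp
    qed
    have s1: "\<sigma> * \<sigma> = 1" using \<sigma>(1) by auto
    have ek: "\<epsilon> * k1 \<noteq> 0" "2 * (\<epsilon> * k1) \<noteq> 0" using \<epsilon> k1 two by simp_all
    have "(\<epsilon> * k1) * (2 * l1) = (\<epsilon> * k1) * (2 * (\<sigma> * a1))" using c3 unfolding \<sigma>(2) by (simp add: algebra_simps)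
    then have "l1 = \<sigma> * a1" using ek(1) two mult_left_cancel by blast
    then have a1: "a1 = \<sigma> * l1" using s1 by (simp add: mult.assoc[symmetric])
    have sl: "(\<sigma> * l1)\<^sup>2 = l1\<^sup>2" using \<sigma>(1) by auto
    have "(2 * (\<epsilon> * k1)) * (\<sigma> * a0) = 2 * \<epsilon>\<^sup>2 * k1 * (k2 * t\<^sup>2) + 2 * k1 * (t * (\<epsilon> * l2)) + (2 * k1 * P e e' + P g1 g1 - l1\<^sup>2)"
    proof -
      have "2 * a0 * a2 = 2 * \<epsilon>\<^sup>2 * k1 * (k2 * t\<^sup>2) + 2 * k1 * (P e e' + t * (\<epsilon> * l2)) + P g1 g1 - l1\<^sup>2"
        using c2 unfolding a1 sl by (simp add: algebra_simps)
      then show ?thesis unfolding \<sigma>(2) by (simp add: algebra_simps)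
    qed
    also have "\<dots> = (2 * (\<epsilon> * k1)) * (\<epsilon> * k2 * t\<^sup>2 + l2 * t + m)" unfolding m[symmetric] by (simp add: power2_eq_square algebra_simps)
    finally have "\<sigma> * a0 = \<epsilon> * k2 * t\<^sup>2 + l2 * t + m" using ek(2) mult_left_cancel by blast
    then have a0: "\<sigma> * a0 = \<epsilon> * k2 * t\<^sup>2 + l2 * t + m" .
    have sa: "\<sigma> * a1 = l1" "\<sigma> * a2 = \<epsilon> * k1" unfolding a1 \<sigma>(2) using s1 by (simp_all add: mult.assoc[symmetric])
    have "\<sigma> * poly h s = (\<sigma> * a2) * s\<^sup>2 + (\<sigma> * a1) * s + \<sigma> * a0" unfolding hh by (simp add: power2_eq_square algebra_simps)
    also have "\<dots> = \<epsilon> * k1 * s\<^sup>2 + l1 * s + \<epsilon> * k2 * t\<^sup>2 + l2 * t + m" unfolding sa a0 by (simp add: algebra_simps)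
    finally have "\<sigma> * poly h s = \<epsilon> * k1 * s\<^sup>2 + l1 * s + \<epsilon> * k2 * t\<^sup>2 + l2 * t + m" .
    moreover have "poly h s \<noteq> 0" using val[of s] unfolding h by auto
    ultimately show ?thesis using \<sigma>(1) by auto
  qed
  have "\<epsilon> * k1 \<noteq> 0" "\<epsilon> * k2 \<noteq> 0" using \<epsilon> k1 k2 by simp_all
  then show False using affine_conic_zero[of "\<epsilon> * k1" "\<epsilon> * k2" l1 l2 m] key by blast
qed

text \<open>A shift by s a changes \<open>\<Phi> a y y y y\<close> by 4 s
  \<open>\<Phi> a a y y y\<close> and leaves the quadratic and cubic expressions at a
  unchanged.\<close>

lemma normalize:
  assumes a: "f a = 0" and y: "\<Phi> a a a y y = 0" "\<Phi> a a y y y \<noteq> 0"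
  obtains s where "\<Phi> a (s *s a + y) (s *s a + y) (s *s a + y) (s *s a + y) = 0"
    "\<Phi> a a (s *s a + y) (s *s a + y) (s *s a + y) = \<Phi> a a y y y" "\<Phi> a a a (s *s a + y) w = \<Phi> a a a y w"
    "\<Phi> a a a (s *s a + y) (s *s a + y) = 0"
proof -
  have z: "\<Phi> a a a a w = 0" for w by (rule singular[OF a])
  define s where "s = - \<Phi> a y y y y / (4 * \<Phi> a a y y y)"
  show ?thesis
  proof (rule that[of s])
    show "\<Phi> a (s *s a + y) (s *s a + y) (s *s a + y) (s *s a + y) = 0"
      unfolding expand4 z y(1) using y(2) by (simp add: s_def)
    show "\<Phi> a a (s *s a + y) (s *s a + y) (s *s a + y) = \<Phi> a a y y y" unfolding expand3 z y(1) by simp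
    show "\<Phi> a a a (s *s a + y) w = \<Phi> a a a y w" unfolding add4 scale4 z by simp
    show "\<Phi> a a a (s *s a + y) (s *s a + y) = 0" unfolding expand2 z y(1) by simp
  qed
qed

text \<open>The edge yields a vector z as required for \<open>radical_vector\<close>. The resulting
  r has \<open>\<Phi> a a r r r\<close> \<noteq> 0, or else a and r would span a plane of zeros.
  Once normalised it is either a zero, against \<open>radical_zero\<close>, or not, against
  \<open>not_radical\<close>.\<close>

lemma no_edge:
  assumes a: "f a = 0" and b: "f b = 0" and e: "\<Phi> a a a b b = 0" "\<Phi> a a b b b \<noteq> 0"
  shows False
proof -
  have a0: "a \<noteq> 0" and bn: "b \<noteq> 0" using e by auto
  have z4: "\<Phi> a a a a w = 0" for w by (rule singular[OF a])
  obtain z where z: "\<And>c. z \<noteq> c *s b" "\<Phi> a a a z z = 0" "\<Phi> a a a b z = 0" "\<Phi> a b b b z = 0"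
    using chevalley_avoid1[of "[(\<lambda>w. \<Phi> a a a w w, 2), (\<lambda>w. \<Phi> a a a b w, 1), (\<lambda>w. \<Phi> a b b b w, 1)]" b] bn by auto
  note ei = edge_isotropic[OF a b e z(2,3,4,1)]
  obtain r where r: "\<And>w. \<Phi> a a a r w = 0" "\<And>c. r \<noteq> c *s a" using radical_vector[OF a z(2) ei(1,2,3)] by blast
  have Cr: "\<Phi> a a r r r \<noteq> 0"
  proof
    assume C: "\<Phi> a a r r r = 0"
    have br: "\<Phi> a a a b r = 0" using r(1) sym4 by metis
    obtain \<beta>0 \<beta>1 n0 n1 where
      "\<And>t. \<Phi> a (t *s b + r) (t *s b + r) (t *s b + r) (t *s b + r) = 4 * \<Phi> a a (t *s b + r) (t *s b + r) (t *s b + r) * (\<beta>0 + \<beta>1 * t)"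
      "\<And>t. f (t *s b + r) = 10 * \<Phi> a a (t *s b + r) (t *s b + r) (t *s b + r) * ((\<beta>0 + \<beta>1 * t)\<^sup>2 - nonsq * (n0 + n1 * t)\<^sup>2)"
      using isotropic_line[OF a e(1) br r(1) e(2)] by metis
    from this(1)[of 0] this(2)[of 0] have "\<Phi> a r r r r = 0" "f r = 0" using C by simp_all
    then show False using no_flat[OF a indep2I[OF a0 r(2)] r(1) C] by blast
  qed
  obtain s where s: "\<Phi> a (s *s a + r) (s *s a + r) (s *s a + r) (s *s a + r) = 0"
    "\<Phi> a a (s *s a + r) (s *s a + r) (s *s a + r) = \<Phi> a a r r r" using normalize[OF a r(1) Cr] by metis
  define \<rho> where "\<rho> = s *s a + r"
  have \<rho>: "\<Phi> a \<rho> \<rho> \<rho> \<rho> = 0" "\<Phi> a a \<rho> \<rho> \<rho> \<noteq> 0" "\<And>w. \<Phi> a a a \<rho> w = 0"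
    using s Cr unfolding \<rho>_def by (simp_all add: add4 scale4 r(1) z4)
  show False
  proof (cases "f \<rho> = 0")
    case True
    then show False using radical_zero[OF a _ \<rho>(3,2)] by blast
  next
    case False
    then show False using not_radical[OF a \<rho>(3) \<rho>(2,1) _ \<rho>(3)] by blast
  qed
qed

text \<open>v1 and v2 span a complement of the common kernel, so a linear identity needs to be
  checked only on the kernel and on these two vectors.\<close>

lemma kernel_complement:
  assumes l: "\<And>x y. l1 (x + y) = l1 x + l1 y" "\<And>c x. l1 (c *s x) = c * l1 x"
      "\<And>x y. l2 (x + y) = l2 x + l2 y" "\<And>c x. l2 (c *s x) = c * l2 x"
  shows "\<exists>v1 v2. \<forall>x. \<exists>c d. l1 (x + c *s v1 + d *s v2) = 0 \<and> l2 (x + c *s v1 + d *s (v2 :: 'v)) = (0 :: 'a)"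
proof -
  have one: "\<exists>v. \<forall>x. l1 x = 0 \<longrightarrow> (\<exists>d. l1 (x + d *s v) = 0 \<and> l2 (x + d *s v) = 0)"
  proof (cases "\<exists>v. l1 v = 0 \<and> l2 v \<noteq> 0")
    case True
    then obtain v where v: "l1 v = 0" "l2 v \<noteq> 0" by blast
    have "l1 (x + (- l2 x / l2 v) *s v) = 0 \<and> l2 (x + (- l2 x / l2 v) *s v) = 0" if "l1 x = 0" for x
      unfolding l using v that by simp
    then show ?thesis by blast
  next
    case False
    then have "l1 x = 0 \<longrightarrow> l1 (x + 0 *s 0) = 0 \<and> l2 (x + 0 *s 0) = 0" for x by auto
    then show ?thesis by blast
  qed
  then obtain v2 where v2: "\<And>x. l1 x = 0 \<Longrightarrow> \<exists>d. l1 (x + d *s v2) = 0 \<and> l2 (x + d *s v2) = 0" by blast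
  show ?thesis
  proof (cases "\<exists>v. l1 v \<noteq> 0")
    case True
    then obtain v where v: "l1 v \<noteq> 0" by blast
    have A: "l1 (x + (- l1 x / l1 v) *s v) = 0" for x unfolding l using v by simp
    show ?thesis
    proof (rule exI[of _ v], rule exI[of _ v2], rule allI)
      fix x
      show "\<exists>c d. l1 (x + c *s v + d *s v2) = 0 \<and> l2 (x + c *s v + d *s v2) = 0"
        by (rule exI[of _ "- l1 x / l1 v"]) (rule v2[OF A])
    qed
  next
    case False
    then have A: "\<exists>d. l1 (x + 0 *s 0 + d *s v2) = 0 \<and> l2 (x + 0 *s 0 + d *s v2) = 0" for x using v2[of x] by simp
    show ?thesis
    proof (rule exI[of _ 0], rule exI[of _ v2], rule allI)
      fix x
      show "\<exists>c d. l1 (x + c *s 0 + d *s v2) = 0 \<and> l2 (x + c *s 0 + d *s v2) = 0"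
        by (rule exI[of _ 0]) (rule A)
    qed
  qed
qed

section \<open>The contradiction\<close>

theorem inconsistent: False
proof -
  obtain a where a0: "a \<noteq> 0" and a: "f a = 0" using chevalley_zero[of "[(\<lambda>y. f y, 5)]"] by auto
  have z4: "\<Phi> a a a a w = 0" "\<Phi> a a a w a = 0" for w using singular[OF a] sym4 by metis+
  \<comment> \<open>Any second zero forms an edge with a in one of the two orientations. From here
    on the zero is unique up to scalars.\<close>
  have Z: "\<exists>c. w = c *s a" if "f w = 0" for w
  proof (rule ccontr)
    assume "\<not> ?thesis"
    then have i: "indep2 a w" using indep2I[OF a0] by blast
    have "\<Phi> w w w a a = \<Phi> a a w w w" "\<Phi> w w a a a = \<Phi> a a a w w" by (rule swap23, rule swap23[symmetric])
    note sw = this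
    from edge_cases[OF a that i] show False
    proof
      assume "\<Phi> a a a w w = 0 \<and> \<Phi> a a w w w \<noteq> 0"
      then show False using no_edge[OF a that] by blast
    next
      assume "\<Phi> a a a w w \<noteq> 0 \<and> \<Phi> a a w w w = 0"
      then show False using no_edge[OF that a] unfolding sw by blast
    qed
  qed
  \<comment> \<open>Otherwise \<open>Y0_exists\<close> produces a zero that is no multiple of
    a.\<close>
  have C: "\<Phi> a a y y y = 0" if y: "\<Phi> a a a y y = 0" "\<And>c. y \<noteq> c *s a" for y
  proof (rule ccontr)
    assume C: "\<Phi> a a y y y \<noteq> 0"
    obtain s where s: "\<Phi> a (s *s a + y) (s *s a + y) (s *s a + y) (s *s a + y) = 0"
      "\<Phi> a a (s *s a + y) (s *s a + y) (s *s a + y) = \<Phi> a a y y y" "\<Phi> a a a (s *s a + y) (s *s a + y) = 0"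
      using normalize[OF a y(1) C] by metis
    have "f (s *s a + y) \<noteq> 0"
    proof
      assume "f (s *s a + y) = 0"
      then obtain c where "s *s a + y = c *s a" using Z by blast
      then have "y = (c - s) *s a" by (simp add: scale_left_diff_distrib algebra_simps)
      then show False using y(2) by blast
    qed
    then obtain e where "f e = 0" "\<forall>c. e \<noteq> c *s a" using Y0_exists[OF a s(3) _ s(1)] s(2) C by auto
    then show False using Z by blast
  qed
  have DE: "\<Phi> a y y y y = 0" "f y \<noteq> 0" if y: "\<Phi> a a a y y = 0" "\<And>c. y \<noteq> c *s a" for y
  proof -
    show "f y \<noteq> 0" using Z y(2) by blast
    show "\<Phi> a y y y y = 0"
    proof (rule ccontr)
      assume D: "\<Phi> a y y y y \<noteq> 0"
      define x where "x = - f y / (5 * \<Phi> a y y y y)"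
      have "f (x *s a + y) = 0" unfolding singular_zero(2)[OF a] y(1) C[OF y] using D by (simp add: x_def)
      then obtain c where "x *s a + y = c *s a" using Z by blast
      then have "y = (c - x) *s a" by (simp add: scale_left_diff_distrib algebra_simps)
      then show False using y(2) by blast
    qed
  qed
  \<comment> \<open>The form at x a + v y + z is cubic in x, with coefficients of degree at most 1,
    at most 3 and exactly 5 in v. \<open>cubic_family\<close> supplies a zero; it is no multiple of
    a, since its product with z is \<open>\<Phi> a a a z z\<close> \<noteq> 0.\<close>
  have NK: "\<Phi> a a a z z = 0" if y: "\<Phi> a a a y y = 0" "\<And>c. y \<noteq> c *s a" and z: "\<Phi> a a a y z = 0" "\<Phi> a a y y z = 0" for y z
  proof (rule ccontr)
    assume k: "\<Phi> a a a z z \<noteq> 0"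
    define p2 p1 p0 where "p2 = [:10 * \<Phi> a a z z z, 30 * \<Phi> a a y z z:]"
      and "p1 = [:5 * \<Phi> a z z z z, 20 * \<Phi> a y z z z, 30 * \<Phi> a y y z z, 20 * \<Phi> a y y y z:]"
      and "p0 = [:f z, 5 * \<Phi> y z z z z, 10 * \<Phi> y y z z z, 10 * \<Phi> y y y z z, 5 * \<Phi> y y y y z, f y:]"
    have "\<exists>v x. (10 * \<Phi> a a a z z) * x ^ 3 + poly p2 v * x\<^sup>2 + poly p1 v * x + poly p0 v = 0"
    proof (rule cubic_family)
      show "10 * \<Phi> a a a z z \<noteq> 0" using k by simp
      show "degree p2 \<le> 1" "degree p1 \<le> 3" by (simp_all add: p2_def p1_def degree_pCons_eq_if)
      show "degree p0 = 5" using DE(2)[OF y] by (simp add: p0_def)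
    qed
    then obtain v x where vx: "(10 * \<Phi> a a a z z) * x ^ 3 + poly p2 v * x\<^sup>2 + poly p1 v * x + poly p0 v = 0" by blast
    have "f (x *s a + (v *s y + z)) = (10 * \<Phi> a a a z z) * x ^ 3 + poly p2 v * x\<^sup>2 + poly p1 v * x + poly p0 v"
      unfolding singular_zero(2)[OF a] unfolding expand5 unfolding expand4 unfolding expand3 unfolding expand2
      unfolding y(1) z C[OF y] DE(1)[OF y] p2_def p1_def p0_def by (simp add: eval_nat_numeral algebra_simps)
    then have "f (x *s a + (v *s y + z)) = 0" using vx by (rule trans)
    then obtain c where c: "x *s a + (v *s y + z) = c *s a" using Z by blast
    have zy: "\<Phi> a a a z y = 0" using z(1) sym4 by metis
    have "\<Phi> a a a z (x *s a + (v *s y + z)) = \<Phi> a a a z z" by (simp add: multilinear z4 zy)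
    moreover have "\<Phi> a a a z (c *s a) = 0" by (simp add: multilinear z4)
    ultimately show False using k c by simp
  qed
  obtain v where v: "\<Phi> a a a v v \<noteq> 0" using not_isotropic[OF a a0] by blast
  obtain y where y: "\<And>c. y \<noteq> c *s a" "\<Phi> a a a y y = 0" using chevalley_avoid1[of "[(\<lambda>w. \<Phi> a a a w w, 2)]" a] a0 by auto
  obtain v1 v2 where v12: "\<And>x. \<exists>c d. \<Phi> a a a y (x + c *s v1 + d *s v2) = 0 \<and> \<Phi> a a y y (x + c *s v1 + d *s v2) = 0"
    using kernel_complement[of "\<lambda>x. \<Phi> a a a y x" "\<lambda>x. \<Phi> a a y y x"] by (auto simp: add5 scale5)
  \<comment> \<open>By \<open>NK\<close> the common kernel of the two linear forms attached to y is
    totally isotropic. A vector r in it that is also orthogonal to the complement v1, v2 lies in the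
    radical.\<close>
  obtain r where r: "\<And>c. r \<noteq> c *s a" "\<Phi> a a a y r = 0" "\<Phi> a a y y r = 0" "\<Phi> a a a v1 r = 0" "\<Phi> a a a v2 r = 0"
    using chevalley_avoid1[of "[(\<lambda>w. \<Phi> a a a y w, 1), (\<lambda>w. \<Phi> a a y y w, 1), (\<lambda>w. \<Phi> a a a v1 w, 1), (\<lambda>w. \<Phi> a a a v2 w, 1)]" a] a0 by auto
  have rr: "\<Phi> a a a r r = 0" by (rule NK[OF y(2,1) r(2,3)])
  have rad: "\<Phi> a a a r x = 0" for x
  proof -
    obtain c d where cd: "\<Phi> a a a y (x + c *s v1 + d *s v2) = 0" "\<Phi> a a y y (x + c *s v1 + d *s v2) = 0" using v12 by blast
    define t where "t = x + c *s v1 + d *s v2"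
    have t: "\<Phi> a a a t t = 0" using NK[OF y(2,1)] cd unfolding t_def by blast
    have "\<Phi> a a a (1 *s r + t) (1 *s r + t) = 0"
      by (rule NK[OF y(2,1)]) (use r cd in \<open>simp_all add: t_def multilinear\<close>)
    then have "2 * \<Phi> a a a r t = 0" unfolding expand2 rr t by simp
    then have "\<Phi> a a a r t = 0" using two_neq_0[where ?'a='a] by simp
    moreover have "\<Phi> a a a r v1 = 0" "\<Phi> a a a r v2 = 0" using r(4,5) sym4 by metis+
    ultimately show ?thesis unfolding t_def by (simp add: multilinear)
  qed
  \<comment> \<open>\<open>NK\<close> is applied twice: with r and u it makes u isotropic, with u
    and v it contradicts the choice of v. The degrees 1 + 1 + 2 just fit the budget when multiples
    of a are avoided.\<close>
  obtain u where u: "\<And>c. u \<noteq> c *s a" "\<Phi> a a r r u = 0" "\<Phi> a a a v u = 0" "\<Phi> a a v u u = 0"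
    using chevalley_avoid1[of "[(\<lambda>w. \<Phi> a a r r w, 1), (\<lambda>w. \<Phi> a a a v w, 1), (\<lambda>w. \<Phi> a a v w w, 2)]" a] a0 by auto
  have uu: "\<Phi> a a a u u = 0" by (rule NK[OF rr r(1) rad u(2)])
  have "\<Phi> a a a u v = 0" "\<Phi> a a u u v = 0" using u(3,4) sym3 sym4 by metis+
  then show False using NK[OF uu u(1), of v] v by blast
qed

end

section \<open>Integral forms over a commutative ring\<close>

definition mon_val :: "(nat \<Rightarrow> 'r :: comm_ring_1) \<Rightarrow> (nat \<Rightarrow>\<^sub>0 nat) \<Rightarrow> 'r" where
  "mon_val x \<alpha> = (\<Prod>i\<in>Poly_Mapping.keys \<alpha>. x i ^ Poly_Mapping.lookup \<alpha> i)"

text \<open>Evaluation in any commutative ring; it is used for the integers, for the prime field,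
  and for integer polynomials when a form is restricted to a line.\<close>

definition zpoly_val :: "zpoly \<Rightarrow> (nat \<Rightarrow> 'r :: comm_ring_1) \<Rightarrow> 'r" where
  "zpoly_val F x = (\<Sum>\<alpha>\<in>Poly_Mapping.keys F. of_int (Poly_Mapping.lookup F \<alpha>) * mon_val x \<alpha>)"

lemma zeval_eq: "zeval F x = zpoly_val F x"
  by (simp add: zeval_def zpoly_val_def mon_val_def)

lemma mon_val_superset:
  assumes "finite S" "Poly_Mapping.keys \<alpha> \<subseteq> S"
  shows "mon_val x \<alpha> = (\<Prod>i\<in>S. x i ^ Poly_Mapping.lookup \<alpha> i)"
  unfolding mon_val_def using assms by (intro prod.mono_neutral_left) (auto simp: in_keys_iff)

lemma mon_val_add: "mon_val x (\<alpha> + \<beta>) = mon_val x \<alpha> * mon_val x \<beta>"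
proof -
  let ?S = "Poly_Mapping.keys \<alpha> \<union> Poly_Mapping.keys \<beta>"
  have "mon_val x (\<alpha> + \<beta>) = (\<Prod>i\<in>?S. x i ^ Poly_Mapping.lookup (\<alpha> + \<beta>) i)"
    by (intro mon_val_superset) (use Poly_Mapping.keys_add[of \<alpha> \<beta>] in auto)
  also have "\<dots> = (\<Prod>i\<in>?S. x i ^ Poly_Mapping.lookup \<alpha> i) * (\<Prod>i\<in>?S. x i ^ Poly_Mapping.lookup \<beta> i)"
    by (simp add: lookup_add power_add prod.distrib)
  also have "\<dots> = mon_val x \<alpha> * mon_val x \<beta>" by (simp add: mon_val_superset[of ?S])
  finally show ?thesis .
qed

lemma zpoly_val_superset:
  assumes "finite S" "Poly_Mapping.keys F \<subseteq> S"
  shows "zpoly_val F x = (\<Sum>\<alpha>\<in>S. of_int (Poly_Mapping.lookup F \<alpha>) * mon_val x \<alpha>)"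
  unfolding zpoly_val_def using assms by (intro sum.mono_neutral_left) (auto simp: in_keys_iff)

lemma zpoly_val_0 [simp]: "zpoly_val 0 x = 0"
  by (simp add: zpoly_val_def)

lemma zpoly_val_add: "zpoly_val (F + G) x = zpoly_val F x + zpoly_val G x"
proof -
  let ?S = "Poly_Mapping.keys F \<union> Poly_Mapping.keys G"
  have "zpoly_val (F + G) x = (\<Sum>\<alpha>\<in>?S. of_int (Poly_Mapping.lookup (F + G) \<alpha>) * mon_val x \<alpha>)"
    by (intro zpoly_val_superset) (use Poly_Mapping.keys_add[of F G] in auto)
  also have "\<dots> = zpoly_val F x + zpoly_val G x"
    by (simp add: lookup_add distrib_right sum.distrib zpoly_val_superset[of ?S])
  finally show ?thesis .
qed

lemma zpoly_val_sum: "zpoly_val (\<Sum>i\<in>A. F i) x = (\<Sum>i\<in>A. zpoly_val (F i) x)"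
  by (induction A rule: infinite_finite_induct) (simp_all add: zpoly_val_add)

lemma zpoly_val_single: "zpoly_val (Poly_Mapping.single \<alpha> c) x = of_int c * mon_val x \<alpha>"
  by (simp add: zpoly_val_def)

lemma zpoly_eq_sum: "(F :: zpoly) = (\<Sum>\<alpha>\<in>Poly_Mapping.keys F. Poly_Mapping.single \<alpha> (Poly_Mapping.lookup F \<alpha>))"
proof (rule poly_mapping_eqI)
  fix \<beta>
  have "Poly_Mapping.lookup (\<Sum>\<alpha>\<in>Poly_Mapping.keys F. Poly_Mapping.single \<alpha> (Poly_Mapping.lookup F \<alpha>)) \<beta> =
      (\<Sum>\<alpha>\<in>Poly_Mapping.keys F. if \<alpha> = \<beta> then Poly_Mapping.lookup F \<beta> else 0)"
    unfolding lookup_sum by (intro sum.cong) (auto simp: lookup_single when_def)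
  also have "\<dots> = Poly_Mapping.lookup F \<beta>" by (simp add: in_keys_iff)
  finally show "Poly_Mapping.lookup F \<beta> = Poly_Mapping.lookup (\<Sum>\<alpha>\<in>Poly_Mapping.keys F. Poly_Mapping.single \<alpha> (Poly_Mapping.lookup F \<alpha>)) \<beta>" by simp
qed

lemma zpoly_val_mult: "zpoly_val (F * G) x = zpoly_val F x * zpoly_val G x"
proof -
  have "F * G = (\<Sum>\<alpha>\<in>Poly_Mapping.keys F. \<Sum>\<beta>\<in>Poly_Mapping.keys G.
      Poly_Mapping.single (\<alpha> + \<beta>) (Poly_Mapping.lookup F \<alpha> * Poly_Mapping.lookup G \<beta>))"
    by (subst zpoly_eq_sum[of F], subst zpoly_eq_sum[of G]) (simp add: sum_product mult_single)
  then have "zpoly_val (F * G) x = (\<Sum>\<alpha>\<in>Poly_Mapping.keys F. \<Sum>\<beta>\<in>Poly_Mapping.keys G.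
      (of_int (Poly_Mapping.lookup F \<alpha>) * mon_val x \<alpha>) * (of_int (Poly_Mapping.lookup G \<beta>) * mon_val x \<beta>))"
    by (simp add: zpoly_val_sum zpoly_val_single mon_val_add mult_ac)
  then show ?thesis by (simp add: zpoly_val_def sum_product)
qed

lemma zpoly_val_1 [simp]: "zpoly_val 1 x = 1"
  using zpoly_val_single[of 0 1 x] by (simp add: mon_val_def)

lemma zpoly_val_power: "zpoly_val (F ^ k) x = zpoly_val F x ^ k"
  by (induction k) (simp_all add: zpoly_val_mult)

lemma zpoly_val_prod: "zpoly_val (\<Prod>i\<in>A. F i) x = (\<Prod>i\<in>A. zpoly_val (F i) x)"
  by (induction A rule: infinite_finite_induct) (simp_all add: zpoly_val_mult)

lemma zpoly_val_lin_subst: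
  "zpoly_val (lin_subst n A F) x = zpoly_val F (\<lambda>i. \<Sum>j<n. of_int (A i j) * x j)"
proof -
  have c: "zpoly_val (zConst k) x = of_int k" for k
    unfolding zConst_def zpoly_val_single by (simp add: mon_val_def)
  have v: "zpoly_val (zVar j) x = x j" for j
    unfolding zVar_def zpoly_val_single by (simp add: mon_val_def)
  show ?thesis unfolding lin_subst_def zpoly_val_sum zpoly_val_mult zpoly_val_prod zpoly_val_power c v
    by (simp add: zpoly_val_def mon_val_def)
qed

text \<open>After a linear substitution only the variables and the single exponents are tracked;
  this is what recovering coefficients from values requires.\<close>

definition form_bound :: "nat \<Rightarrow> nat \<Rightarrow> zpoly \<Rightarrow> bool" where
  "form_bound n d P \<longleftrightarrow> (\<forall>\<alpha>\<in>Poly_Mapping.keys P. Poly_Mapping.keys \<alpha> \<subseteq> {..<n} \<and> (\<forall>i. Poly_Mapping.lookup \<alpha> i \<le> d))"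

lemma form_bound_add: "form_bound n d P \<Longrightarrow> form_bound n d Q \<Longrightarrow> form_bound n d (P + Q)"
  unfolding form_bound_def using Poly_Mapping.keys_add[of P Q] by blast

lemma form_bound_sum: "(\<And>i. i \<in> A \<Longrightarrow> form_bound n d (P i)) \<Longrightarrow> form_bound n d (\<Sum>i\<in>A. P i)"
proof (induction A rule: infinite_finite_induct)
  case (insert i A)
  have "form_bound n d (P i + (\<Sum>i\<in>A. P i))"
    by (rule form_bound_add) (use insert in simp_all)
  then show ?case using insert by simp
qed (simp_all add: form_bound_def)

lemma form_bound_mult: "form_bound n d P \<Longrightarrow> form_bound n e Q \<Longrightarrow> form_bound n (d + e) (P * Q)"
  unfolding form_bound_def
proof
  fix \<gamma> assume P: "\<forall>\<alpha>\<in>Poly_Mapping.keys P. Poly_Mapping.keys \<alpha> \<subseteq> {..<n} \<and> (\<forall>i. Poly_Mapping.lookup \<alpha> i \<le> d)"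
    and Q: "\<forall>\<alpha>\<in>Poly_Mapping.keys Q. Poly_Mapping.keys \<alpha> \<subseteq> {..<n} \<and> (\<forall>i. Poly_Mapping.lookup \<alpha> i \<le> e)"
    and "\<gamma> \<in> Poly_Mapping.keys (P * Q)"
  then obtain \<alpha> \<beta> where ab: "\<alpha> \<in> Poly_Mapping.keys P" "\<beta> \<in> Poly_Mapping.keys Q" "\<gamma> = \<alpha> + \<beta>"
    using keys_mult[of P Q] by blast
  then show "Poly_Mapping.keys \<gamma> \<subseteq> {..<n} \<and> (\<forall>i. Poly_Mapping.lookup \<gamma> i \<le> d + e)"
    using P[rule_format, OF ab(1)] Q[rule_format, OF ab(2)] Poly_Mapping.keys_add[of \<alpha> \<beta>]
    by (auto simp: lookup_add intro!: add_mono)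
qed

lemma form_bound_const: "form_bound n 0 (zConst c)"
  unfolding form_bound_def zConst_def by auto

lemma form_bound_1: "form_bound n 0 1"
  using form_bound_const[of n 1] unfolding zConst_def by simp

lemma form_bound_power: "form_bound n d P \<Longrightarrow> form_bound n (k * d) (P ^ k)"
proof (induction k)
  case (Suc k)
  have "form_bound n (d + k * d) (P * P ^ k)" by (rule form_bound_mult) (use Suc in simp_all)
  then show ?case by simp
qed (simp add: form_bound_1)

lemma form_bound_prod: "(\<And>i. i \<in> A \<Longrightarrow> form_bound n (d i) (P i)) \<Longrightarrow> form_bound n (\<Sum>i\<in>A. d i) (\<Prod>i\<in>A. P i)"
proof (induction A rule: infinite_finite_induct)
  case (insert i A)
  have "form_bound n (d i + (\<Sum>i\<in>A. d i)) (P i * (\<Prod>i\<in>A. P i))"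
    by (rule form_bound_mult) (use insert in simp_all)
  then show ?case using insert by simp
qed (simp_all add: form_bound_1)

lemma form_bound_lin_subst:
  assumes "is_int_form n 5 F"
  shows "form_bound n 5 (lin_subst n A F)"
  unfolding lin_subst_def
proof (rule form_bound_sum)
  fix \<alpha> assume "\<alpha> \<in> Poly_Mapping.keys F"
  then have deg: "(\<Sum>i\<in>Poly_Mapping.keys \<alpha>. Poly_Mapping.lookup \<alpha> i * 1) = 5"
    using assms unfolding is_int_form_def mon_deg_def by simp
  have v: "form_bound n 1 (zVar j)" if "j < n" for j
    using that unfolding form_bound_def zVar_def by (auto simp: lookup_single when_def)
  have "form_bound n (0 + (\<Sum>i\<in>Poly_Mapping.keys \<alpha>. Poly_Mapping.lookup \<alpha> i * 1)) (zConst (Poly_Mapping.lookup F \<alpha>) *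
      (\<Prod>i\<in>Poly_Mapping.keys \<alpha>. (\<Sum>j<n. zConst (A i j) * zVar j) ^ Poly_Mapping.lookup \<alpha> i))"
  proof (intro form_bound_mult form_bound_const form_bound_prod form_bound_power form_bound_sum)
    fix i j assume "j \<in> {..<n}"
    then show "form_bound n 1 (zConst (A i j) * zVar j)"
      using form_bound_mult[OF form_bound_const v] by simp
  qed
  then show "form_bound n 5 (zConst (Poly_Mapping.lookup F \<alpha>) *
      (\<Prod>i\<in>Poly_Mapping.keys \<alpha>. (\<Sum>j<n. zConst (A i j) * zVar j) ^ Poly_Mapping.lookup \<alpha> i))"
    unfolding deg by simp
qed

text \<open>Coefficients are recovered from values by summing against complementary monomials.\<close>

lemma coefficients_eq_0:
  fixes c :: "(nat \<Rightarrow>\<^sub>0 nat) \<Rightarrow> 'a :: big_prime_field"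
  assumes S: "finite S" "\<And>\<alpha>. \<alpha> \<in> S \<Longrightarrow> Poly_Mapping.keys \<alpha> \<subseteq> {..<n} \<and> (\<forall>i. Poly_Mapping.lookup \<alpha> i \<le> 5)"
    and z: "\<And>x. (\<Sum>\<alpha>\<in>S. c \<alpha> * mon_val x \<alpha>) = 0" and \<beta>: "\<beta> \<in> S"
  shows "c \<beta> = 0"
proof -
  define q where "q = CARD('a) - 1"
  have q: "CARD('a) = Suc q" "q > 100" using CARD_gt[where ?'a='a] unfolding q_def by simp_all
  let ?X = "PiE {..<n} (\<lambda>_. UNIV :: 'a set)"
  \<comment> \<open>Complementary exponents: the sum over t of t^(\<alpha>_i + q - \<beta>_i) is - 1
    for \<alpha>_i = \<beta>_i and 0 otherwise, because both exponents are at most 5 and q = p - 1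
    is large.\<close>
  define w where "w x = (\<Prod>i<n. x i ^ (q - Poly_Mapping.lookup \<beta> i))" for x :: "nat \<Rightarrow> 'a"
  have b5: "Poly_Mapping.lookup \<beta> i \<le> 5" for i using S(2)[OF \<beta>] by blast
  have pq: "t ^ (q + Suc k) = t ^ Suc k" for t :: 'a and k
  proof -
    have "t ^ (q + Suc k) = t ^ Suc q * t ^ k" by (simp add: power_add)
    also have "t ^ Suc q = t" using pow_CARD[of t] unfolding q(1) .
    finally show ?thesis by simp
  qed
  have pair: "(\<Sum>x\<in>?X. mon_val x \<alpha> * w x) = (\<Prod>i<n. \<Sum>t\<in>UNIV. t ^ (Poly_Mapping.lookup \<alpha> i + (q - Poly_Mapping.lookup \<beta> i)))"
    if "\<alpha> \<in> S" for \<alpha>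
  proof -
    have "mon_val x \<alpha> * w x = (\<Prod>i<n. x i ^ (Poly_Mapping.lookup \<alpha> i + (q - Poly_Mapping.lookup \<beta> i)))" for x :: "nat \<Rightarrow> 'a"
      using S(2)[OF that] by (simp add: mon_val_superset[of "{..<n}"] w_def power_add prod.distrib)
    then show ?thesis by (simp add: prod_sum_PiE)
  qed
  have off: "(\<Sum>x\<in>?X. mon_val x \<alpha> * w x) = 0" if a: "\<alpha> \<in> S" "\<alpha> \<noteq> \<beta>" for \<alpha>
  proof -
    have "\<exists>i. Poly_Mapping.lookup \<alpha> i \<noteq> Poly_Mapping.lookup \<beta> i" using a(2) by (meson poly_mapping_eqI)
    then obtain i where i: "Poly_Mapping.lookup \<alpha> i \<noteq> Poly_Mapping.lookup \<beta> i" by blast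
    have "i < n"
    proof (rule ccontr)
      assume "\<not> i < n"
      then have "i \<notin> Poly_Mapping.keys \<alpha>" "i \<notin> Poly_Mapping.keys \<beta>" using S(2)[OF a(1)] S(2)[OF \<beta>] by auto
      then show False using i by (simp add: in_keys_iff)
    qed
    have a5: "Poly_Mapping.lookup \<alpha> i \<le> 5" using S(2)[OF a(1)] by blast
    have "(\<Sum>t\<in>(UNIV :: 'a set). t ^ (Poly_Mapping.lookup \<alpha> i + (q - Poly_Mapping.lookup \<beta> i))) = 0"
    proof (cases "Poly_Mapping.lookup \<alpha> i < Poly_Mapping.lookup \<beta> i")
      case True
      then have "Poly_Mapping.lookup \<alpha> i + (q - Poly_Mapping.lookup \<beta> i) < CARD('a) - 1" using b5[of i] q by simp
      then show ?thesis by (rule sum_powers_eq_0)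
    next
      case False
      then obtain k where k: "Poly_Mapping.lookup \<alpha> i = Poly_Mapping.lookup \<beta> i + Suc k" using i less_imp_Suc_add[of "Poly_Mapping.lookup \<beta> i" "Poly_Mapping.lookup \<alpha> i"] by auto
      have e: "Poly_Mapping.lookup \<alpha> i + (q - Poly_Mapping.lookup \<beta> i) = q + Suc k" using k b5[of i] q by simp
      have "Suc k < CARD('a) - 1" using k a5 q by simp
      then show ?thesis unfolding e pq by (rule sum_powers_eq_0)
    qed
    then show ?thesis unfolding pair[OF a(1)] using \<open>i < n\<close> by (intro prod_zero) auto
  qed
  have on: "(\<Sum>x\<in>?X. mon_val x \<beta> * w x) \<noteq> 0"
  proof -
    have e: "Poly_Mapping.lookup \<beta> i + (q - Poly_Mapping.lookup \<beta> i) = q" for i using b5[of i] q by simp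
    have "(\<Sum>t\<in>(UNIV :: 'a set). t ^ q) = (\<Sum>t\<in>UNIV - {0 :: 'a}. t ^ q)"
      using q by (intro sum.mono_neutral_right) auto
    also have "\<dots> = (\<Sum>t\<in>UNIV - {0 :: 'a}. 1)"
    proof (rule sum.cong[OF refl])
      fix t :: 'a assume "t \<in> UNIV - {0}"
      moreover have "t * t ^ q = t * 1" using pow_CARD[of t] unfolding q(1) by simp
      ultimately show "t ^ q = 1" by simp
    qed
    also have "\<dots> = of_nat q" using q by (simp add: card_Diff_subset)
    also have "\<dots> = - 1"
    proof -
      have "of_nat (Suc q) = (0 :: 'a)" using of_nat_CHAR[where ?'a='a] CHAR_eq_CARD[where ?'a='a] q(1) by simp
      then show ?thesis by (simp add: eq_neg_iff_add_eq_0 add.commute)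
    qed
    finally have "(\<Sum>t\<in>(UNIV :: 'a set). t ^ q) = - 1" .
    then show ?thesis unfolding pair[OF \<beta>] e by simp
  qed
  have "0 = (\<Sum>x\<in>?X. (\<Sum>\<alpha>\<in>S. c \<alpha> * mon_val x \<alpha>) * w x)" by (simp add: z)
  also have "\<dots> = (\<Sum>\<alpha>\<in>S. c \<alpha> * (\<Sum>x\<in>?X. mon_val x \<alpha> * w x))"
    by (simp add: sum_distrib_right sum_distrib_left mult.assoc sum.swap[of _ S])
  also have "\<dots> = (\<Sum>\<alpha>\<in>{\<beta>}. c \<alpha> * (\<Sum>x\<in>?X. mon_val x \<alpha> * w x))"
    using S(1) \<beta> off by (intro sum.mono_neutral_right) auto
  finally show ?thesis using on by simp
qed

lemma of_int_eq_0_iff_dvd: "(of_int k :: 'a :: big_prime_field) = 0 \<longleftrightarrow> int CARD('a) dvd k"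
  by (simp add: of_int_eq_0_iff_char_dvd CHAR_eq_CARD)

lemma surj_of_int: "\<exists>k. (of_int k :: 'a :: big_prime_field) = x"
proof -
  have "inj_on (of_int :: int \<Rightarrow> 'a) {0..<int CARD('a)}"
  proof (rule inj_onI)
    fix i j :: int assume ij: "i \<in> {0..<int CARD('a)}" "j \<in> {0..<int CARD('a)}" "of_int i = (of_int j :: 'a)"
    then have "(of_int (i - j) :: 'a) = 0" by simp
    then have "int CARD('a) dvd i - j" by (simp only: of_int_eq_0_iff_dvd)
    moreover have "\<bar>i - j\<bar> < int CARD('a)" using ij by auto
    ultimately have "i - j = 0" using zdvd_not_zless[of "\<bar>i - j\<bar>" "int CARD('a)"] by fastforce
    then show "i = j" by simp
  qed
  then have "card ((of_int :: int \<Rightarrow> 'a) ` {0..<int CARD('a)}) = CARD('a)" by (simp add: card_image)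
  then have "(of_int :: int \<Rightarrow> 'a) ` {0..<int CARD('a)} = UNIV" by (intro card_subset_eq) auto
  then show ?thesis by (metis UNIV_I imageE)
qed

text \<open>In a basis whose last vector is v, translation invariance means that the form does not
  depend on the last coordinate.\<close>

lemma degenerate_order_less:
  fixes v :: "nat \<Rightarrow> 'a :: big_prime_field"
  assumes F: "is_int_form n 5 F" and i0: "i0 < n" "v i0 \<noteq> 0"
    and inv: "\<And>x t. zpoly_val F (\<lambda>i. x i + t * v i) = zpoly_val F x"
  shows "order_mod (int CARD('a)) n F < n"
proof -
  have "\<forall>i. \<exists>k. of_int k = v i" using surj_of_int by blast
  from choice[OF this] obtain V where V: "\<And>i. of_int (V i) = v i" by blast
  obtain u where u: "of_int u = inverse (v i0)" using surj_of_int by blast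
  define l where "l = n - 1"
  have l: "l < n" "n = Suc l" using i0(1) by (auto simp: l_def)
  define \<tau> where "\<tau> = transpose i0 l"
  \<comment> \<open>Column l is an integral lift of v, the other columns are unit vectors. Since v
    is nonzero at i0, the unit vector of i0 is the one left out, by means of the transposition
    \<tau>. B is the inverse modulo p.\<close>
  define A where "A i j = (if j = l then V i else if i = \<tau> j then 1 else 0)" for i j
  define B where "B j k = (if j = l then (if k = i0 then u else 0) else (if k = \<tau> j then 1 else 0) - (if k = i0 then V (\<tau> j) * u else 0))" for j k
  have \<tau>: "\<tau> (\<tau> j) = j" "\<tau> j = i0 \<longleftrightarrow> j = l" for j unfolding \<tau>_def by (auto simp: transpose_def)
  have sumA: "(\<Sum>j<n. A i j * y j) = V i * y l + (if i = i0 then 0 else y (\<tau> i))" if "i < n" for i and y :: "nat \<Rightarrow> int"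
  proof -
    have "(\<Sum>j<n. A i j * y j) = (\<Sum>j<l. A i j * y j) + V i * y l" unfolding l(2) by (simp add: A_def)
    also have "(\<Sum>j<l. A i j * y j) = (\<Sum>j<l. if j = \<tau> i then (if i = i0 then 0 else y (\<tau> i)) else 0)"
    proof (rule sum.cong[OF refl])
      fix j assume "j \<in> {..<l}"
      then have "j \<noteq> l" by simp
      have "i = \<tau> j \<longleftrightarrow> j = \<tau> i" using \<tau>(1) by metis
      moreover have "i \<noteq> i0" if "i = \<tau> j" using that \<tau>(2)[of j] \<open>j \<noteq> l\<close> by simp
      ultimately show "A i j * y j = (if j = \<tau> i then (if i = i0 then 0 else y (\<tau> i)) else 0)"
        using \<open>j \<noteq> l\<close> by (auto simp: A_def)
    qed
    also have "\<dots> = (if i = i0 then 0 else y (\<tau> i))"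
    proof (cases "i = i0")
      case False
      then have "\<tau> i < l" using that l i0(1) unfolding \<tau>_def transpose_def by auto
      then show ?thesis by simp
    qed (simp add: sum.neutral)
    finally show ?thesis by simp
  qed
  have invA: "invertible_mod (int CARD('a)) n A" unfolding invertible_mod_def
  proof (intro exI[of _ B] allI impI)
    fix i k assume i: "i < n" and k: "k < n"
    have "(\<Sum>j<n. A i j * B j k) = V i * B l k + (if i = i0 then 0 else B (\<tau> i) k)" by (rule sumA[OF i])
    also have "\<dots> = (if i = i0 then V i0 * (if k = i0 then u else 0) else (if i = k then 1 else 0))"
    proof (cases "i = i0")
      case True
      then show ?thesis by (simp add: B_def)
    next
      case False
      then have "\<tau> i \<noteq> l" using \<tau>(2)[of "\<tau> i"] \<tau>(1)[of i] by simp
      then show ?thesis using False \<tau>(1)[of i] by (auto simp: B_def)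
    qed
    finally have e: "(\<Sum>j<n. A i j * B j k) = (if i = i0 then V i0 * (if k = i0 then u else 0) else (if i = k then 1 else 0))" .
    have "(of_int (V i0 * u - 1) :: 'a) = 0" using V[of i0] u i0 by simp
    then have "int CARD('a) dvd V i0 * u - 1" by (simp only: of_int_eq_0_iff_dvd)
    then have "(V i0 * u) mod int CARD('a) = 1 mod int CARD('a)" by (simp add: mod_eq_dvd_iff)
    then show "(\<Sum>j<n. A i j * B j k) mod int CARD('a) = (if i = k then 1 else 0) mod int CARD('a)"
      unfolding e by auto
  qed
  define G where "G = lin_subst n A F"
  have Gb: "form_bound n 5 G" unfolding G_def by (rule form_bound_lin_subst[OF F])
  define S where "S = {\<alpha> \<in> Poly_Mapping.keys G. l \<in> Poly_Mapping.keys \<alpha>}"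
  have Gval: "zpoly_val G x = zpoly_val G (x(l := 0))" for x :: "nat \<Rightarrow> 'a"
  proof -
    have lin: "(\<Sum>j<n. of_int (A i j) * x j) = (\<Sum>j<n. of_int (A i j) * (x(l := 0)) j) + x l * v i" for i
      unfolding l(2) by (simp add: A_def V mult.commute)
    show ?thesis unfolding G_def zpoly_val_lin_subst lin by (rule inv)
  qed
  have S0: "(\<Sum>\<alpha>\<in>S. of_int (Poly_Mapping.lookup G \<alpha>) * mon_val x \<alpha>) = 0" for x :: "nat \<Rightarrow> 'a"
  proof -
    have m0: "mon_val (x(l := 0)) \<alpha> = 0" if "\<alpha> \<in> S" for \<alpha>
      unfolding mon_val_def using that by (intro prod_zero bexI[of _ l]) (auto simp: S_def in_keys_iff zero_power)
    have m1: "mon_val (x(l := 0)) \<alpha> = mon_val x \<alpha>" if "\<alpha> \<in> Poly_Mapping.keys G - S" for \<alpha>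
      unfolding mon_val_def using that by (intro prod.cong) (auto simp: S_def)
    have sub: "S \<subseteq> Poly_Mapping.keys G" by (auto simp: S_def)
    have split: "zpoly_val G y = (\<Sum>\<alpha>\<in>Poly_Mapping.keys G - S. of_int (Poly_Mapping.lookup G \<alpha>) * mon_val y \<alpha>) + (\<Sum>\<alpha>\<in>S. of_int (Poly_Mapping.lookup G \<alpha>) * mon_val y \<alpha>)" for y :: "nat \<Rightarrow> 'a"
      unfolding zpoly_val_def by (rule sum.subset_diff[OF sub]) simp
    show ?thesis using Gval[of x] unfolding split[of x] split[of "x(l := 0)"] by (simp add: m0 m1)
  qed
  have "involves_only_mod (int CARD('a)) l G" unfolding involves_only_mod_def
  proof (intro ballI impI)
    fix \<alpha> assume a: "\<alpha> \<in> Poly_Mapping.keys G" "\<not> Poly_Mapping.keys \<alpha> \<subseteq> {..<l}"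
    have "Poly_Mapping.keys \<alpha> \<subseteq> {..<n}" using Gb a(1) unfolding form_bound_def by blast
    then have "l \<in> Poly_Mapping.keys \<alpha>" using a(2) unfolding l(2) lessThan_Suc by blast
    then have "\<alpha> \<in> S" using a(1) by (simp add: S_def)
    then have "(of_int (Poly_Mapping.lookup G \<alpha>) :: 'a) = 0"
    proof (rule coefficients_eq_0[rotated 3])
      show "finite S" by (simp add: S_def)
      show "Poly_Mapping.keys \<alpha> \<subseteq> {..<n} \<and> (\<forall>i. Poly_Mapping.lookup \<alpha> i \<le> 5)" if "\<alpha> \<in> S" for \<alpha>
        using that Gb unfolding S_def form_bound_def by blast
    qed (rule S0)
    then show "int CARD('a) dvd Poly_Mapping.lookup G \<alpha>" by (simp only: of_int_eq_0_iff_dvd)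
  qed
  then have "equiv_m_vars_mod (int CARD('a)) n F l" unfolding equiv_m_vars_mod_def G_def using invA by blast
  then have "order_mod (int CARD('a)) n F \<le> l" unfolding order_mod_def by (rule Least_le)
  then show ?thesis using l by simp
qed

section \<open>Density from a nonsingular zero\<close>

lemma taylor_dvd:
  fixes g :: "int poly"
  shows "h\<^sup>2 dvd poly g (t + h) - poly g t - h * poly (pderiv g) t"
proof (induction g)
  case (pCons a g)
  have "poly (pCons a g) (t + h) - poly (pCons a g) t - h * poly (pderiv (pCons a g)) t =
     (t + h) * (poly g (t + h) - poly g t - h * poly (pderiv g) t) + h\<^sup>2 * poly (pderiv g) t"
    by (simp add: pderiv_pCons power2_eq_square algebra_simps)
  then show ?case using pCons.IH by simp
qed simp

text \<open>Newton iteration for g = c. Keeping p dvd t ensures that the derivative at t agrees with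
  the one at 0 modulo p and stays invertible.\<close>

lemma hensel:
  fixes g :: "int poly"
  assumes p: "prime p" and g0: "p dvd poly g 0" and g1: "\<not> p dvd poly (pderiv g) 0" and c: "p dvd c"
  shows "\<exists>t. p dvd t \<and> p ^ Suc k dvd poly g t - c"
proof (induction k)
  case 0
  show ?case using g0 c by (intro exI[of _ 0]) simp
next
  case (Suc k)
  then obtain t where t: "p dvd t" "p ^ Suc k dvd poly g t - c" by blast
  obtain m where m: "poly g t - c = p ^ Suc k * m" using t(2) by blast
  define d where "d = poly (pderiv g) t"
  have "t dvd poly q t - poly q 0" for q :: "int poly" by (cases q) simp
  then have "p dvd d - poly (pderiv g) 0" unfolding d_def using t(1) dvd_trans by blast
  then have "\<not> p dvd d" using g1 dvd_diff[of p d "d - poly (pderiv g) 0"] by auto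
  then have "coprime d p" using p prime_imp_coprime[of p d] by (simp add: coprime_commute)
  then have "gcd d p = 1" by simp
  then obtain u w where uw: "u * d + w * p = 1" using bezout_int[of d p] by auto
  \<comment> \<open>The Newton correction, with u an inverse of the derivative modulo p.\<close>
  define h where "h = p ^ Suc k * (- (m * u))"
  obtain r where r: "poly g (t + h) - poly g t - h * d = h\<^sup>2 * r" using taylor_dvd[of h g t] unfolding d_def by blast
  have "poly g (t + h) - c = (poly g t - c) + h * d + h\<^sup>2 * r" using r by (simp add: algebra_simps)
  also have "\<dots> = p ^ Suc k * (m * (1 - u * d)) + h\<^sup>2 * r" unfolding m h_def by (simp add: algebra_simps)
  also have "1 - u * d = w * p" using uw by (simp add: algebra_simps)
  finally have e: "poly g (t + h) - c = p ^ Suc (Suc k) * (m * w) + h\<^sup>2 * r" by (simp add: mult_ac)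
  have "p ^ Suc (Suc k) dvd (p ^ Suc k)\<^sup>2"
    unfolding power_mult[symmetric] by (rule le_imp_power_dvd) simp
  then have "p ^ Suc (Suc k) dvd h\<^sup>2 * r" unfolding h_def power_mult_distrib by (simp add: dvd_mult2)
  then have "p ^ Suc (Suc k) dvd poly g (t + h) - c" unfolding e by simp
  moreover have "p dvd t + h" using t(1) unfolding h_def by simp
  ultimately show ?case by blast
qed

text \<open>A rational u/w equals (p u)/(p w), and both p u and p w are values of F up to high
  powers of p.\<close>

lemma padic_dense_if_nonsingular:
  assumes p: "prime p" and val: "\<And>t. poly g t = zeval F (x t)"
    and g0: "p dvd poly g 0" and g1: "\<not> p dvd poly (pderiv g) 0"
  shows "padic_dense p (ratio_set F)"
  unfolding padic_dense_def
proof (intro allI)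
  fix q :: rat and k :: nat
  have rep: "\<exists>Y r. zeval F Y = c + p ^ Suc K * r" if c: "p dvd c" for c K
  proof -
    obtain t where "p ^ Suc K dvd poly g t - c" using hensel[OF p g0 g1 c] by blast
    then obtain r where "poly g t - c = p ^ Suc K * r" by blast
    then have "zeval F (x t) = c + p ^ Suc K * r" unfolding val[symmetric] by (simp add: algebra_simps)
    then show ?thesis by blast
  qed
  have p0: "p \<noteq> 0" "\<not> is_unit p" using p by auto
  obtain u w where uw: "q = of_int u / of_int w" "w \<noteq> 0"
    using quotient_of_div[of q "fst (quotient_of q)" "snd (quotient_of q)"] quotient_of_denom_pos[of q "fst (quotient_of q)" "snd (quotient_of q)"] by auto
  obtain w' where w': "w = p ^ multiplicity p w * w'" "\<not> p dvd w'" using multiplicity_decompose'[OF uw(2) p0(2)] by blast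
  define e where "e = multiplicity p w"
  note w' = w'[folded e_def]
  \<comment> \<open>The common denominator contributes p^(2e+1); the precision p^(K+1) leaves
    p^(k+3) after cancelling.\<close>
  define K where "K = k + 2 * e + 3"
  obtain Y r2 where Y: "zeval F Y = p * w + p ^ Suc K * r2" using rep[of "p * w" K] by auto
  obtain Z r1 where Z: "zeval F Z = p * u + p ^ Suc K * r1" using rep[of "p * u" K] by auto
  define w2 where "w2 = w' + p ^ (K - e) * r2"
  have FY: "zeval F Y = p ^ Suc e * w2"
  proof -
    have "Suc K = Suc e + (K - e)" unfolding K_def by simp
    then have e1: "p ^ Suc K = p ^ Suc e * p ^ (K - e)" by (simp only: power_add)
    have e2: "p * w = p ^ Suc e * w'" by (subst w'(1)) (simp add: mult.assoc)
    show ?thesis unfolding Y w2_def e1 e2 by (simp only: distrib_left mult.assoc)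
  qed
  have "p dvd p ^ (K - e) * r2" unfolding K_def by (simp add: dvd_power)
  then have w2: "\<not> p dvd w2" using w'(2) unfolding w2_def by (simp add: dvd_add_left_iff)
  have nz: "w2 \<noteq> 0" "w' \<noteq> 0" using w2 w'(2) by auto
  have FY0: "zeval F Y \<noteq> 0" unfolding FY using nz p0 by simp
  define s where "s = of_int (zeval F Z) / (of_int (zeval F Y) :: rat)"
  have "s \<in> ratio_set F" unfolding ratio_set_def s_def using FY0 by blast
  moreover have "s - q = of_int (p ^ k * (p ^ 3 * (w * r1 - u * r2))) / of_int (w' * w2)"
  proof -
    have P: "(of_int p :: rat) \<noteq> 0" using p0 by simp
    have num: "zeval F Z * w - u * zeval F Y = p ^ Suc K * (w * r1 - u * r2)" unfolding Y Z by (simp add: algebra_simps)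
    have den: "zeval F Y * w = p ^ (2 * e + 1) * (w' * w2)"
    proof -
      have "zeval F Y * w = p ^ Suc e * w2 * (p ^ e * w')" unfolding FY by (subst w'(1)) simp
      moreover have "p ^ (2 * e + 1) = p ^ Suc e * p ^ e" unfolding power_add[symmetric] by (simp add: mult_2)
      ultimately show ?thesis by (simp only: mult_ac)
    qed
    have K': "Suc K = (2 * e + 1) + (k + 3)" unfolding K_def by simp
    have "s - q = of_int (zeval F Z * w - u * zeval F Y) / of_int (zeval F Y * w)"
      unfolding s_def uw(1) using FY0 uw(2) by (simp add: field_simps)
    also have "\<dots> = of_int (p ^ (2 * e + 1)) * of_int (p ^ (k + 3) * (w * r1 - u * r2)) / (of_int (p ^ (2 * e + 1)) * of_int (w' * w2))"
      unfolding num den K' power_add[of p "2 * e + 1"] by (simp add: mult_ac)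
    also have "\<dots> = of_int (p ^ (k + 3) * (w * r1 - u * r2)) / of_int (w' * w2)"
      by (rule mult_divide_mult_cancel_left) (use P in simp)
    also have "p ^ (k + 3) * (w * r1 - u * r2) = p ^ k * (p ^ 3 * (w * r1 - u * r2))" by (simp add: power_add mult_ac)
    finally show ?thesis .
  qed
  moreover have "w' * w2 \<noteq> 0" "\<not> p dvd w' * w2" using nz w2 w'(2) p by (simp_all add: prime_dvd_mult_iff)
  ultimately show "\<exists>s\<in>ratio_set F. \<exists>a b. b \<noteq> 0 \<and> \<not> p dvd b \<and> s - q = of_int (p ^ k * a) / of_int b" by blast
qed

lemma zpoly_val_cong:
  assumes "is_int_form n d F" "\<And>i. i < n \<Longrightarrow> x i = y i"
  shows "zpoly_val F x = zpoly_val F y"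
  unfolding zpoly_val_def
proof (rule sum.cong[OF refl])
  fix \<alpha> assume "\<alpha> \<in> Poly_Mapping.keys F"
  then have "Poly_Mapping.keys \<alpha> \<subseteq> {..<n}" using assms(1) unfolding is_int_form_def by blast
  then have "mon_val x \<alpha> = mon_val y \<alpha>" unfolding mon_val_def using assms(2) by (intro prod.cong) auto
  then show "of_int (Poly_Mapping.lookup F \<alpha>) * mon_val x \<alpha> = of_int (Poly_Mapping.lookup F \<alpha>) * mon_val y \<alpha>" by simp
qed

lemma of_int_zpoly_val: "of_int (zpoly_val F x) = zpoly_val F (\<lambda>i. of_int (x i))"
  by (simp add: zpoly_val_def mon_val_def)

lemma poly_zpoly_val: "poly (zpoly_val F G) t = zpoly_val F (\<lambda>i. poly (G i) t)"
  by (simp add: zpoly_val_def mon_val_def poly_sum poly_prod)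

lemma degree_zpoly_val_line:
  fixes x z :: "nat \<Rightarrow> 'r :: idom"
  assumes "is_int_form n 5 F"
  shows "degree (zpoly_val F (\<lambda>i. [:x i, z i:])) \<le> 5"
  unfolding zpoly_val_def
proof (rule degree_sum_le)
  fix \<alpha> assume "\<alpha> \<in> Poly_Mapping.keys F"
  then have deg: "(\<Sum>i\<in>Poly_Mapping.keys \<alpha>. Poly_Mapping.lookup \<alpha> i) = 5"
    using assms unfolding is_int_form_def mon_deg_def by simp
  have "degree ([:x i, z i:] ^ k) \<le> k" for i k
    using degree_power_le[of "[:x i, z i:]" k] by (cases "z i = 0") auto
  then have "(\<Sum>i\<in>Poly_Mapping.keys \<alpha>. degree ([:x i, z i:] ^ Poly_Mapping.lookup \<alpha> i)) \<le> 5"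
    unfolding deg[symmetric] by (intro sum_mono)
  then have "degree (mon_val (\<lambda>i. [:x i, z i:]) \<alpha>) \<le> 5"
    unfolding mon_val_def using degree_prod_sum_le[of "Poly_Mapping.keys \<alpha>" "\<lambda>i. [:x i, z i:] ^ Poly_Mapping.lookup \<alpha> i"] by simp
  then show "degree (of_int (Poly_Mapping.lookup F \<alpha>) * mon_val (\<lambda>i. [:x i, z i:]) \<alpha>) \<le> 5"
    using degree_mult_le[of "of_int (Poly_Mapping.lookup F \<alpha>)" "mon_val (\<lambda>i. [:x i, z i:]) \<alpha>"] by (simp add: of_int_poly)
qed simp

lemma of_int_poly_eval: "(of_int (poly g t) :: 'r :: comm_ring_1) = poly (map_poly of_int g) (of_int t)"
  by (induction g) (simp_all add: map_poly_pCons)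

text \<open>Lifting the line to the integers gives a polynomial whose reduction agrees with the
  displayed one at all p elements. The degrees are small, so the coefficients agree, and the
  derivative at 0 reduces to 5 c1 \<noteq> 0.\<close>

lemma padic_dense_if_line_nonsingular:
  fixes x z :: "nat \<Rightarrow> 'a :: big_prime_field"
  assumes F: "is_int_form n 5 F"
    and line: "\<And>t. zpoly_val F (\<lambda>i. t * z i + x i) = t ^ 5 * c5 + 5 * t ^ 4 * c4 + 10 * t ^ 3 * c3 + 10 * t\<^sup>2 * c2 + 5 * t * c1 + c0"
    and c: "c0 = 0" "c1 \<noteq> 0"
  shows "padic_dense (int CARD('a)) (ratio_set F)"
proof -
  have "\<forall>i. \<exists>k. of_int k = x i" "\<forall>i. \<exists>k. of_int k = z i" using surj_of_int by blast+
  from this[THEN choice] obtain X' Z' where XZ: "\<And>i. of_int (X' i) = x i" "\<And>i. of_int (Z' i) = z i" by blast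
  define g where "g = zpoly_val F (\<lambda>i. [:X' i, Z' i:])"
  define h where "h = map_poly (of_int :: int \<Rightarrow> 'a) g - [:c0, 5 * c1, 10 * c2, 10 * c3, 5 * c4, c5:]"
  have val: "poly g t = zeval F (\<lambda>i. X' i + t * Z' i)" for t
    unfolding g_def poly_zpoly_val zeval_eq by simp
  have "degree g \<le> 5" unfolding g_def by (rule degree_zpoly_val_line[OF F])
  then have "degree (map_poly (of_int :: int \<Rightarrow> 'a) g) \<le> 101" using map_poly_degree_leq[of "of_int :: int \<Rightarrow> 'a" g] by linarith
  moreover have "degree [:c0, 5 * c1, 10 * c2, 10 * c3, 5 * c4, c5:] \<le> 101" by (simp add: degree_pCons_eq_if)
  ultimately have "degree h \<le> 101" unfolding h_def by (rule degree_diff_le)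
  moreover have "poly h y = 0" for y
  proof -
    obtain t where t: "of_int t = y" using surj_of_int by blast
    have "poly (map_poly of_int g) y = of_int (poly g t)" unfolding t[symmetric] by (rule of_int_poly_eval[symmetric])
    also have "\<dots> = zpoly_val F (\<lambda>i. y * z i + x i)"
      unfolding val zeval_eq of_int_zpoly_val by (simp add: XZ t add.commute)
    finally show ?thesis unfolding h_def poly_diff line by (simp add: eval_nat_numeral algebra_simps)
  qed
  ultimately have "h = 0" using poly_eq_0_if_all_values_0 by blast
  then have "map_poly (of_int :: int \<Rightarrow> 'a) g = [:c0, 5 * c1, 10 * c2, 10 * c3, 5 * c4, c5:]" unfolding h_def by simp
  from arg_cong[OF this, of coeff] have co: "of_int (coeff g k) = coeff [:c0, 5 * c1, 10 * c2, 10 * c3, 5 * c4, c5:] k" for k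
    by (simp add: fun_eq_iff coeff_map_poly)
  show ?thesis
  proof (rule padic_dense_if_nonsingular[OF _ val])
    show "prime (int CARD('a))" using prime_CARD[where ?'a='a] by simp
    have "(of_int (poly g 0) :: 'a) = 0" unfolding poly_0_coeff_0 co c by simp
    then show "int CARD('a) dvd poly g 0" by (simp only: of_int_eq_0_iff_dvd)
    have "poly (pderiv g) 0 = coeff g 1" by (simp add: poly_0_coeff_0 coeff_pderiv)
    moreover have "(of_int (coeff g 1) :: 'a) \<noteq> 0" unfolding co using c by simp
    ultimately show "\<not> int CARD('a) dvd poly (pderiv g) 0" by (simp only: of_int_eq_0_iff_dvd not_False_eq_True)
  qed
qed

section \<open>Polarisation\<close>

text \<open>The variables of a monomial with repetition, so that a quintic monomial has five places
  over which the five arguments of the polar form can be distributed.\<close>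

definition mon_list :: "(nat \<Rightarrow>\<^sub>0 nat) \<Rightarrow> nat list" where
  "mon_list \<alpha> = concat (map (\<lambda>i. replicate (Poly_Mapping.lookup \<alpha> i) i) (sorted_list_of_set (Poly_Mapping.keys \<alpha>)))"

lemma length_mon_list: "length (mon_list \<alpha>) = mon_deg \<alpha>"
proof -
  have "length (concat (map (\<lambda>i. replicate (e i) i) is)) = (\<Sum>i\<leftarrow>is. e i)" for e and "is" :: "nat list"
    by (induction "is") simp_all
  then show ?thesis unfolding mon_list_def mon_deg_def by (simp add: sum.distinct_set_conv_list[symmetric])
qed

lemma prod_mon_list: "(\<Prod>j<mon_deg \<alpha>. x (mon_list \<alpha> ! j)) = mon_val x \<alpha>"
proof -
  have 1: "prod_list (replicate k y) = y ^ k" for k and y :: 'a by (induction k) simp_all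
  have 2: "prod_list (map x (concat (map (\<lambda>i. replicate (e i) i) is))) = (\<Prod>i\<leftarrow>is. x i ^ e i)" for e and "is" :: "nat list"
    by (induction "is") (simp_all add: 1)
  have "mon_val x \<alpha> = prod_list (map x (mon_list \<alpha>))"
    unfolding mon_val_def mon_list_def 2 by (simp add: prod.distinct_set_conv_list[symmetric])
  also have "\<dots> = (\<Prod>j<mon_deg \<alpha>. x (mon_list \<alpha> ! j))"
    unfolding prod.list_conv_set_nth by (intro prod.cong) (auto simp: length_mon_list)
  finally show ?thesis ..
qed

definition polar_term :: "zpoly \<Rightarrow> (nat \<Rightarrow> 'a) \<Rightarrow> (nat \<Rightarrow> 'a) \<Rightarrow> (nat \<Rightarrow> 'a) \<Rightarrow> (nat \<Rightarrow> 'a) \<Rightarrow> (nat \<Rightarrow> 'a) \<Rightarrow>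
    (nat \<Rightarrow> nat) \<Rightarrow> 'a :: big_prime_field" where
  "polar_term F a b c d e \<sigma> = (\<Sum>\<alpha>\<in>Poly_Mapping.keys F. of_int (Poly_Mapping.lookup F \<alpha>) *
    (a (mon_list \<alpha> ! \<sigma> 0) * b (mon_list \<alpha> ! \<sigma> 1) * c (mon_list \<alpha> ! \<sigma> 2) * d (mon_list \<alpha> ! \<sigma> 3) * e (mon_list \<alpha> ! \<sigma> 4)))"

text \<open>The average over all 5! = 120 assignments of the arguments to the places; 120 is
  invertible as its prime factors are at most 5.\<close>

definition polar :: "zpoly \<Rightarrow> (nat \<Rightarrow> 'a) \<Rightarrow> (nat \<Rightarrow> 'a) \<Rightarrow> (nat \<Rightarrow> 'a) \<Rightarrow> (nat \<Rightarrow> 'a) \<Rightarrow> (nat \<Rightarrow> 'a) \<Rightarrow> 'a :: big_prime_field" where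
  "polar F a b c d e = (\<Sum>\<sigma> | \<sigma> permutes {..<5}. polar_term F a b c d e \<sigma>) / 120"

lemma polar_swap:
  assumes "i < 5" "k < 5" "\<And>\<sigma>. polar_term F a b c d e \<sigma> = polar_term F a' b' c' d' e' (\<sigma> \<circ> transpose i k)"
  shows "polar F a b c d e = polar F a' b' c' d' e'"
proof -
  have t: "transpose i k permutes {..<5}" using assms(1,2) by (intro permutes_swap_id) auto
  have "(\<Sum>\<sigma> | \<sigma> permutes {..<5}. polar_term F a b c d e \<sigma>) = (\<Sum>\<sigma> | \<sigma> permutes {..<5}. polar_term F a' b' c' d' e' \<sigma>)"
    by (rule sum.reindex_bij_witness[of _ "\<lambda>\<sigma>. \<sigma> \<circ> transpose i k" "\<lambda>\<sigma>. \<sigma> \<circ> transpose i k"])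
      (use permutes_compose[OF t] in \<open>auto simp: assms(3) comp_assoc\<close>)
  then show ?thesis unfolding polar_def by simp
qed

lemma polar_sym:
  "polar F x y c d e = polar F y x c d e" "polar F b x y d e = polar F b y x d e"
  "polar F b c x y e = polar F b c y x e" "polar F b c d x y = polar F b c d y x"
  by (rule polar_swap[of 0 1] polar_swap[of 1 2] polar_swap[of 2 3] polar_swap[of 3 4];
    simp add: polar_term_def transpose_def mult_ac; fail)+

lemma polar_add: "polar F (\<lambda>i. x i + y i) b c d e = polar F x b c d e + polar F y b c d e"
  unfolding polar_def polar_term_def by (simp add: distrib_left distrib_right sum.distrib add_divide_distrib)

lemma polar_scale: "polar F (\<lambda>i. k * x i) b c d e = k * polar F x b c d e"
  unfolding polar_def polar_term_def by (simp add: sum_distrib_left mult_ac)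

lemma polar_diagonal:
  fixes x :: "nat \<Rightarrow> 'a :: big_prime_field"
  assumes "is_int_form n 5 F"
  shows "polar F x x x x x = zpoly_val F x"
proof -
  have t: "polar_term F x x x x x \<sigma> = zpoly_val F x" if \<sigma>: "\<sigma> permutes {..<5}" for \<sigma>
    unfolding polar_term_def zpoly_val_def
  proof (rule sum.cong[OF refl])
    fix \<alpha> assume "\<alpha> \<in> Poly_Mapping.keys F"
    then have deg: "mon_deg \<alpha> = 5" using assms unfolding is_int_form_def by blast
    have "x (mon_list \<alpha> ! \<sigma> 0) * x (mon_list \<alpha> ! \<sigma> 1) * x (mon_list \<alpha> ! \<sigma> 2) * x (mon_list \<alpha> ! \<sigma> 3) * x (mon_list \<alpha> ! \<sigma> 4) =
        (\<Prod>j<5. x (mon_list \<alpha> ! \<sigma> j))" by (simp add: eval_nat_numeral mult_ac)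
    also have "\<dots> = (\<Prod>j<5. x (mon_list \<alpha> ! j))"
      using prod.permute[OF \<sigma>, of "\<lambda>j. x (mon_list \<alpha> ! j)"] by (simp add: o_def)
    also have "\<dots> = mon_val x \<alpha>" using prod_mon_list[of x \<alpha>] unfolding deg .
    finally show "of_int (Poly_Mapping.lookup F \<alpha>) * (x (mon_list \<alpha> ! \<sigma> 0) * x (mon_list \<alpha> ! \<sigma> 1) * x (mon_list \<alpha> ! \<sigma> 2) *
        x (mon_list \<alpha> ! \<sigma> 3) * x (mon_list \<alpha> ! \<sigma> 4)) = of_int (Poly_Mapping.lookup F \<alpha>) * mon_val x \<alpha>" by simp
  qed
  have "card {\<sigma>. \<sigma> permutes {..<5::nat}} = fact 5" by (rule card_permutations) auto
  then have "card {\<sigma>. \<sigma> permutes {..<5::nat}} = 120" by (simp add: eval_nat_numeral)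
  then have "(\<Sum>\<sigma> | \<sigma> permutes {..<5}. polar_term F x x x x x \<sigma>) = 120 * zpoly_val F x" by (simp add: t)
  moreover have "(120 :: 'a) \<noteq> 0"
  proof -
    have "(120 :: 'a) = 4 * 30" by simp
    also have "\<dots> \<noteq> 0" unfolding mult_eq_0_iff by simp
    finally show ?thesis .
  qed
  ultimately show ?thesis unfolding polar_def by simp
qed

lemma card_finite_support:
  fixes n :: nat
  defines "A \<equiv> {x :: nat \<Rightarrow> 'a :: {finite, zero}. \<forall>i\<ge>n. x i = 0}"
  shows "finite A" "card A = CARD('a) ^ n"
proof -
  have b: "bij_betw (\<lambda>x. restrict x {..<n}) A (PiE {..<n} (\<lambda>_. UNIV))"
    by (rule bij_betw_byWitness[where f' = "\<lambda>y i. if i < n then y i else 0"])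
      (auto simp: A_def PiE_def extensional_def restrict_def fun_eq_iff)
  then show "finite A" using bij_betw_finite finite_PiE[of "{..<n}" "\<lambda>_. UNIV :: 'a set"] by auto
  show "card A = CARD('a) ^ n" using bij_betw_same_card[OF b] by (simp add: card_PiE)
qed

section \<open>The prime field of a counterexample\<close>

text \<open>Types cannot depend on \<open>p\<close>, so the prime field and its coordinate space are built for one counterexample fixed
  by choice. If there is none, \<open>char0\<close> is an arbitrary large prime and \<open>dim0\<close>, \<open>form0\<close> are junk.\<close>

definition counterexample :: "nat \<Rightarrow> nat \<Rightarrow> zpoly \<Rightarrow> bool" where
  "counterexample p n F \<longleftrightarrow> prime p \<and> p > 101 \<and> is_int_form n 5 F \<and> nondegenerate_mod (int p) n F \<and> n \<ge> 6 \<and>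
    \<not> padic_dense (int p) (ratio_set F)"

definition char0 :: nat where
  "char0 = (if \<exists>p n F. counterexample p n F then SOME p. \<exists>n F. counterexample p n F else SOME p. prime p \<and> p > 101)"

definition dim0 :: nat where
  "dim0 = (SOME n. \<exists>F. counterexample char0 n F)"

definition form0 :: zpoly where
  "form0 = (SOME F. counterexample char0 dim0 F)"

lemma prime_char0: "prime char0" and char0_gt: "char0 > 101"
proof -
  have "prime char0 \<and> char0 > 101"
  proof (cases "\<exists>p n F. counterexample p n F")
    case True
    then have "\<exists>n F. counterexample char0 n F" using someI_ex[OF True] unfolding char0_def by simp
    then show ?thesis unfolding counterexample_def by blast
  next
    case False
    have "\<exists>p :: nat. prime p \<and> p > 101" by (rule bigger_prime)
    from someI_ex[OF this] show ?thesis unfolding char0_def if_not_P[OF False] .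
  qed
  then show "prime char0" "char0 > 101" by auto
qed

lemma counterexample0:
  assumes "counterexample p n F" shows "counterexample char0 dim0 form0"
proof -
  have ex: "\<exists>p n F. counterexample p n F" using assms by blast
  have "\<exists>n F. counterexample char0 n F"
    using someI_ex[OF ex] ex unfolding char0_def by simp
  then have "\<exists>F. counterexample char0 dim0 F" unfolding dim0_def by (rule someI_ex)
  then show ?thesis unfolding form0_def by (rule someI_ex)
qed

typedef gf = "{0..<int char0}"
  by (rule exI[of _ 0]) (use char0_gt in simp)

definition gf :: "int \<Rightarrow> gf" where
  "gf k = Abs_gf (k mod int char0)"

lemma Rep_gf_gf: "Rep_gf (gf k) = k mod int char0"
  unfolding gf_def using char0_gt by (intro Abs_gf_inverse) simp

lemma gf_eq_iff: "gf a = gf b \<longleftrightarrow> a mod int char0 = b mod int char0"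
  unfolding Rep_gf_inject[symmetric] Rep_gf_gf ..

lemma gf_surj: "\<exists>k. x = gf k"
proof -
  have "x = gf (Rep_gf x)" using Rep_gf[of x] by (simp add: gf_def Rep_gf_inverse)
  then show ?thesis ..
qed

instantiation gf :: comm_ring_1
begin

definition "0 = gf 0"
definition "1 = gf 1"
definition "x + y = gf (Rep_gf x + Rep_gf y)"
definition "x - y = gf (Rep_gf x - Rep_gf y)"
definition "- x = gf (- Rep_gf x)"
definition "x * y = gf (Rep_gf x * Rep_gf y)"

lemma gf_arith: "gf a + gf b = gf (a + b)" "gf a - gf b = gf (a - b)" "- gf a = gf (- a)" "gf a * gf b = gf (a * b)"
  unfolding plus_gf_def minus_gf_def uminus_gf_def times_gf_def Rep_gf_gf gf_eq_iff
  by (simp_all add: mod_simps)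

instance
proof
  fix a b c :: gf
  obtain i j k where r: "a = gf i" "b = gf j" "c = gf k" using gf_surj by blast
  note s = r gf_arith zero_gf_def one_gf_def
  show "a * b * c = a * (b * c)" unfolding s by (simp add: mult.assoc)
  show "a * b = b * a" unfolding s by (simp add: mult.commute)
  show "1 * a = a" unfolding s by simp
  show "a + b + c = a + (b + c)" unfolding s by (simp add: add.assoc)
  show "a + b = b + a" unfolding s by (simp add: add.commute)
  show "0 + a = a" unfolding s by simp
  show "- a + a = 0" unfolding s by simp
  show "a - b = a + - b" unfolding s by simp
  show "(a + b) * c = a * c + b * c" unfolding s by (simp add: distrib_right)
  show "(0 :: gf) \<noteq> 1" unfolding s gf_eq_iff using char0_gt by simp
qed

end

lemma gf_inverse_exists: "x \<noteq> 0 \<Longrightarrow> \<exists>y :: gf. y * x = 1"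
proof -
  assume "x \<noteq> 0"
  obtain k where k: "x = gf k" using gf_surj by blast
  then have "gf k \<noteq> gf 0" using \<open>x \<noteq> 0\<close> unfolding zero_gf_def by simp
  then have "\<not> int char0 dvd k" unfolding gf_eq_iff by (simp add: dvd_eq_mod_eq_0)
  then have "coprime (int char0) k" using prime_char0 by (intro prime_imp_coprime) auto
  then have "coprime k (int char0)" by (rule coprime_commute[THEN iffD1])
  then have "gcd k (int char0) = 1" by simp
  then obtain u w where "u * k + w * int char0 = 1" using bezout_int[of k "int char0"] by auto
  then have "u * k = 1 + (- w) * int char0" by simp
  then have "(u * k) mod int char0 = 1 mod int char0" by (simp only: mod_mult_self1)
  then have "gf u * x = 1" unfolding k gf_arith one_gf_def gf_eq_iff .
  then show ?thesis ..
qed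

instantiation gf :: field
begin

definition "inverse (x :: gf) = (if x = 0 then 0 else SOME y. y * x = 1)"
definition "(x :: gf) div y = x * inverse y"

instance
proof
  fix a b :: gf
  show "inverse a * a = 1" if "a \<noteq> 0"
    unfolding inverse_gf_def using that someI_ex[OF gf_inverse_exists[OF that]] by simp
qed (simp_all add: divide_gf_def inverse_gf_def)

end

text \<open>The Euclidean structure demanded by \<open>field_gcd\<close> is the trivial one of a
  field.\<close>

instantiation gf :: "{unique_euclidean_ring, normalization_euclidean_semiring, normalization_semidom_multiplicative}"
begin

definition [simp]: "normalize_gf = (normalize_field :: gf \<Rightarrow> _)"
definition [simp]: "unit_factor_gf = (unit_factor_field :: gf \<Rightarrow> _)"
definition [simp]: "modulo_gf = (mod_field :: gf \<Rightarrow> _)"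
definition [simp]: "euclidean_size_gf = (euclidean_size_field :: gf \<Rightarrow> _)"
definition [simp]: "division_segment (x :: gf) = 1"

instance
  by standard
    (simp_all add: dvd_field_iff field_split_simps split: if_splits)

end

instantiation gf :: euclidean_ring_gcd
begin

definition gcd_gf :: "gf \<Rightarrow> gf \<Rightarrow> gf" where
  "gcd_gf = Euclidean_Algorithm.gcd"
definition lcm_gf :: "gf \<Rightarrow> gf \<Rightarrow> gf" where
  "lcm_gf = Euclidean_Algorithm.lcm"
definition Gcd_gf :: "gf set \<Rightarrow> gf" where
  "Gcd_gf = Euclidean_Algorithm.Gcd"
definition Lcm_gf :: "gf set \<Rightarrow> gf" where
  "Lcm_gf = Euclidean_Algorithm.Lcm"

instance by standard (simp_all add: gcd_gf_def lcm_gf_def Gcd_gf_def Lcm_gf_def)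

end

instance gf :: field_gcd ..

lemma CARD_gf: "CARD(gf) = char0"
  unfolding type_definition.card[OF type_definition_gf] by simp

instance gf :: big_prime_field
proof
  show "finite (UNIV :: gf set)" unfolding type_definition.univ[OF type_definition_gf] by simp
  show "prime CARD(gf)" "101 < CARD(gf)" unfolding CARD_gf by (rule prime_char0 char0_gt)+
qed

typedef point = "{x :: nat \<Rightarrow> gf. \<forall>i\<ge>dim0. x i = 0}" morphisms coord point
  by (rule exI[of _ "\<lambda>_. 0"]) simp

lemma coord_eq_0: "i \<ge> dim0 \<Longrightarrow> coord x i = 0"
  using coord[of x] by simp

lemma coord_point: "(\<And>i. i \<ge> dim0 \<Longrightarrow> x i = 0) \<Longrightarrow> coord (point x) = x"
  by (simp add: point_inverse)

lemma point_eqI: "(\<And>i. coord x i = coord y i) \<Longrightarrow> x = y"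
  unfolding coord_inject[symmetric] by (rule ext)

instantiation point :: ab_group_add
begin

definition "0 = point (\<lambda>_. 0)"
definition "x + y = point (\<lambda>i. coord x i + coord y i)"
definition "x - y = point (\<lambda>i. coord x i - coord y i)"
definition "- x = point (\<lambda>i. - coord x i)"

lemma coord_simps [simp]: "coord 0 = (\<lambda>_. 0)" "coord (x + y) = (\<lambda>i. coord x i + coord y i)"
  "coord (x - y) = (\<lambda>i. coord x i - coord y i)" "coord (- x) = (\<lambda>i. - coord x i)"
  unfolding zero_point_def plus_point_def minus_point_def uminus_point_def by (auto intro!: coord_point simp: coord_eq_0)

instance
  by standard (auto intro!: point_eqI simp: algebra_simps)

end

instance point :: finite
  by standard (simp add: type_definition.univ[OF type_definition_point] card_finite_support(1))

lemma CARD_point: "CARD(point) = CARD(gf) ^ dim0"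
  unfolding type_definition.card[OF type_definition_point] by (rule card_finite_support(2))

definition scale_point :: "gf \<Rightarrow> point \<Rightarrow> point" where
  "scale_point k x = point (\<lambda>i. k * coord x i)"

lemma coord_scale [simp]: "coord (scale_point k x) = (\<lambda>i. k * coord x i)"
  unfolding scale_point_def by (intro coord_point) (simp add: coord_eq_0)

abbreviation (input) polar0 :: "point \<Rightarrow> point \<Rightarrow> point \<Rightarrow> point \<Rightarrow> point \<Rightarrow> gf" where
  "polar0 a b c d e \<equiv> polar form0 (coord a) (coord b) (coord c) (coord d) (coord e)"

interpretation polar0: quintic_form scale_point polar0
  by unfold_locales
    (auto intro!: point_eqI polar_sym simp: algebra_simps polar_add polar_scale)

text \<open>5 \<open>polar0 z x x x x\<close> is the linear coefficient of the form on the line t z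
  + x. A nonzero value makes the zero x nonsingular on that line and the ratio set dense.\<close>

lemma polar0_singular:
  assumes "counterexample char0 dim0 form0" "polar0 x x x x x = 0"
  shows "polar0 x x x x z = 0"
proof (rule ccontr)
  assume nz: "polar0 x x x x z \<noteq> 0"
  have F: "is_int_form dim0 5 form0" using assms(1) unfolding counterexample_def by blast
  have "polar0 z x x x x = polar0 x x x x z" 
    using polar0.sym1[of z x x x x] polar0.sym2[of x z x x x] polar0.sym3[of x x z x x] polar0.sym4[of x x x z x] by simp
  then have nz': "polar0 z x x x x \<noteq> 0" using nz by simp
  have "zpoly_val form0 (\<lambda>i. t * coord z i + coord x i) = t ^ 5 * polar0 z z z z z + 5 * t ^ 4 * polar0 z z z z x
      + 10 * t ^ 3 * polar0 z z z x x + 10 * t\<^sup>2 * polar0 z z x x x + 5 * t * polar0 z x x x x + polar0 x x x x x" for t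
    using polar0.expand5[of t z x] unfolding coord_simps coord_scale polar_diagonal[OF F] .
  then have "padic_dense (int CARD(gf)) (ratio_set form0)"
    using assms(2) nz' by (rule padic_dense_if_line_nonsingular[OF F])
  then show False using assms(1) unfolding CARD_gf counterexample_def by blast
qed

text \<open>A vector v that annihilates the polar form leaves the form invariant under translation
  by its multiples, so the order would drop below the number of variables.\<close>

lemma polar0_nondegenerate:
  assumes "counterexample char0 dim0 form0" "\<And>w x y z. polar0 v w x y z = 0"
  shows "v = 0"
proof (rule ccontr)
  assume "v \<noteq> 0"
  then obtain i0 where i0: "coord v i0 \<noteq> 0" using point_eqI[of v 0] by auto
  then have "i0 < dim0" using coord_eq_0[of i0 v] by (meson not_le)
  have F: "is_int_form dim0 5 form0" using assms(1) unfolding counterexample_def by blast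
  have "zpoly_val form0 (\<lambda>i. x i + t * coord v i) = zpoly_val form0 x" for x t
  proof -
    \<comment> \<open>Invariance is needed at arbitrary integer-indexed x, so x is first truncated
      to the coordinates that the form sees.\<close>
    define y where "y = point (\<lambda>i. if i < dim0 then x i else 0)"
    have y: "coord y = (\<lambda>i. if i < dim0 then x i else 0)" unfolding y_def by (rule coord_point) simp
    have "zpoly_val form0 (\<lambda>i. x i + t * coord v i) = zpoly_val form0 (\<lambda>i. t * coord v i + coord y i)"
      by (rule zpoly_val_cong[OF F]) (simp add: y)
    also have "\<dots> = polar0 y y y y y"
      using polar0.expand5[of t v y] unfolding assms(2)
      unfolding coord_simps coord_scale polar_diagonal[OF F] by simp
    also have "\<dots> = zpoly_val form0 (coord y)" by (rule polar_diagonal[OF F])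
    also have "\<dots> = zpoly_val form0 x" by (rule zpoly_val_cong[OF F]) (simp add: y)
    finally show ?thesis .
  qed
  then have "order_mod (int CARD(gf)) dim0 form0 < dim0"
    by (rule degenerate_order_less[where v = "coord v", OF F \<open>i0 < dim0\<close> i0])
  then show False using assms(1) unfolding counterexample_def nondegenerate_mod_def CARD_gf by simp
qed

lemma no_counterexample: "\<not> counterexample p n F"
proof
  assume "counterexample p n F"
  then have c: "counterexample char0 dim0 form0" by (rule counterexample0)
  have "quintic scale_point polar0"
  proof
    have "6 \<le> dim0" using c unfolding counterexample_def by blast
    then show "CARD(point) \<ge> CARD(gf) ^ 6" unfolding CARD_point by (intro power_increasing) (auto simp: Suc_le_eq)
  qed (rule polar0_nondegenerate[OF c] polar0_singular[OF c]; assumption)+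
  then show False by (rule quintic.inconsistent)
qed

theorem theorem1p3:
  fixes p :: int and n :: nat and F :: zpoly
  assumes "prime p" and "p > 101"
    and "is_int_form n 5 F"
    and "nondegenerate_mod p n F"
    and "order_mod p n F \<ge> 6"
  shows "padic_dense p (ratio_set F)"
proof -
  have p: "int (nat p) = p" using assms(2) by simp
  have "prime (int (nat p))" unfolding p by (rule assms(1))
  then have prime: "prime (nat p)" by (simp only: prime_nat_int_transfer)
  have n: "n \<ge> 6" using assms(4,5) unfolding nondegenerate_mod_def by simp
  have gt: "nat p > 101" using assms(2) by linarith
  show ?thesis
  proof (rule ccontr)
    assume "\<not> ?thesis"
    then have "counterexample (nat p) n F"
      unfolding counterexample_def p using prime gt n assms(3,4) by blast
    then show False using no_counterexample by blast
  qed
qed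

end
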